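(* Fix $r\ge2$, $0<\alpha<1$, a positive smooth $P$-periodic function $L_0$, and nondegenerate closed data $(\mu_*,\delta_*,x_* )$ on a uniformly positive-warp branch for $L_0$ (as defined in the context), with return $2\pi\rho$, $\rho\in\mathbb Q^2$. Every positive $L$ sufficiently close to $L_0$ in $C^{r,\alpha}_{\rm per}$ has a unique nearby datum $(\mu(L),\delta(L),x(L))$ solving the magnitude equation $$x''=\frac{r_\delta}{xq_\delta}-x-r_\delta x\Bigl[\mu w\Bigl(\frac{x^2r_\delta}{q_\delta}\Bigr)^{1/k_2}-\frac{d_1}{L^2}\Bigr],\quad q_\delta=x^2+\delta-\delta^2x^2,\quad r_\delta=1-\delta(x^2+x'^2),\quad w=L^{2k_1/k_2},$$ with the same return and $x(L)\in C^{r+2,\alpha}_{\rm per}$, depending smoothly on $L$. The products close on the same $mP$-cover for every integer $m\ge1$ with $m\rho\in\mathbb Z^2$. Their magnitudes and source warps remain bounded away from zero in a neighborhood of the chosen positive-$\delta_*$ datum.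
   Context: Setting. For $i=1,2$, $(M_i,g_i)$ is a Riemannian manifold of dimension $k_i>0$, and $f_i:(M_i,g_i)\to\mathbb S^{2n_i+1}\subset\mathbb C^{n_i+1}$ (unit round sphere) is an eigenmap: $\Delta f_i=-d_if_i$ with $d_i=|df_i|^2>0$ constant. $C^{j,\alpha}_{\rm per}$ denotes the Hölder space of $P$-periodic functions on $\mathbb R$. Products from data. Let $\sigma\in\{-1,1\}$ be fixed. A positive $P$-periodic solution $x$ of the magnitude equation with $\mu,\delta>0$ and $r_\delta>0$ gives a unit-speed harmonic product as follows: $c=\delta^{-1}$, $\varepsilon=\delta^2(d_2/\mu)^{k_2}$, $a=\sqrt\delta\,x$, $b=\sqrt{1-a^2}$, $Q=1+(c^2-1)a^2$, $R=1-a^2-(a')^2$, $F=\sqrt{\varepsilon Q/(a^2R)}$, $\ell_1=L$, $\ell_2=(F/L^{k_1})^{1/k_2}$, $s_1'=\sigma\sqrt\varepsilon/(Fa^2)$, $s_2'=\sigma c\sqrt\varepsilon/(Fb^2)$; the product is $(ae^{is_1}f_1,be^{is_2}f_2)$ on $(\mathbb R\times M_1\times M_2,\ dt^2+\ell_1^2g_1+\ell_2^2g_2)$. Its magnitudes are $a,b$ and its source warps are $\ell_1,\ell_2$. Its return is the pair of phase increments $\int_0^Ps_i'\,dt=\sigma D_i$, where $$D_1=\int_0^P\frac{\sqrt{r_\delta}}{x\sqrt{q_\delta}}\,dt,\qquad D_2=\int_0^P\frac{x\sqrt{r_\delta}}{(1-\delta x^2)\sqrt{q_\delta}}\,dt .$$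 It closes on the $mP$-cover if the profile $(ae^{is_1},be^{is_2})$ is $mP$-periodic. Uniformly positive-warp branch for $L_0$. Put $w_0=L_0^{2k_1/k_2}$. Choose $\mu_0>0$ with $\mu_0w_0>d_1/L_0^2$ pointwise such that the Pinney equation $x''+(1+\mu_0w_0-d_1/L_0^2)x=x^{-3}$ has a positive smooth $P$-periodic solution $x_0$ whose linearization $\partial_t^2+1+\mu_0w_0-d_1/L_0^2+3x_0^{-4}:C^{2,\alpha}_{\rm per}\to C^{0,\alpha}_{\rm per}$ is an isomorphism (such $\mu_0$ exist). By the implicit function theorem there is a family $x_{\mu,\delta}$ of positive smooth $P$-periodic solutions of the magnitude equation with $L=L_0$, depending smoothly (in every $C^j$ norm) on $(\mu,\delta)$ in a small rectangle $\overline J\times[0,\delta_0]$ with $\mu_0\in J\Subset(0,\infty)$, and with $x_{\mu_0,0}=x_0$; the rectangle is taken so small that $r_\delta>0$, that $\mu w_0>d_1/L_0^2$ on $\overline J\times[0,P]$, and that $\det\partial(D_1,D_2)/\partial(\mu,\delta)\ne0$ throughout. Nondegenerate closed data. These are members $(\mu_*,\delta_*,x_* )$, $x_*=x_{\mu_*,\delta_*}$, $\delta_*>0$, of such a branch whose profile closes on a finite $P$-cover, i.e. whose return is $2\pi\rho$ with $\rho\in\mathbb Q^2$, and for which (i) the linearization in $x$ of the residual (difference of the two sides) of the magnitude equation at $(L_0,\mu_*,\delta_*,x_* )$ is invertible between the periodic Hölder spaces $C^{2,\alpha}_{\rm per}\to C^{0,\alpha}_{\rm per}$, and (ii) the derivative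 in $(\mu,\delta)$ of the phase increments along the branch is invertible at $(\mu_*,\delta_* )$. Every positive smooth $P$-periodic $L_0$ admits such data with arbitrarily small $\delta_*>0$. *)

theory Defs
  imports "HOL-Analysis.Analysis" "HOL-Library.Function_Algebras" "HOL-Library.Periodic_Fun"
begin

section \<open>Calculus between normed spaces given by a carrier and a norm\<close>

text \<open>
  The space \<open>C\<^sup>j\<^sup>,\<^sup>\<alpha>\<^sub>p\<^sub>e\<^sub>r\<close> depends on the parameters \<open>P\<close>, \<open>j\<close>, \<open>\<alpha>\<close>, so it cannot be a type.  A normed
  space is therefore a pair of a linear subspace of a real vector space and a norm on it, and the
  standard notions of Frechet calculus are stated for such pairs.  Function spaces live in
  \<^typ>\<open>real \<Rightarrow> real\<close> with its pointwise vector space structure.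
\<close>

instantiation "fun" :: (type, scaleR) scaleR
begin
definition scaleR_fun :: "real \<Rightarrow> ('a \<Rightarrow> 'b) \<Rightarrow> 'a \<Rightarrow> 'b" where
  "scaleR_fun c f = (\<lambda>x. c *\<^sub>R f x)"
instance ..
end

instance "fun" :: (type, real_vector) real_vector
  by standard (auto simp: scaleR_fun_def fun_eq_iff scaleR_add_left scaleR_add_right)

type_synonym 'a nspace = "'a set \<times> ('a \<Rightarrow> real)"

abbreviation carr :: "'a nspace \<Rightarrow> 'a set" where "carr \<equiv> fst"
abbreviation nrm :: "'a nspace \<Rightarrow> 'a \<Rightarrow> real" where "nrm \<equiv> snd"

abbreviation std :: "'a::real_normed_vector nspace" where "std \<equiv> (UNIV, norm)"

definition linear_between ::
    "'a::real_vector nspace \<Rightarrow> 'b::real_vector nspace \<Rightarrow> ('a \<Rightarrow> 'b) \<Rightarrow> bool" where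
  "linear_between E F A \<longleftrightarrow>
     (\<forall>v\<in>carr E. A v \<in> carr F) \<and>
     (\<forall>v\<in>carr E. \<forall>w\<in>carr E. A (v + w) = A v + A w) \<and>
     (\<forall>c. \<forall>v\<in>carr E. A (c *\<^sub>R v) = c *\<^sub>R A v)"

definition bounded_linear_between ::
    "'a::real_vector nspace \<Rightarrow> 'b::real_vector nspace \<Rightarrow> ('a \<Rightarrow> 'b) \<Rightarrow> bool" where
  "bounded_linear_between E F A \<longleftrightarrow>
     linear_between E F A \<and> (\<exists>C. \<forall>v\<in>carr E. nrm F (A v) \<le> C * nrm E v)"

definition isomorphism_between ::
    "'a::real_vector nspace \<Rightarrow> 'b::real_vector nspace \<Rightarrow> ('a \<Rightarrow> 'b) \<Rightarrow> bool" where
  "isomorphism_between E F A \<longleftrightarrow>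
     bounded_linear_between E F A \<and> bij_betw A (carr E) (carr F) \<and>
     bounded_linear_between F E (inv_into (carr E) A)"

definition has_frechet_derivative_between ::
    "'a::real_vector nspace \<Rightarrow> 'b::real_vector nspace \<Rightarrow> ('a \<Rightarrow> 'b) \<Rightarrow> ('a \<Rightarrow> 'b) \<Rightarrow> 'a \<Rightarrow> bool" where
  "has_frechet_derivative_between E F f A u \<longleftrightarrow>
     u \<in> carr E \<and> bounded_linear_between E F A \<and>
     (\<forall>e>0. \<exists>d>0. \<forall>h\<in>carr E. nrm E h < d \<longrightarrow>
        f (u + h) - f u - A h \<in> carr F \<and>
        nrm F (f (u + h) - f u - A h) \<le> e * nrm E h)"

definition bounded_multilinear_between ::
    "'a::real_vector nspace \<Rightarrow> 'b::real_vector nspace \<Rightarrow> nat \<Rightarrow> ('a list \<Rightarrow> 'b) \<Rightarrow> bool" where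
  "bounded_multilinear_between E F j M \<longleftrightarrow>
     (\<forall>vs. length vs = j \<and> set vs \<subseteq> carr E \<longrightarrow> M vs \<in> carr F) \<and>
     (\<forall>vs i. length vs = j \<and> set vs \<subseteq> carr E \<and> i < j \<longrightarrow>
        linear_between E F (\<lambda>v. M (vs[i := v]))) \<and>
     (\<exists>C. \<forall>vs. length vs = j \<and> set vs \<subseteq> carr E \<longrightarrow>
        nrm F (M vs) \<le> C * prod_list (map (nrm E) vs))"

text \<open>
  \<open>C\<^sup>\<infinity>\<close> in the sense of Frechet: \<open>D j u\<close> is the \<open>j\<close>-th derivative at \<open>u\<close>, a bounded \<open>j\<close>-linear map
  on lists of \<open>j\<close> directions, and \<open>u \<mapsto> D j u\<close> is differentiable in the operator norm with derivative
  \<open>D (j + 1)\<close>.  Increments stay in \<open>U\<close>, so on a closed rectangle this is smoothness up to the boundary.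
\<close>

definition smooth_between ::
    "'a::real_vector nspace \<Rightarrow> 'b::real_vector nspace \<Rightarrow> 'a set \<Rightarrow> ('a \<Rightarrow> 'b) \<Rightarrow> bool" where
  "smooth_between E F U f \<longleftrightarrow> U \<subseteq> carr E \<and>
     (\<exists>D :: nat \<Rightarrow> 'a \<Rightarrow> 'a list \<Rightarrow> 'b.
        (\<forall>u\<in>U. D 0 u [] = f u) \<and>
        (\<forall>j. \<forall>u\<in>U. bounded_multilinear_between E F j (D j u)) \<and>
        (\<forall>j. \<forall>u\<in>U. \<forall>e>0. \<exists>d>0. \<forall>u'\<in>U. nrm E (u' - u) < d \<longrightarrow>
           (\<forall>vs. length vs = j \<and> set vs \<subseteq> carr E \<longrightarrow>
              nrm F (D j u' vs - D j u vs - D (Suc j) u ((u' - u) # vs))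
                \<le> e * nrm E (u' - u) * prod_list (map (nrm E) vs))))"

section \<open>Periodic function spaces\<close>

definition times_cont_diff :: "nat \<Rightarrow> (real \<Rightarrow> real) \<Rightarrow> bool" where
  "times_cont_diff j f \<longleftrightarrow>
     (\<forall>i<j. \<forall>t. (deriv ^^ i) f differentiable (at t)) \<and> continuous_on UNIV ((deriv ^^ j) f)"

definition sup_norm :: "(real \<Rightarrow> real) \<Rightarrow> real" where
  "sup_norm f = (SUP t. \<bar>f t\<bar>)"

definition Cper :: "real \<Rightarrow> nat \<Rightarrow> (real \<Rightarrow> real) nspace" where
  "Cper P j =
     ({f. periodic_fun_simple f P \<and> times_cont_diff j f},
      \<lambda>f. \<Sum>i\<le>j. sup_norm ((deriv ^^ i) f))"

text \<open>The quotient with \<open>s = t\<close> is \<open>0 / 0 = 0\<close> and does not affect the supremum.\<close>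

definition holder_seminorm :: "real \<Rightarrow> (real \<Rightarrow> real) \<Rightarrow> real" where
  "holder_seminorm \<alpha> f = (SUP (s, t). \<bar>f s - f t\<bar> / \<bar>s - t\<bar> powr \<alpha>)"

definition Hper :: "real \<Rightarrow> nat \<Rightarrow> real \<Rightarrow> (real \<Rightarrow> real) nspace" where
  "Hper P j \<alpha> =
     ({f. periodic_fun_simple f P \<and> times_cont_diff j f \<and>
          (\<exists>C. \<forall>s t. \<bar>(deriv ^^ j) f s - (deriv ^^ j) f t\<bar> \<le> C * \<bar>s - t\<bar> powr \<alpha>)},
      \<lambda>f. (\<Sum>i\<le>j. sup_norm ((deriv ^^ i) f)) + holder_seminorm \<alpha> ((deriv ^^ j) f))"

definition positive_smooth_periodic :: "real \<Rightarrow> (real \<Rightarrow> real) \<Rightarrow> bool" where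
  "positive_smooth_periodic P f \<longleftrightarrow>
     periodic_fun_simple f P \<and> (\<forall>j. times_cont_diff j f) \<and> (\<forall>t. 0 < f t)"

section \<open>Riemannian manifolds and eigenmaps into spheres\<close>

text \<open>
  A manifold is a Hausdorff second countable type with an atlas of pairs \<open>(U, \<phi>)\<close>; its dimension
  is \<open>CARD('k)\<close>.  A metric assigns to each chart its Gram matrices in the coordinates of that chart.
\<close>

type_synonym ('m, 'k) chart = "'m set \<times> ('m \<Rightarrow> real ^ 'k)"

definition smooth_atlas ::
    "('m::{t2_space, second_countable_topology}, 'k::finite) chart set \<Rightarrow> bool" where
  "smooth_atlas \<A> \<longleftrightarrow>
     (\<Union>(U, \<phi>)\<in>\<A>. U) = UNIV \<and>
     (\<forall>(U, \<phi>)\<in>\<A>. open U \<and> open (\<phi> ` U) \<and> homeomorphism U (\<phi> ` U) \<phi> (inv_into U \<phi>)) \<and>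
     (\<forall>(U, \<phi>)\<in>\<A>. \<forall>(V, \<psi>)\<in>\<A>.
        smooth_between std std (\<phi> ` (U \<inter> V)) (\<psi> \<circ> inv_into U \<phi>))"

definition riemannian_manifold ::
    "('m::{t2_space, second_countable_topology}, 'k::finite) chart set \<Rightarrow>
     (('m, 'k) chart \<Rightarrow> 'm \<Rightarrow> real ^ 'k ^ 'k) \<Rightarrow> bool" where
  "riemannian_manifold \<A> g \<longleftrightarrow> smooth_atlas \<A> \<and>
     (\<forall>(U, \<phi>)\<in>\<A>. smooth_between std std (\<phi> ` U) (g (U, \<phi>) \<circ> inv_into U \<phi>)) \<and>
     (\<forall>(U, \<phi>)\<in>\<A>. \<forall>p\<in>U. transpose (g (U, \<phi>) p) = g (U, \<phi>) p \<and>
        (\<forall>v. v \<noteq> 0 \<longrightarrow> 0 < v \<bullet> (g (U, \<phi>) p *v v))) \<and>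
     (\<forall>(U, \<phi>)\<in>\<A>. \<forall>(V, \<psi>)\<in>\<A>. \<forall>p\<in>U \<inter> V.
        (let J = matrix (frechet_derivative (\<psi> \<circ> inv_into U \<phi>) (at (\<phi> p)))
         in g (U, \<phi>) p = transpose J ** g (V, \<psi>) p ** J))"

definition partial_deriv ::
    "'k::finite \<Rightarrow> (real ^ 'k \<Rightarrow> 'b::real_normed_vector) \<Rightarrow> real ^ 'k \<Rightarrow> 'b" where
  "partial_deriv i F y = frechet_derivative F (at y) (axis i 1)"

text \<open>
  In local coordinates \<open>\<Delta>u = |G|\<^sup>-\<^sup>1\<^sup>/\<^sup>2 \<partial>\<^sub>i (|G|\<^sup>1\<^sup>/\<^sup>2 G\<^sup>i\<^sup>j \<partial>\<^sub>j u)\<close> and \<open>|du|\<^sup>2 = G\<^sup>i\<^sup>j \<langle>\<partial>\<^sub>i u, \<partial>\<^sub>j u\<rangle>\<close>.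
\<close>

definition laplace_beltrami ::
    "(('m, 'k) chart \<Rightarrow> 'm \<Rightarrow> real ^ 'k ^ 'k) \<Rightarrow> ('m, 'k::finite) chart \<Rightarrow>
     ('m \<Rightarrow> 'b::real_inner) \<Rightarrow> 'm \<Rightarrow> 'b" where
  "laplace_beltrami g c u p =
     (let G = g c \<circ> inv_into (fst c) (snd c); F = u \<circ> inv_into (fst c) (snd c)
      in (1 / sqrt (det (g c p))) *\<^sub>R
           (\<Sum>i\<in>UNIV. partial_deriv i
              (\<lambda>y. sqrt (det (G y)) *\<^sub>R
                 (\<Sum>j\<in>UNIV. (matrix_inv (G y) $ i $ j) *\<^sub>R partial_deriv j F y))
              (snd c p)))"

definition energy_density ::
    "(('m, 'k) chart \<Rightarrow> 'm \<Rightarrow> real ^ 'k ^ 'k) \<Rightarrow> ('m, 'k::finite) chart \<Rightarrow>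
     ('m \<Rightarrow> 'b::real_inner) \<Rightarrow> 'm \<Rightarrow> real" where
  "energy_density g c u p =
     (let F = u \<circ> inv_into (fst c) (snd c)
      in \<Sum>i\<in>UNIV. \<Sum>j\<in>UNIV. (matrix_inv (g c p) $ i $ j) *
           (partial_deriv i F (snd c p) \<bullet> partial_deriv j F (snd c p)))"

definition eigenmap ::
    "('m::{t2_space, second_countable_topology}, 'k::finite) chart set \<Rightarrow>
     (('m, 'k) chart \<Rightarrow> 'm \<Rightarrow> real ^ 'k ^ 'k) \<Rightarrow> ('m \<Rightarrow> complex ^ 'n) \<Rightarrow> real \<Rightarrow> bool" where
  "eigenmap \<A> g f d \<longleftrightarrow> riemannian_manifold \<A> g \<and> 0 < d \<and> (\<forall>p. norm (f p) = 1) \<and>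
     (\<forall>(U, \<phi>)\<in>\<A>. smooth_between std std (\<phi> ` U) (f \<circ> inv_into U \<phi>)) \<and>
     (\<forall>(U, \<phi>)\<in>\<A>. \<forall>p\<in>U. laplace_beltrami g (U, \<phi>) f p = - (d *\<^sub>R f p) \<and>
        energy_density g (U, \<phi>) f p = d)"

section \<open>The magnitude equation and its phase increments\<close>

definition q_fun :: "real \<Rightarrow> (real \<Rightarrow> real) \<Rightarrow> real \<Rightarrow> real" where
  "q_fun \<delta> x t = (x t)\<^sup>2 + \<delta> - \<delta>\<^sup>2 * (x t)\<^sup>2"

definition r_fun :: "real \<Rightarrow> (real \<Rightarrow> real) \<Rightarrow> real \<Rightarrow> real" where
  "r_fun \<delta> x t = 1 - \<delta> * ((x t)\<^sup>2 + (deriv x t)\<^sup>2)"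

definition w_fun :: "nat \<Rightarrow> nat \<Rightarrow> (real \<Rightarrow> real) \<Rightarrow> real \<Rightarrow> real" where
  "w_fun k1 k2 L t = L t powr (2 * real k1 / real k2)"

definition magnitude_rhs ::
    "nat \<Rightarrow> nat \<Rightarrow> real \<Rightarrow> (real \<Rightarrow> real) \<Rightarrow> real \<Rightarrow> real \<Rightarrow> (real \<Rightarrow> real) \<Rightarrow> real \<Rightarrow> real" where
  "magnitude_rhs k1 k2 d1 L \<mu> \<delta> x t =
     r_fun \<delta> x t / (x t * q_fun \<delta> x t) - x t
     - r_fun \<delta> x t * x t *
         (\<mu> * w_fun k1 k2 L t * ((x t)\<^sup>2 * r_fun \<delta> x t / q_fun \<delta> x t) powr (1 / real k2)
          - d1 / (L t)\<^sup>2)"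

definition magnitude_residual ::
    "nat \<Rightarrow> nat \<Rightarrow> real \<Rightarrow> (real \<Rightarrow> real) \<Rightarrow> real \<Rightarrow> real \<Rightarrow> (real \<Rightarrow> real) \<Rightarrow> real \<Rightarrow> real" where
  "magnitude_residual k1 k2 d1 L \<mu> \<delta> x t = deriv (deriv x) t - magnitude_rhs k1 k2 d1 L \<mu> \<delta> x t"

definition magnitude_solution ::
    "nat \<Rightarrow> nat \<Rightarrow> real \<Rightarrow> real \<Rightarrow> (real \<Rightarrow> real) \<Rightarrow> real \<Rightarrow> real \<Rightarrow> (real \<Rightarrow> real) \<Rightarrow> bool" where
  "magnitude_solution k1 k2 d1 P L \<mu> \<delta> x \<longleftrightarrow>
     periodic_fun_simple x P \<and> times_cont_diff 2 x \<and>
     (\<forall>t. 0 < x t) \<and> (\<forall>t. 0 < r_fun \<delta> x t) \<and>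
     (\<forall>t. deriv (deriv x) t = magnitude_rhs k1 k2 d1 L \<mu> \<delta> x t)"

definition D1 :: "real \<Rightarrow> real \<Rightarrow> (real \<Rightarrow> real) \<Rightarrow> real" where
  "D1 P \<delta> x = integral {0..P} (\<lambda>t. sqrt (r_fun \<delta> x t) / (x t * sqrt (q_fun \<delta> x t)))"

definition D2 :: "real \<Rightarrow> real \<Rightarrow> (real \<Rightarrow> real) \<Rightarrow> real" where
  "D2 P \<delta> x =
     integral {0..P} (\<lambda>t. x t * sqrt (r_fun \<delta> x t) / ((1 - \<delta> * (x t)\<^sup>2) * sqrt (q_fun \<delta> x t)))"

definition product_return :: "real \<Rightarrow> real \<Rightarrow> real \<Rightarrow> (real \<Rightarrow> real) \<Rightarrow> real \<times> real" where
  "product_return \<sigma> P \<delta> x = (\<sigma> * D1 P \<delta> x, \<sigma> * D2 P \<delta> x)"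

section \<open>Products from data\<close>

definition mag_a :: "real \<Rightarrow> (real \<Rightarrow> real) \<Rightarrow> real \<Rightarrow> real" where
  "mag_a \<delta> x t = sqrt \<delta> * x t"

definition mag_b :: "real \<Rightarrow> (real \<Rightarrow> real) \<Rightarrow> real \<Rightarrow> real" where
  "mag_b \<delta> x t = sqrt (1 - (mag_a \<delta> x t)\<^sup>2)"

definition prod_c :: "real \<Rightarrow> real" where
  "prod_c \<delta> = 1 / \<delta>"

definition prod_eps :: "nat \<Rightarrow> real \<Rightarrow> real \<Rightarrow> real \<Rightarrow> real" where
  "prod_eps k2 d2 \<mu> \<delta> = \<delta>\<^sup>2 * (d2 / \<mu>) ^ k2"

definition prod_Q :: "real \<Rightarrow> (real \<Rightarrow> real) \<Rightarrow> real \<Rightarrow> real" where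
  "prod_Q \<delta> x t = 1 + ((prod_c \<delta>)\<^sup>2 - 1) * (mag_a \<delta> x t)\<^sup>2"

definition prod_R :: "real \<Rightarrow> (real \<Rightarrow> real) \<Rightarrow> real \<Rightarrow> real" where
  "prod_R \<delta> x t = 1 - (mag_a \<delta> x t)\<^sup>2 - (deriv (mag_a \<delta> x) t)\<^sup>2"

definition prod_F :: "nat \<Rightarrow> real \<Rightarrow> real \<Rightarrow> real \<Rightarrow> (real \<Rightarrow> real) \<Rightarrow> real \<Rightarrow> real" where
  "prod_F k2 d2 \<mu> \<delta> x t =
     sqrt (prod_eps k2 d2 \<mu> \<delta> * prod_Q \<delta> x t / ((mag_a \<delta> x t)\<^sup>2 * prod_R \<delta> x t))"

definition warp1 :: "(real \<Rightarrow> real) \<Rightarrow> real \<Rightarrow> real" where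
  "warp1 L t = L t"

definition warp2 ::
    "nat \<Rightarrow> nat \<Rightarrow> real \<Rightarrow> (real \<Rightarrow> real) \<Rightarrow> real \<Rightarrow> real \<Rightarrow> (real \<Rightarrow> real) \<Rightarrow> real \<Rightarrow> real" where
  "warp2 k1 k2 d2 L \<mu> \<delta> x t = (prod_F k2 d2 \<mu> \<delta> x t / L t ^ k1) powr (1 / real k2)"

definition product_phases ::
    "nat \<Rightarrow> real \<Rightarrow> real \<Rightarrow> real \<Rightarrow> real \<Rightarrow> (real \<Rightarrow> real) \<Rightarrow> (real \<Rightarrow> real) \<Rightarrow> (real \<Rightarrow> real) \<Rightarrow> bool" where
  "product_phases k2 d2 \<sigma> \<mu> \<delta> x s1 s2 \<longleftrightarrow>
     (\<forall>t. (s1 has_real_derivative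
             \<sigma> * sqrt (prod_eps k2 d2 \<mu> \<delta>) / (prod_F k2 d2 \<mu> \<delta> x t * (mag_a \<delta> x t)\<^sup>2)) (at t)) \<and>
     (\<forall>t. (s2 has_real_derivative
             \<sigma> * prod_c \<delta> * sqrt (prod_eps k2 d2 \<mu> \<delta>) /
               (prod_F k2 d2 \<mu> \<delta> x t * (mag_b \<delta> x t)\<^sup>2)) (at t))"

definition profile ::
    "real \<Rightarrow> (real \<Rightarrow> real) \<Rightarrow> (real \<Rightarrow> real) \<Rightarrow> (real \<Rightarrow> real) \<Rightarrow> real \<Rightarrow> complex \<times> complex" where
  "profile \<delta> x s1 s2 t =
     (of_real (mag_a \<delta> x t) * exp (\<i> * of_real (s1 t)),
      of_real (mag_b \<delta> x t) * exp (\<i> * of_real (s2 t)))"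

text \<open>
  The phases are determined up to additive constants, which do not affect closing; the first
  conjunct makes sure that they exist.
\<close>

definition closes_with_period ::
    "nat \<Rightarrow> real \<Rightarrow> real \<Rightarrow> real \<Rightarrow> real \<Rightarrow> real \<Rightarrow> (real \<Rightarrow> real) \<Rightarrow> bool" where
  "closes_with_period k2 d2 \<sigma> T \<mu> \<delta> x \<longleftrightarrow>
     (\<exists>s1 s2. product_phases k2 d2 \<sigma> \<mu> \<delta> x s1 s2) \<and>
     (\<forall>s1 s2. product_phases k2 d2 \<sigma> \<mu> \<delta> x s1 s2 \<longrightarrow>
        periodic_fun_simple (profile \<delta> x s1 s2) T)"

section \<open>Branches and nondegenerate closed data\<close>

definition branch_increments ::
    "real \<Rightarrow> (real \<Rightarrow> real \<Rightarrow> real \<Rightarrow> real) \<Rightarrow> real \<times> real \<Rightarrow> real \<times> real" where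
  "branch_increments P X = (\<lambda>(\<mu>, \<delta>). (D1 P \<delta> (X \<mu> \<delta>), D2 P \<delta> (X \<mu> \<delta>)))"

definition plane_det :: "(real \<times> real \<Rightarrow> real \<times> real) \<Rightarrow> real" where
  "plane_det A = fst (A (1, 0)) * snd (A (0, 1)) - fst (A (0, 1)) * snd (A (1, 0))"

text \<open>
  \<open>J\<close> is the open interval from \<open>jl\<close> to \<open>jr\<close>, and \<open>X \<mu> \<delta>\<close> is the solution at \<open>(\<mu>, \<delta>)\<close>.
\<close>

definition positive_warp_branch ::
    "nat \<Rightarrow> nat \<Rightarrow> real \<Rightarrow> real \<Rightarrow> real \<Rightarrow> (real \<Rightarrow> real) \<Rightarrow> real \<Rightarrow> (real \<Rightarrow> real) \<Rightarrow>
     real \<Rightarrow> real \<Rightarrow> real \<Rightarrow> (real \<Rightarrow> real \<Rightarrow> real \<Rightarrow> real) \<Rightarrow> bool" where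
  "positive_warp_branch k1 k2 d1 P \<alpha> L0 \<mu>0 x0 jl jr \<delta>0 X \<longleftrightarrow>
     0 < \<mu>0 \<and> (\<forall>t. d1 / (L0 t)\<^sup>2 < \<mu>0 * w_fun k1 k2 L0 t) \<and>
     positive_smooth_periodic P x0 \<and>
     (\<forall>t. deriv (deriv x0) t + (1 + \<mu>0 * w_fun k1 k2 L0 t - d1 / (L0 t)\<^sup>2) * x0 t
            = 1 / (x0 t) ^ 3) \<and>
     isomorphism_between (Hper P 2 \<alpha>) (Hper P 0 \<alpha>)
       (\<lambda>\<phi> t. deriv (deriv \<phi>) t
          + (1 + \<mu>0 * w_fun k1 k2 L0 t - d1 / (L0 t)\<^sup>2 + 3 / (x0 t) ^ 4) * \<phi> t) \<and>
     0 < jl \<and> jl < \<mu>0 \<and> \<mu>0 < jr \<and> 0 < \<delta>0 \<and>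
     (\<forall>\<mu>\<in>{jl..jr}. \<forall>\<delta>\<in>{0..\<delta>0}.
        positive_smooth_periodic P (X \<mu> \<delta>) \<and> magnitude_solution k1 k2 d1 P L0 \<mu> \<delta> (X \<mu> \<delta>)) \<and>
     (\<forall>j. smooth_between std (Cper P j) ({jl..jr} \<times> {0..\<delta>0}) (\<lambda>(\<mu>, \<delta>). X \<mu> \<delta>)) \<and>
     X \<mu>0 0 = x0 \<and>
     (\<forall>\<mu>\<in>{jl..jr}. \<forall>t\<in>{0..P}. d1 / (L0 t)\<^sup>2 < \<mu> * w_fun k1 k2 L0 t) \<and>
     (\<forall>z\<in>{jl..jr} \<times> {0..\<delta>0}. \<exists>A.
        (branch_increments P X has_derivative A) (at z within {jl..jr} \<times> {0..\<delta>0}) \<and>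
        plane_det A \<noteq> 0)"

definition nondegenerate_closed_data ::
    "nat \<Rightarrow> nat \<Rightarrow> real \<Rightarrow> real \<Rightarrow> real \<Rightarrow> real \<Rightarrow> (real \<Rightarrow> real) \<Rightarrow>
     real \<Rightarrow> real \<Rightarrow> real \<Rightarrow> (real \<Rightarrow> real \<Rightarrow> real \<Rightarrow> real) \<Rightarrow> real \<Rightarrow> real \<Rightarrow> (real \<Rightarrow> real) \<Rightarrow>
     real \<Rightarrow> real \<Rightarrow> bool" where
  "nondegenerate_closed_data k1 k2 d1 P \<alpha> \<sigma> L0 jl jr \<delta>0 X \<mu>s \<delta>s xs \<rho>1 \<rho>2 \<longleftrightarrow>
     \<mu>s \<in> {jl..jr} \<and> \<delta>s \<in> {0<..\<delta>0} \<and> xs = X \<mu>s \<delta>s \<and>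
     \<rho>1 \<in> \<rat> \<and> \<rho>2 \<in> \<rat> \<and>
     product_return \<sigma> P \<delta>s xs = (2 * pi * \<rho>1, 2 * pi * \<rho>2) \<and>
     (\<exists>A. has_frechet_derivative_between (Hper P 2 \<alpha>) (Hper P 0 \<alpha>)
            (magnitude_residual k1 k2 d1 L0 \<mu>s \<delta>s) A xs \<and>
          isomorphism_between (Hper P 2 \<alpha>) (Hper P 0 \<alpha>) A) \<and>
     (\<exists>B. (branch_increments P X has_derivative B) (at (\<mu>s, \<delta>s) within {jl..jr} \<times> {0..\<delta>0}) \<and>
          bij B)"

definition datum_with_return ::
    "nat \<Rightarrow> nat \<Rightarrow> real \<Rightarrow> real \<Rightarrow> real \<Rightarrow> (real \<Rightarrow> real) \<Rightarrow> real \<Rightarrow> real \<Rightarrow>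
     real \<Rightarrow> real \<Rightarrow> (real \<Rightarrow> real) \<Rightarrow> bool" where
  "datum_with_return k1 k2 d1 P \<sigma> L \<rho>1 \<rho>2 \<mu> \<delta> x \<longleftrightarrow>
     0 < \<mu> \<and> 0 < \<delta> \<and> magnitude_solution k1 k2 d1 P L \<mu> \<delta> x \<and>
     product_return \<sigma> P \<delta> x = (2 * pi * \<rho>1, 2 * pi * \<rho>2)"

definition nearby_data ::
    "(real \<Rightarrow> real) nspace \<Rightarrow> real \<Rightarrow> real \<Rightarrow> real \<Rightarrow> (real \<Rightarrow> real) \<Rightarrow>
     (real \<times> real \<times> (real \<Rightarrow> real)) set" where
  "nearby_data E \<nu> \<mu>s \<delta>s xs =
     {(\<mu>, \<delta>, x). \<bar>\<mu> - \<mu>s\<bar> < \<nu> \<and> \<bar>\<delta> - \<delta>s\<bar> < \<nu> \<and> x \<in> carr E \<and> nrm E (x - xs) < \<nu>}"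

definition nearby_positive ::
    "(real \<Rightarrow> real) nspace \<Rightarrow> real \<Rightarrow> (real \<Rightarrow> real) \<Rightarrow> (real \<Rightarrow> real) set" where
  "nearby_positive E \<eta> L0 = {L \<in> carr E. (\<forall>t. 0 < L t) \<and> nrm E (L - L0) < \<eta>}"

end

theory Submission
  imports Defs
begin

text \<open>
  The magnitude equation and the two return conditions form one equation \<open>\<Psi> (L, (\<mu>, \<delta>, x)) = 0\<close>
  between Hoelder spaces.  Its linearization in \<open>(\<mu>, \<delta>, x)\<close> is bordered: the \<open>x\<close>-block is invertible
  by nondegeneracy, and differentiating \<open>\<Psi>\<close> along the branch shows that the Schur complement is the
  derivative of the phase increments, which is invertible too.  The implicit function theorem then
  gives the unique nearby datum, and elliptic regularity moves invertibility from \<open>C\<^sup>2\<^sup>,\<^sup>\<alpha>\<close> to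
  \<open>C\<^sup>r\<^sup>+\<^sup>2\<^sup>,\<^sup>\<alpha>\<close>.  The derivatives of the solution map are built from smooth functions of the solution,
  products and the inverse linearization; multilinear families of this form are closed under
  differentiation, whence smoothness.  The phases advance by \<open>2\<pi>\<rho>\<^sub>i\<close> over a period, so they close
  after \<open>m\<close> periods when \<open>m\<rho> \<in> \<int>\<^sup>2\<close>.
\<close>

text \<open>Nondegeneracy is given only between C^{2,\<alpha>} and C^{0,\<alpha>}, while the system
  is solved between C^{r+2,\<alpha>} and C^{r,\<alpha>}; the smoothness of \<open>L0\<close> and of
  the branch makes the coefficients of the linearization smooth, and this permits the transfer. The
  branch lives over a closed rectangle and the datum may lie on an edge, so the tangent identity is
  obtained along inward directions only and extended by linearity. Smooth dependence asks for
  bounded multilinear derivatives of every order; they are never written out. The solution is read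
  through the pointwise data (L, x, x', \<mu>, \<delta>), all of which lie in the single space
  C^{r,\<alpha>}, so that repeated differentiation involves no change of space. The two missing
  derivatives of x are recovered at the end, because x'' is again a smooth function of these data.
  Positivity of the bases of all powers is an open condition, uniform by periodicity; it confines
  the equation to the region where \<open>powr\<close> is smooth.\<close>

type_synonym rfun = "real \<Rightarrow> real"

section \<open>Normed spaces and the implicit function theorem\<close>

text \<open>The spaces below depend on \<open>P\<close>, \<open>j\<close> and
  \<open>\<alpha>\<close>, so the norm axioms are imposed on a carrier instead of a type.
  Nonnegativity is derived: it follows from the triangle inequality for \<open>u\<close> and
  \<open>- u\<close>.\<close>

locale nspace =
  fixes E :: "'a::real_vector nspace"
  assumes zero_carr [simp, intro]: "0 \<in> carr E"
    and add_carr [simp, intro]: "u \<in> carr E \<Longrightarrow> v \<in> carr E \<Longrightarrow> u + v \<in> carr E"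
    and scale_carr [simp, intro]: "u \<in> carr E \<Longrightarrow> c *\<^sub>R u \<in> carr E"
    and nrm_triangle: "u \<in> carr E \<Longrightarrow> v \<in> carr E \<Longrightarrow> nrm E (u + v) \<le> nrm E u + nrm E v"
    and nrm_scale: "u \<in> carr E \<Longrightarrow> nrm E (c *\<^sub>R u) = \<bar>c\<bar> * nrm E u"
    and nrm_eq_0: "u \<in> carr E \<Longrightarrow> nrm E u = 0 \<Longrightarrow> u = 0"
begin

lemma uminus_carr [simp, intro]: "u \<in> carr E \<Longrightarrow> - u \<in> carr E"
  using scale_carr[of u "-1"] by simp

lemma diff_carr [simp, intro]: "u \<in> carr E \<Longrightarrow> v \<in> carr E \<Longrightarrow> u - v \<in> carr E"
  using add_carr[of u "- v"] by simp

lemma sum_carr: "(\<And>i. i \<in> I \<Longrightarrow> f i \<in> carr E) \<Longrightarrow> (\<Sum>i\<in>I. f i) \<in> carr E"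
  by (induction I rule: infinite_finite_induct) auto

lemma nrm_0 [simp]: "nrm E 0 = 0"
  using nrm_scale[of 0 0] by simp

lemma nrm_uminus [simp]: "u \<in> carr E \<Longrightarrow> nrm E (- u) = nrm E u"
  using nrm_scale[of u "-1"] by simp

lemma nrm_ge_0: "u \<in> carr E \<Longrightarrow> 0 \<le> nrm E u"
  using nrm_triangle[of u "- u"] by simp

lemma nrm_minus_commute: "u \<in> carr E \<Longrightarrow> v \<in> carr E \<Longrightarrow> nrm E (u - v) = nrm E (v - u)"
  using nrm_uminus[of "u - v"] by simp

lemma nrm_diff_triangle: "u \<in> carr E \<Longrightarrow> v \<in> carr E \<Longrightarrow> nrm E (u - v) \<le> nrm E u + nrm E v"
  using nrm_triangle[of u "- v"] by simp

lemma nrm_triangle3: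
  "u \<in> carr E \<Longrightarrow> v \<in> carr E \<Longrightarrow> w \<in> carr E \<Longrightarrow> nrm E (u - w) \<le> nrm E (u - v) + nrm E (v - w)"
  using nrm_triangle[of "u - v" "v - w"] by simp

lemma nrm_diff_eq_0: "u \<in> carr E \<Longrightarrow> v \<in> carr E \<Longrightarrow> nrm E (u - v) \<le> 0 \<Longrightarrow> u = v"
  using nrm_eq_0[of "u - v"] nrm_ge_0[of "u - v"] by auto

lemma nrm_sum_le: "(\<And>i. i \<in> I \<Longrightarrow> f i \<in> carr E) \<Longrightarrow> nrm E (\<Sum>i\<in>I. f i) \<le> (\<Sum>i\<in>I. nrm E (f i))"
proof (induction I rule: infinite_finite_induct)
  case (insert i I)
  then show ?case
    using nrm_triangle[of "f i" "\<Sum>i\<in>I. f i"] sum_carr[of I f] by fastforce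
qed auto

end

section \<open>Completeness, products and the contraction principle\<close>

definition complete_nspace :: "'a::real_vector nspace \<Rightarrow> bool" where
  "complete_nspace E \<longleftrightarrow> (\<forall>X. (\<forall>n. X n \<in> carr E) \<and>
     (\<forall>e>0. \<exists>M::nat. \<forall>m\<ge>M. \<forall>n\<ge>M. nrm E (X m - X n) < e) \<longrightarrow>
     (\<exists>x\<in>carr E. (\<lambda>n. nrm E (X n - x)) \<longlonglongrightarrow> 0))"

lemma complete_nspaceD:
  fixes X :: "nat \<Rightarrow> 'a::real_vector"
  assumes "complete_nspace E" "\<And>n. X n \<in> carr E"
    "\<And>e. e > 0 \<Longrightarrow> \<exists>M. \<forall>m\<ge>M. \<forall>n\<ge>M. nrm E (X m - X n) < e"
  obtains x where "x \<in> carr E" "(\<lambda>n. nrm E (X n - x)) \<longlonglongrightarrow> 0"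
  using assms unfolding complete_nspace_def by blast

definition prod_nspace :: "'a nspace \<Rightarrow> 'b nspace \<Rightarrow> ('a \<times> 'b) nspace" where
  "prod_nspace E F = (carr E \<times> carr F, \<lambda>z. nrm E (fst z) + nrm F (snd z))"

lemma carr_prod_nspace [simp]: "carr (prod_nspace E F) = carr E \<times> carr F"
  by (simp add: prod_nspace_def)

lemma nrm_prod_nspace: "nrm (prod_nspace E F) z = nrm E (fst z) + nrm F (snd z)"
  by (simp add: prod_nspace_def)

lemma nspace_prod:
  assumes "nspace E" "nspace F"
  shows "nspace (prod_nspace E F)"
proof -
  interpret E: nspace E by fact
  interpret F: nspace F by fact
  show ?thesis
  proof (unfold_locales, goal_cases)
    case (4 u v)
    then show ?case
      using E.nrm_triangle[of "fst u" "fst v"] F.nrm_triangle[of "snd u" "snd v"]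
      by (auto simp: nrm_prod_nspace)
  next
    case (5 u c)
    then show ?case
      using E.nrm_scale[of "fst u" c] F.nrm_scale[of "snd u" c]
      by (auto simp: nrm_prod_nspace algebra_simps)
  next
    case (6 u)
    then have "nrm E (fst u) = 0" "nrm F (snd u) = 0"
      using E.nrm_ge_0[of "fst u"] F.nrm_ge_0[of "snd u"] by (auto simp: nrm_prod_nspace)
    then show ?case using 6 E.nrm_eq_0[of "fst u"] F.nrm_eq_0[of "snd u"] by (auto simp: prod_eq_iff)
  qed (auto simp: zero_prod_def)
qed

lemma complete_nspace_prod:
  assumes "nspace E" "nspace F" "complete_nspace E" "complete_nspace F"
  shows "complete_nspace (prod_nspace E F)"
  unfolding complete_nspace_def
proof (intro allI impI, elim conjE)
  interpret E: nspace E by fact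
  interpret F: nspace F by fact
  fix X :: "nat \<Rightarrow> 'a \<times> 'b"
  assume X: "\<forall>n. X n \<in> carr (prod_nspace E F)"
    and C: "\<forall>e>0. \<exists>M. \<forall>m\<ge>M. \<forall>n\<ge>M. nrm (prod_nspace E F) (X m - X n) < e"
  have c: "fst (X n) \<in> carr E" "snd (X n) \<in> carr F" for n
    using X by (auto simp: mem_Times_iff)
  have le: "nrm E (fst (X m) - fst (X n)) \<le> nrm (prod_nspace E F) (X m - X n)"
    "nrm F (snd (X m) - snd (X n)) \<le> nrm (prod_nspace E F) (X m - X n)" for m n
    using E.nrm_ge_0[of "fst (X m) - fst (X n)"] F.nrm_ge_0[of "snd (X m) - snd (X n)"] c
    by (auto simp: nrm_prod_nspace)
  obtain x where x: "x \<in> carr E" "(\<lambda>n. nrm E (fst (X n) - x)) \<longlonglongrightarrow> 0"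
    by (rule complete_nspaceD[OF assms(3), of "\<lambda>n. fst (X n)"]) (use C c le in \<open>auto intro: le_less_trans, meson le_less_trans\<close>)
  obtain y where y: "y \<in> carr F" "(\<lambda>n. nrm F (snd (X n) - y)) \<longlonglongrightarrow> 0"
    by (rule complete_nspaceD[OF assms(4), of "\<lambda>n. snd (X n)"]) (use C c le in \<open>auto intro: le_less_trans, meson le_less_trans\<close>)
  show "\<exists>x\<in>carr (prod_nspace E F). (\<lambda>n. nrm (prod_nspace E F) (X n - x)) \<longlonglongrightarrow> 0"
    by (rule bexI[of _ "(x, y)"]) (use x y tendsto_add[OF x(2) y(2)] in \<open>auto simp: nrm_prod_nspace\<close>)
qed

lemma nspace_std: "nspace (std :: 'a::real_normed_vector nspace)"
  by unfold_locales (auto simp: norm_triangle_ineq)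

lemma complete_nspace_std: "complete_nspace (std :: 'a::banach nspace)"
  unfolding complete_nspace_def
proof (intro allI impI, elim conjE)
  fix X :: "nat \<Rightarrow> 'a"
  assume "\<forall>e>0. \<exists>M. \<forall>m\<ge>M. \<forall>n\<ge>M. nrm std (X m - X n) < e"
  then have "Cauchy X" by (auto simp: Cauchy_def dist_norm)
  then obtain x where "X \<longlonglongrightarrow> x" by (auto simp: Cauchy_convergent_iff convergent_def)
  then show "\<exists>x\<in>carr std. (\<lambda>n. nrm std (X n - x)) \<longlonglongrightarrow> 0"
    by (auto simp: tendsto_norm_zero_iff LIM_zero_iff)
qed

text \<open>Banach's iteration on a closed ball: consecutive steps shrink by \<open>c\<close>, so
  the total distance travelled from \<open>y0\<close> is at most the first step divided by
  \<open>1 - c\<close>, and smallness of the first step keeps every iterate within the radius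
  \<open>R\<close>. The fixed point inherits this distance bound, which is what places the implicit
  solution near \<open>y0\<close>.\<close>

lemma (in nspace) contraction_fixpoint:
  assumes complete: "complete_nspace E"
    and y0: "y0 \<in> carr E" and c: "0 \<le> c" "c < 1"
    and T: "\<And>y. y \<in> carr E \<Longrightarrow> nrm E (y - y0) \<le> R \<Longrightarrow> T y \<in> carr E"
    and lip: "\<And>y z. y \<in> carr E \<Longrightarrow> z \<in> carr E \<Longrightarrow> nrm E (y - y0) \<le> R \<Longrightarrow> nrm E (z - y0) \<le> R \<Longrightarrow>
                nrm E (T y - T z) \<le> c * nrm E (y - z)"
    and R: "nrm E (T y0 - y0) \<le> (1 - c) * R" "0 \<le> R"
  shows "\<exists>y\<in>carr E. nrm E (y - y0) \<le> nrm E (T y0 - y0) / (1 - c) \<and> T y = y"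
proof -
  define X where "X n = (T ^^ n) y0" for n
  define D where "D = nrm E (T y0 - y0)"
  have Ty0: "T y0 \<in> carr E" using T[of y0] y0 R by simp
  have D0: "0 \<le> D" unfolding D_def using nrm_ge_0 Ty0 y0 by simp
  have DR: "D / (1 - c) \<le> R" using R c by (simp add: D_def field_simps)
  \<comment> \<open>The partial geometric sum belongs to the invariant: it shows that the next
    iterate is still in the ball on which \<open>T\<close> is Lipschitz.\<close>
  have X: "X n \<in> carr E \<and> nrm E (X n - y0) \<le> D * (1 - c ^ n) / (1 - c) \<and>
           nrm E (X (Suc n) - X n) \<le> c ^ n * D" for n
  proof (induction n)
    case 0
    then show ?case using y0 by (simp add: X_def D_def)
  next
    case (Suc n)
    have R1: "D * (1 - c ^ k) / (1 - c) \<le> R" for k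
    proof -
      have "D * (1 - c ^ k) / (1 - c) \<le> D / (1 - c)"
        using c D0 by (intro divide_right_mono) (auto intro: mult_left_le)
      then show ?thesis using DR by linarith
    qed
    have XS: "X (Suc n) = T (X n)" "X (Suc (Suc n)) = T (X (Suc n))" by (simp_all add: X_def)
    have XR: "nrm E (X n - y0) \<le> R" using Suc R1[of n] by linarith
    then have 1: "X (Suc n) \<in> carr E" using Suc T XS by auto
    have "nrm E (X (Suc n) - y0) \<le> nrm E (X (Suc n) - X n) + nrm E (X n - y0)"
      using nrm_triangle3 1 Suc y0 by blast
    also have "\<dots> \<le> c ^ n * D + D * (1 - c ^ n) / (1 - c)" using Suc by auto
    also have "\<dots> = D * (1 - c ^ Suc n) / (1 - c)" using c by (simp add: field_simps)
    finally have 2: "nrm E (X (Suc n) - y0) \<le> D * (1 - c ^ Suc n) / (1 - c)" .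
    have "nrm E (X (Suc (Suc n)) - X (Suc n)) \<le> c * nrm E (X (Suc n) - X n)"
      unfolding XS(2) using 1 2 R1[of "Suc n"] R1[of n] Suc XS(1) lip[of "X (Suc n)" "X n"] by auto
    also have "\<dots> \<le> c * (c ^ n * D)" using Suc c by (intro mult_left_mono) auto
    finally show ?case using 1 2 by simp
  qed
  have diff: "nrm E (X (n + k) - X n) \<le> c ^ n * (D / (1 - c))" for n k
  proof -
    have "nrm E (X (n + k) - X n) \<le> c ^ n * D * (1 - c ^ k) / (1 - c)"
    proof (induction k)
      case 0
      then show ?case using X[of n] by simp
    next
      case (Suc k)
      have "nrm E (X (n + Suc k) - X n) \<le> nrm E (X (Suc (n + k)) - X (n + k)) + nrm E (X (n + k) - X n)"
        using nrm_triangle3[of "X (Suc (n + k))" "X (n + k)" "X n"] X by auto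
      also have "\<dots> \<le> c ^ (n + k) * D + c ^ n * D * (1 - c ^ k) / (1 - c)"
        using X[of "n + k"] Suc by auto
      also have "\<dots> = c ^ n * D * (1 - c ^ Suc k) / (1 - c)"
        using c by (simp add: field_simps power_add)
      finally show ?case .
    qed
    also have "\<dots> \<le> c ^ n * D / (1 - c)"
      using c D0 by (intro divide_right_mono) (auto intro: mult_left_le)
    finally show ?thesis by simp
  qed
  have cn: "(\<lambda>n. c ^ n * (D / (1 - c))) \<longlonglongrightarrow> 0"
    using c by (intro tendsto_mult_left_zero LIMSEQ_power_zero) auto
  obtain y where y: "y \<in> carr E" "(\<lambda>n. nrm E (X n - y)) \<longlonglongrightarrow> 0"
  proof (rule complete_nspaceD[OF complete, of X])
    show "X n \<in> carr E" for n using X by blast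
    fix e :: real assume "0 < e"
    then obtain M where M: "\<And>n. n \<ge> M \<Longrightarrow> c ^ n * (D / (1 - c)) < e"
      using order_tendstoD(2)[OF cn \<open>0 < e\<close>] by (auto simp: eventually_sequentially)
    have "nrm E (X m - X n) < e" if "m \<ge> M" "n \<ge> M" for m n
    proof (cases "m \<ge> n")
      case True
      then show ?thesis using diff[of n "m - n"] M[of n] that by simp
    next
      case False
      then have "nrm E (X n - X m) < e" using diff[of m "n - m"] M[of m] that by simp
      then show ?thesis using nrm_minus_commute X by metis
    qed
    then show "\<exists>M. \<forall>m\<ge>M. \<forall>n\<ge>M. nrm E (X m - X n) < e" by blast
  qed
  have lim: "nrm E (y - y0) \<le> D / (1 - c)"
  proof (rule tendsto_lowerbound[of "\<lambda>n. nrm E (X n - y) + D / (1 - c)" _ sequentially])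
    show "(\<lambda>n. nrm E (X n - y) + D / (1 - c)) \<longlonglongrightarrow> D / (1 - c)"
      using tendsto_add[OF y(2) tendsto_const] by simp
    have "nrm E (y - y0) \<le> nrm E (X n - y) + D / (1 - c)" for n
      using nrm_triangle3[of y "X n" y0] nrm_minus_commute[of y "X n"] X[of n] y y0 diff[of 0 n]
      by (auto simp: X_def)
    then show "\<forall>\<^sub>F n in sequentially. nrm E (y - y0) \<le> nrm E (X n - y) + D / (1 - c)" by simp
  qed simp
  have yR: "nrm E (y - y0) \<le> R" using lim DR by linarith
  have XR: "nrm E (X n - y0) \<le> R" for n
    using diff[of 0 n] DR by (simp add: X_def)
  have "nrm E (T y - y) \<le> nrm E (X n - y) + nrm E (X (Suc n) - y)" for n
  proof -
    have "nrm E (T y - y) \<le> nrm E (T y - X (Suc n)) + nrm E (X (Suc n) - y)"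
      using nrm_triangle3 T y yR X by blast
    moreover have "nrm E (T y - X (Suc n)) \<le> c * nrm E (X n - y)"
      using lip[of y "X n"] y yR X XR nrm_minus_commute[of y "X n"] by (auto simp: X_def)
    moreover have "c * nrm E (X n - y) \<le> 1 * nrm E (X n - y)"
      using c X y nrm_ge_0 by (intro mult_right_mono) auto
    ultimately show ?thesis by linarith
  qed
  moreover have "(\<lambda>n. nrm E (X n - y) + nrm E (X (Suc n) - y)) \<longlonglongrightarrow> 0"
    using tendsto_add[OF y(2) LIMSEQ_Suc[OF y(2)]] by simp
  ultimately have "nrm E (T y - y) \<le> 0"
    using tendsto_lowerbound[of _ 0 sequentially "nrm E (T y - y)"] by (simp add: eventually_sequentially)
  then have "T y = y" using nrm_diff_eq_0 T y yR by blast
  then show ?thesis using lim y unfolding D_def by blast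
qed

section \<open>Bounded linear maps, bounded inverses and the implicit function theorem\<close>

lemma bounded_linear_betweenD:
  assumes "bounded_linear_between E F A"
  shows "\<And>v. v \<in> carr E \<Longrightarrow> A v \<in> carr F"
    and "\<And>v w. v \<in> carr E \<Longrightarrow> w \<in> carr E \<Longrightarrow> A (v + w) = A v + A w"
    and "\<And>c v. v \<in> carr E \<Longrightarrow> A (c *\<^sub>R v) = c *\<^sub>R A v"
  using assms unfolding bounded_linear_between_def linear_between_def by blast+

lemma bounded_linear_between_bound:
  assumes "bounded_linear_between E F A" "nspace E"
  obtains C where "0 < C" "\<And>v. v \<in> carr E \<Longrightarrow> nrm F (A v) \<le> C * nrm E v"
proof -
  interpret E: nspace E by fact
  obtain C where C: "\<And>v. v \<in> carr E \<Longrightarrow> nrm F (A v) \<le> C * nrm E v"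
    using assms(1) unfolding bounded_linear_between_def by blast
  have "nrm F (A v) \<le> max C 1 * nrm E v" if "v \<in> carr E" for v
    using C[OF that] mult_right_mono[OF max.cobounded1[of C 1] E.nrm_ge_0[OF that]] by linarith
  then show ?thesis using that[of "max C 1"] by auto
qed

lemma bounded_linear_between_diff:
  assumes "bounded_linear_between E F A" "nspace E" "v \<in> carr E" "w \<in> carr E"
  shows "A (v - w) = A v - A w"
proof -
  interpret E: nspace E by fact
  have "A (v - w) = A (v + (-1) *\<^sub>R w)" by simp
  also have "\<dots> = A v - A w"
    using bounded_linear_betweenD[OF assms(1)] assms(3,4) E.scale_carr[of w "-1"] by (metis scaleR_minus1_left diff_conv_add_uminus)
  finally show ?thesis .
qed

text \<open>Invertibility in quantitative form: for linear \<open>A\<close> the first conjunct gives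
  injectivity and bounds the inverse by \<open>b\<close>, the second is surjectivity. The explicit
  \<open>b\<close> makes the property stable under perturbation with a known loss.\<close>

definition inverse_bounded_by ::
    "'a::real_vector nspace \<Rightarrow> 'b::real_vector nspace \<Rightarrow> ('a \<Rightarrow> 'b) \<Rightarrow> real \<Rightarrow> bool" where
  "inverse_bounded_by F G A b \<longleftrightarrow>
     (\<forall>v\<in>carr F. nrm F v \<le> b * nrm G (A v)) \<and> (\<forall>w\<in>carr G. \<exists>v\<in>carr F. A v = w)"

lemma inverse_bounded_byE:
  assumes "inverse_bounded_by F G A b"
  obtains B where "\<And>w. w \<in> carr G \<Longrightarrow> B w \<in> carr F" "\<And>w. w \<in> carr G \<Longrightarrow> A (B w) = w"
    "\<And>w. w \<in> carr G \<Longrightarrow> nrm F (B w) \<le> b * nrm G w"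
proof -
  obtain B where B: "\<And>w. w \<in> carr G \<Longrightarrow> B w \<in> carr F \<and> A (B w) = w"
    using assms unfolding inverse_bounded_by_def by metis
  then have "nrm F (B w) \<le> b * nrm G w" if "w \<in> carr G" for w
    using assms that unfolding inverse_bounded_by_def by metis
  then show ?thesis using that B by blast
qed

lemma inverse_bounded_by_inj:
  assumes "nspace F" "nspace G" "bounded_linear_between F G A" "inverse_bounded_by F G A b"
    and "v \<in> carr F" "w \<in> carr F" "A v = A w"
  shows "v = w"
proof -
  interpret F: nspace F by fact
  interpret G: nspace G by fact
  have "A (v - w) = 0" using bounded_linear_between_diff[OF assms(3,1)] assms by simp
  then have "nrm F (v - w) \<le> 0"
    using assms(4,5,6) F.diff_carr unfolding inverse_bounded_by_def by (metis G.nrm_0 mult_zero_right)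
  then show ?thesis using F.nrm_diff_eq_0 assms by blast
qed

text \<open>The solution is the fixed point of \<open>y \<mapsto> y - A\<^sup>-\<^sup>1 (N u y)\<close>.\<close>

lemma strict_implicit_function:
  assumes E: "nspace E" and F: "nspace F" and G: "nspace G" and complete: "complete_nspace F"
    and A: "bounded_linear_between F G A" and b: "0 < b" and inv: "inverse_bounded_by F G A b"
    and u0: "u0 \<in> carr E" and y0: "y0 \<in> carr F" and N0: "N u0 y0 = 0"
    and C: "0 \<le> C"
    and d: "0 < d"
    and NG: "\<And>u y. u \<in> carr E \<Longrightarrow> y \<in> carr F \<Longrightarrow> nrm E (u - u0) < d \<Longrightarrow> nrm F (y - y0) < d \<Longrightarrow> N u y \<in> carr G"
    and N: "\<And>u1 u2 y1 y2. u1 \<in> carr E \<Longrightarrow> u2 \<in> carr E \<Longrightarrow> y1 \<in> carr F \<Longrightarrow> y2 \<in> carr F \<Longrightarrow>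
        nrm E (u1 - u0) < d \<Longrightarrow> nrm E (u2 - u0) < d \<Longrightarrow> nrm F (y1 - y0) < d \<Longrightarrow> nrm F (y2 - y0) < d \<Longrightarrow>
        nrm G (N u1 y1 - N u2 y2 - A (y1 - y2)) \<le> 1 / (2 * b) * nrm F (y1 - y2) + C * nrm E (u1 - u2)"
  shows "\<And>\<nu>. 0 < \<nu> \<Longrightarrow> \<nu> \<le> d \<Longrightarrow>
           \<exists>\<eta>>0. \<forall>u\<in>carr E. nrm E (u - u0) < \<eta> \<longrightarrow> (\<exists>y\<in>carr F. nrm F (y - y0) < \<nu> \<and> N u y = 0)"
    and "\<And>u1 u2 y1 y2. u1 \<in> carr E \<Longrightarrow> u2 \<in> carr E \<Longrightarrow> y1 \<in> carr F \<Longrightarrow> y2 \<in> carr F \<Longrightarrow>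
        nrm E (u1 - u0) < d \<Longrightarrow> nrm E (u2 - u0) < d \<Longrightarrow> nrm F (y1 - y0) < d \<Longrightarrow> nrm F (y2 - y0) < d \<Longrightarrow>
        N u1 y1 = 0 \<Longrightarrow> N u2 y2 = 0 \<Longrightarrow> nrm F (y1 - y2) \<le> 2 * b * C * nrm E (u1 - u2)"
proof -
  interpret E: nspace E by fact
  interpret F: nspace F by fact
  interpret G: nspace G by fact
  obtain B where B: "\<And>w. w \<in> carr G \<Longrightarrow> B w \<in> carr F" "\<And>w. w \<in> carr G \<Longrightarrow> A (B w) = w"
    "\<And>w. w \<in> carr G \<Longrightarrow> nrm F (B w) \<le> b * nrm G w"
    using inverse_bounded_byE[OF inv] by metis
  note Adiff = bounded_linear_between_diff[OF A F]
  {
    fix \<nu> :: real assume \<nu>: "0 < \<nu>" "\<nu> \<le> d"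
    \<comment> \<open>This makes \<open>b * C * nrm E (u - u0)\<close> at most
      \<open>\<nu> / 4\<close>; with contraction factor 1/2 the fixed point then lies within
      \<open>\<nu> / 2\<close> of \<open>y0\<close>. The summand 1 in \<open>C + 1\<close> covers
      \<open>C = 0\<close>.\<close>
    define \<eta> where "\<eta> = min d (\<nu> / (4 * b * (C + 1)))"
    have \<eta>: "0 < \<eta>" "\<eta> \<le> d" using b C d \<nu> by (auto simp: \<eta>_def)
    have "\<exists>y\<in>carr F. nrm F (y - y0) < \<nu> \<and> N u y = 0" if u: "u \<in> carr E" "nrm E (u - u0) < \<eta>" for u
    proof -
      define T where "T y = y - B (N u y)" for y
      have ud: "nrm E (u - u0) < d" using u \<eta> by simp
      have NuG: "N u y \<in> carr G" if "y \<in> carr F" "nrm F (y - y0) \<le> \<nu> / 2" for y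
        using NG[OF u(1) that(1) ud] that \<nu> by linarith
      have lip: "nrm F (T y - T z) \<le> 1 / 2 * nrm F (y - z)"
        if yz: "y \<in> carr F" "z \<in> carr F" "nrm F (y - y0) \<le> \<nu> / 2" "nrm F (z - y0) \<le> \<nu> / 2" for y z
      proof -
        have TF: "T y - T z \<in> carr F" unfolding T_def using B NuG yz by auto
        \<comment> \<open>\<open>B\<close> is a section of \<open>A\<close> chosen pointwise, with
          linearity not established here; differences of values of \<open>T\<close> are therefore
          compared after applying \<open>A\<close> and brought back by the lower bound.\<close>
        have AT: "A (T y) = A y - N u y" if "y \<in> carr F" "nrm F (y - y0) \<le> \<nu> / 2" for y
          unfolding T_def using Adiff B NuG[OF that] that by simp
        have "T y \<in> carr F" "T z \<in> carr F" unfolding T_def using B NuG yz by auto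
        then have "A (T y - T z) = (A y - A z) - (N u y - N u z)"
          using Adiff[of "T y" "T z"] AT yz by simp
        also have "\<dots> = - (N u y - N u z - A (y - z))"
          using Adiff yz by (simp add: algebra_simps)
        finally have "nrm G (A (T y - T z)) = nrm G (N u y - N u z - A (y - z))"
          using G.nrm_minus_commute[of "N u y - N u z" "A (y - z)"] NuG yz bounded_linear_betweenD(1)[OF A]
          by simp
        also have "\<dots> \<le> 1 / (2 * b) * nrm F (y - z)"
          using N[of u u y z] u yz ud \<nu> by simp
        finally have "nrm G (A (T y - T z)) \<le> 1 / (2 * b) * nrm F (y - z)" .
        then have "b * nrm G (A (T y - T z)) \<le> b * (1 / (2 * b) * nrm F (y - z))"
          using b by (intro mult_left_mono) auto
        moreover have "nrm F (T y - T z) \<le> b * nrm G (A (T y - T z))"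
          using inv TF unfolding inverse_bounded_by_def by blast
        ultimately show ?thesis using b by simp
      qed
      have N00: "nrm G (N u y0) \<le> C * nrm E (u - u0)"
        using N[of u u0 y0 y0] u u0 y0 d ud N0 bounded_linear_betweenD(3)[OF A y0, of 0] by simp
      have Ty0: "nrm F (T y0 - y0) \<le> b * (C * nrm E (u - u0))"
      proof -
        have "nrm F (T y0 - y0) = nrm F (B (N u y0))"
          unfolding T_def using B NuG[of y0] y0 \<nu> by simp
        also have "\<dots> \<le> b * nrm G (N u y0)" using B NuG[of y0] y0 \<nu> by simp
        also have "\<dots> \<le> b * (C * nrm E (u - u0))" using b N00 by (intro mult_left_mono) auto
        finally show ?thesis .
      qed
      have "b * (C * nrm E (u - u0)) \<le> b * ((C + 1) * nrm E (u - u0))"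
        using b C E.nrm_ge_0[of "u - u0"] u u0 by (intro mult_left_mono mult_right_mono) auto
      also have "\<dots> \<le> b * ((C + 1) * (\<nu> / (4 * b * (C + 1))))"
        using b C u unfolding \<eta>_def by (intro mult_left_mono) auto
      also have "\<dots> = \<nu> / 4"
      proof -
        have "b * (K * (\<nu> / (4 * b * K))) = \<nu> / 4" if "K > 0" for K
          using b that by (simp add: field_simps)
        from this[of "C + 1"] show ?thesis using C by linarith
      qed
      finally have small: "nrm F (T y0 - y0) \<le> \<nu> / 4" using Ty0 by linarith
      have "\<exists>y\<in>carr F. nrm F (y - y0) \<le> nrm F (T y0 - y0) / (1 - 1 / 2) \<and> T y = y"
        by (rule F.contraction_fixpoint[OF complete y0, of "1/2" "\<nu> / 2"])
          (use lip small \<nu> B NuG in \<open>auto simp: T_def\<close>)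
      then obtain y where y: "y \<in> carr F" "nrm F (y - y0) \<le> \<nu> / 2" "T y = y"
        using small by fastforce
      then have "B (N u y) = 0" by (simp add: T_def)
      then have "N u y = A 0" using B(2)[OF NuG[OF y(1,2)]] by simp
      then have "N u y = 0" using bounded_linear_betweenD(3)[OF A y0, of 0] by simp
      then show ?thesis using y \<nu> by (intro bexI[of _ y]) auto
    qed
    then show "\<exists>\<eta>>0. \<forall>u\<in>carr E. nrm E (u - u0) < \<eta> \<longrightarrow> (\<exists>y\<in>carr F. nrm F (y - y0) < \<nu> \<and> N u y = 0)"
      using \<eta> by blast
  }
  {
    fix u1 u2 y1 y2
    assume *: "u1 \<in> carr E" "u2 \<in> carr E" "y1 \<in> carr F" "y2 \<in> carr F"
        "nrm E (u1 - u0) < d" "nrm E (u2 - u0) < d" "nrm F (y1 - y0) < d" "nrm F (y2 - y0) < d"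
        "N u1 y1 = 0" "N u2 y2 = 0"
    have "nrm G (A (y1 - y2)) \<le> 1 / (2 * b) * nrm F (y1 - y2) + C * nrm E (u1 - u2)"
      using N[of u1 u2 y1 y2] * bounded_linear_betweenD(1)[OF A] by simp
    then have "b * nrm G (A (y1 - y2)) \<le> b * (1 / (2 * b) * nrm F (y1 - y2) + C * nrm E (u1 - u2))"
      using b by (intro mult_left_mono) auto
    moreover have "nrm F (y1 - y2) \<le> b * nrm G (A (y1 - y2))"
      using inv * F.diff_carr unfolding inverse_bounded_by_def by blast
    ultimately show "nrm F (y1 - y2) \<le> 2 * b * C * nrm E (u1 - u2)"
      using b by (simp add: algebra_simps)
  }
qed

text \<open>For given \<open>w\<close> the map \<open>v \<mapsto> v - B (A' v - w)\<close> contracts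
  by 1/2, as in the Neumann series, and its fixed point solves \<open>A' v = w\<close>. In the lower
  bound half of \<open>nrm F v\<close> is absorbed on the left, which doubles the constant.\<close>

lemma inverse_bounded_by_perturbation:
  assumes F: "nspace F" and G: "nspace G" and complete: "complete_nspace F"
    and A: "bounded_linear_between F G A" and b: "0 < b" and inv: "inverse_bounded_by F G A b"
    and A': "bounded_linear_between F G A'"
    and close: "\<And>v. v \<in> carr F \<Longrightarrow> nrm G (A' v - A v) \<le> 1 / (2 * b) * nrm F v"
  shows "inverse_bounded_by F G A' (2 * b)"
proof -
  interpret F: nspace F by fact
  interpret G: nspace G by fact
  obtain B where B: "\<And>w. w \<in> carr G \<Longrightarrow> B w \<in> carr F" "\<And>w. w \<in> carr G \<Longrightarrow> A (B w) = w"
    "\<And>w. w \<in> carr G \<Longrightarrow> nrm F (B w) \<le> b * nrm G w"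
    using inverse_bounded_byE[OF inv] by metis
  note Adiff = bounded_linear_between_diff[OF A F] and A'diff = bounded_linear_between_diff[OF A' F]
  have AF: "v \<in> carr F \<Longrightarrow> A v \<in> carr G" "v \<in> carr F \<Longrightarrow> A' v \<in> carr G" for v
    using bounded_linear_betweenD(1)[OF A] bounded_linear_betweenD(1)[OF A'] by auto
  have le: "nrm F v \<le> 2 * b * nrm G (A' v)" if v: "v \<in> carr F" for v
  proof -
    have "nrm G (A v) \<le> nrm G (A' v) + nrm G (A' v - A v)"
      using G.nrm_diff_triangle[of "A' v" "A' v - A v"] AF v by simp
    then have "b * nrm G (A v) \<le> b * (nrm G (A' v) + 1 / (2 * b) * nrm F v)"
      using close[OF v] b by (intro mult_left_mono) auto
    moreover have "nrm F v \<le> b * nrm G (A v)"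
      using inv v unfolding inverse_bounded_by_def by blast
    ultimately show ?thesis using b by (simp add: algebra_simps)
  qed
  have "\<exists>v\<in>carr F. A' v = w" if w: "w \<in> carr G" for w
  proof -
    define T where "T v = v - B (A' v - w)" for v
    have TF: "T v \<in> carr F" if "v \<in> carr F" for v using that B AF w by (auto simp: T_def)
    have lip: "nrm F (T y - T z) \<le> 1 / 2 * nrm F (y - z)" if yz: "y \<in> carr F" "z \<in> carr F" for y z
    proof -
      have AT: "A (T y) = A y - (A' y - w)" if "y \<in> carr F" for y
        unfolding T_def using Adiff B AF that w by simp
      have "A (T y - T z) = - (A' (y - z) - A (y - z))"
        using Adiff[of "T y" "T z"] AT TF Adiff A'diff yz by simp
      then have "nrm G (A (T y - T z)) \<le> 1 / (2 * b) * nrm F (y - z)"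
        using close[of "y - z"] yz AF G.nrm_minus_commute[of "A (y - z)" "A' (y - z)"] by simp
      then have "b * nrm G (A (T y - T z)) \<le> b * (1 / (2 * b) * nrm F (y - z))"
        using b by (intro mult_left_mono) auto
      moreover have "nrm F (T y - T z) \<le> b * nrm G (A (T y - T z))"
        using inv TF yz F.diff_carr unfolding inverse_bounded_by_def by blast
      ultimately show ?thesis using b by simp
    qed
    \<comment> \<open>The contraction is global, so the radius only has to accommodate the first
      step from 0: twice its length.\<close>
    have "\<exists>y\<in>carr F. nrm F (y - 0) \<le> nrm F (T 0 - 0) / (1 - 1 / 2) \<and> T y = y"
      by (rule F.contraction_fixpoint[OF complete, of 0 "1/2" "2 * nrm F (T 0 - 0)"])
        (use lip TF F.nrm_ge_0[of "T 0"] in auto)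
    then obtain y where y: "y \<in> carr F" "T y = y" by blast
    then have "B (A' y - w) = 0" by (simp add: T_def)
    then have "A' y - w = A 0" using B(2)[of "A' y - w"] AF y w by simp
    then show ?thesis using y bounded_linear_betweenD(3)[OF A y(1), of 0] by auto
  qed
  then show ?thesis using le unfolding inverse_bounded_by_def by blast
qed

section \<open>Periodic Hoelder spaces\<close>

text \<open>The bound \<open>C\<close> ensures that the supremum is taken over a set bounded above;
  without it the value of \<open>SUP\<close> on the reals carries no information.\<close>

lemma abs_le_sup_norm: "(\<And>t. \<bar>f t\<bar> \<le> C) \<Longrightarrow> \<bar>f t\<bar> \<le> sup_norm f"
  unfolding sup_norm_def by (rule cSUP_upper) (auto intro!: bdd_aboveI2)

lemma sup_norm_le: "(\<And>t. \<bar>f t\<bar> \<le> C) \<Longrightarrow> sup_norm f \<le> C"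
  unfolding sup_norm_def by (rule cSUP_least) auto

text \<open>At \<open>s = t\<close> the quotient is 0 by the convention for division by zero, and
  this value is bounded by \<open>C\<close> because \<open>0 \<le> C\<close>.\<close>

lemma holder_quotient_le:
  fixes s t :: real
  assumes "\<And>s t. \<bar>f s - f t\<bar> \<le> C * \<bar>s - t\<bar> powr \<alpha>" "0 \<le> C"
  shows "\<bar>f s - f t\<bar> / \<bar>s - t\<bar> powr \<alpha> \<le> C"
proof (cases "s = t")
  case False
  then show ?thesis using assms(1)[of s t] by (simp add: divide_le_eq)
qed (use assms in auto)

lemma holder_seminorm_le:
  assumes "\<And>s t. \<bar>f s - f t\<bar> \<le> C * \<bar>s - t\<bar> powr \<alpha>" "0 \<le> C"
  shows "holder_seminorm \<alpha> f \<le> C"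
  unfolding holder_seminorm_def
  by (rule cSUP_least) (use holder_quotient_le[OF assms] in auto)

lemma le_holder_seminorm:
  assumes "\<And>s t. \<bar>f s - f t\<bar> \<le> C * \<bar>s - t\<bar> powr \<alpha>"
  shows "\<bar>f s - f t\<bar> \<le> holder_seminorm \<alpha> f * \<bar>s - t\<bar> powr \<alpha>"
proof (cases "s = t")
  case False
  \<comment> \<open>Any two points at distance 1 show that a Hoelder constant is
    nonnegative.\<close>
  have C: "0 \<le> C" using assms[of 1 0] by simp
  have "\<bar>f s - f t\<bar> / \<bar>s - t\<bar> powr \<alpha> \<le> holder_seminorm \<alpha> f"
    unfolding holder_seminorm_def
    by (rule cSUP_upper2[where x = "(s, t)"])
      (use holder_quotient_le[OF assms C] in \<open>auto intro!: bdd_aboveI2\<close>)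
  then show ?thesis using False by (simp add: divide_le_eq)
qed simp

lemma holder_seminorm_ge_0:
  assumes "\<And>s t. \<bar>f s - f t\<bar> \<le> C * \<bar>s - t\<bar> powr \<alpha>"
  shows "0 \<le> holder_seminorm \<alpha> f"
  using le_holder_seminorm[of f C \<alpha> 1 0, OF assms] by simp

section \<open>Periodic functions and the recursion on the order of differentiability\<close>

lemma periodic_fun_simple_iff: "periodic_fun_simple f P \<longleftrightarrow> (\<forall>t. f (t + P) = f t)"
  by (auto simp: periodic_fun_simple_def)

text \<open>Subtracting \<open>\<lfloor>t / P\<rfloor>\<close> periods moves \<open>t\<close> into
  \<open>{0..P}\<close>, so compactness of one period yields bounds, in particular positive lower
  bounds, on the whole line.\<close>

lemma periodic_reduce:
  assumes "periodic_fun_simple f P" "0 < (P::real)"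
  obtains s where "s \<in> {0..P}" "f t = f s"
proof -
  interpret periodic_fun_simple f P by fact
  define k where "k = \<lfloor>t / P\<rfloor>"
  have "of_int k \<le> t / P" "t / P < of_int k + 1" unfolding k_def by linarith+
  then have "0 \<le> t - of_int k * P" "t - of_int k * P \<le> P"
    using assms(2) by (auto simp: field_simps)
  moreover have "f (t - of_int k * P) = f t" by (simp add: minus_of_int)
  ultimately show ?thesis using that[of "t - of_int k * P"] by auto
qed

lemma periodic_bounded:
  fixes f :: "real \<Rightarrow> real"
  assumes "periodic_fun_simple f P" "0 < P" "continuous_on UNIV f"
  obtains C where "\<And>t. \<bar>f t\<bar> \<le> C"
proof -
  have "bounded (f ` {0..P})"
    by (intro compact_imp_bounded compact_continuous_image continuous_on_subset[OF assms(3)]) auto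
  then obtain C where C: "\<forall>s\<in>{0..P}. \<bar>f s\<bar> \<le> C" by (auto simp: bounded_iff)
  have "\<bar>f t\<bar> \<le> C" for t by (rule periodic_reduce[OF assms(1,2), of t]) (use C in simp)
  then show ?thesis by (rule that)
qed

lemma periodic_positive_lower_bound:
  fixes f :: "real \<Rightarrow> real"
  assumes "periodic_fun_simple f P" "0 < P" "continuous_on UNIV f" "\<And>t. 0 < f t"
  obtains m where "0 < m" "\<And>t. m \<le> f t"
proof -
  have "\<exists>s\<in>{0..P}. \<forall>t\<in>{0..P}. f s \<le> f t"
    by (rule continuous_attains_inf) (use assms(2) continuous_on_subset[OF assms(3)] in auto)
  then obtain s where "s \<in> {0..P}" and s: "\<And>t. t \<in> {0..P} \<Longrightarrow> f s \<le> f t" by blast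
  have "f s \<le> f t" for t by (rule periodic_reduce[OF assms(1,2), of t]) (simp add: s)
  then show ?thesis using that[of "f s"] assms(4) by blast
qed

lemma periodic_deriv:
  assumes "periodic_fun_simple f P"
  shows "periodic_fun_simple (deriv f) (P::real)"
proof -
  interpret periodic_fun_simple f P by fact
  have "deriv f (t + P) = deriv (\<lambda>x. f (x + P)) t" for t
    unfolding deriv_def by (simp add: DERIV_shift)
  then show ?thesis by (simp add: plus_period periodic_fun_simple_iff)
qed

text \<open>The derivative is split off at the inner end of the iteration \<open>deriv ^^ i\<close>,
  so that a property of \<open>f\<close> of order \<open>j + 1\<close> becomes a property of
  \<open>deriv f\<close> of order \<open>j\<close>.\<close>

lemma times_cont_diff_Suc:
  "times_cont_diff (Suc j) f \<longleftrightarrow> (\<forall>t. f differentiable (at t)) \<and> times_cont_diff j (deriv f)"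
proof -
  have "(\<forall>i<Suc j. Q i) \<longleftrightarrow> Q 0 \<and> (\<forall>i<j. Q (Suc i))" for Q
    by (metis less_Suc_eq_0_disj zero_less_Suc Suc_less_eq)
  from this[of "\<lambda>i. \<forall>t. (deriv ^^ i) f differentiable (at t)"] show ?thesis
    unfolding times_cont_diff_def by (simp only: funpow_0 funpow_Suc_right comp_apply) blast
qed

locale holder =
  fixes P \<alpha> :: real
  assumes P: "0 < P" and \<alpha>: "0 < \<alpha>" "\<alpha> < 1"
begin

abbreviation H :: "nat \<Rightarrow> rfun nspace" where "H j \<equiv> Hper P j \<alpha>"

lemma carr_H0:
  "f \<in> carr (H 0) \<longleftrightarrow> periodic_fun_simple f P \<and> continuous_on UNIV f \<and>
     (\<exists>C. \<forall>s t. \<bar>f s - f t\<bar> \<le> C * \<bar>s - t\<bar> powr \<alpha>)"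
  by (auto simp: Hper_def times_cont_diff_def)

lemma nrm_H0: "nrm (H 0) f = sup_norm f + holder_seminorm \<alpha> f"
  by (simp add: Hper_def)

text \<open>Together with \<open>nrm_H_Suc\<close> this gives a recursive description of the Hoelder
  spaces. Facts about \<open>H j\<close> can then be proved by induction on \<open>j\<close>, with
  Hoelder quotients appearing only at \<open>j = 0\<close>.\<close>

lemma carr_H_Suc:
  "f \<in> carr (H (Suc j)) \<longleftrightarrow>
     periodic_fun_simple f P \<and> (\<forall>t. f differentiable (at t)) \<and> deriv f \<in> carr (H j)"
  by (auto simp: Hper_def times_cont_diff_Suc periodic_deriv funpow_swap1)

lemma nrm_H_Suc: "nrm (H (Suc j)) f = sup_norm f + nrm (H j) (deriv f)"
  by (simp add: Hper_def sum.atMost_Suc_shift funpow_swap1 del: sum.atMost_Suc)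

lemma H_continuous: "f \<in> carr (H j) \<Longrightarrow> continuous_on UNIV f"
  by (cases j) (auto simp: carr_H0 carr_H_Suc intro!: continuous_at_imp_continuous_on differentiable_imp_continuous_within)

lemma H_periodic: "f \<in> carr (H j) \<Longrightarrow> periodic_fun_simple f P"
  by (cases j) (auto simp: carr_H0 carr_H_Suc)

lemma H_le_sup_norm:
  assumes "f \<in> carr (H j)"
  shows "\<bar>f t\<bar> \<le> sup_norm f"
proof -
  obtain C where "\<And>t. \<bar>f t\<bar> \<le> C"
    using periodic_bounded[OF H_periodic[OF assms] P H_continuous[OF assms]] by blast
  then show ?thesis by (rule abs_le_sup_norm)
qed

lemma H0_holder:
  "f \<in> carr (H 0) \<Longrightarrow> \<bar>f s - f t\<bar> \<le> holder_seminorm \<alpha> f * \<bar>s - t\<bar> powr \<alpha>"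
  using le_holder_seminorm[of f _ \<alpha> s t] by (auto simp: carr_H0)

lemma H0_holder_ge_0: "f \<in> carr (H 0) \<Longrightarrow> 0 \<le> holder_seminorm \<alpha> f"
  using holder_seminorm_ge_0[of f _ \<alpha>] by (auto simp: carr_H0)

lemma sup_norm_ge_0: "f \<in> carr (H j) \<Longrightarrow> 0 \<le> sup_norm f"
  using H_le_sup_norm[of f j 0] by simp

lemma H0I:
  assumes "periodic_fun_simple f P" "continuous_on UNIV f" "\<And>s t. \<bar>f s - f t\<bar> \<le> D * \<bar>s - t\<bar> powr \<alpha>"
  shows "f \<in> carr (H 0)"
  using assms by (auto simp: carr_H0)

lemma nrm_H0_le:
  assumes "\<And>t. \<bar>f t\<bar> \<le> C" "\<And>s t. \<bar>f s - f t\<bar> \<le> D * \<bar>s - t\<bar> powr \<alpha>" "0 \<le> D"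
  shows "nrm (H 0) f \<le> C + D"
  unfolding nrm_H0 by (intro add_mono sup_norm_le holder_seminorm_le assms)

lemma sup_norm_add:
  assumes "f \<in> carr (H i)" "g \<in> carr (H j)"
  shows "sup_norm (f + g) \<le> sup_norm f + sup_norm g"
proof (rule sup_norm_le)
  show "\<bar>(f + g) t\<bar> \<le> sup_norm f + sup_norm g" for t
    using H_le_sup_norm[OF assms(1), of t] H_le_sup_norm[OF assms(2), of t] by simp
qed

lemma sup_norm_scale: "f \<in> carr (H i) \<Longrightarrow> sup_norm (c *\<^sub>R f) = \<bar>c\<bar> * sup_norm f"
proof (rule antisym)
  assume f: "f \<in> carr (H i)"
  show le: "sup_norm (c *\<^sub>R f) \<le> \<bar>c\<bar> * sup_norm f" for c
    by (rule sup_norm_le) (auto simp: scaleR_fun_def abs_mult intro!: mult_left_mono H_le_sup_norm[OF f])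
  have *: "\<bar>c * f t\<bar> \<le> \<bar>c\<bar> * sup_norm f" for t
    by (auto simp: abs_mult intro!: mult_left_mono H_le_sup_norm[OF f])
  show "\<bar>c\<bar> * sup_norm f \<le> sup_norm (c *\<^sub>R f)"
  proof (cases "c = 0")
    case True
    then show ?thesis by (auto simp: sup_norm_def scaleR_fun_def)
  next
    case False
    have "\<bar>f t\<bar> \<le> sup_norm (c *\<^sub>R f) / \<bar>c\<bar>" for t
      using abs_le_sup_norm[of "c *\<^sub>R f" "\<bar>c\<bar> * sup_norm f" t] * False
      by (auto simp: scaleR_fun_def abs_mult field_simps)
    then have "sup_norm f \<le> sup_norm (c *\<^sub>R f) / \<bar>c\<bar>" by (rule sup_norm_le)
    then show ?thesis using False by (simp add: field_simps)
  qed
qed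

lemma deriv_fun_add:
  fixes f g :: "real \<Rightarrow> real"
  assumes "\<And>t. f differentiable (at t)" "\<And>t. g differentiable (at t)"
  shows "deriv (f + g) = deriv f + deriv g"
  using assms unfolding DERIV_deriv_iff_real_differentiable[symmetric]
  by (auto simp: plus_fun_def intro!: ext DERIV_imp_deriv DERIV_add)

lemma deriv_fun_scale:
  fixes f :: "real \<Rightarrow> real"
  assumes "\<And>t. f differentiable (at t)"
  shows "deriv (c *\<^sub>R f) = c *\<^sub>R deriv f"
  using assms unfolding DERIV_deriv_iff_real_differentiable[symmetric]
  by (auto simp: scaleR_fun_def intro!: ext DERIV_imp_deriv DERIV_cmult)

lemma nspace_H0: "nspace (H 0)"
proof (unfold_locales, goal_cases)
  case 1
  show ?case by (rule H0I[where D = 0]) (auto simp: periodic_fun_simple_iff zero_fun_def)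
next
  case (2 u v)
  have "\<bar>(u + v) s - (u + v) t\<bar> \<le> (holder_seminorm \<alpha> u + holder_seminorm \<alpha> v) * \<bar>s - t\<bar> powr \<alpha>" for s t
    using H0_holder[OF 2(1), of s t] H0_holder[OF 2(2), of s t] by (auto simp: algebra_simps)
  then show ?case
    using 2[THEN H_periodic] 2[THEN H_continuous]
    by (intro H0I) (auto simp: periodic_fun_simple_iff plus_fun_def intro!: continuous_intros)
next
  case (3 u c)
  have "\<bar>(c *\<^sub>R u) s - (c *\<^sub>R u) t\<bar> \<le> (\<bar>c\<bar> * holder_seminorm \<alpha> u) * \<bar>s - t\<bar> powr \<alpha>" for s t
    using mult_left_mono[OF H0_holder[OF 3(1), of s t] abs_ge_zero[of c]]
    by (auto simp: scaleR_fun_def abs_mult simp flip: right_diff_distrib)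
  then show ?case
    using 3[THEN H_periodic] 3[THEN H_continuous]
    by (intro H0I) (auto simp: periodic_fun_simple_iff scaleR_fun_def intro!: continuous_intros)
next
  case (4 u v)
  have "\<bar>(u + v) s - (u + v) t\<bar> \<le> (holder_seminorm \<alpha> u + holder_seminorm \<alpha> v) * \<bar>s - t\<bar> powr \<alpha>" for s t
    using H0_holder[OF 4(1), of s t] H0_holder[OF 4(2), of s t] by (auto simp: algebra_simps)
  then have "holder_seminorm \<alpha> (u + v) \<le> holder_seminorm \<alpha> u + holder_seminorm \<alpha> v"
    using H0_holder_ge_0 4 by (intro holder_seminorm_le) auto
  then show ?case using sup_norm_add[OF 4] by (simp add: nrm_H0)
next
  case (5 u c)
  have le: "holder_seminorm \<alpha> (c *\<^sub>R u) \<le> \<bar>c\<bar> * holder_seminorm \<alpha> u" if "u \<in> carr (H 0)" for c u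
  proof (rule holder_seminorm_le)
    show "\<bar>(c *\<^sub>R u) s - (c *\<^sub>R u) t\<bar> \<le> (\<bar>c\<bar> * holder_seminorm \<alpha> u) * \<bar>s - t\<bar> powr \<alpha>" for s t
      using mult_left_mono[OF H0_holder[OF that, of s t] abs_ge_zero[of c]]
      by (auto simp: scaleR_fun_def abs_mult simp flip: right_diff_distrib)
  qed (use H0_holder_ge_0[OF that] in auto)
  have cu: "c *\<^sub>R u \<in> carr (H 0)"
  proof (rule H0I)
    show "\<bar>(c *\<^sub>R u) s - (c *\<^sub>R u) t\<bar> \<le> (\<bar>c\<bar> * holder_seminorm \<alpha> u) * \<bar>s - t\<bar> powr \<alpha>" for s t
      using mult_left_mono[OF H0_holder[OF 5(1), of s t] abs_ge_zero[of c]]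
      by (auto simp: scaleR_fun_def abs_mult simp flip: right_diff_distrib)
  qed (use 5[THEN H_periodic] 5[THEN H_continuous] in
        \<open>auto simp: periodic_fun_simple_iff scaleR_fun_def intro!: continuous_intros\<close>)
  have "\<bar>c\<bar> * holder_seminorm \<alpha> u \<le> holder_seminorm \<alpha> (c *\<^sub>R u)"
  proof (cases "c = 0")
    case False
    then have "holder_seminorm \<alpha> u \<le> \<bar>inverse c\<bar> * holder_seminorm \<alpha> (c *\<^sub>R u)"
      using le[OF cu, of "inverse c"] by simp
    then show ?thesis using False by (simp add: field_simps)
  qed (use H0_holder_ge_0[OF cu] in auto)
  then show ?case
    using le[OF 5, of c] sup_norm_scale[OF 5, of c] by (simp add: nrm_H0 algebra_simps)
next
  case (6 u)
  then have "sup_norm u = 0"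
    using H0_holder_ge_0 sup_norm_ge_0 by (fastforce simp: nrm_H0)
  then show ?case using H_le_sup_norm[OF 6(1)] by (auto simp: fun_eq_iff)
qed

lemma nspace_H: "nspace (H j)"
proof (induction j)
  case 0
  show ?case by (rule nspace_H0)
next
  case (Suc j)
  interpret Hj: nspace "H j" by fact
  show ?case
  proof (unfold_locales, goal_cases)
    case 1
    have "deriv (0 :: real \<Rightarrow> real) = 0" by (simp add: zero_fun_def)
    then show ?case by (simp add: carr_H_Suc periodic_fun_simple_iff zero_fun_def[symmetric]) (simp add: zero_fun_def)
  next
    case (2 u v)
    then show ?case
      by (auto simp: carr_H_Suc deriv_fun_add periodic_fun_simple_iff) (simp add: plus_fun_def)
  next
    case (3 u c)
    then show ?case
      by (auto simp: carr_H_Suc deriv_fun_scale periodic_fun_simple_iff) (simp_all add: scaleR_fun_def)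
  next
    case (4 u v)
    then show ?case
      using sup_norm_add[OF 4] Hj.nrm_triangle[of "deriv u" "deriv v"]
      by (auto simp: carr_H_Suc deriv_fun_add nrm_H_Suc)
  next
    case (5 u c)
    then show ?case
      using sup_norm_scale[OF 5, of c] Hj.nrm_scale[of "deriv u" c]
      by (auto simp: carr_H_Suc deriv_fun_scale nrm_H_Suc algebra_simps)
  next
    case (6 u)
    then have "deriv u \<in> carr (H j)" by (simp add: carr_H_Suc)
    then have "sup_norm u = 0"
      using 6 Hj.nrm_ge_0[of "deriv u"] sup_norm_ge_0[OF 6(1)] by (simp add: nrm_H_Suc)
    then show ?case using H_le_sup_norm[OF 6(1)] by (auto simp: fun_eq_iff)
  qed
qed

sublocale H: nspace "Hper P j \<alpha>" for j
  by (rule nspace_H)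

lemma sup_norm_le_nrm: "f \<in> carr (H j) \<Longrightarrow> sup_norm f \<le> nrm (H j) f"
proof (cases j)
  case 0
  then show "f \<in> carr (H j) \<Longrightarrow> ?thesis" using H0_holder_ge_0 by (auto simp: nrm_H0)
next
  case (Suc i)
  then show "f \<in> carr (H j) \<Longrightarrow> ?thesis" using H.nrm_ge_0[of "deriv f" i] by (auto simp: nrm_H_Suc carr_H_Suc)
qed

lemma H_le_nrm: "f \<in> carr (H j) \<Longrightarrow> \<bar>f t\<bar> \<le> nrm (H j) f"
  using H_le_sup_norm sup_norm_le_nrm order_trans by blast

lemma H_has_derivative:
  "f \<in> carr (H (Suc j)) \<Longrightarrow> (f has_real_derivative deriv f t) (at t)"
  by (auto simp: carr_H_Suc real_differentiable_def DERIV_deriv_iff_real_differentiable)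

text \<open>For \<open>\<bar>s - t\<bar> \<le> 1\<close> the Lipschitz bound
  \<open>B * \<bar>s - t\<bar>\<close> is at most
  \<open>B * \<bar>s - t\<bar> powr \<alpha>\<close>; for larger distances the trivial bound
  \<open>2 * A\<close> is enough, since then the power is at least 1. The sum of the two constants
  serves both ranges.\<close>

lemma holder_of_derivative_bound:
  assumes f: "\<And>t. (f has_real_derivative f' t) (at t)" "\<And>t. \<bar>f t\<bar> \<le> A" "\<And>t. \<bar>f' t\<bar> \<le> B"
  shows "\<bar>f s - f t\<bar> \<le> (2 * A + B) * \<bar>s - t\<bar> powr \<alpha>"
proof -
  have AB: "0 \<le> A" "0 \<le> B" using assms(2,3)[of 0] by auto
  show ?thesis
  proof (cases "\<bar>s - t\<bar> \<le> 1")
    case True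
    have "\<bar>f s - f t\<bar> \<le> B * \<bar>s - t\<bar>"
      using field_differentiable_bound[of UNIV f f' B s t] f by (auto simp: has_field_derivative_at_within)
    also have "\<dots> \<le> B * \<bar>s - t\<bar> powr \<alpha>"
      using True AB \<alpha> powr_mono'[of \<alpha> 1 "\<bar>s - t\<bar>"] by (cases "s = t") (auto intro!: mult_left_mono)
    also have "\<dots> \<le> (2 * A + B) * \<bar>s - t\<bar> powr \<alpha>" using AB by (intro mult_right_mono) auto
    finally show ?thesis .
  next
    case False
    have "\<bar>f s - f t\<bar> \<le> 2 * A * 1" using f(2)[of s] f(2)[of t] by auto
    also have "\<dots> \<le> (2 * A + B) * \<bar>s - t\<bar> powr \<alpha>"
      using False AB \<alpha> by (intro mult_mono ge_one_powr_ge_zero) auto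
    finally show ?thesis .
  qed
qed

text \<open>The constant 3 arises at \<open>j = 0\<close>: one supremum of \<open>f\<close> from the
  norm and two from the interpolated Hoelder bound, besides one supremum of the derivative. The
  induction step passes to \<open>deriv f\<close> and keeps the constant.\<close>

lemma H_Suc_subset: "f \<in> carr (H (Suc j)) \<Longrightarrow> f \<in> carr (H j) \<and> nrm (H j) f \<le> 3 * nrm (H (Suc j)) f"
proof (induction j arbitrary: f)
  case 0
  have f': "deriv f \<in> carr (H 0)" using 0 by (simp add: carr_H_Suc)
  have *: "\<bar>f s - f t\<bar> \<le> (2 * sup_norm f + sup_norm (deriv f)) * \<bar>s - t\<bar> powr \<alpha>" for s t
    by (rule holder_of_derivative_bound[OF H_has_derivative[OF 0] H_le_sup_norm[OF 0] H_le_sup_norm[OF f']])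
  have "f \<in> carr (H 0)" by (rule H0I[OF H_periodic[OF 0] H_continuous[OF 0] *])
  moreover have "nrm (H 0) f \<le> sup_norm f + (2 * sup_norm f + sup_norm (deriv f))"
    by (rule nrm_H0_le[OF H_le_sup_norm[OF 0] *]) (use sup_norm_ge_0[OF 0] sup_norm_ge_0[OF f'] in auto)
  moreover have "sup_norm (deriv f) \<le> nrm (H 0) (deriv f)" by (rule sup_norm_le_nrm[OF f'])
  ultimately show ?case
    using sup_norm_ge_0[OF 0] sup_norm_ge_0[OF f'] by (simp add: nrm_H_Suc)
next
  case (Suc j)
  then have "deriv f \<in> carr (H (Suc j))" by (simp add: carr_H_Suc[of f])
  then have "deriv f \<in> carr (H j) \<and> nrm (H j) (deriv f) \<le> 3 * nrm (H (Suc j)) (deriv f)"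
    by (rule Suc.IH)
  then show ?case using Suc.prems sup_norm_ge_0[OF Suc.prems]
    by (simp add: carr_H_Suc[of f] nrm_H_Suc[of _ f])
qed

lemma H_mono: "i \<le> j \<Longrightarrow> f \<in> carr (H j) \<Longrightarrow> f \<in> carr (H i)"
  by (induction j rule: dec_induct) (use H_Suc_subset in blast)+

lemma nrm_H_mono: "i \<le> j \<Longrightarrow> f \<in> carr (H j) \<Longrightarrow> nrm (H i) f \<le> 3 ^ (j - i) * nrm (H j) f"
proof (induction j rule: dec_induct)
  case (step n)
  then have "nrm (H i) f \<le> 3 ^ (n - i) * nrm (H n) f" "nrm (H n) f \<le> 3 * nrm (H (Suc n)) f"
    using H_Suc_subset[of f n] by auto
  then have "nrm (H i) f \<le> 3 ^ (n - i) * (3 * nrm (H (Suc n)) f)"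
    by (meson mult_left_mono order_trans zero_le_numeral zero_le_power)
  then show ?case using step by (simp add: Suc_diff_le)
qed simp

lemma H_deriv: "f \<in> carr (H (Suc j)) \<Longrightarrow> deriv f \<in> carr (H j)"
  by (simp add: carr_H_Suc)

lemma nrm_H_deriv: "f \<in> carr (H (Suc j)) \<Longrightarrow> nrm (H j) (deriv f) \<le> nrm (H (Suc j)) f"
  using sup_norm_ge_0 by (auto simp: nrm_H_Suc)

lemma H_SucI:
  assumes "periodic_fun_simple f P" "\<And>t. (f has_real_derivative g t) (at t)" "g \<in> carr (H j)"
  shows "f \<in> carr (H (Suc j))" "deriv f = g"
proof -
  show "deriv f = g" using assms(2) by (auto intro: DERIV_imp_deriv)
  then show "f \<in> carr (H (Suc j))"
    using assms by (auto simp: carr_H_Suc real_differentiable_def)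
qed

lemma const_H: "(\<lambda>t. c) \<in> carr (H j)"
proof (induction j arbitrary: c)
  case 0
  show ?case by (rule H0I[where D = 0]) (auto simp: periodic_fun_simple_iff)
next
  case (Suc j)
  then show ?case by (auto simp: carr_H_Suc periodic_fun_simple_iff)
qed

lemma nrm_const_H: "nrm (H j) (\<lambda>t. c) = \<bar>c\<bar>"
proof (induction j arbitrary: c)
  case 0
  show ?case by (simp add: nrm_H0 sup_norm_def holder_seminorm_def)
next
  case (Suc j)
  then show ?case using Suc[of 0] by (simp add: nrm_H_Suc sup_norm_def)
qed

text \<open>At order 0 the pointwise limit inherits both the uniform and the Hoelder estimates,
  since each is an inequality between values at finitely many points. In the step the derivatives
  converge by the induction hypothesis, and uniform convergence of derivatives identifies their
  limit as the derivative of the pointwise limit.\<close>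

lemma complete_H: "complete_nspace (H j)"
proof (induction j)
  case 0
  show ?case
    unfolding complete_nspace_def
  proof (intro allI impI, elim conjE)
    fix X :: "nat \<Rightarrow> real \<Rightarrow> real"
    assume X: "\<forall>n. X n \<in> carr (H 0)" and C: "\<forall>e>0. \<exists>M. \<forall>m\<ge>M. \<forall>n\<ge>M. nrm (H 0) (X m - X n) < e"
    have pt: "\<bar>X m t - X n t\<bar> \<le> nrm (H 0) (X m - X n)" for m n t
      using H_le_nrm[of "X m - X n" 0 t] X by auto
    have "Cauchy (\<lambda>n. X n t)" for t
      unfolding Cauchy_def dist_real_def using C pt by (meson le_less_trans)
    then have "\<forall>t. \<exists>l. (\<lambda>n. X n t) \<longlonglongrightarrow> l" by (simp add: real_Cauchy_convergent flip: convergent_def)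
    then obtain x where x: "\<And>t. (\<lambda>n. X n t) \<longlonglongrightarrow> x t" by metis
    have M: "\<exists>M. \<forall>n\<ge>M. (\<forall>t. \<bar>X n t - x t\<bar> \<le> e) \<and>
        (\<forall>s t. \<bar>(X n - x) s - (X n - x) t\<bar> \<le> e * \<bar>s - t\<bar> powr \<alpha>)" if "e > 0" for e
    proof -
      obtain M where M: "\<And>m n. m \<ge> M \<Longrightarrow> n \<ge> M \<Longrightarrow> nrm (H 0) (X m - X n) < e" using C \<open>e > 0\<close> by meson
      have "\<bar>X n t - x t\<bar> \<le> e" if "n \<ge> M" for n t
      proof (rule tendsto_upperbound)
        show "(\<lambda>m. \<bar>X n t - X m t\<bar>) \<longlonglongrightarrow> \<bar>X n t - x t\<bar>" by (intro tendsto_intros x)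
        show "\<forall>\<^sub>F m in sequentially. \<bar>X n t - X m t\<bar> \<le> e"
          unfolding eventually_sequentially using M[of n] that pt by (meson less_imp_le order_trans)
      qed simp
      moreover have "\<bar>(X n - x) s - (X n - x) t\<bar> \<le> e * \<bar>s - t\<bar> powr \<alpha>" if "n \<ge> M" for n s t
      proof (rule tendsto_upperbound)
        show "(\<lambda>m. \<bar>(X n - X m) s - (X n - X m) t\<bar>) \<longlonglongrightarrow> \<bar>(X n - x) s - (X n - x) t\<bar>"
          unfolding minus_apply by (intro tendsto_intros x)
        have "\<bar>(X n - X m) s - (X n - X m) t\<bar> \<le> e * \<bar>s - t\<bar> powr \<alpha>" if "m \<ge> M" for m
        proof -
          have mem: "X n - X m \<in> carr (H 0)" using X by auto
          have "holder_seminorm \<alpha> (X n - X m) \<le> e"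
            using M[of n m] \<open>n \<ge> M\<close> that sup_norm_ge_0[OF mem] by (auto simp: nrm_H0)
          then show ?thesis using H0_holder[OF mem, of s t] by (meson mult_right_mono order_trans powr_ge_zero)
        qed
        then show "\<forall>\<^sub>F m in sequentially. \<bar>(X n - X m) s - (X n - X m) t\<bar> \<le> e * \<bar>s - t\<bar> powr \<alpha>"
          unfolding eventually_sequentially by blast
      qed simp
      ultimately show ?thesis by blast
    qed
    have per: "periodic_fun_simple x P"
    proof -
      have "x (t + P) = x t" for t
        using x[of "t + P"] x[of t] X[rule_format, THEN H_periodic]
        by (simp add: periodic_fun_simple_iff LIMSEQ_unique)
      then show ?thesis by (simp add: periodic_fun_simple_iff)
    qed
    obtain N where N: "\<And>s t. \<bar>(X N - x) s - (X N - x) t\<bar> \<le> 1 * \<bar>s - t\<bar> powr \<alpha>" using M[of 1] by force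
    have hol: "\<bar>x s - x t\<bar> \<le> (1 + holder_seminorm \<alpha> (X N)) * \<bar>s - t\<bar> powr \<alpha>" for s t
      using N[of s t] H0_holder[of "X N" s t] X by (auto simp: algebra_simps)
    have "uniform_limit UNIV X x sequentially"
      unfolding uniform_limit_iff eventually_sequentially dist_real_def
    proof (intro allI impI)
      fix e :: real assume "0 < e"
      then obtain M' where "\<forall>n\<ge>M'. \<forall>t. \<bar>X n t - x t\<bar> \<le> e / 2" using M[of "e / 2"] by auto
      then have "\<bar>X n t - x t\<bar> < e" if "n \<ge> M'" for n t
      proof -
        have "\<bar>X n t - x t\<bar> \<le> e / 2" using \<open>\<forall>n\<ge>M'. _\<close> that by blast
        then show ?thesis using \<open>0 < e\<close> by linarith
      qed
      then show "\<exists>N. \<forall>n\<ge>N. \<forall>t\<in>UNIV. \<bar>X n t - x t\<bar> < e" by blast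
    qed
    then have "continuous_on UNIV x"
      by (rule uniform_limit_theorem[rotated]) (use X in \<open>auto intro!: always_eventually H_continuous\<close>)
    then have xH: "x \<in> carr (H 0)" using H0I[OF per _ hol] by simp
    have "(\<lambda>n. nrm (H 0) (X n - x)) \<longlonglongrightarrow> 0"
    proof (rule LIMSEQ_I)
      fix e :: real assume "0 < e"
      then obtain K where "\<And>n. n \<ge> K \<Longrightarrow> (\<forall>t. \<bar>X n t - x t\<bar> \<le> e / 4) \<and>
        (\<forall>s t. \<bar>(X n - x) s - (X n - x) t\<bar> \<le> e / 4 * \<bar>s - t\<bar> powr \<alpha>)" using M[of "e / 4"] by auto
      then have "nrm (H 0) (X n - x) \<le> e / 4 + e / 4" if "n \<ge> K" for n
        using that \<open>0 < e\<close> by (intro nrm_H0_le) auto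
      then have "norm (nrm (H 0) (X n - x) - 0) < e" if "n \<ge> K" for n
        using that \<open>0 < e\<close> H.nrm_ge_0[of "X n - x" 0] X xH by fastforce
      then show "\<exists>no. \<forall>n\<ge>no. norm (nrm (H 0) (X n - x) - 0) < e" by blast
    qed
    then show "\<exists>x\<in>carr (H 0). (\<lambda>n. nrm (H 0) (X n - x)) \<longlonglongrightarrow> 0" using xH by blast
  qed
next
  case (Suc j)
  show ?case
    unfolding complete_nspace_def
  proof (intro allI impI, elim conjE)
    fix X :: "nat \<Rightarrow> real \<Rightarrow> real"
    assume X: "\<forall>n. X n \<in> carr (H (Suc j))"
      and C: "\<forall>e>0. \<exists>M. \<forall>m\<ge>M. \<forall>n\<ge>M. nrm (H (Suc j)) (X m - X n) < e"
    have pt: "\<bar>X m t - X n t\<bar> \<le> nrm (H (Suc j)) (X m - X n)" for m n t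
      using H_le_nrm[of "X m - X n" "Suc j" t] X by auto
    have "Cauchy (\<lambda>n. X n t)" for t
      unfolding Cauchy_def dist_real_def using C pt by (meson le_less_trans)
    then have "\<forall>t. \<exists>l. (\<lambda>n. X n t) \<longlonglongrightarrow> l" by (simp add: real_Cauchy_convergent flip: convergent_def)
    then obtain x where x: "\<And>t. (\<lambda>n. X n t) \<longlonglongrightarrow> x t" by metis
    have M: "\<exists>M. \<forall>n\<ge>M. (\<forall>t. \<bar>X n t - x t\<bar> \<le> e)" if "e > 0" for e
    proof -
      obtain M where M: "\<And>m n. m \<ge> M \<Longrightarrow> n \<ge> M \<Longrightarrow> nrm (H (Suc j)) (X m - X n) < e" using C \<open>e > 0\<close> by meson
      have "\<bar>X n t - x t\<bar> \<le> e" if "n \<ge> M" for n t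
      proof (rule tendsto_upperbound)
        show "(\<lambda>m. \<bar>X n t - X m t\<bar>) \<longlonglongrightarrow> \<bar>X n t - x t\<bar>" by (intro tendsto_intros x)
        show "\<forall>\<^sub>F m in sequentially. \<bar>X n t - X m t\<bar> \<le> e"
          unfolding eventually_sequentially using M[of n] that pt by (meson less_imp_le order_trans)
      qed simp
      then show ?thesis by blast
    qed
    have der: "deriv (X m - X n) = deriv (X m) - deriv (X n)" for m n
      using H_has_derivative[of _ j] X
      by (intro ext DERIV_imp_deriv) (auto simp: fun_diff_def intro!: DERIV_diff)
    have "nrm (H j) (deriv (X m) - deriv (X n)) \<le> nrm (H (Suc j)) (X m - X n)" for m n
      using nrm_H_deriv[of "X m - X n" j] X der by auto
    then have "\<exists>M. \<forall>m\<ge>M. \<forall>n\<ge>M. nrm (H j) (deriv (X m) - deriv (X n)) < e" if "e > 0" for e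
      using C that by (meson le_less_trans)
    then obtain g where g: "g \<in> carr (H j)" "(\<lambda>n. nrm (H j) (deriv (X n) - g)) \<longlonglongrightarrow> 0"
      by (rule complete_nspaceD[OF Suc, of "\<lambda>n. deriv (X n)", rotated]) (use X H_deriv in auto)
    have der_x: "(x has_real_derivative g t) (at t)" for t
    proof -
      \<comment> \<open>The theorem on differentiating a sequence of functions produces its own
        limit \<open>h\<close>; uniqueness of limits identifies it with \<open>x\<close>.\<close>
      have "\<exists>h. \<forall>t\<in>UNIV. (\<lambda>n. X n t) \<longlonglongrightarrow> h t \<and> (h has_derivative (\<lambda>v. v * g t)) (at t within UNIV)"
      proof (rule has_derivative_sequence[of UNIV X "\<lambda>n t v. v * deriv (X n) t" "\<lambda>t v. v * g t" 0 "x 0"])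
        show "(X n has_derivative (\<lambda>v. v * deriv (X n) t)) (at t within UNIV)" for n t
          using H_has_derivative[of "X n" j t] X by (simp add: has_field_derivative_def mult.commute[of _ "deriv (X n) t"])
        fix e :: real assume e: "0 < e"
        have "\<forall>\<^sub>F n in sequentially. nrm (H j) (deriv (X n) - g) < e" by (rule order_tendstoD(2)[OF g(2) e])
        then show "\<forall>\<^sub>F n in sequentially. \<forall>t\<in>UNIV. \<forall>v. norm (v * deriv (X n) t - v * g t) \<le> e * norm v"
        proof (rule eventually_mono, intro ballI allI)
          fix n t and v :: real assume *: "nrm (H j) (deriv (X n) - g) < e"
          have "\<bar>deriv (X n) t - g t\<bar> \<le> e"
            using H_le_nrm[of "deriv (X n) - g" j t] X g(1) H_deriv * by auto
          then have "\<bar>v\<bar> * \<bar>deriv (X n) t - g t\<bar> \<le> \<bar>v\<bar> * e" by (intro mult_left_mono) auto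
          then show "norm (v * deriv (X n) t - v * g t) \<le> e * norm v"
            by (simp add: abs_mult mult.commute flip: right_diff_distrib)
        qed
      qed (use x in auto)
      then obtain h where h: "\<And>t. (\<lambda>n. X n t) \<longlonglongrightarrow> h t" "\<And>t. (h has_derivative (\<lambda>v. v * g t)) (at t)"
        by auto
      have "h = x" using h(1) x LIMSEQ_unique by blast
      then show ?thesis using h(2)[of t] by (simp add: has_field_derivative_def mult.commute[of _ "g t"])
    qed
    have per: "periodic_fun_simple x P"
    proof -
      have "x (t + P) = x t" for t
        using x[of "t + P"] x[of t] X[rule_format, THEN H_periodic]
        by (simp add: periodic_fun_simple_iff LIMSEQ_unique)
      then show ?thesis by (simp add: periodic_fun_simple_iff)
    qed
    have xH: "x \<in> carr (H (Suc j))" "deriv x = g" using H_SucI[OF per der_x g(1)] by auto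
    have "nrm (H (Suc j)) (X n - x) = sup_norm (X n - x) + nrm (H j) (deriv (X n) - g)" for n
    proof -
      have "deriv (X n - x) = deriv (X n) - g"
        using H_has_derivative[of "X n" j] X der_x
        by (intro ext DERIV_imp_deriv) (auto simp: fun_diff_def intro!: DERIV_diff)
      then show ?thesis by (simp add: nrm_H_Suc)
    qed
    moreover have "(\<lambda>n. sup_norm (X n - x)) \<longlonglongrightarrow> 0"
    proof (rule LIMSEQ_I)
      fix e :: real assume "0 < e"
      then obtain K where "\<And>n. n \<ge> K \<Longrightarrow> (\<forall>t. \<bar>X n t - x t\<bar> \<le> e / 2)" using M[of "e / 2"] by auto
      then have "sup_norm (X n - x) \<le> e / 2" if "n \<ge> K" for n
        using that by (intro sup_norm_le) auto
      then have "norm (sup_norm (X n - x) - 0) < e" if "n \<ge> K" for n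
        using that \<open>0 < e\<close> sup_norm_ge_0[of "X n - x" "Suc j"] X xH by fastforce
      then show "\<exists>no. \<forall>n\<ge>no. norm (sup_norm (X n - x) - 0) < e" by blast
    qed
    ultimately have "(\<lambda>n. nrm (H (Suc j)) (X n - x)) \<longlonglongrightarrow> 0"
      using tendsto_add[OF _ g(2), of "\<lambda>n. sup_norm (X n - x)" 0] by simp
    then show "\<exists>x\<in>carr (H (Suc j)). (\<lambda>n. nrm (H (Suc j)) (X n - x)) \<longlonglongrightarrow> 0" using xH by blast
  qed
qed

text \<open>The factor 7 per order is 1 + 3 + 3: one for the supremum of the product, and 3 for each
  Leibniz term, where the undifferentiated factor passes from order \<open>j + 1\<close> to order
  \<open>j\<close> at the cost of the embedding constant.\<close>

lemma H_mult:
  "f \<in> carr (H j) \<Longrightarrow> g \<in> carr (H j) \<Longrightarrow> f * g \<in> carr (H j) \<and> nrm (H j) (f * g) \<le> 7 ^ j * nrm (H j) f * nrm (H j) g"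
proof (induction j arbitrary: f g)
  case 0
  define Sf Sg hf hg where [abs_def]: "Sf = sup_norm f" "Sg = sup_norm g" "hf = holder_seminorm \<alpha> f" "hg = holder_seminorm \<alpha> g"
  note defs = this
  have nn: "0 \<le> Sf" "0 \<le> Sg" "0 \<le> hf" "0 \<le> hg"
    unfolding defs using 0 sup_norm_ge_0 H0_holder_ge_0 by auto
  have *: "\<bar>(f * g) s - (f * g) t\<bar> \<le> (Sf * hg + hf * Sg) * \<bar>s - t\<bar> powr \<alpha>" for s t
  proof -
    have "(f * g) s - (f * g) t = f s * (g s - g t) + (f s - f t) * g t" by (simp add: algebra_simps)
    then have "\<bar>(f * g) s - (f * g) t\<bar> \<le> \<bar>f s\<bar> * \<bar>g s - g t\<bar> + \<bar>f s - f t\<bar> * \<bar>g t\<bar>"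
      by (metis abs_mult abs_triangle_ineq)
    also have "\<dots> \<le> Sf * (hg * \<bar>s - t\<bar> powr \<alpha>) + (hf * \<bar>s - t\<bar> powr \<alpha>) * Sg"
      unfolding defs using H0_holder[OF 0(1)] H0_holder[OF 0(2)] H_le_sup_norm[OF 0(1)] H_le_sup_norm[OF 0(2)] nn
      by (intro add_mono mult_mono) (auto simp: defs intro!: mult_nonneg_nonneg)
    finally show ?thesis by (simp add: algebra_simps)
  qed
  have "f * g \<in> carr (H 0)"
    using 0[THEN H_periodic] 0[THEN H_continuous]
    by (intro H0I[OF _ _ *]) (auto simp: periodic_fun_simple_iff times_fun_def intro!: continuous_intros)
  moreover have "nrm (H 0) (f * g) \<le> Sf * Sg + (Sf * hg + hf * Sg)"
  proof (rule nrm_H0_le[OF _ *])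
    show "\<bar>(f * g) t\<bar> \<le> Sf * Sg" for t
      unfolding defs using H_le_sup_norm[OF 0(1)] H_le_sup_norm[OF 0(2)] nn by (auto simp: abs_mult defs intro!: mult_mono)
  qed (use nn in simp)
  moreover have "Sf * Sg + (Sf * hg + hf * Sg) \<le> (Sf + hf) * (Sg + hg)"
    using nn by (simp add: algebra_simps)
  ultimately show ?case by (auto simp: nrm_H0 defs times_fun_def)
next
  case (Suc j)
  define F G F' G' where [abs_def]: "F = nrm (H (Suc j)) f" "G = nrm (H (Suc j)) g"
    "F' = nrm (H j) (deriv f)" "G' = nrm (H j) (deriv g)"
  note defs = this
  have f': "deriv f \<in> carr (H j)" "deriv g \<in> carr (H j)" using Suc.prems H_deriv by auto
  have fj: "f \<in> carr (H j)" "g \<in> carr (H j)" "nrm (H j) f \<le> 3 * F" "nrm (H j) g \<le> 3 * G"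
    using Suc.prems H_Suc_subset by (auto simp: defs)
  have le: "F' \<le> F" "G' \<le> G" "0 \<le> F'" "0 \<le> G'"
    using Suc.prems nrm_H_deriv f' H.nrm_ge_0 by (auto simp: defs)
  have der: "((f * g) has_real_derivative (deriv f * g + f * deriv g) t) (at t)" for t
    unfolding times_fun_def plus_fun_def
    by (rule DERIV_cong[OF DERIV_mult[OF H_has_derivative H_has_derivative]]) (use Suc.prems in auto)
  have m1: "deriv f * g \<in> carr (H j)" "nrm (H j) (deriv f * g) \<le> 7 ^ j * F' * nrm (H j) g"
    using Suc.IH[OF f'(1) fj(2)] unfolding defs by (blast, blast)
  have m2: "f * deriv g \<in> carr (H j)" "nrm (H j) (f * deriv g) \<le> 7 ^ j * nrm (H j) f * G'"
    using Suc.IH[OF fj(1) f'(2)] unfolding defs by (blast, blast)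
  have per: "periodic_fun_simple (f * g) P"
    using Suc.prems[THEN H_periodic] by (auto simp: periodic_fun_simple_iff)
  have sum: "deriv f * g + f * deriv g \<in> carr (H j)" using m1 m2 by auto
  have mem: "f * g \<in> carr (H (Suc j))" by (rule H_SucI(1)[OF per der sum])
  have d: "deriv (f * g) = deriv f * g + f * deriv g" by (rule H_SucI(2)[OF per der sum])
  have "nrm (H j) (deriv f * g + f * deriv g) \<le> 7 ^ j * F' * nrm (H j) g + 7 ^ j * nrm (H j) f * G'"
    using H.nrm_triangle[OF m1(1) m2(1)] m1 m2 by linarith
  also have "\<dots> \<le> 7 ^ j * F * (3 * G) + 7 ^ j * (3 * F) * G"
    using le fj f' H.nrm_ge_0[of f j] H.nrm_ge_0[of g j] by (intro add_mono mult_mono) auto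
  finally have 1: "nrm (H j) (deriv (f * g)) \<le> 6 * 7 ^ j * F * G" by (simp add: d algebra_simps)
  have "sup_norm (f * g) \<le> F * G"
    using H_le_nrm[OF Suc.prems(1)] H_le_nrm[OF Suc.prems(2)] le
    by (intro sup_norm_le) (auto simp: abs_mult defs intro!: mult_mono)
  also have "\<dots> \<le> 7 ^ j * (F * G)" using le mult_right_mono[of 1 "7 ^ j" "F * G"] by simp
  finally have "nrm (H (Suc j)) (f * g) \<le> 7 ^ j * (F * G) + 6 * 7 ^ j * F * G"
    using 1 unfolding nrm_H_Suc by linarith
  also have "\<dots> = 7 ^ Suc j * F * G" by (simp add: algebra_simps)
  finally show ?case using mem unfolding defs by blast
qed

end

text \<open>Each estimate is the mean value inequality for \<open>x \<mapsto> f x - k * x\<close> on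
  the segment between \<open>a\<close> and \<open>b\<close>, with \<open>k\<close> equal to 0,
  \<open>\<phi>2 g\<close> and \<open>\<phi>1 g\<close>. In the last two, points of the segment stay
  within \<open>d\<close> of \<open>g\<close>, which bounds the variation of the derivative.\<close>

lemma second_difference_bound:
  fixes \<phi> \<phi>1 \<phi>2 \<phi>3 :: "real \<Rightarrow> real"
  assumes D0: "\<And>x. x \<in> {lo..hi} \<Longrightarrow> (\<phi> has_real_derivative \<phi>1 x) (at x)"
    and D1: "\<And>x. x \<in> {lo..hi} \<Longrightarrow> (\<phi>1 has_real_derivative \<phi>2 x) (at x)"
    and D2: "\<And>x. x \<in> {lo..hi} \<Longrightarrow> (\<phi>2 has_real_derivative \<phi>3 x) (at x)"
    and C2: "\<And>x. x \<in> {lo..hi} \<Longrightarrow> \<bar>\<phi>2 x\<bar> \<le> C2"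
    and C3: "\<And>x. x \<in> {lo..hi} \<Longrightarrow> \<bar>\<phi>3 x\<bar> \<le> C3"
    and mem: "g \<in> {lo..hi}" "a \<in> {lo..hi}" "b \<in> {lo..hi}"
  shows "\<bar>\<phi>1 b - \<phi>1 a\<bar> \<le> C2 * \<bar>b - a\<bar>"
    and "\<bar>a - g\<bar> \<le> d \<Longrightarrow> \<bar>b - g\<bar> \<le> d \<Longrightarrow> \<bar>\<phi>1 b - \<phi>1 a - \<phi>2 g * (b - a)\<bar> \<le> C3 * d * \<bar>b - a\<bar>"
    and "\<bar>a - g\<bar> \<le> d \<Longrightarrow> \<bar>b - g\<bar> \<le> d \<Longrightarrow> \<bar>\<phi> b - \<phi> a - \<phi>1 g * (b - a)\<bar> \<le> C2 * d * \<bar>b - a\<bar>"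
proof -
  have mvt: "\<bar>f b - f a - k * (b - a)\<bar> \<le> c * \<bar>b - a\<bar>"
    if "\<And>x. x \<in> {lo..hi} \<Longrightarrow> (f has_real_derivative f' x) (at x)"
      "\<And>x. x \<in> {min a b..max a b} \<Longrightarrow> \<bar>f' x - k\<bar> \<le> c" for f f' k c
  proof -
    have "norm ((f b - k * b) - (f a - k * a)) \<le> c * norm (b - a)"
    proof (rule field_differentiable_bound[of "{min a b..max a b}" _ "\<lambda>x. f' x - k"])
      fix x assume "x \<in> {min a b..max a b}"
      then have "x \<in> {lo..hi}" using mem by auto
      then show "((\<lambda>x. f x - k * x) has_real_derivative f' x - k) (at x within {min a b..max a b})"
        by (intro has_field_derivative_at_within[OF DERIV_diff[OF that(1) DERIV_cmult_Id]])
    qed (use that(2) in auto)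
    then show ?thesis by (simp add: algebra_simps)
  qed
  show 1: "\<bar>\<phi>1 b - \<phi>1 a\<bar> \<le> C2 * \<bar>b - a\<bar>"
  proof -
    have "\<bar>\<phi>2 x - 0\<bar> \<le> C2" if "x \<in> {min a b..max a b}" for x
    proof -
      have "x \<in> {lo..hi}" using mem that by auto
      then show ?thesis using C2 by simp
    qed
    then show ?thesis using mvt[OF D1, of 0 C2] by simp
  qed
  assume d: "\<bar>a - g\<bar> \<le> d" "\<bar>b - g\<bar> \<le> d"
  have lip: "\<bar>f x - f g\<bar> \<le> C * d"
    if "\<And>x. x \<in> {lo..hi} \<Longrightarrow> (f has_real_derivative f' x) (at x)" "\<And>x. x \<in> {lo..hi} \<Longrightarrow> \<bar>f' x\<bar> \<le> C"
      "x \<in> {min a b..max a b}" for f f' C x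
  proof -
    have x: "x \<in> {lo..hi}" "\<bar>x - g\<bar> \<le> d" using that(3) mem d by auto
    have "0 \<le> C" using that(2)[OF x(1)] by linarith
    have "norm (f x - f g) \<le> C * norm (x - g)"
      by (rule field_differentiable_bound[of "{lo..hi}" _ f'])
        (use that(1,2) x mem in \<open>auto intro: has_field_derivative_at_within\<close>)
    also have "\<dots> \<le> C * d" using x \<open>0 \<le> C\<close> by (intro mult_left_mono) auto
    finally show ?thesis by simp
  qed
  show "\<bar>\<phi>1 b - \<phi>1 a - \<phi>2 g * (b - a)\<bar> \<le> C3 * d * \<bar>b - a\<bar>"
    by (rule mvt[OF D1 lip[OF D2 C3]])
  show "\<bar>\<phi> b - \<phi> a - \<phi>1 g * (b - a)\<bar> \<le> C2 * d * \<bar>b - a\<bar>"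
    by (rule mvt[OF D0 lip[OF D1 C2]])
qed

text \<open>Differentiate along the segment from \<open>(g', a', b')\<close> to \<open>(g, a, b)\<close>.\<close>

lemma second_difference_holder:
  fixes \<phi> \<phi>1 \<phi>2 \<phi>3 :: "real \<Rightarrow> real"
  assumes D0: "\<And>x. x \<in> {lo..hi} \<Longrightarrow> (\<phi> has_real_derivative \<phi>1 x) (at x)"
    and D1: "\<And>x. x \<in> {lo..hi} \<Longrightarrow> (\<phi>1 has_real_derivative \<phi>2 x) (at x)"
    and D2: "\<And>x. x \<in> {lo..hi} \<Longrightarrow> (\<phi>2 has_real_derivative \<phi>3 x) (at x)"
    and C2: "\<And>x. x \<in> {lo..hi} \<Longrightarrow> \<bar>\<phi>2 x\<bar> \<le> C2"
    and C3: "\<And>x. x \<in> {lo..hi} \<Longrightarrow> \<bar>\<phi>3 x\<bar> \<le> C3"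
    and mem: "g \<in> {lo..hi}" "a \<in> {lo..hi}" "b \<in> {lo..hi}" "g' \<in> {lo..hi}" "a' \<in> {lo..hi}" "b' \<in> {lo..hi}"
    and d: "\<bar>a - g\<bar> \<le> d" "\<bar>b - g\<bar> \<le> d" "\<bar>a' - g'\<bar> \<le> d" "\<bar>b' - g'\<bar> \<le> d"
    and k: "\<bar>b - a\<bar> \<le> k" "\<bar>b' - a'\<bar> \<le> k"
  shows "\<bar>(\<phi> b - \<phi> a - \<phi>1 g * (b - a)) - (\<phi> b' - \<phi> a' - \<phi>1 g' * (b' - a'))\<bar>
    \<le> C3 * d * k * \<bar>g - g'\<bar> + C2 * k * \<bar>(a - g) - (a' - g')\<bar> + C2 * d * \<bar>(b - a) - (b' - a')\<bar>"
    (is "_ \<le> ?B")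
proof -
  define G A B where "G x = g' + x * (g - g')" and "A x = a' + x * (a - a')" and "B x = b' + x * (b - b')" for x
  define F where "F x = \<phi> (B x) - \<phi> (A x) - \<phi>1 (G x) * (B x - A x)" for x
  \<comment> \<open>The product rule, regrouped so that each summand is a small increment of
    \<open>\<phi>1\<close> times a variation of the data: the Taylor remainder of
    \<open>\<phi>1\<close> at \<open>G\<close> meets \<open>g - g'\<close>, and the increments of
    \<open>\<phi>1\<close> from \<open>A\<close> and from \<open>G\<close> to \<open>B\<close> meet
    the changes of \<open>a - g\<close> and \<open>b - a\<close>.\<close>
  define F' where "F' x = (\<phi>1 (B x) - \<phi>1 (A x) - \<phi>2 (G x) * (B x - A x)) * (g - g')
      + (\<phi>1 (B x) - \<phi>1 (A x)) * ((a - g) - (a' - g'))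
      + (\<phi>1 (B x) - \<phi>1 (G x)) * ((b - a) - (b' - a'))" for x
  have conv: "v' + x * (v - v') \<in> {l..h}" if "v \<in> {l..h}" "v' \<in> {l..h}" "x \<in> {0..1}" for v v' x l h :: real
  proof -
    have "(1 - x) *\<^sub>R v' + x *\<^sub>R v \<in> {l..h}" by (rule convexD_alt) (use that in auto)
    then show ?thesis by (simp add: algebra_simps)
  qed
  have C: "0 \<le> C2" "0 \<le> C3" using C2[OF mem(1)] C3[OF mem(1)] by auto
  have *: "(F has_real_derivative F' x) (at x) \<and> \<bar>F' x\<bar> \<le> ?B" if x: "x \<in> {0..1}" for x
  proof -
    have m: "G x \<in> {lo..hi}" "A x \<in> {lo..hi}" "B x \<in> {lo..hi}"
      unfolding G_def A_def B_def using conv mem x by auto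
    \<comment> \<open>These differences are affine in \<open>x\<close>, so the bounds
      \<open>d\<close> and \<open>k\<close> valid at both ends of the segment hold along it.\<close>
    have "A x - G x = (a' - g') + x * ((a - g) - (a' - g'))" "B x - G x = (b' - g') + x * ((b - g) - (b' - g'))"
      "B x - A x = (b' - a') + x * ((b - a) - (b' - a'))" unfolding G_def A_def B_def by algebra+
    then have "A x - G x \<in> {-d..d}" "B x - G x \<in> {-d..d}" "B x - A x \<in> {-k..k}"
      using conv[of "a - g" "-d" d "a' - g'" x] conv[of "b - g" "-d" d "b' - g'" x] conv[of "b - a" "-k" k "b' - a'" x] d k x
      by (auto simp: abs_le_iff)
    then have dk: "\<bar>A x - G x\<bar> \<le> d" "\<bar>B x - G x\<bar> \<le> d" "\<bar>B x - A x\<bar> \<le> k" by auto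
    then have d0: "0 \<le> d" "0 \<le> k" by auto
    have DG: "(G has_real_derivative (g - g')) (at x)" "(A has_real_derivative (a - a')) (at x)"
      "(B has_real_derivative (b - b')) (at x)"
      unfolding G_def A_def B_def by (auto intro!: derivative_eq_intros)
    have "(F has_real_derivative \<phi>1 (B x) * (b - b') - \<phi>1 (A x) * (a - a')
        - (\<phi>2 (G x) * (g - g') * (B x - A x) + \<phi>1 (G x) * ((b - b') - (a - a')))) (at x)"
      unfolding F_def
      by (rule DERIV_cong, (rule DERIV_diff DERIV_mult DERIV_chain2[OF D0] DERIV_chain2[OF D1] DG m)+) (simp add: algebra_simps)
    moreover have "\<phi>1 (B x) * (b - b') - \<phi>1 (A x) * (a - a')
        - (\<phi>2 (G x) * (g - g') * (B x - A x) + \<phi>1 (G x) * ((b - b') - (a - a'))) = F' x"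
      unfolding F'_def by algebra
    ultimately have DF: "(F has_real_derivative F' x) (at x)" by simp
    note bnd = second_difference_bound[OF D0 D1 D2 C2 C3]
    have "\<bar>F' x\<bar> \<le> \<bar>\<phi>1 (B x) - \<phi>1 (A x) - \<phi>2 (G x) * (B x - A x)\<bar> * \<bar>g - g'\<bar>
      + \<bar>\<phi>1 (B x) - \<phi>1 (A x)\<bar> * \<bar>(a - g) - (a' - g')\<bar>
      + \<bar>\<phi>1 (B x) - \<phi>1 (G x)\<bar> * \<bar>(b - a) - (b' - a')\<bar>"
      unfolding F'_def abs_mult[symmetric] by linarith
    also have "\<dots> \<le> (C3 * d * k) * \<bar>g - g'\<bar> + (C2 * k) * \<bar>(a - g) - (a' - g')\<bar> + (C2 * d) * \<bar>(b - a) - (b' - a')\<bar>"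
    proof (intro add_mono mult_right_mono)
      have "\<bar>\<phi>1 (B x) - \<phi>1 (A x) - \<phi>2 (G x) * (B x - A x)\<bar> \<le> C3 * d * \<bar>B x - A x\<bar>"
        by (rule bnd(2)) (use m dk in auto)
      also have "\<dots> \<le> C3 * d * k" using C d0 dk by (intro mult_left_mono) auto
      finally show "\<bar>\<phi>1 (B x) - \<phi>1 (A x) - \<phi>2 (G x) * (B x - A x)\<bar> \<le> C3 * d * k" .
      have "\<bar>\<phi>1 (B x) - \<phi>1 (A x)\<bar> \<le> C2 * \<bar>B x - A x\<bar>"
        by (rule bnd(1)) (use m in auto)
      also have "\<dots> \<le> C2 * k" using C dk by (intro mult_left_mono) auto
      finally show "\<bar>\<phi>1 (B x) - \<phi>1 (A x)\<bar> \<le> C2 * k" .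
      have "\<bar>\<phi>1 (B x) - \<phi>1 (G x)\<bar> \<le> C2 * \<bar>B x - G x\<bar>"
        by (rule bnd(1)) (use m in auto)
      also have "\<dots> \<le> C2 * d" using C dk by (intro mult_left_mono) auto
      finally show "\<bar>\<phi>1 (B x) - \<phi>1 (G x)\<bar> \<le> C2 * d" .
    qed auto
    finally show ?thesis using DF by simp
  qed
  have "norm (F 1 - F 0) \<le> ?B * norm (1 - 0 :: real)"
    by (rule field_differentiable_bound[of "{0..1}" F F']) (use * in \<open>auto intro: has_field_derivative_at_within\<close>)
  then show ?thesis by (simp add: F_def A_def B_def G_def)
qed

section \<open>Strict derivatives\<close>

text \<open>
  Strict differentiability is stable under composition and products, controls differences of nearby
  values without a mean value theorem, and is exactly what the contraction argument needs.
\<close>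

definition strict_derivative_at ::
    "'a::real_vector nspace \<Rightarrow> 'b::real_vector nspace \<Rightarrow> ('a \<Rightarrow> 'b) \<Rightarrow> ('a \<Rightarrow> 'b) \<Rightarrow> 'a \<Rightarrow> bool" where
  "strict_derivative_at E F f A u \<longleftrightarrow> u \<in> carr E \<and> bounded_linear_between E F A \<and>
     (\<forall>e>0. \<exists>d>0. \<forall>u1\<in>carr E. \<forall>u2\<in>carr E. nrm E (u1 - u) < d \<longrightarrow> nrm E (u2 - u) < d \<longrightarrow>
        f u1 \<in> carr F \<and> nrm F (f u1 - f u2 - A (u1 - u2)) \<le> e * nrm E (u1 - u2))"

lemma bounded_linear_betweenI:
  assumes "\<And>v. v \<in> carr E \<Longrightarrow> A v \<in> carr F"
    and "\<And>v w. v \<in> carr E \<Longrightarrow> w \<in> carr E \<Longrightarrow> A (v + w) = A v + A w"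
    and "\<And>c v. v \<in> carr E \<Longrightarrow> A (c *\<^sub>R v) = c *\<^sub>R A v"
    and "\<And>v. v \<in> carr E \<Longrightarrow> nrm F (A v) \<le> C * nrm E v"
  shows "bounded_linear_between E F A"
  using assms unfolding bounded_linear_between_def linear_between_def by blast

lemma bounded_linear_between_compose:
  assumes "nspace E" "nspace F" "bounded_linear_between E F A" "bounded_linear_between F G B"
  shows "bounded_linear_between E G (\<lambda>v. B (A v))"
proof -
  obtain a where a: "0 < a" "\<And>v. v \<in> carr E \<Longrightarrow> nrm F (A v) \<le> a * nrm E v"
    using bounded_linear_between_bound[OF assms(3,1)] by blast
  obtain b where b: "0 < b" "\<And>v. v \<in> carr F \<Longrightarrow> nrm G (B v) \<le> b * nrm F v"
    using bounded_linear_between_bound[OF assms(4,2)] by blast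
  note AD = bounded_linear_betweenD[OF assms(3)] and BD = bounded_linear_betweenD[OF assms(4)]
  show ?thesis
  proof (rule bounded_linear_betweenI[where C = "b * a"])
    fix v assume v: "v \<in> carr E"
    have "nrm G (B (A v)) \<le> b * nrm F (A v)" by (rule b(2)[OF AD(1)[OF v]])
    also have "\<dots> \<le> b * (a * nrm E v)" using b a v by (intro mult_left_mono) auto
    finally show "nrm G (B (A v)) \<le> b * a * nrm E v" by simp
  qed (simp_all add: AD BD)
qed

lemma bounded_linear_between_add:
  assumes "nspace F" "bounded_linear_between E F A" "bounded_linear_between E F B"
  shows "bounded_linear_between E F (\<lambda>v. A v + B v)"
proof -
  interpret F: nspace F by fact
  obtain a where a: "\<And>v. v \<in> carr E \<Longrightarrow> nrm F (A v) \<le> a * nrm E v"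
    using assms(2) unfolding bounded_linear_between_def by blast
  obtain b where b: "\<And>v. v \<in> carr E \<Longrightarrow> nrm F (B v) \<le> b * nrm E v"
    using assms(3) unfolding bounded_linear_between_def by blast
  note AD = bounded_linear_betweenD[OF assms(2)] and BD = bounded_linear_betweenD[OF assms(3)]
  show ?thesis
  proof (rule bounded_linear_betweenI[where C = "a + b"])
    fix v assume v: "v \<in> carr E"
    show "nrm F (A v + B v) \<le> (a + b) * nrm E v"
      using F.nrm_triangle[OF AD(1)[OF v] BD(1)[OF v]] a[OF v] b[OF v] by (simp add: algebra_simps)
  qed (simp_all add: AD BD scaleR_add_right)
qed

lemma strict_derivative_atD:
  assumes "strict_derivative_at E F f A u"
  shows "u \<in> carr E" "bounded_linear_between E F A"
    "\<And>e. e > 0 \<Longrightarrow> \<exists>d>0. \<forall>u1\<in>carr E. \<forall>u2\<in>carr E. nrm E (u1 - u) < d \<longrightarrow> nrm E (u2 - u) < d \<longrightarrow>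
        f u1 \<in> carr F \<and> nrm F (f u1 - f u2 - A (u1 - u2)) \<le> e * nrm E (u1 - u2)"
  using assms unfolding strict_derivative_at_def by blast+

lemma strict_derivative_atE:
  assumes "strict_derivative_at E F f A u" "e > 0"
  obtains d where "d > 0"
    "\<And>u1. u1 \<in> carr E \<Longrightarrow> nrm E (u1 - u) < d \<Longrightarrow> f u1 \<in> carr F"
    "\<And>u1 u2. u1 \<in> carr E \<Longrightarrow> u2 \<in> carr E \<Longrightarrow> nrm E (u1 - u) < d \<Longrightarrow> nrm E (u2 - u) < d \<Longrightarrow>
      nrm F (f u1 - f u2 - A (u1 - u2)) \<le> e * nrm E (u1 - u2)"
  using strict_derivative_atD(3)[OF assms] by blast

text \<open>Lets a closure rule lose a fixed factor \<open>C\<close>: the estimate is applied with a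
  parameter smaller than \<open>e / (C + 1)\<close> or equal to it. The restriction to parameters
  below 1 allows quadratic terms to be treated as linear ones.\<close>

lemma strict_derivative_atI:
  assumes u: "u \<in> carr E" and A: "bounded_linear_between E F A" and C: "0 \<le> C" and E: "nspace E"
    and *: "\<And>e. 0 < e \<Longrightarrow> e < 1 \<Longrightarrow> \<exists>d>0. \<forall>u1\<in>carr E. \<forall>u2\<in>carr E. nrm E (u1 - u) < d \<longrightarrow> nrm E (u2 - u) < d \<longrightarrow>
        f u1 \<in> carr F \<and> nrm F (f u1 - f u2 - A (u1 - u2)) \<le> C * e * nrm E (u1 - u2)"
  shows "strict_derivative_at E F f A u"
  unfolding strict_derivative_at_def
proof (intro conjI u A allI impI)
  interpret E: nspace E by fact
  fix e :: real assume e: "0 < e"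
  define e' where "e' = min (1 / 2) (e / (C + 1))"
  have e': "0 < e'" "e' < 1" using e C by (auto simp: e'_def)
  have "C * e' \<le> C * (e / (C + 1))" using C by (intro mult_left_mono) (auto simp: e'_def)
  also have "\<dots> \<le> e" using C e by (simp add: field_simps)
  finally have le: "C * e' \<le> e" .
  obtain d where d: "d > 0" "\<forall>u1\<in>carr E. \<forall>u2\<in>carr E. nrm E (u1 - u) < d \<longrightarrow> nrm E (u2 - u) < d \<longrightarrow>
        f u1 \<in> carr F \<and> nrm F (f u1 - f u2 - A (u1 - u2)) \<le> C * e' * nrm E (u1 - u2)"
    using *[OF e'] by blast
  have "C * e' * nrm E (u1 - u2) \<le> e * nrm E (u1 - u2)" if "u1 \<in> carr E" "u2 \<in> carr E" for u1 u2
    using le E.nrm_ge_0 that by (intro mult_right_mono) auto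
  then show "\<exists>d>0. \<forall>u1\<in>carr E. \<forall>u2\<in>carr E. nrm E (u1 - u) < d \<longrightarrow> nrm E (u2 - u) < d \<longrightarrow>
        f u1 \<in> carr F \<and> nrm F (f u1 - f u2 - A (u1 - u2)) \<le> e * nrm E (u1 - u2)"
    using d by (meson order_trans)
qed

text \<open>The definition with \<open>e = 1\<close>: the increment is within
  \<open>nrm E (u1 - u2)\<close> of the linear part, so the Lipschitz constant is 1 plus a bound for
  \<open>A\<close>.\<close>

lemma strict_derivative_lipschitz:
  assumes "strict_derivative_at E F f A u" "nspace E" "nspace F"
  obtains d C where "0 < d" "0 < C" "\<And>u1. u1 \<in> carr E \<Longrightarrow> nrm E (u1 - u) < d \<Longrightarrow> f u1 \<in> carr F"
    "\<And>u1 u2. u1 \<in> carr E \<Longrightarrow> u2 \<in> carr E \<Longrightarrow> nrm E (u1 - u) < d \<Longrightarrow> nrm E (u2 - u) < d \<Longrightarrow>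
      nrm F (f u1 - f u2) \<le> C * nrm E (u1 - u2)"
proof -
  interpret E: nspace E by fact
  interpret F: nspace F by fact
  note A = strict_derivative_atD(2)[OF assms(1)]
  obtain a where a: "0 < a" "\<And>v. v \<in> carr E \<Longrightarrow> nrm F (A v) \<le> a * nrm E v"
    using bounded_linear_between_bound[OF A assms(2)] by blast
  obtain d where d: "d > 0" "\<And>u1. u1 \<in> carr E \<Longrightarrow> nrm E (u1 - u) < d \<Longrightarrow> f u1 \<in> carr F"
    "\<And>u1 u2. u1 \<in> carr E \<Longrightarrow> u2 \<in> carr E \<Longrightarrow> nrm E (u1 - u) < d \<Longrightarrow> nrm E (u2 - u) < d \<Longrightarrow>
      nrm F (f u1 - f u2 - A (u1 - u2)) \<le> 1 * nrm E (u1 - u2)"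
    by (rule strict_derivative_atE[OF assms(1) zero_less_one]) (rule that; blast)
  have "nrm F (f u1 - f u2) \<le> (1 + a) * nrm E (u1 - u2)"
    if *: "u1 \<in> carr E" "u2 \<in> carr E" "nrm E (u1 - u) < d" "nrm E (u2 - u) < d" for u1 u2
  proof -
    have m: "A (u1 - u2) \<in> carr F" "f u1 \<in> carr F" "f u2 \<in> carr F"
      using * d bounded_linear_betweenD(1)[OF A] by auto
    have "nrm F ((f u1 - f u2 - A (u1 - u2)) + A (u1 - u2)) \<le> nrm F (f u1 - f u2 - A (u1 - u2)) + nrm F (A (u1 - u2))"
      by (rule F.nrm_triangle) (use m in auto)
    then show ?thesis using d(3)[OF *] a(2)[of "u1 - u2"] * by (simp add: algebra_simps)
  qed
  then show ?thesis using that[of d "1 + a"] d a by auto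
qed

lemma strict_derivative_linear:
  assumes "nspace E" "nspace F" "bounded_linear_between E F A" "u \<in> carr E"
  shows "strict_derivative_at E F A A u"
proof -
  interpret E: nspace E by fact
  interpret F: nspace F by fact
  show ?thesis
    unfolding strict_derivative_at_def
    using assms bounded_linear_between_diff[OF assms(3,1)] bounded_linear_betweenD(1)[OF assms(3)]
    by (auto intro!: exI[of _ 1] mult_nonneg_nonneg E.nrm_ge_0)
qed

lemma strict_derivative_const:
  assumes "nspace E" "nspace F" "c \<in> carr F" "u \<in> carr E"
  shows "strict_derivative_at E F (\<lambda>_. c) (\<lambda>_. 0) u"
proof -
  interpret E: nspace E by fact
  interpret F: nspace F by fact
  have "bounded_linear_between E F (\<lambda>_. 0)"
    by (rule bounded_linear_betweenI[where C = 0]) auto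
  then show ?thesis
    unfolding strict_derivative_at_def using assms by (auto intro!: exI[of _ 1] mult_nonneg_nonneg E.nrm_ge_0)
qed

lemma strict_derivative_compose:
  assumes E: "nspace E" and F: "nspace F" and G: "nspace G"
    and f: "strict_derivative_at E F f A u" and g: "strict_derivative_at F G g B (f u)"
  shows "strict_derivative_at E G (\<lambda>u. g (f u)) (\<lambda>v. B (A v)) u"
proof -
  interpret E: nspace E by fact
  interpret F: nspace F by fact
  interpret G: nspace G by fact
  note A = strict_derivative_atD(2)[OF f] and B = strict_derivative_atD(2)[OF g] and u = strict_derivative_atD(1)[OF f]
  obtain b where b: "0 < b" "\<And>v. v \<in> carr F \<Longrightarrow> nrm G (B v) \<le> b * nrm F v"
    using bounded_linear_between_bound[OF B F] by blast
  obtain d0 C where d0: "0 < d0" "0 < C" "\<And>u1. u1 \<in> carr E \<Longrightarrow> nrm E (u1 - u) < d0 \<Longrightarrow> f u1 \<in> carr F"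
    "\<And>u1 u2. u1 \<in> carr E \<Longrightarrow> u2 \<in> carr E \<Longrightarrow> nrm E (u1 - u) < d0 \<Longrightarrow> nrm E (u2 - u) < d0 \<Longrightarrow>
      nrm F (f u1 - f u2) \<le> C * nrm E (u1 - u2)" using strict_derivative_lipschitz[OF f E F] by blast
  show ?thesis
  proof (rule strict_derivative_atI[OF u bounded_linear_between_compose[OF E F A B], of "C + b"])
    fix e :: real assume e: "0 < e" "e < 1"
    obtain d1 where d1: "d1 > 0" "\<And>u1. u1 \<in> carr E \<Longrightarrow> nrm E (u1 - u) < d1 \<Longrightarrow> f u1 \<in> carr F"
      "\<And>u1 u2. u1 \<in> carr E \<Longrightarrow> u2 \<in> carr E \<Longrightarrow> nrm E (u1 - u) < d1 \<Longrightarrow> nrm E (u2 - u) < d1 \<Longrightarrow>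
      nrm F (f u1 - f u2 - A (u1 - u2)) \<le> e * nrm E (u1 - u2)"
      by (rule strict_derivative_atE[OF f e(1)]) (rule that; blast)
    obtain d2 where d2: "d2 > 0" "\<And>u1. u1 \<in> carr F \<Longrightarrow> nrm F (u1 - f u) < d2 \<Longrightarrow> g u1 \<in> carr G"
      "\<And>u1 u2. u1 \<in> carr F \<Longrightarrow> u2 \<in> carr F \<Longrightarrow> nrm F (u1 - f u) < d2 \<Longrightarrow> nrm F (u2 - f u) < d2 \<Longrightarrow>
      nrm G (g u1 - g u2 - B (u1 - u2)) \<le> e * nrm F (u1 - u2)"
      by (rule strict_derivative_atE[OF g e(1)]) (rule that; blast)
    define d where "d = Min {d0, d1, d2 / C}"
    have d: "0 < d" "d \<le> d0" "d \<le> d1" "d \<le> d2 / C" using d0(1,2) d1(1) d2(1) unfolding d_def by auto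
    have near: "f u1 \<in> carr F" "nrm F (f u1 - f u) < d2" if "u1 \<in> carr E" "nrm E (u1 - u) < d" for u1
    proof -
      show "f u1 \<in> carr F" using that d d0 by auto
      have "nrm F (f u1 - f u) \<le> C * nrm E (u1 - u)" using d0(4)[of u1 u] that u d by auto
      also have "\<dots> < C * (d2 / C)" using that d d0 by (intro mult_strict_left_mono) auto
      finally show "nrm F (f u1 - f u) < d2" using d0 by simp
    qed
    have "nrm G (g (f u1) - g (f u2) - B (A (u1 - u2))) \<le> (C + b) * e * nrm E (u1 - u2)"
      if *: "u1 \<in> carr E" "u2 \<in> carr E" "nrm E (u1 - u) < d" "nrm E (u2 - u) < d" for u1 u2
    proof -
      have m: "A (u1 - u2) \<in> carr F" "f u1 \<in> carr F" "f u2 \<in> carr F" "g (f u1) \<in> carr G" "g (f u2) \<in> carr G"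
        using * near d2 bounded_linear_betweenD(1)[OF A] by auto
      have BB: "\<And>v. v \<in> carr F \<Longrightarrow> B v \<in> carr G" using bounded_linear_betweenD(1)[OF B] .
      \<comment> \<open>The remainder of \<open>g\<close> is taken at the true increment of
        \<open>f\<close>, and \<open>B\<close> acts on the remainder of \<open>f\<close>; the
        Lipschitz constant of \<open>f\<close> converts the first into a multiple of
        \<open>nrm E (u1 - u2)\<close>.\<close>
      have "g (f u1) - g (f u2) - B (A (u1 - u2)) = (g (f u1) - g (f u2) - B (f u1 - f u2)) + B (f u1 - f u2 - A (u1 - u2))"
        using bounded_linear_between_diff[OF B F, of "f u1 - f u2" "A (u1 - u2)"] m by simp
      then have "nrm G (g (f u1) - g (f u2) - B (A (u1 - u2))) \<le>
          nrm G (g (f u1) - g (f u2) - B (f u1 - f u2)) + nrm G (B (f u1 - f u2 - A (u1 - u2)))"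
        using G.nrm_triangle[of "g (f u1) - g (f u2) - B (f u1 - f u2)" "B (f u1 - f u2 - A (u1 - u2))"] m BB
        by (metis F.diff_carr G.diff_carr)
      also have "\<dots> \<le> e * nrm F (f u1 - f u2) + b * nrm F (f u1 - f u2 - A (u1 - u2))"
        by (intro add_mono d2 b) (use * near m in auto)
      also have "\<dots> \<le> e * (C * nrm E (u1 - u2)) + b * (e * nrm E (u1 - u2))"
        using e b * d by (intro add_mono mult_left_mono d0 d1) auto
      finally show ?thesis by (simp add: algebra_simps)
    qed
    then show "\<exists>d>0. \<forall>u1\<in>carr E. \<forall>u2\<in>carr E. nrm E (u1 - u) < d \<longrightarrow> nrm E (u2 - u) < d \<longrightarrow>
        g (f u1) \<in> carr G \<and> nrm G (g (f u1) - g (f u2) - B (A (u1 - u2))) \<le> (C + b) * e * nrm E (u1 - u2)"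
      using near d d2 by (intro exI[of _ d]) auto
  qed (use b d0 E in auto)
qed

lemma strict_derivative_add:
  assumes E: "nspace E" and F: "nspace F"
    and f: "strict_derivative_at E F f A u" and g: "strict_derivative_at E F g B u"
  shows "strict_derivative_at E F (\<lambda>u. f u + g u) (\<lambda>v. A v + B v) u"
proof -
  interpret E: nspace E by fact
  interpret F: nspace F by fact
  note A = strict_derivative_atD(2)[OF f] and B = strict_derivative_atD(2)[OF g] and u = strict_derivative_atD(1)[OF f]
  show ?thesis
  proof (rule strict_derivative_atI[OF u bounded_linear_between_add[OF F A B], of 2])
    fix e :: real assume e: "0 < e" "e < 1"
    obtain d1 where d1: "d1 > 0" "\<And>u1. u1 \<in> carr E \<Longrightarrow> nrm E (u1 - u) < d1 \<Longrightarrow> f u1 \<in> carr F"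
      "\<And>u1 u2. u1 \<in> carr E \<Longrightarrow> u2 \<in> carr E \<Longrightarrow> nrm E (u1 - u) < d1 \<Longrightarrow> nrm E (u2 - u) < d1 \<Longrightarrow>
      nrm F (f u1 - f u2 - A (u1 - u2)) \<le> e * nrm E (u1 - u2)"
      by (rule strict_derivative_atE[OF f e(1)]) (rule that; blast)
    obtain d2 where d2: "d2 > 0" "\<And>u1. u1 \<in> carr E \<Longrightarrow> nrm E (u1 - u) < d2 \<Longrightarrow> g u1 \<in> carr F"
      "\<And>u1 u2. u1 \<in> carr E \<Longrightarrow> u2 \<in> carr E \<Longrightarrow> nrm E (u1 - u) < d2 \<Longrightarrow> nrm E (u2 - u) < d2 \<Longrightarrow>
      nrm F (g u1 - g u2 - B (u1 - u2)) \<le> e * nrm E (u1 - u2)"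
      by (rule strict_derivative_atE[OF g e(1)]) (rule that; blast)
    have "nrm F (f u1 + g u1 - (f u2 + g u2) - (A (u1 - u2) + B (u1 - u2))) \<le> 2 * e * nrm E (u1 - u2)"
      if *: "u1 \<in> carr E" "u2 \<in> carr E" "nrm E (u1 - u) < min d1 d2" "nrm E (u2 - u) < min d1 d2" for u1 u2
    proof -
      have m: "A (u1 - u2) \<in> carr F" "B (u1 - u2) \<in> carr F" "f u1 \<in> carr F" "f u2 \<in> carr F" "g u1 \<in> carr F" "g u2 \<in> carr F"
        using * d1 d2 bounded_linear_betweenD(1)[OF A] bounded_linear_betweenD(1)[OF B] by auto
      have "f u1 + g u1 - (f u2 + g u2) - (A (u1 - u2) + B (u1 - u2)) =
          (f u1 - f u2 - A (u1 - u2)) + (g u1 - g u2 - B (u1 - u2))" by simp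
      then have "nrm F (f u1 + g u1 - (f u2 + g u2) - (A (u1 - u2) + B (u1 - u2))) \<le>
          nrm F (f u1 - f u2 - A (u1 - u2)) + nrm F (g u1 - g u2 - B (u1 - u2))"
        using F.nrm_triangle[of "f u1 - f u2 - A (u1 - u2)" "g u1 - g u2 - B (u1 - u2)"] m by (metis F.diff_carr)
      then show ?thesis using d1(3)[of u1 u2] d2(3)[of u1 u2] * by simp
    qed
    then show "\<exists>d>0. \<forall>u1\<in>carr E. \<forall>u2\<in>carr E. nrm E (u1 - u) < d \<longrightarrow> nrm E (u2 - u) < d \<longrightarrow>
        f u1 + g u1 \<in> carr F \<and> nrm F (f u1 + g u1 - (f u2 + g u2) - (A (u1 - u2) + B (u1 - u2))) \<le> 2 * e * nrm E (u1 - u2)"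
      using d1 d2 by (intro exI[of _ "min d1 d2"]) auto
  qed (use E in auto)
qed

lemma bounded_linear_between_pair:
  assumes "bounded_linear_between E F A" "bounded_linear_between E G B"
  shows "bounded_linear_between E (prod_nspace F G) (\<lambda>v. (A v, B v))"
proof -
  obtain a where a: "\<And>v. v \<in> carr E \<Longrightarrow> nrm F (A v) \<le> a * nrm E v"
    using assms(1) unfolding bounded_linear_between_def by blast
  obtain b where b: "\<And>v. v \<in> carr E \<Longrightarrow> nrm G (B v) \<le> b * nrm E v"
    using assms(2) unfolding bounded_linear_between_def by blast
  note AD = bounded_linear_betweenD[OF assms(1)] and BD = bounded_linear_betweenD[OF assms(2)]
  show ?thesis
  proof (rule bounded_linear_betweenI[where C = "a + b"])
    fix v assume v: "v \<in> carr E"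
    show "nrm (prod_nspace F G) (A v, B v) \<le> (a + b) * nrm E v"
      using a[OF v] b[OF v] by (simp add: nrm_prod_nspace algebra_simps)
  qed (simp_all add: AD BD)
qed

lemma strict_derivative_pair:
  assumes E: "nspace E"
    and f: "strict_derivative_at E F f A u" and g: "strict_derivative_at E G g B u"
  shows "strict_derivative_at E (prod_nspace F G) (\<lambda>u. (f u, g u)) (\<lambda>v. (A v, B v)) u"
proof -
  note A = strict_derivative_atD(2)[OF f] and B = strict_derivative_atD(2)[OF g] and u = strict_derivative_atD(1)[OF f]
  show ?thesis
  proof (rule strict_derivative_atI[OF u bounded_linear_between_pair[OF A B], of 2])
    fix e :: real assume e: "0 < e" "e < 1"
    obtain d1 where d1: "d1 > 0" "\<And>u1. u1 \<in> carr E \<Longrightarrow> nrm E (u1 - u) < d1 \<Longrightarrow> f u1 \<in> carr F"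
      "\<And>u1 u2. u1 \<in> carr E \<Longrightarrow> u2 \<in> carr E \<Longrightarrow> nrm E (u1 - u) < d1 \<Longrightarrow> nrm E (u2 - u) < d1 \<Longrightarrow>
      nrm F (f u1 - f u2 - A (u1 - u2)) \<le> e * nrm E (u1 - u2)"
      by (rule strict_derivative_atE[OF f e(1)]) (rule that; blast)
    obtain d2 where d2: "d2 > 0" "\<And>u1. u1 \<in> carr E \<Longrightarrow> nrm E (u1 - u) < d2 \<Longrightarrow> g u1 \<in> carr G"
      "\<And>u1 u2. u1 \<in> carr E \<Longrightarrow> u2 \<in> carr E \<Longrightarrow> nrm E (u1 - u) < d2 \<Longrightarrow> nrm E (u2 - u) < d2 \<Longrightarrow>
      nrm G (g u1 - g u2 - B (u1 - u2)) \<le> e * nrm E (u1 - u2)"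
      by (rule strict_derivative_atE[OF g e(1)]) (rule that; blast)
    have "nrm (prod_nspace F G) ((f u1, g u1) - (f u2, g u2) - (A (u1 - u2), B (u1 - u2))) \<le> 2 * e * nrm E (u1 - u2)"
      if *: "u1 \<in> carr E" "u2 \<in> carr E" "nrm E (u1 - u) < min d1 d2" "nrm E (u2 - u) < min d1 d2" for u1 u2
      using d1(3)[of u1 u2] d2(3)[of u1 u2] * by (simp add: nrm_prod_nspace)
    then show "\<exists>d>0. \<forall>u1\<in>carr E. \<forall>u2\<in>carr E. nrm E (u1 - u) < d \<longrightarrow> nrm E (u2 - u) < d \<longrightarrow>
        (f u1, g u1) \<in> carr (prod_nspace F G) \<and>
        nrm (prod_nspace F G) ((f u1, g u1) - (f u2, g u2) - (A (u1 - u2), B (u1 - u2))) \<le> 2 * e * nrm E (u1 - u2)"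
      using d1 d2 by (intro exI[of _ "min d1 d2"]) auto
  qed (use E in auto)
qed

section \<open>Strict derivatives of products and of real powers\<close>

context holder
begin

definition HK :: "nat \<Rightarrow> real" where "HK j = 7 ^ j"

lemma HK_pos: "0 < HK j" by (simp add: HK_def)

lemma mult_carr: "f \<in> carr (H j) \<Longrightarrow> g \<in> carr (H j) \<Longrightarrow> f * g \<in> carr (H j)"
  using H_mult by blast

lemma nrm_mult: "f \<in> carr (H j) \<Longrightarrow> g \<in> carr (H j) \<Longrightarrow> nrm (H j) (f * g) \<le> HK j * nrm (H j) f * nrm (H j) g"
  using H_mult HK_def by simp

text \<open>The form used in estimates: bounds for the factors are inserted directly, so that
  products of several estimated terms can be handled by introduction rules.\<close>

lemma nrm_mult_le:
  assumes "f \<in> carr (H j)" "g \<in> carr (H j)" "nrm (H j) f \<le> a" "nrm (H j) g \<le> b"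
  shows "nrm (H j) (f * g) \<le> HK j * a * b"
proof -
  have "nrm (H j) f * nrm (H j) g \<le> a * b"
    using assms H.nrm_ge_0 by (intro mult_mono) (auto intro: order_trans)
  then have "HK j * (nrm (H j) f * nrm (H j) g) \<le> HK j * (a * b)"
    using HK_pos[of j] by (intro mult_left_mono) auto
  then show ?thesis using nrm_mult[OF assms(1,2)] by (simp add: mult.assoc)
qed

lemma bounded_linear_mult_left:
  assumes "bounded_linear_between E (H j) A" "nspace E" "c \<in> carr (H j)"
  shows "bounded_linear_between E (H j) (\<lambda>v. c * A v)"
proof -
  obtain a where a: "0 < a" "\<And>v. v \<in> carr E \<Longrightarrow> nrm (H j) (A v) \<le> a * nrm E v"
    using bounded_linear_between_bound[OF assms(1,2)] by blast
  note AD = bounded_linear_betweenD[OF assms(1)]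
  show ?thesis
  proof (rule bounded_linear_betweenI[where C = "HK j * nrm (H j) c * a"])
    fix v assume v: "v \<in> carr E"
    show "nrm (H j) (c * A v) \<le> HK j * nrm (H j) c * a * nrm E v"
      using nrm_mult_le[OF assms(3) AD(1)[OF v] order_refl a(2)[OF v]] by (simp add: mult.assoc)
  qed (auto simp: AD assms mult_carr algebra_simps scaleR_fun_def)
qed

lemma strict_derivative_mult:
  assumes E: "nspace E"
    and f: "strict_derivative_at E (H j) f A u" and g: "strict_derivative_at E (H j) g B u"
  shows "strict_derivative_at E (H j) (\<lambda>u. f u * g u) (\<lambda>v. g u * A v + f u * B v) u"
proof -
  interpret E: nspace E by fact
  note A = strict_derivative_atD(2)[OF f] and B = strict_derivative_atD(2)[OF g] and u = strict_derivative_atD(1)[OF f]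
  obtain a where a: "0 < a" "\<And>v. v \<in> carr E \<Longrightarrow> nrm (H j) (A v) \<le> a * nrm E v"
    using bounded_linear_between_bound[OF A E] by blast
  obtain b where b: "0 < b" "\<And>v. v \<in> carr E \<Longrightarrow> nrm (H j) (B v) \<le> b * nrm E v"
    using bounded_linear_between_bound[OF B E] by blast
  obtain df Cf where df: "0 < df" "0 < Cf" "\<And>u1. u1 \<in> carr E \<Longrightarrow> nrm E (u1 - u) < df \<Longrightarrow> f u1 \<in> carr (H j)"
    "\<And>u1 u2. u1 \<in> carr E \<Longrightarrow> u2 \<in> carr E \<Longrightarrow> nrm E (u1 - u) < df \<Longrightarrow> nrm E (u2 - u) < df \<Longrightarrow>
      nrm (H j) (f u1 - f u2) \<le> Cf * nrm E (u1 - u2)" using strict_derivative_lipschitz[OF f E nspace_H] by blast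
  obtain dg Cg where dg: "0 < dg" "0 < Cg" "\<And>u1. u1 \<in> carr E \<Longrightarrow> nrm E (u1 - u) < dg \<Longrightarrow> g u1 \<in> carr (H j)"
    "\<And>u1 u2. u1 \<in> carr E \<Longrightarrow> u2 \<in> carr E \<Longrightarrow> nrm E (u1 - u) < dg \<Longrightarrow> nrm E (u2 - u) < dg \<Longrightarrow>
      nrm (H j) (g u1 - g u2) \<le> Cg * nrm E (u1 - u2)" using strict_derivative_lipschitz[OF g E nspace_H] by blast
  have fu: "f u \<in> carr (H j)" "g u \<in> carr (H j)" using df dg u by auto
  \<comment> \<open>Bounds for \<open>f\<close> and \<open>g\<close> near \<open>u\<close>: on the
    neighbourhood chosen below they deviate from their values at \<open>u\<close> by at most
    \<open>Cf * e\<close> and \<open>Cg * e\<close>, and \<open>e < 1\<close>.\<close>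
  define Nf Ng where "Nf = nrm (H j) (f u) + Cf" and "Ng = nrm (H j) (g u) + Cg"
  have N0: "0 \<le> Nf" "0 \<le> Ng" using H.nrm_ge_0 fu df dg by (auto simp: Nf_def Ng_def add_nonneg_nonneg)
  define C where "C = HK j * (Ng + a * Cg + Nf + Cf * b)"
  have C0: "0 \<le> C" using HK_pos[of j] N0 a b df dg by (auto simp: C_def)
  show ?thesis
  proof (rule strict_derivative_atI[OF u _ C0 E])
    show "bounded_linear_between E (H j) (\<lambda>v. g u * A v + f u * B v)"
      by (intro bounded_linear_between_add bounded_linear_mult_left nspace_H A B E fu)
    fix e :: real assume e: "0 < e" "e < 1"
    obtain d1 where d1: "d1 > 0" "\<And>u1. u1 \<in> carr E \<Longrightarrow> nrm E (u1 - u) < d1 \<Longrightarrow> f u1 \<in> carr (H j)"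
      "\<And>u1 u2. u1 \<in> carr E \<Longrightarrow> u2 \<in> carr E \<Longrightarrow> nrm E (u1 - u) < d1 \<Longrightarrow> nrm E (u2 - u) < d1 \<Longrightarrow>
      nrm (H j) (f u1 - f u2 - A (u1 - u2)) \<le> e * nrm E (u1 - u2)"
      by (rule strict_derivative_atE[OF f e(1)]) (rule that; blast)
    obtain d2 where d2: "d2 > 0" "\<And>u1. u1 \<in> carr E \<Longrightarrow> nrm E (u1 - u) < d2 \<Longrightarrow> g u1 \<in> carr (H j)"
      "\<And>u1 u2. u1 \<in> carr E \<Longrightarrow> u2 \<in> carr E \<Longrightarrow> nrm E (u1 - u) < d2 \<Longrightarrow> nrm E (u2 - u) < d2 \<Longrightarrow>
      nrm (H j) (g u1 - g u2 - B (u1 - u2)) \<le> e * nrm E (u1 - u2)"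
      by (rule strict_derivative_atE[OF g e(1)]) (rule that; blast)
    \<comment> \<open>Including \<open>e\<close> makes the Lipschitz increments of \<open>f\<close>
      and \<open>g\<close> themselves of order \<open>e\<close>, which controls the two mixed terms
      below.\<close>
    define d where "d = Min {df, dg, d1, d2, e}"
    have d: "0 < d" "d \<le> df" "d \<le> dg" "d \<le> d1" "d \<le> d2" "d \<le> e" using df(1) dg(1) d1(1) d2(1) e(1) unfolding d_def by auto
    have fgm: "f u1 \<in> carr (H j)" "g u1 \<in> carr (H j)" if "u1 \<in> carr E" "nrm E (u1 - u) < d" for u1
      using df dg d that by auto
    have near: "nrm (H j) (f u1 - f u) \<le> Cf * e" "nrm (H j) (g u1 - g u) \<le> Cg * e" "nrm (H j) (f u1) \<le> Nf" "nrm (H j) (g u1) \<le> Ng"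
      if "u1 \<in> carr E" "nrm E (u1 - u) < d" for u1
    proof -
      have "nrm (H j) (f u1 - f u) \<le> Cf * nrm E (u1 - u)" using df(4)[of u1 u] that u d by auto
      also have "\<dots> \<le> Cf * e" using that d df by (intro mult_left_mono) auto
      finally show f: "nrm (H j) (f u1 - f u) \<le> Cf * e" .
      have "nrm (H j) (g u1 - g u) \<le> Cg * nrm E (u1 - u)" using dg(4)[of u1 u] that u d by auto
      also have "\<dots> \<le> Cg * e" using that d dg by (intro mult_left_mono) auto
      finally show g: "nrm (H j) (g u1 - g u) \<le> Cg * e" .
      have "Cf * e \<le> Cf" "Cg * e \<le> Cg" using e df dg by auto
      then show "nrm (H j) (f u1) \<le> Nf" "nrm (H j) (g u1) \<le> Ng"
        unfolding Nf_def Ng_def using f g H.nrm_triangle[of "f u1 - f u" j "f u"] H.nrm_triangle[of "g u1 - g u" j "g u"] fgm[OF that] fu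
        by auto
    qed
    have "nrm (H j) (f u1 * g u1 - f u2 * g u2 - (g u * A (u1 - u2) + f u * B (u1 - u2))) \<le> C * e * nrm E (u1 - u2)"
      if *: "u1 \<in> carr E" "u2 \<in> carr E" "nrm E (u1 - u) < d" "nrm E (u2 - u) < d" for u1 u2
    proof -
      define k where "k = nrm E (u1 - u2)"
      define f' where "f' = f u1 - f u2 - A (u1 - u2)"
      define g' where "g' = g u1 - g u2 - B (u1 - u2)"
      have m: "A (u1 - u2) \<in> carr (H j)" "B (u1 - u2) \<in> carr (H j)" "f u1 \<in> carr (H j)" "f u2 \<in> carr (H j)" "g u1 \<in> carr (H j)" "g u2 \<in> carr (H j)"
        using * fgm bounded_linear_betweenD(1)[OF A] bounded_linear_betweenD(1)[OF B] by auto
      have fg': "f' \<in> carr (H j)" "g' \<in> carr (H j)" using m by (auto simp: f'_def g'_def)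
      \<comment> \<open>Asymmetric splitting: \<open>f\<close> is changed first with
        \<open>g\<close> at \<open>u1\<close>, then \<open>g\<close> with \<open>f\<close> at
        \<open>u2\<close>. What remains are the two remainders and two products of a linear part
        with a small increment from the base point.\<close>
      have "f u1 * g u1 - f u2 * g u2 - (g u * A (u1 - u2) + f u * B (u1 - u2)) =
          (f' * g u1 + A (u1 - u2) * (g u1 - g u)) + (f u2 * g' + (f u2 - f u) * B (u1 - u2))"
        unfolding f'_def g'_def by (rule ext, simp only: times_fun_apply plus_fun_apply minus_apply) algebra
      moreover have "nrm (H j) ((f' * g u1 + A (u1 - u2) * (g u1 - g u)) + (f u2 * g' + (f u2 - f u) * B (u1 - u2))) \<le>
        (HK j * (e * k) * Ng + HK j * (a * k) * (Cg * e)) + (HK j * Nf * (e * k) + HK j * (Cf * e) * (b * k))"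
      proof (intro order_trans[OF H.nrm_triangle] add_mono nrm_mult_le)
        show "nrm (H j) f' \<le> e * k" "nrm (H j) g' \<le> e * k"
          unfolding f'_def g'_def k_def using d1(3) d2(3) * d by auto
        show "nrm (H j) (A (u1 - u2)) \<le> a * k" "nrm (H j) (B (u1 - u2)) \<le> b * k"
          unfolding k_def using a b * by auto
      qed (use near * fg' m fu in \<open>auto intro: mult_carr\<close>)
      moreover have "\<dots> = C * e * k" by (simp add: C_def algebra_simps)
      ultimately show ?thesis by (simp add: k_def)
    qed
    then show "\<exists>d>0. \<forall>u1\<in>carr E. \<forall>u2\<in>carr E. nrm E (u1 - u) < d \<longrightarrow> nrm E (u2 - u) < d \<longrightarrow>
        f u1 * g u1 \<in> carr (H j) \<and>
        nrm (H j) (f u1 * g u1 - f u2 * g u2 - (g u * A (u1 - u2) + f u * B (u1 - u2))) \<le> C * e * nrm E (u1 - u2)"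
    proof (intro exI[of _ d] conjI ballI impI d(1))
      fix u1 assume "u1 \<in> carr E" "nrm E (u1 - u) < d"
      then show "f u1 * g u1 \<in> carr (H j)" by (intro mult_carr fgm)
    qed
  qed
qed

lemma bounded_linear_subset: "bounded_linear_between (H (Suc j)) (H j) (\<lambda>f. f)"
  by (rule bounded_linear_betweenI[where C = 3]) (use H_Suc_subset in auto)

lemma bounded_linear_H_mono: "i \<le> j \<Longrightarrow> bounded_linear_between (H j) (H i) (\<lambda>f. f)"
  by (rule bounded_linear_betweenI[where C = "3 ^ (j - i)"]) (use H_mono nrm_H_mono in auto)

lemma deriv_add_H: "f \<in> carr (H (Suc j)) \<Longrightarrow> g \<in> carr (H (Suc j)) \<Longrightarrow> deriv (f + g) = deriv f + deriv g"
  by (rule deriv_fun_add) (auto simp: carr_H_Suc)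

lemma deriv_scale_H: "f \<in> carr (H (Suc j)) \<Longrightarrow> deriv (c *\<^sub>R f) = c *\<^sub>R deriv f"
  by (rule deriv_fun_scale) (auto simp: carr_H_Suc)

lemma bounded_linear_deriv: "bounded_linear_between (H (Suc j)) (H j) deriv"
  by (rule bounded_linear_betweenI[where C = 1])
    (use H_deriv nrm_H_deriv deriv_add_H deriv_scale_H in auto)

lemma deriv_diff_H: "f \<in> carr (H (Suc j)) \<Longrightarrow> g \<in> carr (H (Suc j)) \<Longrightarrow> deriv (f - g) = deriv f - deriv g"
  by (rule bounded_linear_between_diff[OF bounded_linear_deriv nspace_H])

text \<open>The norm of order \<open>j + 1\<close> is the supremum plus the norm of order
  \<open>j\<close> of the time derivative, so it suffices to estimate the remainder and its time
  derivative, both at order \<open>j\<close>.\<close>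

lemma strict_derivative_H_Suc:
  assumes E: "nspace E"
    and f: "strict_derivative_at E (H j) f A u" and f': "strict_derivative_at E (H j) (\<lambda>u. deriv (f u)) (\<lambda>v. deriv (A v)) u"
    and A: "bounded_linear_between E (H (Suc j)) A"
    and d0: "0 < d0" "\<And>u1. u1 \<in> carr E \<Longrightarrow> nrm E (u1 - u) < d0 \<Longrightarrow> f u1 \<in> carr (H (Suc j))"
  shows "strict_derivative_at E (H (Suc j)) f A u"
proof (rule strict_derivative_atI[OF strict_derivative_atD(1)[OF f] A _ E, of 2])
  interpret E: nspace E by fact
  fix e :: real assume e: "0 < e" "e < 1"
  obtain d1 where d1: "d1 > 0" "\<And>u1. u1 \<in> carr E \<Longrightarrow> nrm E (u1 - u) < d1 \<Longrightarrow> f u1 \<in> carr (H j)"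
      "\<And>u1 u2. u1 \<in> carr E \<Longrightarrow> u2 \<in> carr E \<Longrightarrow> nrm E (u1 - u) < d1 \<Longrightarrow> nrm E (u2 - u) < d1 \<Longrightarrow>
      nrm (H j) (f u1 - f u2 - A (u1 - u2)) \<le> e * nrm E (u1 - u2)"
    by (rule strict_derivative_atE[OF f e(1)]) (rule that; blast)
  obtain d2 where d2: "d2 > 0" "\<And>u1. u1 \<in> carr E \<Longrightarrow> nrm E (u1 - u) < d2 \<Longrightarrow> deriv (f u1) \<in> carr (H j)"
      "\<And>u1 u2. u1 \<in> carr E \<Longrightarrow> u2 \<in> carr E \<Longrightarrow> nrm E (u1 - u) < d2 \<Longrightarrow> nrm E (u2 - u) < d2 \<Longrightarrow>
      nrm (H j) (deriv (f u1) - deriv (f u2) - deriv (A (u1 - u2))) \<le> e * nrm E (u1 - u2)"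
    by (rule strict_derivative_atE[OF f' e(1)]) (rule that; blast)
  define d where "d = Min {d0, d1, d2}"
  have d: "0 < d" "d \<le> d0" "d \<le> d1" "d \<le> d2" using d0(1) d1(1) d2(1) unfolding d_def by auto
  have "nrm (H (Suc j)) (f u1 - f u2 - A (u1 - u2)) \<le> 2 * e * nrm E (u1 - u2)"
    if *: "u1 \<in> carr E" "u2 \<in> carr E" "nrm E (u1 - u) < d" "nrm E (u2 - u) < d" for u1 u2
  proof -
    have m: "f u1 \<in> carr (H (Suc j))" "f u2 \<in> carr (H (Suc j))" "A (u1 - u2) \<in> carr (H (Suc j))"
      using d0 * d bounded_linear_betweenD(1)[OF A] by auto
    have mem: "f u1 - f u2 - A (u1 - u2) \<in> carr (H (Suc j))" using m by auto
    have "deriv (f u1 - f u2 - A (u1 - u2)) = deriv (f u1) - deriv (f u2) - deriv (A (u1 - u2))"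
      using m by (simp add: deriv_diff_H[of _ j])
    moreover have "sup_norm (f u1 - f u2 - A (u1 - u2)) \<le> nrm (H j) (f u1 - f u2 - A (u1 - u2))"
      using H_Suc_subset[OF mem] sup_norm_le_nrm by blast
    ultimately show ?thesis using d1(3)[of u1 u2] d2(3)[of u1 u2] * d by (simp add: nrm_H_Suc)
  qed
  then show "\<exists>d>0. \<forall>u1\<in>carr E. \<forall>u2\<in>carr E. nrm E (u1 - u) < d \<longrightarrow> nrm E (u2 - u) < d \<longrightarrow>
     f u1 \<in> carr (H (Suc j)) \<and> nrm (H (Suc j)) (f u1 - f u2 - A (u1 - u2)) \<le> 2 * e * nrm E (u1 - u2)"
    using d d0 by (intro exI[of _ d]) auto
qed simp

definition fpow :: "real \<Rightarrow> rfun \<Rightarrow> real \<Rightarrow> real" where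
  "fpow p g = (\<lambda>t. g t powr p)"

text \<open>A power is monotone on the positive axis, increasing or decreasing according to the sign
  of the exponent; the sum of the end values bounds it in either case.\<close>

lemma powr_le_ends:
  fixes x q :: real
  assumes "0 < m" "x \<in> {m..M}"
  shows "x powr q \<le> m powr q + M powr q"
proof (cases "0 \<le> q")
  case True
  then have "x powr q \<le> M powr q" using assms by (intro powr_mono2) auto
  then show ?thesis by (simp add: add_increasing)
next
  case False
  then have "x powr q \<le> m powr q" using assms by (intro powr_mono2') auto
  then show ?thesis by (simp add: add_increasing2)
qed

lemma fpow_has_derivative:
  assumes "g \<in> carr (H (Suc j))" "\<And>t. 0 < g t"
  shows "(fpow p g has_real_derivative ((\<lambda>t. p) * fpow (p - 1) g * deriv g) t) (at t)"
  unfolding fpow_def times_fun_def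
  using has_real_derivative_powr[THEN DERIV_chain2, OF assms(2) H_has_derivative[OF assms(1)], of p t] by simp

lemma fpow_periodic: "periodic_fun_simple g P \<Longrightarrow> periodic_fun_simple (fpow p g) P"
  by (simp add: periodic_fun_simple_iff fpow_def)

text \<open>At order 0 the power is Lipschitz on the range of \<open>g\<close>, which is bounded
  away from 0 by periodicity. The derivative involves the exponent \<open>p - 1\<close>, hence the
  induction for arbitrary exponents.\<close>

lemma fpow_carr:
  "g \<in> carr (H j) \<Longrightarrow> (\<And>t. 0 < g t) \<Longrightarrow> fpow p g \<in> carr (H j)"
proof (induction j arbitrary: p)
  case 0
  obtain m where m: "0 < m" "\<And>t. m \<le> g t"
    using periodic_positive_lower_bound[OF H_periodic[OF 0(1)] P H_continuous[OF 0(1)] 0(2)] by blast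
  define M where "M = sup_norm g"
  have gM: "g t \<in> {m..M}" for t using m(2)[of t] H_le_sup_norm[OF 0(1), of t] by (auto simp: M_def)
  define C where "C = \<bar>p\<bar> * (m powr (p - 1) + M powr (p - 1))"
  have C: "0 \<le> C" by (simp add: C_def)
  have "\<bar>g s powr p - g t powr p\<bar> \<le> C * holder_seminorm \<alpha> g * \<bar>s - t\<bar> powr \<alpha>" for s t
  proof -
    have "norm (g s powr p - g t powr p) \<le> C * norm (g s - g t)"
    proof (rule field_differentiable_bound[of "{m..M}" "\<lambda>x. x powr p" "\<lambda>x. p * x powr (p - 1)"])
      fix x assume x: "x \<in> {m..M}"
      then show "((\<lambda>x. x powr p) has_real_derivative p * x powr (p - 1)) (at x within {m..M})"
        using m(1) by (intro has_field_derivative_at_within[OF has_real_derivative_powr]) auto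
      show "norm (p * x powr (p - 1)) \<le> C"
        using powr_le_ends[OF m(1) x, of "p - 1"] by (auto simp: C_def abs_mult intro!: mult_left_mono)
    qed (use gM in auto)
    also have "\<dots> \<le> C * (holder_seminorm \<alpha> g * \<bar>s - t\<bar> powr \<alpha>)"
      using H0_holder[OF 0(1), of s t] C by (intro mult_left_mono) auto
    finally show ?thesis by simp
  qed
  moreover have "continuous_on UNIV (fpow p g)"
  proof -
    have "g t \<noteq> 0" for t using 0(2)[of t] by simp
    then show ?thesis unfolding fpow_def by (intro continuous_on_powr H_continuous[OF 0(1)] continuous_on_const) auto
  qed
  ultimately show ?case using fpow_periodic[OF H_periodic[OF 0(1)]]
    by (intro H0I) (auto simp: fpow_def)
next
  case (Suc j)
  have "(\<lambda>t. p) * fpow (p - 1) g * deriv g \<in> carr (H j)"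
    using Suc H_Suc_subset H_deriv by (intro mult_carr const_H) auto
  then show ?case
    using fpow_has_derivative[OF Suc.prems] fpow_periodic[OF H_periodic[OF Suc.prems(1)]] by (intro H_SucI(1))
qed

lemma deriv_fpow:
  assumes "g \<in> carr (H (Suc j))" "\<And>t. 0 < g t"
  shows "deriv (fpow p g) = (\<lambda>t. p) * fpow (p - 1) g * deriv g"
  using fpow_has_derivative[OF assms] by (intro ext DERIV_imp_deriv)

text \<open>Half of the minimum of \<open>g\<close> serves both as radius of the neighbourhood and
  as uniform lower bound on it.\<close>

lemma positive_neighbourhood:
  assumes "g \<in> carr (H j)" "\<And>t. 0 < g t"
  obtains m where "0 < m" "\<And>f t. f \<in> carr (H j) \<Longrightarrow> nrm (H j) (f - g) < m \<Longrightarrow> m < f t"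
proof -
  obtain m where m: "0 < m" "\<And>t. m \<le> g t"
    using periodic_positive_lower_bound[OF H_periodic[OF assms(1)] P H_continuous[OF assms(1)] assms(2)] by blast
  have "m / 2 < f t" if "f \<in> carr (H j)" "nrm (H j) (f - g) < m / 2" for f t
    using H_le_nrm[of "f - g" j t] that assms(1) m(2)[of t] by (auto simp: abs_le_iff)
  then show ?thesis using that[of "m / 2"] m by auto
qed

text \<open>The supremum of the remainder is a second order Taylor estimate. Its Hoelder seminorm
  compares the remainders at two times \<open>s\<close> and \<open>t\<close>, and this comparison
  requires the third derivative of the power.\<close>

lemma fpow_strict_derivative_0:
  assumes g: "g \<in> carr (H 0)" "\<And>t. 0 < g t"
  shows "strict_derivative_at (H 0) (H 0) (fpow p) (\<lambda>h. (\<lambda>t. p) * fpow (p - 1) g * h) g"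
proof -
  obtain m where m: "0 < m" "\<And>f t. f \<in> carr (H 0) \<Longrightarrow> nrm (H 0) (f - g) < m \<Longrightarrow> m < f t"
    using positive_neighbourhood[OF g] by blast
  define M where "M = nrm (H 0) g + m"
  have range: "f t \<in> {m..M}" if "f \<in> carr (H 0)" "nrm (H 0) (f - g) < m" for f t
  proof -
    have "\<bar>f t - g t\<bar> \<le> nrm (H 0) (f - g)" using H_le_nrm[of "f - g" 0 t] that g by auto
    then show ?thesis using m(2)[OF that, of t] that H_le_nrm[OF g(1), of t] by (auto simp: M_def)
  qed
  \<comment> \<open>\<open>C2\<close> and \<open>C3\<close> bound the second and third derivative of
    the power on the common range \<open>{m..M}\<close> of all functions near
    \<open>g\<close>.\<close>
  define C2 where "C2 = \<bar>p * (p - 1)\<bar> * (m powr (p - 2) + M powr (p - 2))"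
  define C3 where "C3 = \<bar>p * (p - 1) * (p - 2)\<bar> * (m powr (p - 3) + M powr (p - 3))"
  have C: "0 \<le> C2" "0 \<le> C3" by (auto simp: C2_def C3_def)
  have D: "((\<lambda>x. x powr p) has_real_derivative p * x powr (p - 1)) (at x)"
    "((\<lambda>x. p * x powr (p - 1)) has_real_derivative p * (p - 1) * x powr (p - 2)) (at x)"
    "((\<lambda>x. p * (p - 1) * x powr (p - 2)) has_real_derivative p * (p - 1) * (p - 2) * x powr (p - 3)) (at x)"
    if "x \<in> {m..M}" for x
    using that m(1) DERIV_cmult[OF has_real_derivative_powr[of x "p - 1"], of p]
      DERIV_cmult[OF has_real_derivative_powr[of x "p - 2"], of "p * (p - 1)"]
    by (auto intro!: has_real_derivative_powr simp: mult.assoc)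
  have B: "\<bar>p * (p - 1) * x powr (p - 2)\<bar> \<le> C2" "\<bar>p * (p - 1) * (p - 2) * x powr (p - 3)\<bar> \<le> C3" if "x \<in> {m..M}" for x
    unfolding C2_def C3_def abs_mult
    using powr_le_ends[OF m(1) that] by (auto intro!: mult_left_mono)
  have pos: "0 < f t" if "f \<in> carr (H 0)" "nrm (H 0) (f - g) < m" for f t
    using m(1) m(2)[OF that, of t] by simp
  have c0: "(\<lambda>t. p) * fpow (p - 1) g \<in> carr (H 0)" by (intro mult_carr const_H fpow_carr g)
  show ?thesis
  proof (rule strict_derivative_atI[OF g(1) _ _ nspace_H, of _ _ "3 * C2 + C3 * nrm (H 0) g"])
    show "bounded_linear_between (H 0) (H 0) (\<lambda>h. (\<lambda>t. p) * fpow (p - 1) g * h)"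
      by (rule bounded_linear_mult_left[OF bounded_linear_H_mono nspace_H c0]) simp
    show "0 \<le> 3 * C2 + C3 * nrm (H 0) g" using C H.nrm_ge_0[OF g(1)] by simp
    fix e :: real assume e: "0 < e" "e < 1"
    define d where "d = min m e"
    have "nrm (H 0) (fpow p u1 - fpow p u2 - (\<lambda>t. p) * fpow (p - 1) g * (u1 - u2)) \<le>
        (3 * C2 + C3 * nrm (H 0) g) * e * nrm (H 0) (u1 - u2)"
      if *: "u1 \<in> carr (H 0)" "u2 \<in> carr (H 0)" "nrm (H 0) (u1 - g) < d" "nrm (H 0) (u2 - g) < d" for u1 u2
    proof -
      define k where "k = nrm (H 0) (u1 - u2)"
      have k0: "0 \<le> k" using * by (simp add: k_def H.nrm_ge_0)
      have r: "u1 t \<in> {m..M}" "u2 t \<in> {m..M}" "g t \<in> {m..M}" for t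
        using range[of u1 t] range[of u2 t] range[of g t] * g m(1) by (auto simp: d_def)
      have e1: "\<bar>u1 t - g t\<bar> \<le> e" "\<bar>u2 t - g t\<bar> \<le> e" "\<bar>u1 t - u2 t\<bar> \<le> k" for t
        using H_le_nrm[of "u1 - g" 0 t] H_le_nrm[of "u2 - g" 0 t] H_le_nrm[of "u1 - u2" 0 t] * g(1)
        by (auto simp: d_def k_def)
      have sup: "\<bar>(fpow p u1 - fpow p u2 - (\<lambda>t. p) * fpow (p - 1) g * (u1 - u2)) t\<bar> \<le> C2 * e * k" for t
      proof -
        have "\<bar>u1 t powr p - u2 t powr p - p * g t powr (p - 1) * (u1 t - u2 t)\<bar> \<le> C2 * e * \<bar>u1 t - u2 t\<bar>"
          by (rule second_difference_bound(3)[OF D B]) (use r e1 in auto)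
        also have "\<dots> \<le> C2 * e * k" using C e e1 by (intro mult_left_mono) auto
        finally show ?thesis by (simp add: fpow_def)
      qed
      have hol: "holder_seminorm \<alpha> f \<le> nrm (H 0) f" if "f \<in> carr (H 0)" for f
        using sup_norm_ge_0[OF that] by (simp add: nrm_H0)
      have "\<bar>(fpow p u1 - fpow p u2 - (\<lambda>t. p) * fpow (p - 1) g * (u1 - u2)) s -
          (fpow p u1 - fpow p u2 - (\<lambda>t. p) * fpow (p - 1) g * (u1 - u2)) t\<bar> \<le>
          (C3 * e * k * nrm (H 0) g + C2 * k * e + C2 * e * k) * \<bar>s - t\<bar> powr \<alpha>" for s t
      proof -
        have h: "\<bar>f s - f t\<bar> \<le> b * \<bar>s - t\<bar> powr \<alpha>" if "f \<in> carr (H 0)" "nrm (H 0) f \<le> b" for f b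
        proof -
          have "\<bar>f s - f t\<bar> \<le> holder_seminorm \<alpha> f * \<bar>s - t\<bar> powr \<alpha>" by (rule H0_holder[OF that(1)])
          also have "\<dots> \<le> b * \<bar>s - t\<bar> powr \<alpha>" using hol[OF that(1)] that(2) by (intro mult_right_mono) auto
          finally show ?thesis .
        qed
        \<comment> \<open>The two triples are \<open>(g, u2, u1)\<close> evaluated at
          \<open>s\<close> and at \<open>t\<close>. The increments of \<open>u2 - g\<close> and of
          \<open>u1 - u2\<close> in time are bounded through their norms, which supplies the factors
          \<open>e\<close> and \<open>k\<close>.\<close>
        have "\<bar>(u1 s powr p - u2 s powr p - p * g s powr (p - 1) * (u1 s - u2 s)) -
            (u1 t powr p - u2 t powr p - p * g t powr (p - 1) * (u1 t - u2 t))\<bar>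
          \<le> C3 * e * k * \<bar>g s - g t\<bar> + C2 * k * \<bar>(u2 s - g s) - (u2 t - g t)\<bar> + C2 * e * \<bar>(u1 s - u2 s) - (u1 t - u2 t)\<bar>"
          by (rule second_difference_holder[OF D B]) (use r e1 in auto)
        also have "\<dots> \<le> C3 * e * k * (nrm (H 0) g * \<bar>s - t\<bar> powr \<alpha>) + C2 * k * (e * \<bar>s - t\<bar> powr \<alpha>) + C2 * e * (k * \<bar>s - t\<bar> powr \<alpha>)"
          using h[of g] h[of "u2 - g" e] h[of "u1 - u2" k] g * C e k0
          by (intro add_mono mult_left_mono) (auto simp: d_def k_def)
        finally show ?thesis by (simp add: fpow_def algebra_simps)
      qed
      then have "nrm (H 0) (fpow p u1 - fpow p u2 - (\<lambda>t. p) * fpow (p - 1) g * (u1 - u2)) \<le>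
        C2 * e * k + (C3 * e * k * nrm (H 0) g + C2 * k * e + C2 * e * k)"
        by (intro nrm_H0_le sup) (use C e k0 H.nrm_ge_0[OF g(1)] in auto)
      then show ?thesis by (simp add: k_def algebra_simps)
    qed
    then show "\<exists>d>0. \<forall>u1\<in>carr (H 0). \<forall>u2\<in>carr (H 0). nrm (H 0) (u1 - g) < d \<longrightarrow> nrm (H 0) (u2 - g) < d \<longrightarrow>
      fpow p u1 \<in> carr (H 0) \<and> nrm (H 0) (fpow p u1 - fpow p u2 - (\<lambda>t. p) * fpow (p - 1) g * (u1 - u2)) \<le>
        (3 * C2 + C3 * nrm (H 0) g) * e * nrm (H 0) (u1 - u2)"
      using m(1) e pos by (intro exI[of _ d]) (auto simp: d_def intro!: fpow_carr)
  qed
qed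

text \<open>The time derivative of the power is \<open>p\<close> times a power with exponent
  \<open>p - 1\<close> times \<open>deriv u\<close>, a product whose factors are strictly
  differentiable at order \<open>j\<close> by the induction hypothesis. It remains to identify its
  differential with the time derivative of the asserted one.\<close>

lemma fpow_strict_derivative:
  "g \<in> carr (H j) \<Longrightarrow> (\<And>t. 0 < g t) \<Longrightarrow>
     strict_derivative_at (H j) (H j) (fpow p) (\<lambda>h. (\<lambda>t. p) * fpow (p - 1) g * h) g"
proof (induction j arbitrary: p)
  case 0
  then show ?case by (rule fpow_strict_derivative_0)
next
  case (Suc j)
  note g = Suc.prems
  have gj: "g \<in> carr (H j)" using g H_Suc_subset by blast
  have c: "(\<lambda>t. p) * fpow (p - 1) g \<in> carr (H (Suc j))" by (intro mult_carr const_H fpow_carr g)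
  have incl: "strict_derivative_at (H (Suc j)) (H j) (\<lambda>f. f) (\<lambda>f. f) g"
    by (rule strict_derivative_linear[OF nspace_H nspace_H bounded_linear_subset g(1)])
  have der: "strict_derivative_at (H (Suc j)) (H j) deriv deriv g"
    by (rule strict_derivative_linear[OF nspace_H nspace_H bounded_linear_deriv g(1)])
  have pw: "strict_derivative_at (H (Suc j)) (H j) (fpow q) (\<lambda>h. (\<lambda>t. q) * fpow (q - 1) g * h) g" for q
    by (rule strict_derivative_compose[OF nspace_H nspace_H nspace_H incl, where g = "fpow q", OF Suc.IH[OF gj g(2)]])
  have bl: "bounded_linear_between (H (Suc j)) (H (Suc j)) (\<lambda>h. (\<lambda>t. p) * fpow (p - 1) g * h)"
    by (rule bounded_linear_mult_left[OF bounded_linear_H_mono nspace_H c]) simp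
  obtain m where m: "0 < m" "\<And>f t. f \<in> carr (H (Suc j)) \<Longrightarrow> nrm (H (Suc j)) (f - g) < m \<Longrightarrow> m < f t"
    using positive_neighbourhood[OF g] by blast
  have pos: "0 < f t" if "f \<in> carr (H (Suc j))" "nrm (H (Suc j)) (f - g) < m" for f t
    using m(1) m(2)[OF that, of t] by simp
  \<comment> \<open>The differential is left exactly as the product rule produces it; the summand
    with factor 0 comes from the constant \<open>p\<close>.\<close>
  have prod: "strict_derivative_at (H (Suc j)) (H j) (\<lambda>u. (\<lambda>t. p) * fpow (p - 1) u * deriv u)
      (\<lambda>h. deriv g * (fpow (p - 1) g * 0 + (\<lambda>t. p) * ((\<lambda>t. p - 1) * fpow (p - 1 - 1) g * h)) + (\<lambda>t. p) * fpow (p - 1) g * deriv h) g"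
    by (intro strict_derivative_mult[OF nspace_H] strict_derivative_const[OF nspace_H nspace_H] const_H pw der g(1))
  have "strict_derivative_at (H (Suc j)) (H j) (\<lambda>u. deriv (fpow p u)) (\<lambda>h. deriv ((\<lambda>t. p) * fpow (p - 1) g * h)) g"
    unfolding strict_derivative_at_def
  proof (intro conjI g(1) allI impI)
    show "bounded_linear_between (H (Suc j)) (H j) (\<lambda>h. deriv ((\<lambda>t. p) * fpow (p - 1) g * h))"
      by (rule bounded_linear_between_compose[OF nspace_H nspace_H bl bounded_linear_deriv])
    fix e :: real assume e: "0 < e"
    obtain d where d: "d > 0" "\<And>u1. u1 \<in> carr (H (Suc j)) \<Longrightarrow> nrm (H (Suc j)) (u1 - g) < d \<Longrightarrow> (\<lambda>t. p) * fpow (p - 1) u1 * deriv u1 \<in> carr (H j)"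
      "\<And>u1 u2. u1 \<in> carr (H (Suc j)) \<Longrightarrow> u2 \<in> carr (H (Suc j)) \<Longrightarrow> nrm (H (Suc j)) (u1 - g) < d \<Longrightarrow> nrm (H (Suc j)) (u2 - g) < d \<Longrightarrow>
        nrm (H j) ((\<lambda>t. p) * fpow (p - 1) u1 * deriv u1 - (\<lambda>t. p) * fpow (p - 1) u2 * deriv u2 -
        (deriv g * (fpow (p - 1) g * 0 + (\<lambda>t. p) * ((\<lambda>t. p - 1) * fpow (p - 1 - 1) g * (u1 - u2))) + (\<lambda>t. p) * fpow (p - 1) g * deriv (u1 - u2)))
        \<le> e * nrm (H (Suc j)) (u1 - u2)"
      by (rule strict_derivative_atE[OF prod e]) (rule that; blast)
    have lin: "deriv ((\<lambda>t. p) * fpow (p - 1) g * h) =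
        deriv g * (fpow (p - 1) g * 0 + (\<lambda>t. p) * ((\<lambda>t. p - 1) * fpow (p - 1 - 1) g * h)) + (\<lambda>t. p) * fpow (p - 1) g * deriv h"
      if h: "h \<in> carr (H (Suc j))" for h
    proof (rule ext, rule DERIV_imp_deriv)
      fix t
      show "((\<lambda>t. p) * fpow (p - 1) g * h has_real_derivative
        (deriv g * (fpow (p - 1) g * 0 + (\<lambda>t. p) * ((\<lambda>t. p - 1) * fpow (p - 1 - 1) g * h)) + (\<lambda>t. p) * fpow (p - 1) g * deriv h) t) (at t)"
        using DERIV_mult[OF DERIV_cmult[OF fpow_has_derivative[OF g, of "p - 1" t], of p] H_has_derivative[OF h, of t]]
        by (simp add: times_fun_def algebra_simps)
    qed
    show "\<exists>d>0. \<forall>u1\<in>carr (H (Suc j)). \<forall>u2\<in>carr (H (Suc j)). nrm (H (Suc j)) (u1 - g) < d \<longrightarrow> nrm (H (Suc j)) (u2 - g) < d \<longrightarrow>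
      deriv (fpow p u1) \<in> carr (H j) \<and>
      nrm (H j) (deriv (fpow p u1) - deriv (fpow p u2) - deriv ((\<lambda>t. p) * fpow (p - 1) g * (u1 - u2))) \<le> e * nrm (H (Suc j)) (u1 - u2)"
    proof (intro exI[of _ "min d m"] conjI ballI impI)
      fix u1 u2
      assume *: "u1 \<in> carr (H (Suc j))" "u2 \<in> carr (H (Suc j))" "nrm (H (Suc j)) (u1 - g) < min d m" "nrm (H (Suc j)) (u2 - g) < min d m"
      have p: "0 < u1 t" "0 < u2 t" for t using pos * by auto
      show "deriv (fpow p u1) \<in> carr (H j)"
        using deriv_fpow[OF *(1) p(1)] d(2)[OF *(1)] * by simp
      show "nrm (H j) (deriv (fpow p u1) - deriv (fpow p u2) - deriv ((\<lambda>t. p) * fpow (p - 1) g * (u1 - u2))) \<le> e * nrm (H (Suc j)) (u1 - u2)"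
        unfolding deriv_fpow[OF *(1) p(1)] deriv_fpow[OF *(2) p(2)] lin[OF H.diff_carr[OF *(1,2)]]
        by (rule d(3)) (use * in auto)
    qed (use d m in auto)
  qed
  then show ?case
    by (rule strict_derivative_H_Suc[OF nspace_H pw _ bl m(1)]) (use pos in \<open>auto intro!: fpow_carr\<close>)
qed

end

section \<open>Superposition operators\<close>

text \<open>A syntax for the nonlinearities of the problem. It is closed under formal partial
  differentiation, so properties of all superposition operators and of all their derivatives follow
  by one structural induction. Reciprocals and square roots are real powers.\<close>

datatype 'v ex = Var 'v | Cst real | Add "'v ex" "'v ex" | Mul "'v ex" "'v ex" | Pow "'v ex" real

primrec ev :: "'v ex \<Rightarrow> ('v \<Rightarrow> real) \<Rightarrow> real" where
  "ev (Var i) v = v i"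
| "ev (Cst c) v = c"
| "ev (Add a b) v = ev a v + ev b v"
| "ev (Mul a b) v = ev a v * ev b v"
| "ev (Pow a p) v = ev a v powr p"

text \<open>\<open>ok e v\<close>: no power in \<open>e\<close> has a base where \<open>powr\<close> takes its junk values or fails to be smooth.\<close>

primrec ok :: "'v ex \<Rightarrow> ('v \<Rightarrow> real) \<Rightarrow> bool" where
  "ok (Var i) v = True"
| "ok (Cst c) v = True"
| "ok (Add a b) v = (ok a v \<and> ok b v)"
| "ok (Mul a b) v = (ok a v \<and> ok b v)"
| "ok (Pow a p) v = (ok a v \<and> 0 < ev a v)"

primrec pd :: "'v \<Rightarrow> 'v ex \<Rightarrow> 'v ex" where
  "pd i (Var k) = Cst (if k = i then 1 else 0)"
| "pd i (Cst c) = Cst 0"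
| "pd i (Add a b) = Add (pd i a) (pd i b)"
| "pd i (Mul a b) = Add (Mul b (pd i a)) (Mul a (pd i b))"
| "pd i (Pow a p) = Mul (Mul (Cst p) (Pow a (p - 1))) (pd i a)"

text \<open>Differentiating a power repeats its base with a smaller exponent, so every base
  occurring in a derivative already occurs in the expression.\<close>

lemma ok_pd: "ok e v \<Longrightarrow> ok (pd i e) v"
  by (induction e) auto

definition nemytskii :: "'v ex \<Rightarrow> ('v \<Rightarrow> real \<Rightarrow> real) \<Rightarrow> real \<Rightarrow> real" where
  "nemytskii e V = (\<lambda>t. ev e (\<lambda>i. V i t))"

text \<open>The chain rule with time as a spectator: the coefficients are superposition operators at
  \<open>V\<close>, and they act on the direction \<open>W\<close> by multiplication.\<close>

definition nemytskii_deriv ::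
    "'v::finite ex \<Rightarrow> ('v \<Rightarrow> real \<Rightarrow> real) \<Rightarrow> ('v \<Rightarrow> real \<Rightarrow> real) \<Rightarrow> real \<Rightarrow> real" where
  "nemytskii_deriv e V W = (\<Sum>i\<in>UNIV. nemytskii (pd i e) V * W i)"

definition ok_on :: "'v ex \<Rightarrow> ('v \<Rightarrow> real \<Rightarrow> real) \<Rightarrow> bool" where
  "ok_on e V \<longleftrightarrow> (\<forall>t. ok e (\<lambda>i. V i t))"

lemma ok_on_pd: "ok_on e V \<Longrightarrow> ok_on (pd i e) V"
  by (simp add: ok_on_def ok_pd)

definition fun_nspace :: "'a nspace \<Rightarrow> ('v::finite \<Rightarrow> 'a) nspace" where
  "fun_nspace E = ({V. \<forall>i. V i \<in> carr E}, \<lambda>V. \<Sum>i\<in>UNIV. nrm E (V i))"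

lemma carr_fun_nspace [simp]: "V \<in> carr (fun_nspace E) \<longleftrightarrow> (\<forall>i. V i \<in> carr E)"
  by (simp add: fun_nspace_def)

lemma nrm_fun_nspace: "nrm (fun_nspace E) V = (\<Sum>i\<in>UNIV. nrm E (V i))"
  by (simp add: fun_nspace_def)

lemma sum_fun_apply: "(\<Sum>i\<in>I. f i) t = (\<Sum>i\<in>I. (f i t :: 'a::comm_monoid_add))"
  by (induction I rule: infinite_finite_induct) auto

lemma nspace_fun:
  assumes "nspace E"
  shows "nspace (fun_nspace E :: ('v::finite \<Rightarrow> 'a::real_vector) nspace)"
proof -
  interpret E: nspace E by fact
  show ?thesis
  proof (unfold_locales, goal_cases)
    case (4 u v)
    then show ?case
      unfolding nrm_fun_nspace sum.distrib[symmetric] by (intro sum_mono) (auto intro: E.nrm_triangle)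
  next
    case (5 u c)
    then show ?case by (simp add: nrm_fun_nspace scaleR_fun_def E.nrm_scale sum_distrib_left)
  next
    case (6 u)
    then have "nrm E (u i) = 0" for i
      by (auto simp: nrm_fun_nspace sum_nonneg_eq_0_iff E.nrm_ge_0)
    then show ?case using 6 E.nrm_eq_0 by (auto simp: fun_eq_iff)
  qed (auto simp: scaleR_fun_def)
qed

lemma (in nspace) nrm_component_le: "V \<in> carr (fun_nspace E) \<Longrightarrow> nrm E (V i) \<le> nrm (fun_nspace E) V"
  unfolding nrm_fun_nspace by (rule member_le_sum) (auto intro: nrm_ge_0)

context holder
begin

lemma bounded_linear_component: "bounded_linear_between (fun_nspace (H j)) (H j) (\<lambda>V. V i)"
  by (rule bounded_linear_betweenI[where C = 1]) (auto simp: scaleR_fun_def[of _ "_ :: _ \<Rightarrow> real \<Rightarrow> real"] intro: H.nrm_component_le)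

lemma nemytskii_simps:
  "nemytskii (Var i) V = V i"
  "nemytskii (Cst c) V = (\<lambda>t. c)"
  "nemytskii (Add a b) V = nemytskii a V + nemytskii b V"
  "nemytskii (Mul a b) V = nemytskii a V * nemytskii b V"
  "nemytskii (Pow a p) V = fpow p (nemytskii a V)"
  by (auto simp: nemytskii_def fpow_def)

lemma nemytskii_carr:
  "V \<in> carr (fun_nspace (H j)) \<Longrightarrow> ok_on e V \<Longrightarrow> nemytskii e V \<in> carr (H j)"
proof (induction e)
  case (Pow a p)
  have "0 < nemytskii a V t" for t using Pow.prems(2) by (simp add: ok_on_def nemytskii_def)
  then show ?case using Pow unfolding nemytskii_simps by (intro fpow_carr) (auto simp: ok_on_def)
qed (auto simp: nemytskii_simps ok_on_def intro: const_H mult_carr)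

lemma nemytskii_deriv_simps:
  "nemytskii_deriv (Var i) V W = W i"
  "nemytskii_deriv (Cst c) V W = 0"
  "nemytskii_deriv (Add a b) V W = nemytskii_deriv a V W + nemytskii_deriv b V W"
  "nemytskii_deriv (Mul a b) V W = nemytskii b V * nemytskii_deriv a V W + nemytskii a V * nemytskii_deriv b V W"
  "nemytskii_deriv (Pow a p) V W = (\<lambda>t. p) * fpow (p - 1) (nemytskii a V) * nemytskii_deriv a V W"
proof -
  have "(\<Sum>k\<in>UNIV. (\<lambda>t. if i = k then 1 else 0) * W k) = (\<Sum>k\<in>UNIV. if i = k then W k else 0)"
    by (intro sum.cong) (auto simp: fun_eq_iff)
  then show "nemytskii_deriv (Var i) V W = W i" by (simp add: nemytskii_deriv_def nemytskii_simps)
  show "nemytskii_deriv (Cst c) V W = 0"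
    by (auto simp: nemytskii_deriv_def nemytskii_simps fun_eq_iff sum_fun_apply)
  show "nemytskii_deriv (Add a b) V W = nemytskii_deriv a V W + nemytskii_deriv b V W"
    by (simp add: nemytskii_deriv_def nemytskii_simps distrib_right sum.distrib)
  show "nemytskii_deriv (Mul a b) V W = nemytskii b V * nemytskii_deriv a V W + nemytskii a V * nemytskii_deriv b V W"
    by (simp add: nemytskii_deriv_def nemytskii_simps distrib_right sum.distrib sum_distrib_left mult.assoc)
  show "nemytskii_deriv (Pow a p) V W = (\<lambda>t. p) * fpow (p - 1) (nemytskii a V) * nemytskii_deriv a V W"
    by (simp add: nemytskii_deriv_def nemytskii_simps sum_distrib_left mult.assoc)
qed

text \<open>Each constructor of the syntax matches a closure rule for strict derivatives: linear
  maps, constants, sums, products and composition with a power.\<close>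

lemma strict_derivative_nemytskii:
  fixes V :: "'v::finite \<Rightarrow> real \<Rightarrow> real"
  assumes V: "V \<in> carr (fun_nspace (H j))"
  shows "ok_on e V \<Longrightarrow> strict_derivative_at (fun_nspace (H j)) (H j) (nemytskii e) (nemytskii_deriv e V) V"
proof (induction e)
  case (Var i)
  show ?case
    unfolding nemytskii_simps[abs_def] nemytskii_deriv_simps[abs_def]
    by (rule strict_derivative_linear[OF nspace_fun[OF nspace_H] nspace_H bounded_linear_component V])
next
  case (Cst c)
  show ?case
    unfolding nemytskii_simps[abs_def] nemytskii_deriv_simps[abs_def]
    by (rule strict_derivative_const[OF nspace_fun[OF nspace_H] nspace_H const_H V])
next
  case (Add a b)
  then have "ok_on a V" "ok_on b V" by (auto simp: ok_on_def)
  then show ?case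
    unfolding nemytskii_simps[abs_def] nemytskii_deriv_simps[abs_def]
    by (intro strict_derivative_add[OF nspace_fun[OF nspace_H] nspace_H] Add.IH)
next
  case (Mul a b)
  then have "ok_on a V" "ok_on b V" by (auto simp: ok_on_def)
  then show ?case
    unfolding nemytskii_simps[abs_def] nemytskii_deriv_simps[abs_def]
    by (intro strict_derivative_mult[OF nspace_fun[OF nspace_H]] Mul.IH)
next
  case (Pow a p)
  then have ok: "ok_on a V" "\<And>t. 0 < nemytskii a V t" by (auto simp: ok_on_def nemytskii_def)
  show ?case
    unfolding nemytskii_simps[abs_def] nemytskii_deriv_simps[abs_def]
    by (rule strict_derivative_compose[OF nspace_fun[OF nspace_H] nspace_H nspace_H Pow.IH[OF ok(1)], where g = "fpow p",
          OF fpow_strict_derivative[OF nemytskii_carr[OF V ok(1)] ok(2)]])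
qed

text \<open>For a power, the base at \<open>V\<close> is bounded below by periodicity, and its local
  Lipschitz dependence on the arguments keeps it above half of that bound.\<close>

lemma ok_on_open:
  fixes V :: "'v::finite \<Rightarrow> real \<Rightarrow> real"
  assumes V: "V \<in> carr (fun_nspace (H j))"
  shows "ok_on e V \<Longrightarrow> \<exists>d>0. \<forall>W\<in>carr (fun_nspace (H j)). nrm (fun_nspace (H j)) (W - V) < d \<longrightarrow> ok_on e W"
proof (induction e)
  case (Add a b)
  then have "ok_on a V" "ok_on b V" by (auto simp: ok_on_def)
  then obtain d1 d2 where d12: "d1 > 0" "\<forall>W\<in>carr (fun_nspace (H j)). nrm (fun_nspace (H j)) (W - V) < d1 \<longrightarrow> ok_on a W"
    "d2 > 0" "\<forall>W\<in>carr (fun_nspace (H j)). nrm (fun_nspace (H j)) (W - V) < d2 \<longrightarrow> ok_on b W"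
    using Add.IH by meson
  have step: "ok_on (Add a b) W" if "W \<in> carr (fun_nspace (H j))" "nrm (fun_nspace (H j)) (W - V) < min d1 d2" for W
  proof -
    have "ok_on a W" "ok_on b W" using d12 that by auto
    then show ?thesis by (simp add: ok_on_def)
  qed
  have "0 < min d1 d2" using d12(1,3) by simp
  then show ?case using step by blast
next
  case (Mul a b)
  then have "ok_on a V" "ok_on b V" by (auto simp: ok_on_def)
  then obtain d1 d2 where d12: "d1 > 0" "\<forall>W\<in>carr (fun_nspace (H j)). nrm (fun_nspace (H j)) (W - V) < d1 \<longrightarrow> ok_on a W"
    "d2 > 0" "\<forall>W\<in>carr (fun_nspace (H j)). nrm (fun_nspace (H j)) (W - V) < d2 \<longrightarrow> ok_on b W"
    using Mul.IH by meson
  have step: "ok_on (Mul a b) W" if "W \<in> carr (fun_nspace (H j))" "nrm (fun_nspace (H j)) (W - V) < min d1 d2" for W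
  proof -
    have "ok_on a W" "ok_on b W" using d12 that by auto
    then show ?thesis by (simp add: ok_on_def)
  qed
  have "0 < min d1 d2" using d12(1,3) by simp
  then show ?case using step by blast
next
  case (Pow a p)
  then have ok: "ok_on a V" "\<And>t. 0 < nemytskii a V t" by (auto simp: ok_on_def nemytskii_def)
  obtain d1 where d1: "d1 > 0" "\<forall>W\<in>carr (fun_nspace (H j)). nrm (fun_nspace (H j)) (W - V) < d1 \<longrightarrow> ok_on a W"
    using Pow.IH[OF ok(1)] by blast
  obtain m where m: "0 < m" "\<And>f t. f \<in> carr (H j) \<Longrightarrow> nrm (H j) (f - nemytskii a V) < m \<Longrightarrow> m < f t"
    using positive_neighbourhood[OF nemytskii_carr[OF V ok(1)] ok(2)] by blast
  obtain d2 C where d2: "0 < d2" "0 < C"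
    "\<And>u1. u1 \<in> carr (fun_nspace (H j)) \<Longrightarrow> nrm (fun_nspace (H j)) (u1 - V) < d2 \<Longrightarrow> nemytskii a u1 \<in> carr (H j)"
    "\<And>u1 u2. u1 \<in> carr (fun_nspace (H j)) \<Longrightarrow> u2 \<in> carr (fun_nspace (H j)) \<Longrightarrow> nrm (fun_nspace (H j)) (u1 - V) < d2 \<Longrightarrow>
      nrm (fun_nspace (H j)) (u2 - V) < d2 \<Longrightarrow> nrm (H j) (nemytskii a u1 - nemytskii a u2) \<le> C * nrm (fun_nspace (H j)) (u1 - u2)"
    using strict_derivative_lipschitz[OF strict_derivative_nemytskii[OF V ok(1)] nspace_fun[OF nspace_H] nspace_H] by blast
  interpret N: nspace "fun_nspace (H j) :: ('v \<Rightarrow> _) nspace" by (rule nspace_fun[OF nspace_H])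
  have step: "ok_on (Pow a p) W" if W: "W \<in> carr (fun_nspace (H j))" "nrm (fun_nspace (H j)) (W - V) < Min {d1, d2, m / C}" for W
  proof -
    have "nrm (H j) (nemytskii a W - nemytskii a V) \<le> C * nrm (fun_nspace (H j)) (W - V)"
      using d2(4)[OF W(1) V] W(2) d2(1) by simp
    also have "\<dots> < C * (m / C)" using W(2) d2(2) by (intro mult_strict_left_mono) auto
    finally have "nrm (H j) (nemytskii a W - nemytskii a V) < m" using d2(2) by simp
    then have "m < nemytskii a W t" for t using m(2) d2(3)[OF W(1)] W(2) by simp
    then have "0 < nemytskii a W t" for t using m(1) less_trans by blast
    moreover have "ok_on a W" using d1 W by auto
    ultimately show ?thesis by (simp add: ok_on_def nemytskii_def)
  qed
  have "0 < Min {d1, d2, m / C}" using d1(1) d2(1,2) m(1) by simp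
  then show ?case using step by blast
qed (auto simp: ok_on_def intro: exI[of _ 1])

end

section \<open>Multilinear families closed under differentiation\<close>

text \<open>From here on functions are elements of an algebra: identities between them are
  simplified with ring laws, and evaluation at a point is requested explicitly where it is
  wanted.\<close>

declare plus_fun_apply [simp del] times_fun_apply [simp del] minus_apply [simp del] uminus_apply [simp del]

lemma scaleR_fun_mult_left: "(c *\<^sub>R f) * g = c *\<^sub>R (f * g)" for f g :: "'a \<Rightarrow> real"
  by (simp add: scaleR_fun_def times_fun_def mult.left_commute mult.assoc)

lemma scaleR_fun_mult_right: "f * (c *\<^sub>R g) = c *\<^sub>R (f * g)" for f g :: "'a \<Rightarrow> real"
  by (simp add: scaleR_fun_def times_fun_def mult.left_commute mult.assoc)

text \<open>\<open>G\<close> holds the coefficient functions and \<open>op\<close> the components of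
  a solution operator, linear in its three arguments jointly, not in each separately; the three
  arguments must therefore carry the same slots. The parameters come without axioms because the
  axioms of the calculus below refer to the class \<open>tame\<close>.\<close>

locale tame_base = holder +
  fixes r :: nat and U :: "rfun set" and G :: "(rfun \<Rightarrow> real \<Rightarrow> real) set"
    and op :: "'i \<Rightarrow> rfun \<Rightarrow> rfun \<Rightarrow> rfun \<Rightarrow> rfun \<Rightarrow> real \<Rightarrow> real"
begin

text \<open>
  Multilinear families \<open>u \<mapsto> f u vs\<close>, where \<open>S\<close> is the set of slots of the directions \<open>vs\<close>.  The class
  is closed under differentiation in \<open>u\<close>, the new direction being put into a fresh slot.
\<close>

inductive tame :: "nat set \<Rightarrow> (rfun \<Rightarrow> (nat \<Rightarrow> real \<Rightarrow> real) \<Rightarrow> real \<Rightarrow> real) \<Rightarrow> bool" where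
  tame_gen: "g \<in> G \<Longrightarrow> tame {} (\<lambda>u vs. g u)"
| tame_dir: "tame {n} (\<lambda>u vs. vs n)"
| tame_add: "tame S f \<Longrightarrow> tame S g \<Longrightarrow> tame S (\<lambda>u vs. f u vs + g u vs)"
| tame_mult: "tame S f \<Longrightarrow> tame T g \<Longrightarrow> S \<inter> T = {} \<Longrightarrow> tame (S \<union> T) (\<lambda>u vs. f u vs * g u vs)"
| tame_op: "tame S f \<Longrightarrow> tame S g \<Longrightarrow> tame S h \<Longrightarrow> tame S (\<lambda>u vs. op i u (f u vs) (g u vs) (h u vs))"

lemma tame_sum:
  "finite I \<Longrightarrow> I \<noteq> {} \<Longrightarrow> (\<And>i. i \<in> I \<Longrightarrow> tame S (f i)) \<Longrightarrow> tame S (\<lambda>u vs. \<Sum>i\<in>I. f i u vs)"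
proof (induction I rule: finite_ne_induct)
  case (insert i I)
  then show ?case using tame_add[of S "f i" "\<lambda>u vs. \<Sum>i\<in>I. f i u vs"] by simp
qed simp

abbreviation dirs :: "nat set \<Rightarrow> (nat \<Rightarrow> real \<Rightarrow> real) \<Rightarrow> bool" where
  "dirs S vs \<equiv> \<forall>i\<in>S. vs i \<in> carr (H r)"

abbreviation pr :: "nat set \<Rightarrow> (nat \<Rightarrow> real \<Rightarrow> real) \<Rightarrow> real" where
  "pr S vs \<equiv> \<Prod>i\<in>S. nrm (H r) (vs i)"

text \<open>The estimate is uniform over all directions, relative to the product of their norms;
  this is differentiability in the operator norm of multilinear maps. The increment
  \<open>u' - u\<close> occupies slot \<open>n\<close>.\<close>

definition tame_derivative where
  "tame_derivative S n f f' \<longleftrightarrow> (\<forall>u\<in>U. \<forall>e>0. \<exists>d>0. \<forall>u'\<in>U. nrm (H r) (u' - u) < d \<longrightarrow> (\<forall>vs. dirs S vs \<longrightarrow>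
     nrm (H r) (f u' vs - f u vs - f' u (vs(n := u' - u))) \<le> e * nrm (H r) (u' - u) * pr S vs))"

end

text \<open>The axioms state what differentiation of a tame family uses: generators and the
  operators \<open>op\<close> have derivatives inside the class, and \<open>op\<close> is bounded
  uniformly and Lipschitz locally. \<open>G_zero\<close> provides a zero of any prescribed slot set,
  as a product with the zero function.\<close>

locale tame_calculus = tame_base +
  assumes U: "U \<subseteq> carr (H r)"
    and G_zero: "(\<lambda>u. 0) \<in> G"
    and G_carr: "g \<in> G \<Longrightarrow> u \<in> U \<Longrightarrow> g u \<in> carr (H r)"
    and op_carr: "u \<in> U \<Longrightarrow> a \<in> carr (H r) \<Longrightarrow> b \<in> carr (H r) \<Longrightarrow> c \<in> carr (H r) \<Longrightarrow> op i u a b c \<in> carr (H r)"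
    and op_add: "u \<in> U \<Longrightarrow> a \<in> carr (H r) \<Longrightarrow> b \<in> carr (H r) \<Longrightarrow> c \<in> carr (H r) \<Longrightarrow>
        a' \<in> carr (H r) \<Longrightarrow> b' \<in> carr (H r) \<Longrightarrow> c' \<in> carr (H r) \<Longrightarrow>
        op i u (a + a') (b + b') (c + c') = op i u a b c + op i u a' b' c'"
    and op_scale: "u \<in> U \<Longrightarrow> a \<in> carr (H r) \<Longrightarrow> b \<in> carr (H r) \<Longrightarrow> c \<in> carr (H r) \<Longrightarrow>
        op i u (k *\<^sub>R a) (k *\<^sub>R b) (k *\<^sub>R c) = k *\<^sub>R op i u a b c"
    and op_bound: "\<exists>K. \<forall>u\<in>U. \<forall>a\<in>carr (H r). \<forall>b\<in>carr (H r). \<forall>c\<in>carr (H r).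
        nrm (H r) (op i u a b c) \<le> K * (nrm (H r) a + nrm (H r) b + nrm (H r) c)"
    and op_lipschitz: "u \<in> U \<Longrightarrow> \<exists>K d. 0 < d \<and> (\<forall>u'\<in>U. nrm (H r) (u' - u) < d \<longrightarrow> (\<forall>a\<in>carr (H r). \<forall>b\<in>carr (H r). \<forall>c\<in>carr (H r).
        nrm (H r) (op i u' a b c - op i u a b c) \<le> K * nrm (H r) (u' - u) * (nrm (H r) a + nrm (H r) b + nrm (H r) c)))"
    and G_deriv: "g \<in> G \<Longrightarrow> \<exists>g'. tame {n} g' \<and> tame_derivative {} n (\<lambda>u vs. g u) g'"
    and op_deriv: "\<exists>op'. (\<forall>S n f g h. n \<notin> S \<longrightarrow> tame S f \<longrightarrow> tame S g \<longrightarrow> tame S h \<longrightarrow>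
          tame (insert n S) (\<lambda>u vs. op' u (vs n) (f u vs) (g u vs) (h u vs))) \<and>
        (\<forall>u\<in>U. \<forall>e>0. \<exists>d>0. \<forall>u'\<in>U. nrm (H r) (u' - u) < d \<longrightarrow> (\<forall>a\<in>carr (H r). \<forall>b\<in>carr (H r). \<forall>c\<in>carr (H r).
          nrm (H r) (op i u' a b c - op i u a b c - op' u (u' - u) a b c) \<le>
            e * nrm (H r) (u' - u) * (nrm (H r) a + nrm (H r) b + nrm (H r) c)))"
begin

lemma UD: "u \<in> U \<Longrightarrow> u \<in> carr (H r)" using U by blast

lemma op_diff:
  assumes "u \<in> U" "a \<in> carr (H r)" "b \<in> carr (H r)" "c \<in> carr (H r)" "a' \<in> carr (H r)" "b' \<in> carr (H r)" "c' \<in> carr (H r)"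
  shows "op i u (a - a') (b - b') (c - c') = op i u a b c - op i u a' b' c'"
proof -
  have "op i u (a + (-1) *\<^sub>R a') (b + (-1) *\<^sub>R b') (c + (-1) *\<^sub>R c') = op i u a b c + (-1) *\<^sub>R op i u a' b' c'"
    unfolding op_scale[OF assms(1,5-7), symmetric] by (rule op_add) (use assms in auto)
  then show ?thesis by (simp only: scaleR_minus1_left diff_conv_add_uminus)
qed

lemma tame_finite: "tame S f \<Longrightarrow> finite S"
  by (induction rule: tame.induct) auto

lemma tame_carr: "tame S f \<Longrightarrow> u \<in> U \<Longrightarrow> dirs S vs \<Longrightarrow> f u vs \<in> carr (H r)"
proof (induction rule: tame.induct)
  case (tame_gen g)
  then show ?case using G_carr[of g u] by blast
next
  case (tame_mult S f T g)
  then show ?case by (intro mult_carr) simp_all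
next
  case (tame_op S f g h i)
  then show ?case by (intro op_carr) simp_all
qed simp_all

lemma tame_cong: "tame S f \<Longrightarrow> (\<And>i. i \<in> S \<Longrightarrow> vs i = ws i) \<Longrightarrow> f u vs = f u ws"
  by (induction rule: tame.induct) auto

lemma tame_fresh:
  assumes "tame S f" "n \<notin> S"
  shows "f u (vs(n := v)) = f u vs"
  using tame_cong[OF assms(1), of "vs(n := v)" vs u] assms(2) by fastforce

lemma pr_ge_0: "dirs S vs \<Longrightarrow> 0 \<le> pr S vs"
  by (rule prod_nonneg) (auto intro: H.nrm_ge_0)

text \<open>The factors of a product have disjoint slot sets, so a given direction enters exactly
  one of them, while sums and operators pass it to all their arguments at once.\<close>

lemma tame_linear:
  "tame S f \<Longrightarrow> u \<in> U \<Longrightarrow> dirs (S - {i}) vs \<Longrightarrow> i \<in> S \<Longrightarrow> linear_between (H r) (H r) (\<lambda>v. f u (vs(i := v)))"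
proof (induction arbitrary: i rule: tame.induct)
  case (tame_dir n)
  then show ?case by (auto simp: linear_between_def)
next
  case (tame_add S f g)
  then show ?case
    unfolding linear_between_def by (simp add: scaleR_add_right)
next
  case (tame_mult S f T g)
  have d: "dirs (S - {i}) vs" "dirs (T - {i}) vs" using tame_mult.prems by auto
  show ?case
  proof (cases "i \<in> S")
    case True
    then have "i \<notin> T" using tame_mult.hyps by blast
    then have g: "g u (vs(i := v)) = g u vs" for v by (rule tame_fresh[OF tame_mult.hyps(2)])
    have gc: "g u vs \<in> carr (H r)"
      by (rule tame_carr[OF tame_mult.hyps(2)]) (use tame_mult.prems d \<open>i \<notin> T\<close> in auto)
    show ?thesis
      using tame_mult.IH(1)[OF tame_mult.prems(1) d(1) True] gc
      unfolding linear_between_def g by (auto simp: mult_carr distrib_right scaleR_fun_mult_left)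
  next
    case False
    then have "i \<in> T" using tame_mult.prems by blast
    have f: "f u (vs(i := v)) = f u vs" for v by (rule tame_fresh[OF tame_mult.hyps(1) False])
    have fc: "f u vs \<in> carr (H r)"
      by (rule tame_carr[OF tame_mult.hyps(1)]) (use tame_mult.prems d False in auto)
    show ?thesis
      using tame_mult.IH(2)[OF tame_mult.prems(1) d(2) \<open>i \<in> T\<close>] fc
      unfolding linear_between_def f by (auto simp: mult_carr distrib_left scaleR_fun_mult_right)
  qed
next
  case (tame_op S f g h k)
  then show ?case
    unfolding linear_between_def by (simp add: op_carr op_add op_scale)
qed simp

lemma tame_bound:
  "tame S f \<Longrightarrow> u \<in> U \<Longrightarrow> \<exists>C\<ge>0. \<forall>vs. dirs S vs \<longrightarrow> nrm (H r) (f u vs) \<le> C * pr S vs"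
proof (induction rule: tame.induct)
  case (tame_gen g)
  then show ?case using H.nrm_ge_0[OF G_carr] by (intro exI[of _ "nrm (H r) (g u)"]) auto
next
  case (tame_dir n)
  then show ?case by (intro exI[of _ 1]) auto
next
  case (tame_add S f g)
  then obtain C D where C: "0 \<le> C" "\<And>vs. dirs S vs \<Longrightarrow> nrm (H r) (f u vs) \<le> C * pr S vs"
    "0 \<le> D" "\<And>vs. dirs S vs \<Longrightarrow> nrm (H r) (g u vs) \<le> D * pr S vs" by metis
  have "nrm (H r) (f u vs + g u vs) \<le> (C + D) * pr S vs" if "dirs S vs" for vs
    using H.nrm_triangle[OF tame_carr[OF tame_add.hyps(1) _ that] tame_carr[OF tame_add.hyps(2) _ that]] C(2,4)[OF that] tame_add.prems
    unfolding distrib_right by (meson add_mono order_trans)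
  then show ?case using C by (intro exI[of _ "C + D"]) auto
next
  case (tame_mult S f T g)
  then obtain C D where C: "0 \<le> C" "\<And>vs. dirs S vs \<Longrightarrow> nrm (H r) (f u vs) \<le> C * pr S vs"
    "0 \<le> D" "\<And>vs. dirs T vs \<Longrightarrow> nrm (H r) (g u vs) \<le> D * pr T vs" by metis
  have "nrm (H r) (f u vs * g u vs) \<le> (HK r * C * D) * pr (S \<union> T) vs" if "dirs (S \<union> T) vs" for vs
  proof -
    have d: "dirs S vs" "dirs T vs" using that by auto
    have "nrm (H r) (f u vs * g u vs) \<le> HK r * (C * pr S vs) * (D * pr T vs)"
      by (rule nrm_mult_le[OF tame_carr[OF tame_mult.hyps(1) _ d(1)] tame_carr[OF tame_mult.hyps(2) _ d(2)] C(2)[OF d(1)] C(4)[OF d(2)]])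
        (use tame_mult.prems in auto)
    also have "\<dots> = (HK r * C * D) * pr (S \<union> T) vs"
      unfolding prod.union_disjoint[OF tame_finite[OF tame_mult.hyps(1)] tame_finite[OF tame_mult.hyps(2)] tame_mult.hyps(3)]
      by (simp add: algebra_simps)
    finally show ?thesis .
  qed
  then show ?case using C HK_pos[of r] by (intro exI[of _ "HK r * C * D"]) auto
next
  case (tame_op S f g h i)
  then obtain C D F where C: "0 \<le> C" "\<And>vs. dirs S vs \<Longrightarrow> nrm (H r) (f u vs) \<le> C * pr S vs"
    "0 \<le> D" "\<And>vs. dirs S vs \<Longrightarrow> nrm (H r) (g u vs) \<le> D * pr S vs"
    "0 \<le> F" "\<And>vs. dirs S vs \<Longrightarrow> nrm (H r) (h u vs) \<le> F * pr S vs" by metis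
  obtain K where K: "\<And>a b c. a \<in> carr (H r) \<Longrightarrow> b \<in> carr (H r) \<Longrightarrow> c \<in> carr (H r) \<Longrightarrow>
        nrm (H r) (op i u a b c) \<le> K * (nrm (H r) a + nrm (H r) b + nrm (H r) c)"
    using op_bound[of i] tame_op.prems by blast
  have "nrm (H r) (op i u (f u vs) (g u vs) (h u vs)) \<le> (\<bar>K\<bar> * (C + D + F)) * pr S vs" if vs: "dirs S vs" for vs
  proof -
    have m: "f u vs \<in> carr (H r)" "g u vs \<in> carr (H r)" "h u vs \<in> carr (H r)"
      using tame_op tame_carr vs by blast+
    have "nrm (H r) (op i u (f u vs) (g u vs) (h u vs)) \<le> K * (nrm (H r) (f u vs) + nrm (H r) (g u vs) + nrm (H r) (h u vs))"
      by (rule K[OF m])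
    also have "\<dots> \<le> \<bar>K\<bar> * (nrm (H r) (f u vs) + nrm (H r) (g u vs) + nrm (H r) (h u vs))"
      using H.nrm_ge_0 m by (intro mult_right_mono) auto
    also have "\<dots> \<le> \<bar>K\<bar> * (C * pr S vs + D * pr S vs + F * pr S vs)"
      using C vs by (intro mult_left_mono add_mono) auto
    finally show ?thesis by (simp add: algebra_simps)
  qed
  then show ?case using C by (intro exI[of _ "\<bar>K\<bar> * (C + D + F)"]) auto
qed

lemma tame_derivativeE:
  assumes "tame_derivative S n f f'" "u \<in> U" "0 < e"
  obtains d where "0 < d" "\<And>u' vs. u' \<in> U \<Longrightarrow> nrm (H r) (u' - u) < d \<Longrightarrow> dirs S vs \<Longrightarrow>
      nrm (H r) (f u' vs - f u vs - f' u (vs(n := u' - u))) \<le> e * nrm (H r) (u' - u) * pr S vs"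
proof -
  have "\<exists>d>0. \<forall>u'\<in>U. nrm (H r) (u' - u) < d \<longrightarrow> (\<forall>vs. dirs S vs \<longrightarrow>
     nrm (H r) (f u' vs - f u vs - f' u (vs(n := u' - u))) \<le> e * nrm (H r) (u' - u) * pr S vs)"
    using assms unfolding tame_derivative_def by blast
  then show ?thesis using that by blast
qed

text \<open>As for strict derivatives, the estimate may lose a constant that depends on
  \<open>u\<close>, and only small \<open>e\<close> have to be considered.\<close>

lemma tame_derivativeI:
  assumes "\<And>u. u \<in> U \<Longrightarrow> \<exists>C\<ge>0. \<forall>e. 0 < e \<longrightarrow> e < 1 \<longrightarrow> (\<exists>d>0. \<forall>u'\<in>U. nrm (H r) (u' - u) < d \<longrightarrow> (\<forall>vs. dirs S vs \<longrightarrow>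
     nrm (H r) (f u' vs - f u vs - f' u (vs(n := u' - u))) \<le> C * e * nrm (H r) (u' - u) * pr S vs))"
  shows "tame_derivative S n f f'"
  unfolding tame_derivative_def
proof (intro ballI allI impI)
  fix u and e :: real assume u: "u \<in> U" and e: "0 < e"
  obtain C where C: "C \<ge> 0" "\<And>e. 0 < e \<Longrightarrow> e < 1 \<Longrightarrow> (\<exists>d>0. \<forall>u'\<in>U. nrm (H r) (u' - u) < d \<longrightarrow> (\<forall>vs. dirs S vs \<longrightarrow>
     nrm (H r) (f u' vs - f u vs - f' u (vs(n := u' - u))) \<le> C * e * nrm (H r) (u' - u) * pr S vs))"
    using assms[OF u] by blast
  define e' where "e' = min (1 / 2) (e / (C + 1))"
  have e': "0 < e'" "e' < 1" using e C by (auto simp: e'_def)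
  have "C * e' \<le> C * (e / (C + 1))" using C by (intro mult_left_mono) (auto simp: e'_def)
  also have "\<dots> \<le> e" using C e by (simp add: field_simps)
  finally have le: "C * e' * (nrm (H r) (u' - u) * pr S vs) \<le> e * (nrm (H r) (u' - u) * pr S vs)" if "u' \<in> U" "dirs S vs" for u' vs
    using that u UD H.nrm_ge_0[of "u' - u" r] pr_ge_0[of S vs] by (intro mult_right_mono mult_nonneg_nonneg) auto
  obtain d where d: "d > 0" "\<forall>u'\<in>U. nrm (H r) (u' - u) < d \<longrightarrow> (\<forall>vs. dirs S vs \<longrightarrow>
     nrm (H r) (f u' vs - f u vs - f' u (vs(n := u' - u))) \<le> C * e' * nrm (H r) (u' - u) * pr S vs)"
    using C(2)[OF e'] by blast
  show "\<exists>d>0. \<forall>u'\<in>U. nrm (H r) (u' - u) < d \<longrightarrow> (\<forall>vs. dirs S vs \<longrightarrow>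
     nrm (H r) (f u' vs - f u vs - f' u (vs(n := u' - u))) \<le> e * nrm (H r) (u' - u) * pr S vs)"
  proof (intro exI[of _ d] conjI ballI allI impI d(1))
    fix u' vs assume *: "u' \<in> U" "nrm (H r) (u' - u) < d" "dirs S vs"
    then have "nrm (H r) (f u' vs - f u vs - f' u (vs(n := u' - u))) \<le> C * e' * nrm (H r) (u' - u) * pr S vs"
      using d(2) by blast
    then show "nrm (H r) (f u' vs - f u vs - f' u (vs(n := u' - u))) \<le> e * nrm (H r) (u' - u) * pr S vs"
      using le[OF *(1,3)] by (simp add: mult.assoc)
  qed
qed

text \<open>One constant bounds the family at \<open>u\<close>, its derivative, and its increments
  near \<open>u\<close>; these three bounds are what the product rule and the rule for operators
  consume.\<close>

lemma tame_derivative_control: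
  assumes f: "tame S f" and f': "tame (insert n S) f'" and D: "tame_derivative S n f f'" and n: "n \<notin> S" and u: "u \<in> U"
  obtains C where "0 \<le> C"
    "\<And>vs. dirs S vs \<Longrightarrow> nrm (H r) (f u vs) \<le> C * pr S vs"
    "\<And>vs u'. u' \<in> U \<Longrightarrow> dirs S vs \<Longrightarrow> nrm (H r) (f' u (vs(n := u' - u))) \<le> C * nrm (H r) (u' - u) * pr S vs"
    "\<And>e. 0 < e \<Longrightarrow> e < 1 \<Longrightarrow> \<exists>d>0. \<forall>u'\<in>U. nrm (H r) (u' - u) < d \<longrightarrow> (\<forall>vs. dirs S vs \<longrightarrow>
      nrm (H r) (f u' vs - f u vs - f' u (vs(n := u' - u))) \<le> e * nrm (H r) (u' - u) * pr S vs \<and>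
      nrm (H r) (f u' vs - f u vs) \<le> C * nrm (H r) (u' - u) * pr S vs)"
proof -
  obtain A where A: "0 \<le> A" "\<And>vs. dirs S vs \<Longrightarrow> nrm (H r) (f u vs) \<le> A * pr S vs"
    using tame_bound[OF f u] by blast
  obtain B where B: "0 \<le> B" "\<And>vs. dirs (insert n S) vs \<Longrightarrow> nrm (H r) (f' u vs) \<le> B * pr (insert n S) vs"
    using tame_bound[OF f' u] by blast
  have pr_upd: "pr (insert n S) (vs(n := v)) = nrm (H r) v * pr S vs" for vs v
  proof -
    have "pr S (vs(n := v)) = pr S vs" using n by (intro prod.cong) auto
    then show ?thesis using n tame_finite[OF f] by simp
  qed
  have B': "nrm (H r) (f' u (vs(n := u' - u))) \<le> B * nrm (H r) (u' - u) * pr S vs" if "u' \<in> U" "dirs S vs" for u' vs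
  proof -
    have "dirs (insert n S) (vs(n := u' - u))" using that u UD n by auto
    from B(2)[OF this] show ?thesis unfolding pr_upd by (simp only: mult.assoc)
  qed
  define C where "C = A + B + 1"
  have AC: "A \<le> C" "B \<le> C" "B + 1 \<le> C" "0 \<le> C" using A B by (auto simp: C_def)
  show ?thesis
  proof (rule that[of C])
    show "0 \<le> C" by fact
    show "nrm (H r) (f u vs) \<le> C * pr S vs" if "dirs S vs" for vs
      using A(2)[OF that] mult_right_mono[OF AC(1) pr_ge_0[OF that]] by linarith
    show "nrm (H r) (f' u (vs(n := u' - u))) \<le> C * nrm (H r) (u' - u) * pr S vs" if "u' \<in> U" "dirs S vs" for u' vs
    proof -
      have "B * (nrm (H r) (u' - u) * pr S vs) \<le> C * (nrm (H r) (u' - u) * pr S vs)"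
        using AC that u UD H.nrm_ge_0[of "u' - u" r] pr_ge_0[of S vs] by (intro mult_right_mono mult_nonneg_nonneg) auto
      then show ?thesis using B'[OF that] by (simp add: mult.assoc)
    qed
    fix e :: real assume e: "0 < e" "e < 1"
    obtain d where d: "d > 0" "\<And>u' vs. u' \<in> U \<Longrightarrow> nrm (H r) (u' - u) < d \<Longrightarrow> dirs S vs \<Longrightarrow>
      nrm (H r) (f u' vs - f u vs - f' u (vs(n := u' - u))) \<le> e * nrm (H r) (u' - u) * pr S vs"
      by (rule tame_derivativeE[OF D u e(1)]) (rule that)
    show "\<exists>d>0. \<forall>u'\<in>U. nrm (H r) (u' - u) < d \<longrightarrow> (\<forall>vs. dirs S vs \<longrightarrow>
      nrm (H r) (f u' vs - f u vs - f' u (vs(n := u' - u))) \<le> e * nrm (H r) (u' - u) * pr S vs \<and>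
      nrm (H r) (f u' vs - f u vs) \<le> C * nrm (H r) (u' - u) * pr S vs)"
    proof (intro exI[of _ d] conjI ballI allI impI d(1))
      fix u' vs assume *: "u' \<in> U" "nrm (H r) (u' - u) < d" "dirs S vs"
      show 1: "nrm (H r) (f u' vs - f u vs - f' u (vs(n := u' - u))) \<le> e * nrm (H r) (u' - u) * pr S vs"
        by (rule d(2)[OF *])
      have m: "f u' vs \<in> carr (H r)" "f u vs \<in> carr (H r)" "f' u (vs(n := u' - u)) \<in> carr (H r)"
        using tame_carr[OF f] tame_carr[OF f', of u "vs(n := u' - u)"] * u UD n by auto
      have "nrm (H r) (f u' vs - f u vs) \<le> nrm (H r) (f u' vs - f u vs - f' u (vs(n := u' - u))) + nrm (H r) (f' u (vs(n := u' - u)))"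
        using H.nrm_triangle[of "f u' vs - f u vs - f' u (vs(n := u' - u))" r "f' u (vs(n := u' - u))"] m by simp
      also have "\<dots> \<le> e * nrm (H r) (u' - u) * pr S vs + B * nrm (H r) (u' - u) * pr S vs"
        using 1 B'[OF *(1,3)] by linarith
      also have "\<dots> = (e + B) * (nrm (H r) (u' - u) * pr S vs)" by (simp add: algebra_simps)
      also have "\<dots> \<le> C * (nrm (H r) (u' - u) * pr S vs)"
        using AC e * u UD H.nrm_ge_0[of "u' - u" r] pr_ge_0[of S vs] by (intro mult_right_mono mult_nonneg_nonneg) auto
      finally show "nrm (H r) (f u' vs - f u vs) \<le> C * nrm (H r) (u' - u) * pr S vs" by (simp add: mult.assoc)
    qed
  qed
qed

text \<open>Induction on the construction of the family. Sums and products obey the usual rules. An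
  operator contributes two terms, one from its arguments and one from the dependence of the operator
  itself on \<open>u\<close>.\<close>

lemma tame_derivative_exists:
  "tame S f \<Longrightarrow> n \<notin> S \<Longrightarrow> \<exists>f'. tame (insert n S) f' \<and> tame_derivative S n f f'"
proof (induction rule: tame.induct)
  case (tame_gen g)
  then show ?case using G_deriv[of g n] by simp
next
  case (tame_dir k)
  \<comment> \<open>A direction is independent of \<open>u\<close>, so its derivative vanishes; the
    zero is written as a product because it must carry both slots \<open>k\<close> and
    \<open>n\<close>.\<close>
  have "tame ({k} \<union> ({} \<union> {n})) (\<lambda>u vs. vs k * (0 * vs n))"
    by (intro tame.tame_mult tame.tame_gen[OF G_zero] tame.tame_dir) (use tame_dir in auto)
  then have "tame (insert n {k}) (\<lambda>u vs. vs k * (0 * vs n))" by (simp add: insert_commute)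
  moreover have "tame_derivative {k} n (\<lambda>u vs. vs k) (\<lambda>u vs. vs k * (0 * vs n))"
    unfolding tame_derivative_def
    using tame_dir UD by (auto intro!: exI[of _ 1] mult_nonneg_nonneg H.nrm_ge_0)
  ultimately show ?case by blast
next
  case (tame_add S f g)
  then obtain f' g' where D: "tame (insert n S) f'" "tame_derivative S n f f'" "tame (insert n S) g'" "tame_derivative S n g g'"
    by blast
  have "tame_derivative S n (\<lambda>u vs. f u vs + g u vs) (\<lambda>u vs. f' u vs + g' u vs)"
  proof (rule tame_derivativeI)
    fix u assume u: "u \<in> U"
    obtain Cf where Cf: "\<And>e. 0 < e \<Longrightarrow> e < 1 \<Longrightarrow> \<exists>d>0. \<forall>u'\<in>U. nrm (H r) (u' - u) < d \<longrightarrow> (\<forall>vs. dirs S vs \<longrightarrow>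
      nrm (H r) (f u' vs - f u vs - f' u (vs(n := u' - u))) \<le> e * nrm (H r) (u' - u) * pr S vs \<and>
      nrm (H r) (f u' vs - f u vs) \<le> Cf * nrm (H r) (u' - u) * pr S vs)"
      by (rule tame_derivative_control[OF tame_add.hyps(1) D(1,2) tame_add.prems u]) (rule that)
    obtain Cg where Cg: "\<And>e. 0 < e \<Longrightarrow> e < 1 \<Longrightarrow> \<exists>d>0. \<forall>u'\<in>U. nrm (H r) (u' - u) < d \<longrightarrow> (\<forall>vs. dirs S vs \<longrightarrow>
      nrm (H r) (g u' vs - g u vs - g' u (vs(n := u' - u))) \<le> e * nrm (H r) (u' - u) * pr S vs \<and>
      nrm (H r) (g u' vs - g u vs) \<le> Cg * nrm (H r) (u' - u) * pr S vs)"
      by (rule tame_derivative_control[OF tame_add.hyps(2) D(3,4) tame_add.prems u]) (rule that)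
    show "\<exists>C\<ge>0. \<forall>e. 0 < e \<longrightarrow> e < 1 \<longrightarrow> (\<exists>d>0. \<forall>u'\<in>U. nrm (H r) (u' - u) < d \<longrightarrow> (\<forall>vs. dirs S vs \<longrightarrow>
       nrm (H r) (f u' vs + g u' vs - (f u vs + g u vs) - (f' u (vs(n := u' - u)) + g' u (vs(n := u' - u))))
         \<le> C * e * nrm (H r) (u' - u) * pr S vs))"
    proof (rule exI[of _ 2], intro conjI allI impI)
      fix e :: real assume e: "0 < e" "e < 1"
      obtain d1 where d1: "d1 > 0" "\<And>u' vs. u' \<in> U \<Longrightarrow> nrm (H r) (u' - u) < d1 \<Longrightarrow> dirs S vs \<Longrightarrow>
        nrm (H r) (f u' vs - f u vs - f' u (vs(n := u' - u))) \<le> e * nrm (H r) (u' - u) * pr S vs" using Cf[OF e] by blast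
      obtain d2 where d2: "d2 > 0" "\<And>u' vs. u' \<in> U \<Longrightarrow> nrm (H r) (u' - u) < d2 \<Longrightarrow> dirs S vs \<Longrightarrow>
        nrm (H r) (g u' vs - g u vs - g' u (vs(n := u' - u))) \<le> e * nrm (H r) (u' - u) * pr S vs" using Cg[OF e] by blast
      have "nrm (H r) (f u' vs + g u' vs - (f u vs + g u vs) - (f' u (vs(n := u' - u)) + g' u (vs(n := u' - u))))
         \<le> 2 * e * nrm (H r) (u' - u) * pr S vs"
        if *: "u' \<in> U" "nrm (H r) (u' - u) < min d1 d2" "dirs S vs" for u' vs
      proof -
        have dn: "dirs (insert n S) (vs(n := u' - u))" using * u UD tame_add.prems by auto
        have m: "f u' vs \<in> carr (H r)" "f u vs \<in> carr (H r)" "f' u (vs(n := u' - u)) \<in> carr (H r)"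
          "g u' vs \<in> carr (H r)" "g u vs \<in> carr (H r)" "g' u (vs(n := u' - u)) \<in> carr (H r)"
          using tame_carr[OF tame_add.hyps(1) _ *(3)] tame_carr[OF tame_add.hyps(2) _ *(3)] tame_carr[OF D(1) u dn] tame_carr[OF D(3) u dn] *(1) u
          by blast+
        have eq: "f u' vs + g u' vs - (f u vs + g u vs) - (f' u (vs(n := u' - u)) + g' u (vs(n := u' - u))) =
          (f u' vs - f u vs - f' u (vs(n := u' - u))) + (g u' vs - g u vs - g' u (vs(n := u' - u)))" by (simp add: algebra_simps)
        have "nrm (H r) (f u' vs + g u' vs - (f u vs + g u vs) - (f' u (vs(n := u' - u)) + g' u (vs(n := u' - u)))) \<le>
          nrm (H r) (f u' vs - f u vs - f' u (vs(n := u' - u))) + nrm (H r) (g u' vs - g u vs - g' u (vs(n := u' - u)))"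
          unfolding eq by (rule H.nrm_triangle) (use m in auto)
        then show ?thesis using d1(2)[OF *(1) _ *(3)] d2(2)[OF *(1) _ *(3)] *(2) by simp
      qed
      then show "\<exists>d>0. \<forall>u'\<in>U. nrm (H r) (u' - u) < d \<longrightarrow> (\<forall>vs. dirs S vs \<longrightarrow>
       nrm (H r) (f u' vs + g u' vs - (f u vs + g u vs) - (f' u (vs(n := u' - u)) + g' u (vs(n := u' - u))))
         \<le> 2 * e * nrm (H r) (u' - u) * pr S vs)"
        using d1(1) d2(1) by (intro exI[of _ "min d1 d2"]) simp
    qed simp
  qed
  then show ?case using tame.tame_add[OF D(1,3)] by blast
next
  case (tame_mult S f T g)
  have nST: "n \<notin> S" "n \<notin> T" using tame_mult.prems by auto
  obtain f' g' where D: "tame (insert n S) f'" "tame_derivative S n f f'" "tame (insert n T) g'" "tame_derivative T n g g'"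
    using tame_mult.IH nST by blast
  have "insert n S \<union> T = insert n (S \<union> T)" "S \<union> insert n T = insert n (S \<union> T)" by auto
  then have t: "tame (insert n (S \<union> T)) (\<lambda>u vs. f' u vs * g u vs + f u vs * g' u vs)"
    using tame.tame_add[OF tame.tame_mult[OF D(1) tame_mult.hyps(2)], of "\<lambda>u vs. f u vs * g' u vs"]
      tame.tame_mult[OF tame_mult.hyps(1) D(3)] nST tame_mult.hyps(3) by simp
  have "tame_derivative (S \<union> T) n (\<lambda>u vs. f u vs * g u vs) (\<lambda>u vs. f' u vs * g u vs + f u vs * g' u vs)"
  proof (rule tame_derivativeI)
    fix u assume u: "u \<in> U"
    obtain Cf where Cf: "0 \<le> Cf" "\<And>vs. dirs S vs \<Longrightarrow> nrm (H r) (f u vs) \<le> Cf * pr S vs"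
      "\<And>vs u'. u' \<in> U \<Longrightarrow> dirs S vs \<Longrightarrow> nrm (H r) (f' u (vs(n := u' - u))) \<le> Cf * nrm (H r) (u' - u) * pr S vs"
      "\<And>e. 0 < e \<Longrightarrow> e < 1 \<Longrightarrow> \<exists>d>0. \<forall>u'\<in>U. nrm (H r) (u' - u) < d \<longrightarrow> (\<forall>vs. dirs S vs \<longrightarrow>
      nrm (H r) (f u' vs - f u vs - f' u (vs(n := u' - u))) \<le> e * nrm (H r) (u' - u) * pr S vs \<and>
      nrm (H r) (f u' vs - f u vs) \<le> Cf * nrm (H r) (u' - u) * pr S vs)"
      by (rule tame_derivative_control[OF tame_mult.hyps(1) D(1,2) nST(1) u]) (rule that)
    obtain Cg where Cg: "0 \<le> Cg" "\<And>vs. dirs T vs \<Longrightarrow> nrm (H r) (g u vs) \<le> Cg * pr T vs"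
      "\<And>vs u'. u' \<in> U \<Longrightarrow> dirs T vs \<Longrightarrow> nrm (H r) (g' u (vs(n := u' - u))) \<le> Cg * nrm (H r) (u' - u) * pr T vs"
      "\<And>e. 0 < e \<Longrightarrow> e < 1 \<Longrightarrow> \<exists>d>0. \<forall>u'\<in>U. nrm (H r) (u' - u) < d \<longrightarrow> (\<forall>vs. dirs T vs \<longrightarrow>
      nrm (H r) (g u' vs - g u vs - g' u (vs(n := u' - u))) \<le> e * nrm (H r) (u' - u) * pr T vs \<and>
      nrm (H r) (g u' vs - g u vs) \<le> Cg * nrm (H r) (u' - u) * pr T vs)"
      by (rule tame_derivative_control[OF tame_mult.hyps(2) D(3,4) nST(2) u]) (rule that)
    define C where "C = HK r * (2 * Cg + Cf * Cg + Cf)"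
    have C0: "0 \<le> C" using Cf(1) Cg(1) HK_pos[of r] by (simp add: C_def)
    show "\<exists>C\<ge>0. \<forall>e. 0 < e \<longrightarrow> e < 1 \<longrightarrow> (\<exists>d>0. \<forall>u'\<in>U. nrm (H r) (u' - u) < d \<longrightarrow> (\<forall>vs. dirs (S \<union> T) vs \<longrightarrow>
       nrm (H r) (f u' vs * g u' vs - f u vs * g u vs -
         (f' u (vs(n := u' - u)) * g u (vs(n := u' - u)) + f u (vs(n := u' - u)) * g' u (vs(n := u' - u))))
         \<le> C * e * nrm (H r) (u' - u) * pr (S \<union> T) vs))"
    proof (rule exI[of _ C], intro conjI allI impI C0)
      fix e :: real assume e: "0 < e" "e < 1"
      obtain d1 where d1: "d1 > 0" "\<And>u' vs. u' \<in> U \<Longrightarrow> nrm (H r) (u' - u) < d1 \<Longrightarrow> dirs S vs \<Longrightarrow>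
        nrm (H r) (f u' vs - f u vs - f' u (vs(n := u' - u))) \<le> e * nrm (H r) (u' - u) * pr S vs" using Cf(4)[OF e] by blast
      obtain d2 where d2: "d2 > 0" "\<And>u' vs. u' \<in> U \<Longrightarrow> nrm (H r) (u' - u) < d2 \<Longrightarrow> dirs T vs \<Longrightarrow>
        nrm (H r) (g u' vs - g u vs - g' u (vs(n := u' - u))) \<le> e * nrm (H r) (u' - u) * pr T vs \<and>
        nrm (H r) (g u' vs - g u vs) \<le> Cg * nrm (H r) (u' - u) * pr T vs" using Cg(4)[OF e] by blast
      define d where "d = Min {d1, d2, e}"
      have d: "0 < d" "d \<le> d1" "d \<le> d2" "d \<le> e" using d1(1) d2(1) e(1) unfolding d_def by auto
      have "nrm (H r) (f u' vs * g u' vs - f u vs * g u vs -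
         (f' u (vs(n := u' - u)) * g u (vs(n := u' - u)) + f u (vs(n := u' - u)) * g' u (vs(n := u' - u))))
         \<le> C * e * nrm (H r) (u' - u) * pr (S \<union> T) vs"
        if *: "u' \<in> U" "nrm (H r) (u' - u) < d" "dirs (S \<union> T) vs" for u' vs
      proof -
        define k where "k = nrm (H r) (u' - u)"
        have k: "0 \<le> k" "k \<le> e" using * d u UD by (auto simp: k_def intro!: H.nrm_ge_0)
        have dST: "dirs S vs" "dirs T vs" using * by auto
        have dn: "dirs (insert n S) (vs(n := u' - u))" "dirs (insert n T) (vs(n := u' - u))" using * u UD nST by auto
        define f0 f1 f2 g0 g1 g2 where [abs_def]: "f0 = f u vs" "f1 = f u' vs" "f2 = f' u (vs(n := u' - u))"
          "g0 = g u vs" "g1 = g u' vs" "g2 = g' u (vs(n := u' - u))"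
        note defs = this
        have m: "f0 \<in> carr (H r)" "f1 \<in> carr (H r)" "f2 \<in> carr (H r)" "g0 \<in> carr (H r)" "g1 \<in> carr (H r)" "g2 \<in> carr (H r)"
          unfolding defs using tame_carr[OF tame_mult.hyps(1) _ dST(1)] tame_carr[OF tame_mult.hyps(2) _ dST(2)]
            tame_carr[OF D(1) u dn(1)] tame_carr[OF D(3) u dn(2)] *(1) u by blast+
        define p q where "p = pr S vs" and "q = pr T vs"
        have pq: "0 \<le> p" "0 \<le> q" using pr_ge_0 dST by (auto simp: p_def q_def)
        have b: "nrm (H r) (f1 - f0 - f2) \<le> e * k * p" "nrm (H r) (g1 - g0 - g2) \<le> e * k * q"
          "nrm (H r) (g1 - g0) \<le> Cg * k * q" "nrm (H r) f2 \<le> Cf * k * p" "nrm (H r) f0 \<le> Cf * p" "nrm (H r) g0 \<le> Cg * q"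
          unfolding defs k_def p_def q_def
          using d1(2)[OF *(1) _ dST(1)] d2(2)[OF *(1) _ dST(2)] Cf(2)[OF dST(1)] Cg(2)[OF dST(2)] Cf(3)[OF *(1) dST(1)] *(2) d by auto
        have "Cg * k * q \<le> Cg * 1 * q" using Cg k e pq by (intro mult_right_mono mult_left_mono) auto
        then have g1: "nrm (H r) g1 \<le> 2 * Cg * q"
          using H.nrm_triangle[of "g1 - g0" r g0] m b by simp
        have fr: "f u (vs(n := u' - u)) = f0" "g u (vs(n := u' - u)) = g0"
          unfolding defs using tame_fresh[OF tame_mult.hyps(1) nST(1)] tame_fresh[OF tame_mult.hyps(2) nST(2)] by auto
        \<comment> \<open>Both remainders occur with bounded cofactors, and
          \<open>f2 * (g1 - g0)\<close> is quadratic in the increment; one of its two factors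
          \<open>k\<close> is replaced by \<open>e\<close>, using \<open>k \<le> e\<close>.\<close>
        have "f1 * g1 - f0 * g0 - (f2 * g0 + f0 * g2) = (f1 - f0 - f2) * g1 + f2 * (g1 - g0) + f0 * (g1 - g0 - g2)"
          by (simp add: algebra_simps)
        moreover have "nrm (H r) ((f1 - f0 - f2) * g1 + f2 * (g1 - g0) + f0 * (g1 - g0 - g2)) \<le>
           HK r * (e * k * p) * (2 * Cg * q) + HK r * (Cf * k * p) * (Cg * k * q) + HK r * (Cf * p) * (e * k * q)"
          by (intro order_trans[OF H.nrm_triangle] add_mono nrm_mult_le b g1) (use m in \<open>auto intro: mult_carr\<close>)
        moreover have "HK r * (Cf * k * p) * (Cg * k * q) \<le> HK r * (Cf * k * p) * (Cg * e * q)"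
          using HK_pos[of r] Cf(1) Cg(1) k pq by (intro mult_left_mono mult_right_mono) auto
        moreover have "HK r * (e * k * p) * (2 * Cg * q) + HK r * (Cf * k * p) * (Cg * e * q) + HK r * (Cf * p) * (e * k * q) = C * e * k * (p * q)"
          by (simp add: C_def algebra_simps)
        moreover have "pr (S \<union> T) vs = p * q"
          unfolding p_def q_def by (rule prod.union_disjoint[OF tame_finite[OF tame_mult.hyps(1)] tame_finite[OF tame_mult.hyps(2)] tame_mult.hyps(3)])
        ultimately have "nrm (H r) (f1 * g1 - f0 * g0 - (f2 * g0 + f0 * g2)) \<le> C * e * k * pr (S \<union> T) vs" by simp
        then show ?thesis unfolding fr unfolding defs k_def .
      qed
      then show "\<exists>d>0. \<forall>u'\<in>U. nrm (H r) (u' - u) < d \<longrightarrow> (\<forall>vs. dirs (S \<union> T) vs \<longrightarrow>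
       nrm (H r) (f u' vs * g u' vs - f u vs * g u vs -
         (f' u (vs(n := u' - u)) * g u (vs(n := u' - u)) + f u (vs(n := u' - u)) * g' u (vs(n := u' - u))))
         \<le> C * e * nrm (H r) (u' - u) * pr (S \<union> T) vs)"
        using d(1) by blast
    qed
  qed
  then show ?case using t by blast
next
  case (tame_op S f g h i)
  note n = tame_op.prems
  obtain f' g' h' where D: "tame (insert n S) f'" "tame_derivative S n f f'" "tame (insert n S) g'" "tame_derivative S n g g'"
    "tame (insert n S) h'" "tame_derivative S n h h'"
    using tame_op.IH n by blast
  from op_deriv[of i] obtain op' where op'_props: "(\<forall>S n f g h. n \<notin> S \<longrightarrow> tame S f \<longrightarrow> tame S g \<longrightarrow> tame S h \<longrightarrow>
          tame (insert n S) (\<lambda>u vs. op' u (vs n) (f u vs) (g u vs) (h u vs))) \<and>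
        (\<forall>u\<in>U. \<forall>e>0. \<exists>d>0. \<forall>u'\<in>U. nrm (H r) (u' - u) < d \<longrightarrow> (\<forall>a\<in>carr (H r). \<forall>b\<in>carr (H r). \<forall>c\<in>carr (H r).
          nrm (H r) (op i u' a b c - op i u a b c - op' u (u' - u) a b c) \<le>
            e * nrm (H r) (u' - u) * (nrm (H r) a + nrm (H r) b + nrm (H r) c)))" by (rule exE)
  note op'_tame = op'_props[THEN conjunct1, rule_format] and op' = op'_props[THEN conjunct2, rule_format]
  \<comment> \<open>The first summand differentiates the arguments, which brings slot
    \<open>n\<close> into all three of them; the second differentiates the operator and receives the
    new direction explicitly.\<close>
  have t: "tame (insert n S) (\<lambda>u vs. op i u (f' u vs) (g' u vs) (h' u vs) + op' u (vs n) (f u vs) (g u vs) (h u vs))"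
    by (rule tame.tame_add[OF tame.tame_op[OF D(1,3,5)] op'_tame[OF n tame_op.hyps]])
  have "tame_derivative S n (\<lambda>u vs. op i u (f u vs) (g u vs) (h u vs))
      (\<lambda>u vs. op i u (f' u vs) (g' u vs) (h' u vs) + op' u (vs n) (f u vs) (g u vs) (h u vs))"
  proof (rule tame_derivativeI)
    fix u assume u: "u \<in> U"
    obtain K0 where K0: "\<And>u a b c. u \<in> U \<Longrightarrow> a \<in> carr (H r) \<Longrightarrow> b \<in> carr (H r) \<Longrightarrow> c \<in> carr (H r) \<Longrightarrow>
        nrm (H r) (op i u a b c) \<le> K0 * (nrm (H r) a + nrm (H r) b + nrm (H r) c)"
      using op_bound[of i] by blast
    obtain L0 d0 where L0: "d0 > 0" "\<And>u' a b c. u' \<in> U \<Longrightarrow> nrm (H r) (u' - u) < d0 \<Longrightarrow> a \<in> carr (H r) \<Longrightarrow> b \<in> carr (H r) \<Longrightarrow> c \<in> carr (H r) \<Longrightarrow>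
        nrm (H r) (op i u' a b c - op i u a b c) \<le> L0 * nrm (H r) (u' - u) * (nrm (H r) a + nrm (H r) b + nrm (H r) c)"
      using op_lipschitz[OF u, of i] by blast
    define K L where "K = \<bar>K0\<bar>" and "L = \<bar>L0\<bar>"
    have KL0: "0 \<le> K" "0 \<le> L" by (auto simp: K_def L_def)
    have K: "nrm (H r) (op i u a b c) \<le> K * x"
      if "u \<in> U" "a \<in> carr (H r)" "b \<in> carr (H r)" "c \<in> carr (H r)" "nrm (H r) a + nrm (H r) b + nrm (H r) c \<le> x" for u a b c x
    proof -
      have s: "0 \<le> nrm (H r) a + nrm (H r) b + nrm (H r) c" using H.nrm_ge_0[of _ r] that by (intro add_nonneg_nonneg) auto
      have "K0 * (nrm (H r) a + nrm (H r) b + nrm (H r) c) \<le> K * x"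
        unfolding K_def using that s by (intro mult_mono) auto
      then show ?thesis using K0[OF that(1-4)] by linarith
    qed
    have L: "nrm (H r) (op i u' a b c - op i u a b c) \<le> L * nrm (H r) (u' - u) * x"
      if "u' \<in> U" "nrm (H r) (u' - u) < d0" "a \<in> carr (H r)" "b \<in> carr (H r)" "c \<in> carr (H r)" "nrm (H r) a + nrm (H r) b + nrm (H r) c \<le> x" for u' a b c x
    proof -
      have s: "0 \<le> nrm (H r) a + nrm (H r) b + nrm (H r) c" using H.nrm_ge_0[of _ r] that by (intro add_nonneg_nonneg) auto
      have k: "0 \<le> nrm (H r) (u' - u)" using that u UD by (intro H.nrm_ge_0) auto
      have "L0 * nrm (H r) (u' - u) * (nrm (H r) a + nrm (H r) b + nrm (H r) c) \<le> L * nrm (H r) (u' - u) * x"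
        unfolding L_def using that s k by (intro mult_mono) auto
      then show ?thesis using L0(2)[OF that(1-5)] by linarith
    qed
    obtain Cf where Cf: "0 \<le> Cf" "\<And>vs. dirs S vs \<Longrightarrow> nrm (H r) (f u vs) \<le> Cf * pr S vs"
      "\<And>vs u'. u' \<in> U \<Longrightarrow> dirs S vs \<Longrightarrow> nrm (H r) (f' u (vs(n := u' - u))) \<le> Cf * nrm (H r) (u' - u) * pr S vs"
      "\<And>e. 0 < e \<Longrightarrow> e < 1 \<Longrightarrow> \<exists>d>0. \<forall>u'\<in>U. nrm (H r) (u' - u) < d \<longrightarrow> (\<forall>vs. dirs S vs \<longrightarrow>
      nrm (H r) (f u' vs - f u vs - f' u (vs(n := u' - u))) \<le> e * nrm (H r) (u' - u) * pr S vs \<and>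
      nrm (H r) (f u' vs - f u vs) \<le> Cf * nrm (H r) (u' - u) * pr S vs)"
      by (rule tame_derivative_control[OF tame_op.hyps(1) D(1,2) n u]) (rule that)
    obtain Cg where Cg: "0 \<le> Cg" "\<And>vs. dirs S vs \<Longrightarrow> nrm (H r) (g u vs) \<le> Cg * pr S vs"
      "\<And>vs u'. u' \<in> U \<Longrightarrow> dirs S vs \<Longrightarrow> nrm (H r) (g' u (vs(n := u' - u))) \<le> Cg * nrm (H r) (u' - u) * pr S vs"
      "\<And>e. 0 < e \<Longrightarrow> e < 1 \<Longrightarrow> \<exists>d>0. \<forall>u'\<in>U. nrm (H r) (u' - u) < d \<longrightarrow> (\<forall>vs. dirs S vs \<longrightarrow>
      nrm (H r) (g u' vs - g u vs - g' u (vs(n := u' - u))) \<le> e * nrm (H r) (u' - u) * pr S vs \<and>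
      nrm (H r) (g u' vs - g u vs) \<le> Cg * nrm (H r) (u' - u) * pr S vs)"
      by (rule tame_derivative_control[OF tame_op.hyps(2) D(3,4) n u]) (rule that)
    obtain Ch where Ch: "0 \<le> Ch" "\<And>vs. dirs S vs \<Longrightarrow> nrm (H r) (h u vs) \<le> Ch * pr S vs"
      "\<And>vs u'. u' \<in> U \<Longrightarrow> dirs S vs \<Longrightarrow> nrm (H r) (h' u (vs(n := u' - u))) \<le> Ch * nrm (H r) (u' - u) * pr S vs"
      "\<And>e. 0 < e \<Longrightarrow> e < 1 \<Longrightarrow> \<exists>d>0. \<forall>u'\<in>U. nrm (H r) (u' - u) < d \<longrightarrow> (\<forall>vs. dirs S vs \<longrightarrow>
      nrm (H r) (h u' vs - h u vs - h' u (vs(n := u' - u))) \<le> e * nrm (H r) (u' - u) * pr S vs \<and>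
      nrm (H r) (h u' vs - h u vs) \<le> Ch * nrm (H r) (u' - u) * pr S vs)"
      by (rule tame_derivative_control[OF tame_op.hyps(3) D(5,6) n u]) (rule that)
    define M where "M = Cf + Cg + Ch"
    have M0: "0 \<le> M" using Cf(1) Cg(1) Ch(1) by (simp add: M_def)
    define C where "C = 3 * K + L * M + M"
    have C0: "0 \<le> C" using KL0 M0 by (simp add: C_def)
    show "\<exists>C\<ge>0. \<forall>e. 0 < e \<longrightarrow> e < 1 \<longrightarrow> (\<exists>d>0. \<forall>u'\<in>U. nrm (H r) (u' - u) < d \<longrightarrow> (\<forall>vs. dirs S vs \<longrightarrow>
       nrm (H r) (op i u' (f u' vs) (g u' vs) (h u' vs) - op i u (f u vs) (g u vs) (h u vs) -
         (op i u (f' u (vs(n := u' - u))) (g' u (vs(n := u' - u))) (h' u (vs(n := u' - u))) +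
          op' u ((vs(n := u' - u)) n) (f u (vs(n := u' - u))) (g u (vs(n := u' - u))) (h u (vs(n := u' - u)))))
         \<le> C * e * nrm (H r) (u' - u) * pr S vs))"
    proof (rule exI[of _ C], intro conjI allI impI C0)
      fix e :: real assume e: "0 < e" "e < 1"
      obtain d1 where d1: "d1 > 0" "\<And>u' vs. u' \<in> U \<Longrightarrow> nrm (H r) (u' - u) < d1 \<Longrightarrow> dirs S vs \<Longrightarrow>
        nrm (H r) (f u' vs - f u vs - f' u (vs(n := u' - u))) \<le> e * nrm (H r) (u' - u) * pr S vs" using Cf(4)[OF e] by blast
      obtain d2 where d2: "d2 > 0" "\<And>u' vs. u' \<in> U \<Longrightarrow> nrm (H r) (u' - u) < d2 \<Longrightarrow> dirs S vs \<Longrightarrow>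
        nrm (H r) (g u' vs - g u vs - g' u (vs(n := u' - u))) \<le> e * nrm (H r) (u' - u) * pr S vs" using Cg(4)[OF e] by blast
      obtain d3 where d3: "d3 > 0" "\<And>u' vs. u' \<in> U \<Longrightarrow> nrm (H r) (u' - u) < d3 \<Longrightarrow> dirs S vs \<Longrightarrow>
        nrm (H r) (h u' vs - h u vs - h' u (vs(n := u' - u))) \<le> e * nrm (H r) (u' - u) * pr S vs" using Ch(4)[OF e] by blast
      obtain d4 where d4: "d4 > 0" "\<And>u' a b c. u' \<in> U \<Longrightarrow> nrm (H r) (u' - u) < d4 \<Longrightarrow> a \<in> carr (H r) \<Longrightarrow> b \<in> carr (H r) \<Longrightarrow> c \<in> carr (H r) \<Longrightarrow>
          nrm (H r) (op i u' a b c - op i u a b c - op' u (u' - u) a b c) \<le>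
            e * nrm (H r) (u' - u) * (nrm (H r) a + nrm (H r) b + nrm (H r) c)" using op'[OF u e(1)] by blast
      define d where "d = Min {d0, d1, d2, d3, d4, e}"
      have d: "0 < d" "d \<le> d0" "d \<le> d1" "d \<le> d2" "d \<le> d3" "d \<le> d4" "d \<le> e"
        using L0(1) d1(1) d2(1) d3(1) d4(1) e(1) unfolding d_def by auto
      have "nrm (H r) (op i u' (f u' vs) (g u' vs) (h u' vs) - op i u (f u vs) (g u vs) (h u vs) -
         (op i u (f' u (vs(n := u' - u))) (g' u (vs(n := u' - u))) (h' u (vs(n := u' - u))) +
          op' u ((vs(n := u' - u)) n) (f u (vs(n := u' - u))) (g u (vs(n := u' - u))) (h u (vs(n := u' - u)))))
         \<le> C * e * nrm (H r) (u' - u) * pr S vs"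
        if *: "u' \<in> U" "nrm (H r) (u' - u) < d" "dirs S vs" for u' vs
      proof -
        define k where "k = nrm (H r) (u' - u)"
        have k: "0 \<le> k" "k \<le> e" using * d u UD by (auto simp: k_def intro!: H.nrm_ge_0)
        have near: "nrm (H r) (u' - u) < d0" "nrm (H r) (u' - u) < d1" "nrm (H r) (u' - u) < d2" "nrm (H r) (u' - u) < d3" "nrm (H r) (u' - u) < d4"
          using * d by auto
        have dn: "dirs (insert n S) (vs(n := u' - u))" using * u UD by auto
        define f0 f1 f2 g0 g1 g2 h0 h1 h2 where [abs_def]: "f0 = f u vs" "f1 = f u' vs" "f2 = f' u (vs(n := u' - u))"
          "g0 = g u vs" "g1 = g u' vs" "g2 = g' u (vs(n := u' - u))"
          "h0 = h u vs" "h1 = h u' vs" "h2 = h' u (vs(n := u' - u))"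
        note defs = this
        have m: "f0 \<in> carr (H r)" "f1 \<in> carr (H r)" "f2 \<in> carr (H r)" "g0 \<in> carr (H r)" "g1 \<in> carr (H r)" "g2 \<in> carr (H r)"
          "h0 \<in> carr (H r)" "h1 \<in> carr (H r)" "h2 \<in> carr (H r)"
          unfolding defs using tame_carr[OF tame_op.hyps(1) _ *(3)] tame_carr[OF tame_op.hyps(2) _ *(3)] tame_carr[OF tame_op.hyps(3) _ *(3)]
            tame_carr[OF D(1) u dn] tame_carr[OF D(3) u dn] tame_carr[OF D(5) u dn] *(1) u by blast+
        define p where "p = pr S vs"
        have p: "0 \<le> p" using pr_ge_0 * by (auto simp: p_def)
        have b: "nrm (H r) (f1 - f0 - f2) \<le> e * k * p" "nrm (H r) f2 \<le> Cf * k * p" "nrm (H r) f0 \<le> Cf * p"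
          "nrm (H r) (g1 - g0 - g2) \<le> e * k * p" "nrm (H r) g2 \<le> Cg * k * p" "nrm (H r) g0 \<le> Cg * p"
          "nrm (H r) (h1 - h0 - h2) \<le> e * k * p" "nrm (H r) h2 \<le> Ch * k * p" "nrm (H r) h0 \<le> Ch * p"
          unfolding defs k_def p_def
          using d1(2)[OF *(1) near(2) *(3)] d2(2)[OF *(1) near(3) *(3)] d3(2)[OF *(1) near(4) *(3)]
            Cf(2)[OF *(3)] Cg(2)[OF *(3)] Ch(2)[OF *(3)] Cf(3)[OF *(1,3)] Cg(3)[OF *(1,3)] Ch(3)[OF *(1,3)] by auto
        have fr: "f u (vs(n := u' - u)) = f0" "g u (vs(n := u' - u)) = g0" "h u (vs(n := u' - u)) = h0" "(vs(n := u' - u)) n = u' - u"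
          unfolding defs using tame_fresh[OF tame_op.hyps(1) n] tame_fresh[OF tame_op.hyps(2) n] tame_fresh[OF tame_op.hyps(3) n] by auto
        \<comment> \<open>The error splits into the operator at \<open>u'\<close> on the remainders
          of the arguments, the change of the operator on their first order parts, and the remainder
          of the operator on the unchanged arguments. The middle one is quadratic in the
          increment.\<close>
        define E1 where "E1 = op i u' (f1 - f0 - f2) (g1 - g0 - g2) (h1 - h0 - h2)"
        define E2 where "E2 = op i u' f2 g2 h2 - op i u f2 g2 h2"
        define E3 where "E3 = op i u' f0 g0 h0 - op i u f0 g0 h0 - op' u (u' - u) f0 g0 h0"
        have "op i u' f1 g1 h1 = E1 + op i u' f2 g2 h2 + op i u' f0 g0 h0"
          using op_diff[OF *(1), of "f1 - f0" "g1 - g0" "h1 - h0" f2 g2 h2 i] op_diff[OF *(1), of f1 g1 h1 f0 g0 h0 i] m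
          by (simp add: E1_def)
        then have eq: "op i u' f1 g1 h1 - op i u f0 g0 h0 - (op i u f2 g2 h2 + op' u (u' - u) f0 g0 h0) = E1 + E2 + E3"
          by (simp add: E2_def E3_def)
        have E1: "E1 \<in> carr (H r)" "nrm (H r) E1 \<le> K * (3 * (e * k * p))"
          unfolding E1_def using m b *(1) by (auto intro!: op_carr K)
        have E2: "E2 \<in> carr (H r)" "nrm (H r) E2 \<le> L * k * (M * k * p)"
        proof -
          show "E2 \<in> carr (H r)" unfolding E2_def using m *(1) u by (intro H.diff_carr op_carr) auto
          show "nrm (H r) E2 \<le> L * k * (M * k * p)"
            unfolding E2_def k_def
            by (rule L[OF *(1) near(1) m(3,6,9)]) (use b in \<open>simp add: M_def k_def[symmetric] distrib_right\<close>)
        qed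
        have "nrm (H r) E3 \<le> e * k * (nrm (H r) f0 + nrm (H r) g0 + nrm (H r) h0)"
          unfolding E3_def k_def by (rule d4(2)[OF *(1) near(5)]) (use m in auto)
        also have "\<dots> \<le> e * k * (M * p)"
          using b e k by (intro mult_left_mono) (auto simp: M_def distrib_right)
        finally have E3: "nrm (H r) E3 \<le> e * k * (M * p)" .
        have E3c: "E3 \<in> carr (H r)"
        proof -
          have "op' u (u' - u) f0 g0 h0 \<in> carr (H r)"
            using tame_carr[OF op'_tame[OF n tame_op.hyps] u dn] unfolding fr by simp
          then show ?thesis unfolding E3_def using m *(1) u by (intro H.diff_carr op_carr) auto
        qed
        have "L * k * (M * k * p) \<le> L * k * (M * e * p)"
          using KL0 k M0 p by (intro mult_left_mono mult_right_mono) auto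
        moreover have "nrm (H r) (E1 + E2 + E3) \<le> nrm (H r) E1 + nrm (H r) E2 + nrm (H r) E3"
          using H.nrm_triangle[of "E1 + E2" r E3] H.nrm_triangle[of E1 r E2] E1 E2 E3c by fastforce
        moreover have "K * (3 * (e * k * p)) + L * k * (M * e * p) + e * k * (M * p) = C * e * k * p"
          by (simp add: C_def algebra_simps)
        ultimately have "nrm (H r) (E1 + E2 + E3) \<le> C * e * k * p" using E1 E2 E3 by linarith
        then show ?thesis unfolding fr eq[symmetric] unfolding defs k_def p_def .
      qed
      then show "\<exists>d>0. \<forall>u'\<in>U. nrm (H r) (u' - u) < d \<longrightarrow> (\<forall>vs. dirs S vs \<longrightarrow>
       nrm (H r) (op i u' (f u' vs) (g u' vs) (h u' vs) - op i u (f u vs) (g u vs) (h u vs) -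
         (op i u (f' u (vs(n := u' - u))) (g' u (vs(n := u' - u))) (h' u (vs(n := u' - u))) +
          op' u ((vs(n := u' - u)) n) (f u (vs(n := u' - u))) (g u (vs(n := u' - u))) (h u (vs(n := u' - u)))))
         \<le> C * e * nrm (H r) (u' - u) * pr S vs)"
        using d(1) by blast
    qed
  qed
  then show ?case using t by blast
qed

text \<open>The direction added by the \<open>j\<close>-th differentiation sits in slot \<open>j\<close>, at the head of the list of directions.\<close>

definition slots :: "rfun list \<Rightarrow> nat \<Rightarrow> real \<Rightarrow> real" where
  "slots vs i = (if i < length vs then rev vs ! i else 0)"

lemma slots_Cons: "slots (h # vs) = (slots vs)(length vs := h)"
  by (auto simp: slots_def fun_eq_iff nth_append)

lemma slots_carr: "set vs \<subseteq> carr (H r) \<Longrightarrow> length vs = j \<Longrightarrow> dirs {..<j} (slots vs)"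
  by (auto simp: slots_def) (metis length_rev nth_mem set_rev subsetD)

lemma slots_pr: "length vs = j \<Longrightarrow> pr {..<j} (slots vs) = prod_list (map (nrm (H r)) vs)"
proof (induction vs arbitrary: j)
  case (Cons v vs)
  have "pr {..<length vs} (slots (v # vs)) = pr {..<length vs} (slots vs)"
    by (intro prod.cong) (auto simp: slots_Cons)
  then show ?case using Cons by (auto simp: lessThan_Suc slots_Cons)
qed simp

text \<open>Slots are numbered from the end of the list, since later differentiations add directions
  at its head; position \<open>i\<close> is slot \<open>length vs - 1 - i\<close>.\<close>

lemma slots_update:
  assumes "i < length vs"
  shows "slots (vs[i := v]) = (slots vs)(length vs - 1 - i := v)"
proof (rule ext)
  fix k
  show "slots (vs[i := v]) k = ((slots vs)(length vs - 1 - i := v)) k"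
    using assms by (auto simp: slots_def rev_nth nth_list_update)
qed

text \<open>Repeated differentiation within the class yields a whole sequence of derivatives;
  boundedness and multilinearity of each come from membership in the class.\<close>

lemma tame_smooth:
  assumes "tame {} f"
  shows "smooth_between (H r) (H r) U (\<lambda>u. f u (\<lambda>_. 0))"
proof -
  have "\<exists>T. tame {..<0} (T 0) \<and> T 0 = f \<and> (\<forall>j. tame {..<Suc j} (T (Suc j)) \<and> tame_derivative {..<j} j (T j) (T (Suc j)))"
  proof -
    define P where "P j T \<longleftrightarrow> tame {..<j} T \<and> (j = 0 \<longrightarrow> T = f)" for j :: nat and T
    \<comment> \<open>Dependent choice, since the derivative of order \<open>j + 1\<close> is
      obtained only from the one chosen at order \<open>j\<close>; the second part of
      \<open>P\<close> anchors the sequence at \<open>f\<close>.\<close>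
    have "\<exists>T. \<forall>j. P j (T j) \<and> tame_derivative {..<j} j (T j) (T (Suc j))"
    proof (rule dependent_nat_choice)
      show "\<exists>T. P 0 T" using assms by (auto simp: P_def)
      fix T and j :: nat assume "P j T"
      then have "tame {..<j} T" by (simp add: P_def)
      from tame_derivative_exists[OF this, of j] show "\<exists>T'. P (Suc j) T' \<and> tame_derivative {..<j} j T T'"
        by (auto simp: P_def lessThan_Suc)
    qed
    then obtain T where T: "\<And>j. P j (T j)" "\<And>j. tame_derivative {..<j} j (T j) (T (Suc j))" by blast
    show ?thesis using T(1)[of 0] T unfolding P_def by blast
  qed
  then obtain T where T0: "T 0 = f" and Tt: "\<And>j. tame {..<j} (T j)"
    and TD: "\<And>j. tame_derivative {..<j} j (T j) (T (Suc j))"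
    by (metis not0_implies_Suc)
  define D where "D j u vs = T j u (slots vs)" for j u vs
  have "bounded_multilinear_between (H r) (H r) j (D j u)" if u: "u \<in> U" for j u
    unfolding bounded_multilinear_between_def
  proof (intro conjI allI impI)
    fix vs :: "rfun list" assume vs: "length vs = j \<and> set vs \<subseteq> carr (H r)"
    show "D j u vs \<in> carr (H r)" unfolding D_def by (rule tame_carr[OF Tt u slots_carr]) (use vs in auto)
  next
    fix vs :: "rfun list" and i assume vs: "length vs = j \<and> set vs \<subseteq> carr (H r) \<and> i < j"
    have "linear_between (H r) (H r) (\<lambda>v. T j u ((slots vs)(j - 1 - i := v)))"
      by (rule tame_linear[OF Tt u]) (use vs slots_carr[of vs j] in auto)
    then show "linear_between (H r) (H r) (\<lambda>v. D j u (vs[i := v]))" using slots_update[of i vs] vs by (simp add: D_def)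
  next
    obtain C where C: "\<And>vs. dirs {..<j} vs \<Longrightarrow> nrm (H r) (T j u vs) \<le> C * pr {..<j} vs"
      using tame_bound[OF Tt u] by blast
    have "nrm (H r) (D j u vs) \<le> C * prod_list (map (nrm (H r)) vs)" if "length vs = j" "set vs \<subseteq> carr (H r)" for vs
      unfolding D_def slots_pr[OF that(1), symmetric] by (rule C[OF slots_carr[OF that(2,1)]])
    then show "\<exists>C. \<forall>vs. length vs = j \<and> set vs \<subseteq> carr (H r) \<longrightarrow> nrm (H r) (D j u vs) \<le> C * prod_list (map (nrm (H r)) vs)"
      by blast
  qed
  moreover have "\<exists>d>0. \<forall>u'\<in>U. nrm (H r) (u' - u) < d \<longrightarrow> (\<forall>vs. length vs = j \<and> set vs \<subseteq> carr (H r) \<longrightarrow>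
        nrm (H r) (D j u' vs - D j u vs - D (Suc j) u ((u' - u) # vs)) \<le> e * nrm (H r) (u' - u) * prod_list (map (nrm (H r)) vs))"
    if u: "u \<in> U" and e: "e > 0" for j u e
  proof -
    obtain d where d: "d > 0" "\<And>u' vs. u' \<in> U \<Longrightarrow> nrm (H r) (u' - u) < d \<Longrightarrow> dirs {..<j} vs \<Longrightarrow>
      nrm (H r) (T j u' vs - T j u vs - T (Suc j) u (vs(j := u' - u))) \<le> e * nrm (H r) (u' - u) * pr {..<j} vs"
      by (rule tame_derivativeE[OF TD[of j] u e]) (rule that)
    have "nrm (H r) (D j u' vs - D j u vs - D (Suc j) u ((u' - u) # vs)) \<le> e * nrm (H r) (u' - u) * prod_list (map (nrm (H r)) vs)"
      if "u' \<in> U" "nrm (H r) (u' - u) < d" "length vs = j" "set vs \<subseteq> carr (H r)" for u' vs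
      using d(2)[OF that(1,2) slots_carr[OF that(4,3)]] unfolding D_def slots_Cons slots_pr[OF that(3)] that(3) .
    then show ?thesis using d(1) by blast
  qed
  moreover have "D 0 u [] = f u (\<lambda>_. 0)" if "u \<in> U" for u
    unfolding D_def T0 by (rule tame_cong[OF assms]) simp
  ultimately show ?thesis unfolding smooth_between_def using U by blast
qed

end

declare mem_Times_iff [simp]

section \<open>Second order periodic systems with two integral constraints\<close>

text \<open>The pointwise inputs of the equation: the warp L, the solution x, its derivative x', and
  the parameters \<mu> and \<delta>.\<close>

datatype bvar = VL | VX | VY | VM | VD

lemma UNIV_bvar: "UNIV = {VL, VX, VY, VM, VD}"
  using bvar.exhaust by auto

instance bvar :: finite
  by standard (simp add: UNIV_bvar)

text \<open>Encodes the warp and the unknown as one vector of functions, the parameters as constant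
  functions, so that the right hand side and both integrands become superposition operators of the
  same argument. The encoding is linear in both arguments jointly, hence directions are encoded in
  the same way.\<close>

definition bvec :: "rfun \<Rightarrow> real \<times> real \<times> rfun \<Rightarrow> bvar \<Rightarrow> real \<Rightarrow> real" where
  "bvec L y v = (case v of VL \<Rightarrow> L | VX \<Rightarrow> snd (snd y) | VY \<Rightarrow> deriv (snd (snd y))
     | VM \<Rightarrow> (\<lambda>t. fst y) | VD \<Rightarrow> (\<lambda>t. fst (snd y)))"

lemma vec_simps [simp]:
  "bvec L y VL = L" "bvec L y VX = snd (snd y)" "bvec L y VY = deriv (snd (snd y))"
  "bvec L y VM = (\<lambda>t. fst y)" "bvec L y VD = (\<lambda>t. fst (snd y))"
  by (simp_all add: bvec_def)

text \<open>The second derivative in the directions \<open>V1\<close> and \<open>W\<close>;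
  differentiating a coefficient once more is again a chain rule.\<close>

definition nemytskii_deriv2 ::
    "'v::finite ex \<Rightarrow> ('v \<Rightarrow> real \<Rightarrow> real) \<Rightarrow> ('v \<Rightarrow> real \<Rightarrow> real) \<Rightarrow> ('v \<Rightarrow> real \<Rightarrow> real) \<Rightarrow> real \<Rightarrow> real" where
  "nemytskii_deriv2 e V V1 W = (\<Sum>i\<in>UNIV. nemytskii_deriv (pd i e) V V1 * W i)"

context holder
begin

abbreviation YS :: "nat \<Rightarrow> (real \<times> real \<times> rfun) nspace" where
  "YS j \<equiv> prod_nspace std (prod_nspace std (H (Suc (Suc j))))"

abbreviation ZS :: "nat \<Rightarrow> (rfun \<times> real \<times> real) nspace" where
  "ZS j \<equiv> prod_nspace (H j) (prod_nspace std std)"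

abbreviation VS :: "nat \<Rightarrow> (bvar \<Rightarrow> real \<Rightarrow> real) nspace" where
  "VS j \<equiv> fun_nspace (H j)"

abbreviation XS :: "nat \<Rightarrow> (rfun \<times> real \<times> real \<times> rfun) nspace" where
  "XS j \<equiv> prod_nspace (H j) (YS j)"

lemma nspace_YS: "nspace (YS j)" by (intro nspace_prod nspace_std nspace_H)
lemma nspace_ZS: "nspace (ZS j)" by (intro nspace_prod nspace_std nspace_H)
lemma nspace_VS: "nspace (VS j)" by (intro nspace_fun nspace_H)
lemma nspace_XS: "nspace (XS j)" by (intro nspace_prod nspace_YS nspace_H)
lemma complete_YS: "complete_nspace (YS j)"
  by (intro complete_nspace_prod nspace_prod nspace_std nspace_H complete_nspace_std complete_H)

sublocale YS: nspace "YS j" for j by (rule nspace_YS)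
sublocale ZS: nspace "ZS j" for j by (rule nspace_ZS)
sublocale VS: nspace "VS j" for j by (rule nspace_VS)
sublocale XS: nspace "XS j" for j by (rule nspace_XS)

lemma carr_YS: "y \<in> carr (YS j) \<longleftrightarrow> snd (snd y) \<in> carr (H (Suc (Suc j)))"
  by (cases y) auto

lemma nrm_YS: "nrm (YS j) y = \<bar>fst y\<bar> + \<bar>fst (snd y)\<bar> + nrm (H (Suc (Suc j))) (snd (snd y))"
  by (simp add: nrm_prod_nspace)

lemma nrm_ZS: "nrm (ZS j) z = nrm (H j) (fst z) + \<bar>fst (snd z)\<bar> + \<bar>snd (snd z)\<bar>"
  by (simp add: nrm_prod_nspace)

lemma vec_add:
  "y \<in> carr (YS j) \<Longrightarrow> y' \<in> carr (YS j) \<Longrightarrow> bvec (L + L') (y + y') = bvec L y + bvec L' y'"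
  by (rule ext, rename_tac v, case_tac v)
    (auto simp: carr_YS plus_fun_apply[of "bvec L y"] deriv_add_H[of _ "Suc j"], auto simp: plus_fun_def)

lemma vec_scale: "y \<in> carr (YS j) \<Longrightarrow> bvec (c *\<^sub>R L) (c *\<^sub>R y) = c *\<^sub>R bvec L y"
  by (rule ext, rename_tac v, case_tac v)
    (auto simp: carr_YS scaleR_fun_def[of c "bvec L y"] deriv_scale_H[of _ "Suc j"], auto simp: scaleR_fun_def)

lemma vec_carr: "L \<in> carr (H j) \<Longrightarrow> y \<in> carr (YS j) \<Longrightarrow> bvec L y \<in> carr (VS j)"
  unfolding carr_fun_nspace
proof
  fix v assume "L \<in> carr (H j)" "y \<in> carr (YS j)"
  moreover from this have "snd (snd y) \<in> carr (H j)" "deriv (snd (snd y)) \<in> carr (H j)"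
    using H_mono[of j "Suc (Suc j)"] H_deriv[of _ "Suc j"] H_mono[of j "Suc j"] by (auto simp: carr_YS)
  ultimately show "bvec L y v \<in> carr (H j)"
    by (cases v) (auto intro: const_H)
qed

text \<open>12 = 9 + 3: x loses two orders of differentiability at a factor 3 each, and x' loses
  one.\<close>

lemma nrm_vec_le:
  assumes "L \<in> carr (H j)" "y \<in> carr (YS j)"
  shows "nrm (VS j) (bvec L y) \<le> 12 * (nrm (H j) L + nrm (YS j) y)"
proof -
  define x where "x = snd (snd y)"
  have x: "x \<in> carr (H (Suc (Suc j)))" using assms by (simp add: x_def carr_YS)
  have "nrm (H j) x \<le> 9 * nrm (H (Suc (Suc j))) x" using nrm_H_mono[OF _ x, of j] by (simp add: power2_eq_square)
  moreover have "nrm (H j) (deriv x) \<le> 3 * nrm (H (Suc (Suc j))) x"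
    using H_Suc_subset[OF H_deriv[OF x]] nrm_H_deriv[OF x] by linarith
  ultimately show ?thesis
    using H.nrm_ge_0[OF assms(1)] H.nrm_ge_0[OF x]
    by (simp add: nrm_fun_nspace UNIV_bvar nrm_YS nrm_const_H x_def[symmetric])
qed

lemma bounded_linear_vec: "bounded_linear_between (XS j) (VS j) (\<lambda>z. bvec (fst z) (snd z))"
proof (rule bounded_linear_betweenI[where C = 12])
  show "nrm (VS j) (bvec (fst z) (snd z)) \<le> 12 * nrm (XS j) z" if "z \<in> carr (XS j)" for z
    using nrm_vec_le[of "fst z" j "snd z"] that by (auto simp: nrm_prod_nspace[of "H j"])
qed (auto intro!: vec_carr[unfolded carr_fun_nspace, rule_format] vec_add[of _ j] vec_scale[of _ j, simplified] simp: carr_YS)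

definition intP :: "rfun \<Rightarrow> real" where "intP f = integral {0..P} f"

lemma H_integrable: "f \<in> carr (H j) \<Longrightarrow> f integrable_on {0..P}"
  using continuous_on_subset[OF H_continuous] by (intro integrable_continuous_real) auto

lemma bounded_linear_intP: "bounded_linear_between (H j) std intP"
proof (rule bounded_linear_betweenI[where C = P])
  fix f assume f: "f \<in> carr (H j)"
  have "norm (integral (cbox 0 P) f) \<le> nrm (H j) f * measure lborel (cbox 0 P)"
    by (rule integrable_bound) (use H_integrable[OF f] H_le_nrm[OF f] H.nrm_ge_0[OF f] in auto)
  then show "nrm std (intP f) \<le> P * nrm (H j) f" using P by (simp add: intP_def mult.commute)
qed (auto simp: intP_def plus_fun_def scaleR_fun_def integral_add H_integrable)

lemma intP_le: "f \<in> carr (H j) \<Longrightarrow> nrm (H j) f \<le> c \<Longrightarrow> \<bar>intP f\<bar> \<le> P * c"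
proof -
  assume f: "f \<in> carr (H j)" "nrm (H j) f \<le> c"
  have "norm (integral (cbox 0 P) f) \<le> nrm (H j) f * measure lborel (cbox 0 P)"
    by (rule integrable_bound) (use H_integrable[OF f(1)] H_le_nrm[OF f(1)] H.nrm_ge_0[OF f(1)] in auto)
  then have "\<bar>intP f\<bar> \<le> P * nrm (H j) f" using P by (simp add: intP_def mult.commute)
  also have "\<dots> \<le> P * c" using P f by (intro mult_left_mono) auto
  finally show ?thesis .
qed

lemma intP_diff: "f \<in> carr (H j) \<Longrightarrow> g \<in> carr (H j) \<Longrightarrow> intP (f - g) = intP f - intP g"
  by (rule bounded_linear_between_diff[OF bounded_linear_intP nspace_H])

lemma nemytskii_deriv_carr:
  "V \<in> carr (fun_nspace (H j)) \<Longrightarrow> W \<in> carr (fun_nspace (H j)) \<Longrightarrow> ok_on e V \<Longrightarrow> nemytskii_deriv e V W \<in> carr (H j)"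
  unfolding nemytskii_deriv_def by (intro H.sum_carr mult_carr nemytskii_carr ok_on_pd) auto

lemma nrm_sum_mult_le:
  assumes "\<And>i. A i \<in> carr (H j)" "W \<in> carr (fun_nspace (H j))" "\<And>i. nrm (H j) (A i) \<le> c"
  shows "nrm (H j) (\<Sum>i\<in>(UNIV :: 'v::finite set). A i * W i) \<le> HK j * c * nrm (fun_nspace (H j)) W"
proof -
  have "nrm (H j) (\<Sum>i\<in>UNIV. A i * W i) \<le> (\<Sum>i\<in>UNIV. nrm (H j) (A i * W i))"
    by (rule H.nrm_sum_le) (use assms in \<open>auto intro: mult_carr\<close>)
  also have "\<dots> \<le> (\<Sum>i\<in>UNIV. HK j * c * nrm (H j) (W i))"
    by (intro sum_mono nrm_mult_le assms order_refl) (use assms in auto)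
  finally show ?thesis by (simp add: nrm_fun_nspace sum_distrib_left)
qed

text \<open>Only the coefficients vary with \<open>V'\<close>, and each of them is locally
  Lipschitz, being the value of a superposition operator; the finitely many variables allow a common
  radius and constant.\<close>

lemma nemytskii_deriv_lipschitz:
  fixes V :: "'v::finite \<Rightarrow> real \<Rightarrow> real"
  assumes V: "V \<in> carr (fun_nspace (H j))" "ok_on e V"
  obtains d C where "0 < d" "0 < C"
    "\<And>V' W. V' \<in> carr (fun_nspace (H j)) \<Longrightarrow> nrm (fun_nspace (H j)) (V' - V) < d \<Longrightarrow> W \<in> carr (fun_nspace (H j)) \<Longrightarrow>
       nemytskii_deriv e V' W \<in> carr (H j) \<and>
       nrm (H j) (nemytskii_deriv e V' W - nemytskii_deriv e V W) \<le>
         C * nrm (fun_nspace (H j)) (V' - V) * nrm (fun_nspace (H j)) W"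
proof -
  interpret N: nspace "fun_nspace (H j) :: ('v \<Rightarrow> _) nspace" by (rule nspace_fun[OF nspace_H])
  have "\<exists>d C. 0 < d \<and> 0 < C \<and> (\<forall>V'\<in>carr (fun_nspace (H j)). nrm (fun_nspace (H j)) (V' - V) < d \<longrightarrow>
      nemytskii (pd i e) V' \<in> carr (H j) \<and>
      nrm (H j) (nemytskii (pd i e) V' - nemytskii (pd i e) V) \<le> C * nrm (fun_nspace (H j)) (V' - V))" for i
  proof -
    obtain d C where dC: "0 < d" "0 < C" "\<And>u1. u1 \<in> carr (fun_nspace (H j)) \<Longrightarrow> nrm (fun_nspace (H j)) (u1 - V) < d \<Longrightarrow> nemytskii (pd i e) u1 \<in> carr (H j)"
      "\<And>u1 u2. u1 \<in> carr (fun_nspace (H j)) \<Longrightarrow> u2 \<in> carr (fun_nspace (H j)) \<Longrightarrow> nrm (fun_nspace (H j)) (u1 - V) < d \<Longrightarrow>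
        nrm (fun_nspace (H j)) (u2 - V) < d \<Longrightarrow> nrm (H j) (nemytskii (pd i e) u1 - nemytskii (pd i e) u2) \<le> C * nrm (fun_nspace (H j)) (u1 - u2)"
      using strict_derivative_lipschitz[OF strict_derivative_nemytskii[OF V(1) ok_on_pd[OF V(2), of i]] N.nspace_axioms nspace_H] by blast
    have "nrm (fun_nspace (H j)) (V - V) < d" using dC(1) by simp
    then show ?thesis using dC(1,2) dC(3) dC(4)[OF _ V(1)] by blast
  qed
  then obtain d C where dC: "\<And>i. 0 < d i" "\<And>i. 0 < C i" "\<And>i V'. V' \<in> carr (fun_nspace (H j)) \<Longrightarrow> nrm (fun_nspace (H j)) (V' - V) < d i \<Longrightarrow>
      nemytskii (pd i e) V' \<in> carr (H j) \<and>
      nrm (H j) (nemytskii (pd i e) V' - nemytskii (pd i e) V) \<le> C i * nrm (fun_nspace (H j)) (V' - V)" by metis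
  define d0 where "d0 = Min (range d)"
  define C0 where "C0 = (\<Sum>i\<in>UNIV. C i)"
  have d0: "0 < d0" "d0 \<le> d i" for i using dC(1) by (auto simp: d0_def)
  have C0: "C i \<le> C0" "0 < C0" for i
  proof -
    show "C i \<le> C0" unfolding C0_def by (rule member_le_sum) (use dC(2) in \<open>auto intro: less_imp_le\<close>)
    show "0 < C0" unfolding C0_def by (rule sum_pos) (use dC(2) in auto)
  qed
  have step: "nemytskii_deriv e V' W \<in> carr (H j) \<and>
       nrm (H j) (nemytskii_deriv e V' W - nemytskii_deriv e V W) \<le>
         (HK j * C0) * nrm (fun_nspace (H j)) (V' - V) * nrm (fun_nspace (H j)) W"
    if *: "V' \<in> carr (fun_nspace (H j))" "nrm (fun_nspace (H j)) (V' - V) < d0" "W \<in> carr (fun_nspace (H j))" for V' W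
  proof
    have n: "nrm (fun_nspace (H j)) (V' - V) < d i" for i using * d0(2)[of i] by linarith
    have k: "0 \<le> nrm (fun_nspace (H j)) (V' - V)" by (rule N.nrm_ge_0[OF N.diff_carr[OF *(1) V(1)]])
    have nc: "nemytskii (pd i e) V \<in> carr (H j)" for i by (rule nemytskii_carr[OF V(1) ok_on_pd[OF V(2)]])
    show "nemytskii_deriv e V' W \<in> carr (H j)"
      unfolding nemytskii_deriv_def using dC(3)[OF *(1) n] *(3) by (intro H.sum_carr mult_carr) auto
    have "nemytskii_deriv e V' W - nemytskii_deriv e V W = (\<Sum>i\<in>UNIV. (nemytskii (pd i e) V' - nemytskii (pd i e) V) * W i)"
      by (simp add: nemytskii_deriv_def sum_subtractf left_diff_distrib)
    moreover have "nrm (H j) (\<Sum>i\<in>UNIV. (nemytskii (pd i e) V' - nemytskii (pd i e) V) * W i) \<le>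
        HK j * (C0 * nrm (fun_nspace (H j)) (V' - V)) * nrm (fun_nspace (H j)) W"
    proof (rule nrm_sum_mult_le[OF _ *(3)])
      fix i
      show "nemytskii (pd i e) V' - nemytskii (pd i e) V \<in> carr (H j)" using dC(3)[OF *(1) n] nc by auto
      have "C i * nrm (fun_nspace (H j)) (V' - V) \<le> C0 * nrm (fun_nspace (H j)) (V' - V)"
        using C0 k by (intro mult_right_mono) auto
      then show "nrm (H j) (nemytskii (pd i e) V' - nemytskii (pd i e) V) \<le> C0 * nrm (fun_nspace (H j)) (V' - V)"
        using dC(3)[OF *(1) n, of i] by linarith
    qed
    ultimately show "nrm (H j) (nemytskii_deriv e V' W - nemytskii_deriv e V W) \<le>
         (HK j * C0) * nrm (fun_nspace (H j)) (V' - V) * nrm (fun_nspace (H j)) W"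
      by (simp add: mult.assoc)
  qed
  have "0 < HK j * C0" using HK_pos[of j] C0(2) by simp
  then show ?thesis by (rule that[OF d0(1) _ step])
qed

end

text \<open>\<open>e0\<close> is the right hand side of the second order equation; \<open>e1\<close>
  and \<open>e2\<close> are the integrands of two quantities whose integrals over a period are
  prescribed as \<open>c1\<close> and \<open>c2\<close>.\<close>

locale periodic_system = holder +
  fixes r :: nat and e0 e1 e2 :: "bvar ex" and c1 c2 :: real
begin

definition sysmap :: "rfun \<Rightarrow> real \<times> real \<times> rfun \<Rightarrow> rfun \<times> real \<times> real" where
  "sysmap L y = (deriv (deriv (snd (snd y))) + - nemytskii e0 (bvec L y),
     intP (nemytskii e1 (bvec L y)) + - c1, intP (nemytskii e2 (bvec L y)) + - c2)"

text \<open>The differential of the system at a point whose pointwise data are \<open>V\<close>. The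
  shapes \<open>+ -\<close> and \<open>+ 0\<close>, here and in \<open>sysmap\<close>, are those
  produced by the rules for sums and constants, so the two definitions match these rules
  literally.\<close>

definition lin :: "(bvar \<Rightarrow> real \<Rightarrow> real) \<Rightarrow> rfun \<Rightarrow> real \<times> real \<times> rfun \<Rightarrow> rfun \<times> real \<times> real" where
  "lin V L y = (deriv (deriv (snd (snd y))) + - nemytskii_deriv e0 V (bvec L y),
     intP (nemytskii_deriv e1 V (bvec L y)) + 0, intP (nemytskii_deriv e2 V (bvec L y)) + 0)"

definition admissible :: "(bvar \<Rightarrow> real \<Rightarrow> real) \<Rightarrow> bool" where
  "admissible V \<longleftrightarrow> ok_on e0 V \<and> ok_on e1 V \<and> ok_on e2 V"

lemma bounded_linear_uminus: "bounded_linear_between (H j) (H j) (\<lambda>f. - f)"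
  by (rule bounded_linear_betweenI[where C = 1]) auto

lemma bounded_linear_second_deriv: "bounded_linear_between (XS j) (H j) (\<lambda>z. deriv (deriv (snd (snd (snd z)))))"
proof (rule bounded_linear_betweenI[where C = 1])
  fix z assume z: "z \<in> carr (XS j)"
  define x where "x = snd (snd (snd z))"
  have x: "x \<in> carr (H (Suc (Suc j)))" using z by (auto simp: x_def)
  have 1: "fst z \<in> carr (H j)" using z by auto
  show "nrm (H j) (deriv (deriv (snd (snd (snd z))))) \<le> 1 * nrm (XS j) z"
    using nrm_H_deriv[OF x] nrm_H_deriv[OF H_deriv[OF x]] H.nrm_ge_0[OF 1] by (simp add: nrm_prod_nspace x_def)
qed (auto simp: deriv_add_H[of _ "Suc j"] deriv_add_H[of _ j] deriv_scale_H[of _ "Suc j"] deriv_scale_H[of _ j] H_deriv intro: H_deriv)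

lemma strict_derivative_nemytskii_vec:
  assumes z: "(L, y) \<in> carr (XS j)" and ok: "ok_on e (bvec L y)"
  shows "strict_derivative_at (XS j) (H j) (\<lambda>z. nemytskii e (bvec (fst z) (snd z)))
    (\<lambda>z. nemytskii_deriv e (bvec L y) (bvec (fst z) (snd z))) (L, y)"
proof -
  have "strict_derivative_at (XS j) (VS j) (\<lambda>z. bvec (fst z) (snd z)) (\<lambda>z. bvec (fst z) (snd z)) (L, y)"
    by (rule strict_derivative_linear[OF nspace_XS nspace_VS bounded_linear_vec z])
  moreover have "strict_derivative_at (VS j) (H j) (nemytskii e) (nemytskii_deriv e (bvec L y)) (bvec (fst (L, y)) (snd (L, y)))"
    using strict_derivative_nemytskii[OF vec_carr ok, of j] z by auto
  ultimately show ?thesis by (rule strict_derivative_compose[OF nspace_XS nspace_VS nspace_H])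
qed

lemma strict_derivative_sysmap:
  assumes z: "L \<in> carr (H r)" "y \<in> carr (YS r)" and ok: "admissible (bvec L y)"
  shows "strict_derivative_at (XS r) (ZS r) (\<lambda>z. sysmap (fst z) (snd z)) (\<lambda>z. lin (bvec L y) (fst z) (snd z)) (L, y)"
proof -
  have z': "(L, y) \<in> carr (XS r)" using z by auto
  have ok': "ok_on e0 (bvec L y)" "ok_on e1 (bvec L y)" "ok_on e2 (bvec L y)" using ok by (auto simp: admissible_def)
  have int: "strict_derivative_at (XS r) std (\<lambda>z. intP (nemytskii e (bvec (fst z) (snd z))))
      (\<lambda>z. intP (nemytskii_deriv e (bvec L y) (bvec (fst z) (snd z)))) (L, y)" if ok: "ok_on e (bvec L y)" for e
  proof (rule strict_derivative_compose[OF nspace_XS nspace_H nspace_std strict_derivative_nemytskii_vec[OF z' ok], where g = intP])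
    show "strict_derivative_at (H r) std intP intP (nemytskii e (bvec (fst (L, y)) (snd (L, y))))"
      using nemytskii_carr[OF vec_carr[OF z] ok]
      by (intro strict_derivative_linear[OF nspace_H nspace_std bounded_linear_intP]) simp
  qed
  have neg: "strict_derivative_at (XS r) (H r) (\<lambda>z. - nemytskii e0 (bvec (fst z) (snd z)))
      (\<lambda>z. - nemytskii_deriv e0 (bvec L y) (bvec (fst z) (snd z))) (L, y)"
  proof (rule strict_derivative_compose[OF nspace_XS nspace_H nspace_H strict_derivative_nemytskii_vec[OF z' ok'(1)], where g = uminus])
    show "strict_derivative_at (H r) (H r) uminus uminus (nemytskii e0 (bvec (fst (L, y)) (snd (L, y))))"
      using nemytskii_carr[OF vec_carr[OF z] ok'(1)]
      by (intro strict_derivative_linear[OF nspace_H nspace_H bounded_linear_uminus]) simp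
  qed
  show ?thesis
    unfolding sysmap_def lin_def
    by (intro strict_derivative_pair[OF nspace_XS] strict_derivative_add[OF nspace_XS nspace_H] strict_derivative_add[OF nspace_XS nspace_std]
        strict_derivative_linear[OF nspace_XS nspace_H bounded_linear_second_deriv z'] neg int ok'
        strict_derivative_const[OF nspace_XS nspace_std _ z']) auto
qed

lemma bounded_linear_lin:
  assumes "L \<in> carr (H r)" "y \<in> carr (YS r)" "admissible (bvec L y)"
  shows "bounded_linear_between (XS r) (ZS r) (\<lambda>z. lin (bvec L y) (fst z) (snd z))"
  by (rule strict_derivative_atD(2)[OF strict_derivative_sysmap[OF assms]])

lemma lin_split:
  assumes "L \<in> carr (H r)" "y \<in> carr (YS r)" "admissible (bvec L y)" "h \<in> carr (H r)" "k \<in> carr (YS r)"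
  shows "lin (bvec L y) h k = lin (bvec L y) 0 k + lin (bvec L y) h 0"
  using bounded_linear_betweenD(2)[OF bounded_linear_lin[OF assms(1-3)], of "(0, k)" "(h, 0)"] assms(4,5) by (simp add: carr_YS)

lemma bounded_linear_lin0:
  assumes "L \<in> carr (H r)" "y \<in> carr (YS r)" "admissible (bvec L y)"
  shows "bounded_linear_between (YS r) (ZS r) (lin (bvec L y) 0)"
proof -
  have "bounded_linear_between (YS r) (XS r) (\<lambda>k. (0, k))"
    by (rule bounded_linear_betweenI[where C = 1]) (auto simp: nrm_prod_nspace[of "H r"])
  from bounded_linear_between_compose[OF nspace_YS nspace_XS this bounded_linear_lin[OF assms]] show ?thesis by simp
qed

lemma lin_carr:
  assumes "L \<in> carr (H r)" "y \<in> carr (YS r)" "admissible (bvec L y)" "h \<in> carr (H r)" "k \<in> carr (YS r)"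
  shows "lin (bvec L y) h k \<in> carr (ZS r)"
  using bounded_linear_betweenD(1)[OF bounded_linear_lin[OF assms(1-3)], of "(h, k)"] assms(4,5) by simp

lemma lin_lipschitz:
  assumes "V \<in> carr (VS r)" "admissible V"
  obtains d C where "0 < d" "0 < C"
    "\<And>V' k. V' \<in> carr (VS r) \<Longrightarrow> nrm (VS r) (V' - V) < d \<Longrightarrow> k \<in> carr (YS r) \<Longrightarrow>
       nrm (ZS r) (lin V' 0 k - lin V 0 k) \<le> C * nrm (VS r) (V' - V) * nrm (YS r) k"
proof -
  have ok: "ok_on e0 V" "ok_on e1 V" "ok_on e2 V" using assms by (auto simp: admissible_def)
  obtain d0 C0 where 0: "0 < d0" "0 < C0"
    "\<And>V' W. V' \<in> carr (VS r) \<Longrightarrow> nrm (VS r) (V' - V) < d0 \<Longrightarrow> W \<in> carr (VS r) \<Longrightarrow> nemytskii_deriv e0 V' W \<in> carr (H r) \<and>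
       nrm (H r) (nemytskii_deriv e0 V' W - nemytskii_deriv e0 V W) \<le> C0 * nrm (VS r) (V' - V) * nrm (VS r) W"
    using nemytskii_deriv_lipschitz[OF assms(1) ok(1)] by blast
  obtain d1 C1 where 1: "0 < d1" "0 < C1"
    "\<And>V' W. V' \<in> carr (VS r) \<Longrightarrow> nrm (VS r) (V' - V) < d1 \<Longrightarrow> W \<in> carr (VS r) \<Longrightarrow> nemytskii_deriv e1 V' W \<in> carr (H r) \<and>
       nrm (H r) (nemytskii_deriv e1 V' W - nemytskii_deriv e1 V W) \<le> C1 * nrm (VS r) (V' - V) * nrm (VS r) W"
    using nemytskii_deriv_lipschitz[OF assms(1) ok(2)] by blast
  obtain d2 C2 where 2: "0 < d2" "0 < C2"
    "\<And>V' W. V' \<in> carr (VS r) \<Longrightarrow> nrm (VS r) (V' - V) < d2 \<Longrightarrow> W \<in> carr (VS r) \<Longrightarrow> nemytskii_deriv e2 V' W \<in> carr (H r) \<and>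
       nrm (H r) (nemytskii_deriv e2 V' W - nemytskii_deriv e2 V W) \<le> C2 * nrm (VS r) (V' - V) * nrm (VS r) W"
    using nemytskii_deriv_lipschitz[OF assms(1) ok(3)] by blast
  \<comment> \<open>12 is the norm of the encoding of directions, and each integral over a period
    contributes a factor \<open>P\<close>.\<close>
  define C where "C = 12 * (C0 + P * C1 + P * C2)"
  have step: "nrm (ZS r) (lin V' 0 k - lin V 0 k) \<le> C * nrm (VS r) (V' - V) * nrm (YS r) k"
    if *: "V' \<in> carr (VS r)" "nrm (VS r) (V' - V) < Min {d0, d1, d2}" "k \<in> carr (YS r)" for V' k
  proof -
    have W: "bvec 0 k \<in> carr (VS r)" by (rule vec_carr[OF H.zero_carr *(3)])
    define m w where "m = nrm (VS r) (V' - V)" and "w = nrm (VS r) (bvec 0 k)"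
    have m: "0 \<le> m" unfolding m_def by (rule VS.nrm_ge_0[OF VS.diff_carr[OF *(1) assms(1)]])
    have near: "nrm (VS r) (V' - V) < d0" "nrm (VS r) (V' - V) < d1" "nrm (VS r) (V' - V) < d2" using *(2) by auto
    note b = 0(3)[OF *(1) near(1) W] 1(3)[OF *(1) near(2) W] 2(3)[OF *(1) near(3) W]
    have nV: "nemytskii_deriv e0 V (bvec 0 k) \<in> carr (H r)" "nemytskii_deriv e1 V (bvec 0 k) \<in> carr (H r)" "nemytskii_deriv e2 V (bvec 0 k) \<in> carr (H r)"
      by (rule nemytskii_deriv_carr[OF assms(1) W ok(1)] nemytskii_deriv_carr[OF assms(1) W ok(2)] nemytskii_deriv_carr[OF assms(1) W ok(3)])+
    have "nrm (ZS r) (lin V' 0 k - lin V 0 k) = nrm (H r) (nemytskii_deriv e0 V' (bvec 0 k) - nemytskii_deriv e0 V (bvec 0 k)) +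
       \<bar>intP (nemytskii_deriv e1 V' (bvec 0 k) - nemytskii_deriv e1 V (bvec 0 k))\<bar> + \<bar>intP (nemytskii_deriv e2 V' (bvec 0 k) - nemytskii_deriv e2 V (bvec 0 k))\<bar>"
      using b nV by (simp add: lin_def nrm_ZS intP_diff[of _ r] H.nrm_minus_commute)
    also have "\<dots> \<le> C0 * m * w + P * (C1 * m * w) + P * (C2 * m * w)"
      unfolding m_def w_def using b nV by (intro add_mono intP_le[of _ r] H.diff_carr) auto
    also have "\<dots> = (C0 + P * C1 + P * C2) * m * w" by (simp add: algebra_simps)
    also have "\<dots> \<le> (C0 + P * C1 + P * C2) * m * (12 * nrm (YS r) k)"
    proof (rule mult_left_mono)
      show "w \<le> 12 * nrm (YS r) k" using nrm_vec_le[OF H.zero_carr *(3)] by (simp add: w_def)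
      show "0 \<le> (C0 + P * C1 + P * C2) * m" using m P 0(2) 1(2) 2(2) by (intro mult_nonneg_nonneg add_nonneg_nonneg) auto
    qed
    finally show ?thesis by (simp add: m_def C_def algebra_simps)
  qed
  have C: "0 < C" using P 0(2) 1(2) 2(2) by (auto simp: C_def intro!: add_pos_pos)
  have d: "0 < Min {d0, d1, d2}" using 0(1) 1(1) 2(1) by simp
  show ?thesis by (rule that[OF d C step])
qed

lemma admissible_open:
  assumes "V \<in> carr (VS r)" "admissible V"
  obtains d where "0 < d" "\<And>V'. V' \<in> carr (VS r) \<Longrightarrow> nrm (VS r) (V' - V) < d \<Longrightarrow> admissible V'"
proof -
  obtain d0 where 0: "d0 > 0" "\<And>W. W \<in> carr (VS r) \<Longrightarrow> nrm (VS r) (W - V) < d0 \<Longrightarrow> ok_on e0 W"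
    using ok_on_open[OF assms(1), of e0] assms(2) unfolding admissible_def by blast
  obtain d1 where 1: "d1 > 0" "\<And>W. W \<in> carr (VS r) \<Longrightarrow> nrm (VS r) (W - V) < d1 \<Longrightarrow> ok_on e1 W"
    using ok_on_open[OF assms(1), of e1] assms(2) unfolding admissible_def by blast
  obtain d2 where 2: "d2 > 0" "\<And>W. W \<in> carr (VS r) \<Longrightarrow> nrm (VS r) (W - V) < d2 \<Longrightarrow> ok_on e2 W"
    using ok_on_open[OF assms(1), of e2] assms(2) unfolding admissible_def by blast
  show ?thesis
  proof (rule that[of "Min {d0, d1, d2}"])
    show "0 < Min {d0, d1, d2}" using 0(1) 1(1) 2(1) by simp
    show "admissible V'" if "V' \<in> carr (VS r)" "nrm (VS r) (V' - V) < Min {d0, d1, d2}" for V'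
      unfolding admissible_def using that 0(2) 1(2) 2(2) by simp
  qed
qed

end

section \<open>Smooth maps into Hoelder spaces\<close>

definition derivative_tower ::
    "'a::real_vector nspace \<Rightarrow> 'b::real_vector nspace \<Rightarrow> 'a set \<Rightarrow> (nat \<Rightarrow> 'a \<Rightarrow> 'a list \<Rightarrow> 'b) \<Rightarrow> bool" where
  "derivative_tower E F U D \<longleftrightarrow>
     (\<forall>j. \<forall>u\<in>U. bounded_multilinear_between E F j (D j u)) \<and>
     (\<forall>j. \<forall>u\<in>U. \<forall>e>0. \<exists>d>0. \<forall>u'\<in>U. nrm E (u' - u) < d \<longrightarrow>
        (\<forall>vs. length vs = j \<and> set vs \<subseteq> carr E \<longrightarrow>
           nrm F (D j u' vs - D j u vs - D (Suc j) u ((u' - u) # vs)) \<le> e * nrm E (u' - u) * prod_list (map (nrm E) vs)))"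

lemma smooth_between_iff_tower:
  "smooth_between E F U f \<longleftrightarrow> U \<subseteq> carr E \<and> (\<exists>D. (\<forall>u\<in>U. D 0 u [] = f u) \<and> derivative_tower E F U D)"
  unfolding smooth_between_def derivative_tower_def ..

lemma smooth_betweenE:
  assumes "smooth_between E F U f"
  obtains D where "U \<subseteq> carr E" "\<And>u. u \<in> U \<Longrightarrow> D 0 u [] = f u"
    "\<And>j u. u \<in> U \<Longrightarrow> bounded_multilinear_between E F j (D j u)"
    "\<And>j u e. u \<in> U \<Longrightarrow> e > 0 \<Longrightarrow> \<exists>d>0. \<forall>u'\<in>U. nrm E (u' - u) < d \<longrightarrow>
           (\<forall>vs. length vs = j \<and> set vs \<subseteq> carr E \<longrightarrow>
              nrm F (D j u' vs - D j u vs - D (Suc j) u ((u' - u) # vs)) \<le> e * nrm E (u' - u) * prod_list (map (nrm E) vs))"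
proof -
  from assms have U: "U \<subseteq> carr E" and "\<exists>D. (\<forall>u\<in>U. D 0 u [] = f u) \<and> derivative_tower E F U D"
    by (simp_all add: smooth_between_iff_tower)
  then obtain D where D: "\<forall>u\<in>U. D 0 u [] = f u" "derivative_tower E F U D" by blast
  note T = D(2)[unfolded derivative_tower_def]
  show ?thesis
    by (rule that[OF U D(1)[rule_format] T[THEN conjunct1, rule_format] T[THEN conjunct2, rule_format]])
qed

lemma smooth_betweenI:
  assumes "U \<subseteq> carr E" "\<And>u. u \<in> U \<Longrightarrow> D 0 u [] = f u"
    "\<And>j u. u \<in> U \<Longrightarrow> bounded_multilinear_between E F j (D j u)"
    "\<And>j u e. u \<in> U \<Longrightarrow> e > 0 \<Longrightarrow> \<exists>d>0. \<forall>u'\<in>U. nrm E (u' - u) < d \<longrightarrow>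
           (\<forall>vs. length vs = j \<and> set vs \<subseteq> carr E \<longrightarrow>
              nrm F (D j u' vs - D j u vs - D (Suc j) u ((u' - u) # vs)) \<le> e * nrm E (u' - u) * prod_list (map (nrm E) vs))"
  shows "smooth_between E F U f"
  unfolding smooth_between_iff_tower derivative_tower_def
  by (intro conjI exI[of _ D] ballI allI impI) (rule assms; assumption)+

lemma bounded_multilinear_betweenD:
  assumes "bounded_multilinear_between E F j M"
  shows "\<And>vs. length vs = j \<Longrightarrow> set vs \<subseteq> carr E \<Longrightarrow> M vs \<in> carr F"
    and "\<And>vs i. length vs = j \<Longrightarrow> set vs \<subseteq> carr E \<Longrightarrow> i < j \<Longrightarrow> linear_between E F (\<lambda>v. M (vs[i := v]))"
    and "\<exists>C. \<forall>vs. length vs = j \<and> set vs \<subseteq> carr E \<longrightarrow> nrm F (M vs) \<le> C * prod_list (map (nrm E) vs)"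
  using assms unfolding bounded_multilinear_between_def by blast+

text \<open>The map \<open>A\<close> is applied to every derivative of the tower; its bound is
  compensated by using \<open>e / a\<close> in the estimate for \<open>f\<close>.\<close>

lemma smooth_between_linear:
  assumes E: "nspace E" and F: "nspace F" and f: "smooth_between E F U f" and A: "bounded_linear_between F G A"
  shows "smooth_between E G U (\<lambda>u. A (f u))"
proof -
  interpret E: nspace E by fact
  interpret F: nspace F by fact
  obtain a where a: "0 < a" "\<And>v. v \<in> carr F \<Longrightarrow> nrm G (A v) \<le> a * nrm F v"
    by (rule bounded_linear_between_bound[OF A F]) (rule that)
  note AD = bounded_linear_betweenD[OF A]
  obtain D where U: "U \<subseteq> carr E" and D0: "\<And>u. u \<in> U \<Longrightarrow> D 0 u [] = f u"
    and Dm: "\<And>j u. u \<in> U \<Longrightarrow> bounded_multilinear_between E F j (D j u)"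
    and Dd: "\<And>j u e. u \<in> U \<Longrightarrow> e > 0 \<Longrightarrow> \<exists>d>0. \<forall>u'\<in>U. nrm E (u' - u) < d \<longrightarrow>
           (\<forall>vs. length vs = j \<and> set vs \<subseteq> carr E \<longrightarrow>
              nrm F (D j u' vs - D j u vs - D (Suc j) u ((u' - u) # vs)) \<le> e * nrm E (u' - u) * prod_list (map (nrm E) vs))"
    by (rule smooth_betweenE[OF f]) (rule that)
  have DF: "D j u vs \<in> carr F" if "u \<in> U" "length vs = j" "set vs \<subseteq> carr E" for j u vs
    using Dm[OF that(1), of j] that unfolding bounded_multilinear_between_def by blast
  have m1: "bounded_multilinear_between E G j (\<lambda>vs. A (D j u vs))" if u: "u \<in> U" for j u
    unfolding bounded_multilinear_between_def
  proof (intro conjI allI impI)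
    show "A (D j u vs) \<in> carr G" if "length vs = j \<and> set vs \<subseteq> carr E" for vs
      using AD(1) DF u that by blast
    show "linear_between E G (\<lambda>v. A (D j u (vs[i := v])))" if "length vs = j \<and> set vs \<subseteq> carr E \<and> i < j" for vs i
    proof -
      have "linear_between E F (\<lambda>v. D j u (vs[i := v]))"
        using Dm[OF u, of j] that unfolding bounded_multilinear_between_def by blast
      then show ?thesis using AD unfolding linear_between_def by simp
    qed
    obtain C where C: "\<And>vs. length vs = j \<and> set vs \<subseteq> carr E \<Longrightarrow> nrm F (D j u vs) \<le> C * prod_list (map (nrm E) vs)"
      using Dm[OF u, of j] unfolding bounded_multilinear_between_def by blast
    have "nrm G (A (D j u vs)) \<le> a * C * prod_list (map (nrm E) vs)" if "length vs = j \<and> set vs \<subseteq> carr E" for vs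
    proof -
      have "nrm G (A (D j u vs)) \<le> a * nrm F (D j u vs)" using a(2) DF u that by blast
      also have "\<dots> \<le> a * (C * prod_list (map (nrm E) vs))" using a(1) C[OF that] by (intro mult_left_mono) auto
      finally show ?thesis by simp
    qed
    then show "\<exists>C. \<forall>vs. length vs = j \<and> set vs \<subseteq> carr E \<longrightarrow> nrm G (A (D j u vs)) \<le> C * prod_list (map (nrm E) vs)"
      by blast
  qed
  have m2: "\<exists>d>0. \<forall>u'\<in>U. nrm E (u' - u) < d \<longrightarrow> (\<forall>vs. length vs = j \<and> set vs \<subseteq> carr E \<longrightarrow>
      nrm G (A (D j u' vs) - A (D j u vs) - A (D (Suc j) u ((u' - u) # vs))) \<le> e * nrm E (u' - u) * prod_list (map (nrm E) vs))"
    if u: "u \<in> U" and e: "e > 0" for j u e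
  proof -
    have "e / a > 0" using a e by simp
    from Dd[OF u this, of j] obtain d where d: "d > 0" "\<And>u' vs. u' \<in> U \<Longrightarrow> nrm E (u' - u) < d \<Longrightarrow> length vs = j \<Longrightarrow> set vs \<subseteq> carr E \<Longrightarrow>
        nrm F (D j u' vs - D j u vs - D (Suc j) u ((u' - u) # vs)) \<le> e / a * nrm E (u' - u) * prod_list (map (nrm E) vs)" by blast
    have "nrm G (A (D j u' vs) - A (D j u vs) - A (D (Suc j) u ((u' - u) # vs))) \<le> e * nrm E (u' - u) * prod_list (map (nrm E) vs)"
      if *: "u' \<in> U" "nrm E (u' - u) < d" "length vs = j" "set vs \<subseteq> carr E" for u' vs
    proof -
      have uu: "u' - u \<in> carr E" using subsetD[OF U *(1)] subsetD[OF U u] by auto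
      have m: "D j u' vs \<in> carr F" "D j u vs \<in> carr F" "D (Suc j) u ((u' - u) # vs) \<in> carr F"
        using DF[OF *(1,3,4)] DF[OF u *(3,4)] DF[OF u, of "(u' - u) # vs" "Suc j"] uu *(3,4) by auto
      have "A (D j u' vs) - A (D j u vs) - A (D (Suc j) u ((u' - u) # vs)) = A (D j u' vs - D j u vs - D (Suc j) u ((u' - u) # vs))"
        using bounded_linear_between_diff[OF A F] m by simp
      then have "nrm G (A (D j u' vs) - A (D j u vs) - A (D (Suc j) u ((u' - u) # vs))) \<le> a * nrm F (D j u' vs - D j u vs - D (Suc j) u ((u' - u) # vs))"
        using a(2) m by simp
      also have "\<dots> \<le> a * (e / a * nrm E (u' - u) * prod_list (map (nrm E) vs))" using a(1) d(2)[OF *] by (intro mult_left_mono) auto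
      finally show ?thesis using a by simp
    qed
    then show ?thesis using d(1) by blast
  qed
  have m0: "A (D 0 u []) = A (f u)" if "u \<in> U" for u using D0 that by simp
  show ?thesis by (rule smooth_betweenI[where D = "\<lambda>j u vs. A (D j u vs)", OF U m0 m1 m2])
qed

lemma smooth_between_cong:
  assumes "smooth_between E F U f" "\<And>u. u \<in> U \<Longrightarrow> f u = g u"
  shows "smooth_between E F U g"
  using assms(1) unfolding smooth_between_iff_tower by (simp add: assms(2) cong: ball_cong)

context holder
begin

text \<open>Closedness of time differentiation: convergence of the functions, possibly in a weaker
  norm, together with convergence of their derivatives identifies the derivative of the
  limit.\<close>

lemma H_SucI_limit:
  assumes F: "\<And>n. F n \<in> carr (H (Suc j))" and f: "f \<in> carr (H i)" and g: "g \<in> carr (H j)"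
    and lim: "(\<lambda>n. nrm (H i) (F n - f)) \<longlonglongrightarrow> 0" "(\<lambda>n. nrm (H j) (deriv (F n) - g)) \<longlonglongrightarrow> 0"
    and sub: "\<And>n. F n \<in> carr (H i)"
  shows "f \<in> carr (H (Suc j))" "deriv f = g"
proof -
  have pt: "(\<lambda>n. F n t) \<longlonglongrightarrow> f t" for t
  proof -
    have "\<forall>\<^sub>F n in sequentially. norm (F n t - f t) \<le> nrm (H i) (F n - f)"
      using H_le_nrm[OF H.diff_carr[OF sub f], of _ t] by (simp add: minus_apply)
    then have "(\<lambda>n. F n t - f t) \<longlonglongrightarrow> 0" by (rule Lim_null_comparison[OF _ lim(1)])
    then show ?thesis by (rule LIM_zero_cancel)
  qed
  have der: "(f has_real_derivative g t) (at t)" for t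
  proof -
    have "\<exists>h. \<forall>t\<in>UNIV. (\<lambda>n. F n t) \<longlonglongrightarrow> h t \<and> (h has_derivative (\<lambda>v. v * g t)) (at t within UNIV)"
    proof (rule has_derivative_sequence[of UNIV F "\<lambda>n t v. v * deriv (F n) t" "\<lambda>t v. v * g t" 0 "f 0"])
      show "(F n has_derivative (\<lambda>v. v * deriv (F n) t)) (at t within UNIV)" for n t
        using H_has_derivative[OF F, of n t] by (simp add: has_field_derivative_def mult.commute[of _ "deriv (F n) t"])
      fix e :: real assume e: "0 < e"
      have "\<forall>\<^sub>F n in sequentially. nrm (H j) (deriv (F n) - g) < e" by (rule order_tendstoD(2)[OF lim(2) e])
      then show "\<forall>\<^sub>F n in sequentially. \<forall>t\<in>UNIV. \<forall>v. norm (v * deriv (F n) t - v * g t) \<le> e * norm v"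
      proof (rule eventually_mono, intro ballI allI)
        fix n t and v :: real assume *: "nrm (H j) (deriv (F n) - g) < e"
        have "\<bar>deriv (F n) t - g t\<bar> \<le> e"
          using H_le_nrm[OF H.diff_carr[OF H_deriv[OF F] g], of n t] * by (simp add: minus_apply)
        then have "\<bar>v\<bar> * \<bar>deriv (F n) t - g t\<bar> \<le> \<bar>v\<bar> * e" by (intro mult_left_mono) auto
        then show "norm (v * deriv (F n) t - v * g t) \<le> e * norm v"
          by (simp add: abs_mult mult.commute flip: right_diff_distrib)
      qed
    qed (use pt in auto)
    then obtain h where h: "\<And>t. (\<lambda>n. F n t) \<longlonglongrightarrow> h t" "\<And>t. (h has_derivative (\<lambda>v. v * g t)) (at t)"
      by auto
    have "h = f" using h(1) pt LIMSEQ_unique by blast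
    then show ?thesis using h(2)[of t] by (simp add: has_field_derivative_def mult.commute[of _ "g t"])
  qed
  show "f \<in> carr (H (Suc j))" "deriv f = g" using H_SucI[OF H_periodic[OF f] der g] by auto
qed

text \<open>
  The derivatives of \<open>u \<mapsto> deriv (f u)\<close> are the time derivatives of those of \<open>f\<close>: difference quotients
  converge together with their time derivatives.
\<close>

lemma smooth_between_H_Suc:
  assumes E: "nspace E" and f: "smooth_between E (H j) U f" and f': "smooth_between E (H j) U (\<lambda>u. deriv (f u))"
    and fU: "\<And>u. u \<in> U \<Longrightarrow> f u \<in> carr (H (Suc j))"
    and open_U: "\<And>u. u \<in> U \<Longrightarrow> \<exists>d>0. \<forall>u'\<in>carr E. nrm E (u' - u) < d \<longrightarrow> u' \<in> U"
  shows "smooth_between E (H (Suc j)) U f"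
proof -
  interpret E: nspace E by fact
  obtain D where U: "U \<subseteq> carr E" and D0: "\<And>u. u \<in> U \<Longrightarrow> D 0 u [] = f u"
    and Dm: "\<And>k u. u \<in> U \<Longrightarrow> bounded_multilinear_between E (H j) k (D k u)"
    and Dd: "\<And>k u e. u \<in> U \<Longrightarrow> e > 0 \<Longrightarrow> \<exists>d>0. \<forall>u'\<in>U. nrm E (u' - u) < d \<longrightarrow>
           (\<forall>vs. length vs = k \<and> set vs \<subseteq> carr E \<longrightarrow>
              nrm (H j) (D k u' vs - D k u vs - D (Suc k) u ((u' - u) # vs)) \<le> e * nrm E (u' - u) * prod_list (map (nrm E) vs))"
    by (rule smooth_betweenE[OF f]) (rule that)
  obtain D' where D'0: "\<And>u. u \<in> U \<Longrightarrow> D' 0 u [] = deriv (f u)"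
    and D'm: "\<And>k u. u \<in> U \<Longrightarrow> bounded_multilinear_between E (H j) k (D' k u)"
    and D'd: "\<And>k u e. u \<in> U \<Longrightarrow> e > 0 \<Longrightarrow> \<exists>d>0. \<forall>u'\<in>U. nrm E (u' - u) < d \<longrightarrow>
           (\<forall>vs. length vs = k \<and> set vs \<subseteq> carr E \<longrightarrow>
              nrm (H j) (D' k u' vs - D' k u vs - D' (Suc k) u ((u' - u) # vs)) \<le> e * nrm E (u' - u) * prod_list (map (nrm E) vs))"
    by (rule smooth_betweenE[OF f']) (rule that)
  \<comment> \<open>Stated for an arbitrary tower because it is applied to the derivatives of
    \<open>f\<close> as well as to those of \<open>deriv f\<close>. The steps
    \<open>s / real (Suc n)\<close> along one direction suffice.\<close>
  have quotient: "(\<lambda>n. nrm (H j) ((real (Suc n) / s) *\<^sub>R (T k (u + (s / real (Suc n)) *\<^sub>R h) vs - T k u vs) - T (Suc k) u (h # vs))) \<longlonglongrightarrow> 0"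
    if u: "u \<in> U" and h: "h \<in> carr E" and vs: "length vs = k" "set vs \<subseteq> carr E"
      and s: "0 < s" "\<And>n. u + (s / real (Suc n)) *\<^sub>R h \<in> U"
      and Tm: "\<And>k u. u \<in> U \<Longrightarrow> bounded_multilinear_between E (H j) k (T k u)"
      and Td: "\<And>k u e. u \<in> U \<Longrightarrow> e > 0 \<Longrightarrow> \<exists>d>0. \<forall>u'\<in>U. nrm E (u' - u) < d \<longrightarrow>
           (\<forall>vs. length vs = k \<and> set vs \<subseteq> carr E \<longrightarrow>
              nrm (H j) (T k u' vs - T k u vs - T (Suc k) u ((u' - u) # vs)) \<le> e * nrm E (u' - u) * prod_list (map (nrm E) vs))"
    for T :: "nat \<Rightarrow> 'a \<Rightarrow> 'a list \<Rightarrow> real \<Rightarrow> real" and k u h vs s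
  proof (rule LIMSEQ_I)
    fix e :: real assume e: "0 < e"
    have TH: "T k u vs \<in> carr (H j)" if "u \<in> U" "length vs = k" "set vs \<subseteq> carr E" for k u vs
      using Tm[OF that(1), of k] that unfolding bounded_multilinear_between_def by blast
    define q where "q = prod_list (map (nrm E) vs)"
    have q: "0 \<le> q" unfolding q_def by (rule prod_list_nonneg) (use vs E.nrm_ge_0 in auto)
    define M where "M = nrm E h * q + 1"
    have M: "0 < M" using q E.nrm_ge_0[OF h] by (auto simp: M_def intro!: add_nonneg_pos)
    have "e / (2 * M) > 0" using e M by simp
    from Td[OF u this, of k] obtain d where d: "d > 0" "\<And>u'. u' \<in> U \<Longrightarrow> nrm E (u' - u) < d \<Longrightarrow>
        nrm (H j) (T k u' vs - T k u vs - T (Suc k) u ((u' - u) # vs)) \<le> e / (2 * M) * nrm E (u' - u) * q"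
      using vs unfolding q_def by blast
    have "(\<lambda>n. s * nrm E h / real (Suc n)) \<longlonglongrightarrow> 0" by (rule LIMSEQ_Suc[OF lim_const_over_n])
    from order_tendstoD(2)[OF this d(1)] obtain n0 where n0: "\<And>n. n \<ge> n0 \<Longrightarrow> s * nrm E h / real (Suc n) < d"
      by (auto simp: eventually_sequentially)
    have "norm (nrm (H j) ((real (Suc n) / s) *\<^sub>R (T k (u + (s / real (Suc n)) *\<^sub>R h) vs - T k u vs) - T (Suc k) u (h # vs)) - 0) < e"
      if n: "n \<ge> n0" for n
    proof -
      define c where "c = s / real (Suc n)"
      have c: "0 < c" "1 / c = real (Suc n) / s" using s by (auto simp: c_def)
      define u' where "u' = u + c *\<^sub>R h"
      have u': "u' \<in> U" using s(2)[of n] by (simp add: u'_def c_def)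
      have nu': "nrm E (u' - u) = c * nrm E h" using h c by (simp add: u'_def E.nrm_scale)
      have near: "nrm E (u' - u) < d" using n0[OF n] unfolding nu' by (simp add: c_def)
      have m: "T k u' vs \<in> carr (H j)" "T k u vs \<in> carr (H j)" "T (Suc k) u (h # vs) \<in> carr (H j)"
        using u u' vs h by (auto intro!: TH)
      have "linear_between E (H j) (\<lambda>v. T (Suc k) u ((h # vs)[0 := v]))"
        by (rule bounded_multilinear_betweenD(2)[OF Tm[OF u]]) (use vs h in auto)
      then have "T (Suc k) u ((c *\<^sub>R h) # vs) = c *\<^sub>R T (Suc k) u (h # vs)"
        using h unfolding linear_between_def by simp
      then have eq: "(1 / c) *\<^sub>R (T k u' vs - T k u vs) - T (Suc k) u (h # vs) =
          (1 / c) *\<^sub>R (T k u' vs - T k u vs - T (Suc k) u ((u' - u) # vs))"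
        using c(1) by (simp add: u'_def scaleR_diff_right)
      have "nrm (H j) ((1 / c) *\<^sub>R (T k u' vs - T k u vs) - T (Suc k) u (h # vs)) =
          (1 / c) * nrm (H j) (T k u' vs - T k u vs - T (Suc k) u ((u' - u) # vs))"
      proof -
        have "T k u' vs - T k u vs - T (Suc k) u ((u' - u) # vs) \<in> carr (H j)"
          using m TH[OF u, of "(u' - u) # vs" "Suc k"] subsetD[OF U u] subsetD[OF U u'] vs by auto
        then show ?thesis unfolding eq using c(1) by (simp only: H.nrm_scale) simp
      qed
      also have "\<dots> \<le> (1 / c) * (e / (2 * M) * (c * nrm E h) * q)"
        using d(2)[OF u' near] c(1) unfolding nu' by (intro mult_left_mono) auto
      also have "\<dots> = e / 2 * ((nrm E h * q) / M)" using c M by (simp add: field_simps)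
      also have "\<dots> \<le> e / 2 * 1" using e M by (intro mult_left_mono) (auto simp: M_def field_simps)
      finally have "nrm (H j) ((1 / c) *\<^sub>R (T k u' vs - T k u vs) - T (Suc k) u (h # vs)) < e" using e by simp
      moreover have "0 \<le> nrm (H j) ((1 / c) *\<^sub>R (T k u' vs - T k u vs) - T (Suc k) u (h # vs))"
        by (rule H.nrm_ge_0) (use m in auto)
      ultimately show ?thesis unfolding c(2) u'_def c_def by simp
    qed
    then show "\<exists>n0. \<forall>n\<ge>n0. norm (nrm (H j) ((real (Suc n) / s) *\<^sub>R (T k (u + (s / real (Suc n)) *\<^sub>R h) vs - T k u vs) - T (Suc k) u (h # vs)) - 0) < e"
      by blast
  qed
  \<comment> \<open>Induction on the order of the derivative: the next one is a limit of difference
    quotients whose time derivatives converge as well, and time differentiation is closed.\<close>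
  have commute: "D k u vs \<in> carr (H (Suc j)) \<and> deriv (D k u vs) = D' k u vs"
    if "u \<in> U" "length vs = k" "set vs \<subseteq> carr E" for k u vs
    using that
  proof (induction k arbitrary: u vs)
    case 0
    then show ?case using D0 D'0 fU by simp
  next
    case (Suc k)
    then obtain h ws where vs: "vs = h # ws" "length ws = k" "set ws \<subseteq> carr E" and h: "h \<in> carr E"
      by (cases vs) auto
    obtain d where d: "d > 0" "\<And>u'. u' \<in> carr E \<Longrightarrow> nrm E (u' - u) < d \<Longrightarrow> u' \<in> U"
      using open_U[OF Suc.prems(1)] by blast
    have u: "u \<in> carr E" using Suc.prems(1) U by blast
    \<comment> \<open>With this step length all points of the difference quotients stay in the ball
      of radius \<open>d\<close> and therefore in \<open>U\<close>; the summand 1 covers directions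
      of norm 0.\<close>
    define s where "s = d / (nrm E h + 1)"
    have nh: "0 \<le> nrm E h" by (rule E.nrm_ge_0[OF h])
    have s: "0 < s" using d(1) nh by (simp add: s_def add_nonneg_pos)
    have inU: "u + (s / real (Suc n)) *\<^sub>R h \<in> U" for n
    proof (rule d(2))
      show "u + (s / real (Suc n)) *\<^sub>R h \<in> carr E" using u h by auto
      have "s / real (Suc n) * nrm E h \<le> s * nrm E h"
        using s nh by (intro mult_right_mono) (auto simp: divide_le_eq mult_le_cancel_left1)
      also have "\<dots> < d"
      proof -
        have "d * nrm E h < d * (nrm E h + 1)" using d(1) by simp
        then show ?thesis using nh by (simp add: s_def divide_less_eq)
      qed
      finally show "nrm E (u + (s / real (Suc n)) *\<^sub>R h - u) < d" using s h by (simp add: E.nrm_scale)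
    qed
    define F where "F n = (real (Suc n) / s) *\<^sub>R (D k (u + (s / real (Suc n)) *\<^sub>R h) ws - D k u ws)" for n
    have IH: "D k u' ws \<in> carr (H (Suc j))" "deriv (D k u' ws) = D' k u' ws" if "u' \<in> U" for u'
      using Suc.IH[OF that vs(2,3)] by auto
    have F: "F n \<in> carr (H (Suc j))" for n unfolding F_def using IH(1)[OF inU[of n]] IH(1)[OF Suc.prems(1)] by auto
    have dF: "deriv (F n) = (real (Suc n) / s) *\<^sub>R (D' k (u + (s / real (Suc n)) *\<^sub>R h) ws - D' k u ws)" for n
      unfolding F_def using IH[OF inU[of n]] IH[OF Suc.prems(1)]
      by (simp only: deriv_scale_H[of _ j] deriv_diff_H[of _ j] H.diff_carr)
    have DH: "D (Suc k) u vs \<in> carr (H j)" "D' (Suc k) u vs \<in> carr (H j)"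
      using Dm[OF Suc.prems(1), of "Suc k"] D'm[OF Suc.prems(1), of "Suc k"] Suc.prems unfolding bounded_multilinear_between_def by blast+
    have l1: "(\<lambda>n. nrm (H j) (F n - D (Suc k) u vs)) \<longlonglongrightarrow> 0"
      unfolding F_def vs(1) by (rule quotient[OF Suc.prems(1) h vs(2,3) s inU Dm Dd])
    have l2: "(\<lambda>n. nrm (H j) (deriv (F n) - D' (Suc k) u vs)) \<longlonglongrightarrow> 0"
      unfolding dF vs(1) by (rule quotient[OF Suc.prems(1) h vs(2,3) s inU D'm D'd])
    show ?case
      using H_SucI_limit[OF F DH(1,2) l1 l2] F H_Suc_subset by blast
  qed
  have nSuc: "nrm (H (Suc j)) g \<le> nrm (H j) g + nrm (H j) (deriv g)" if "g \<in> carr (H (Suc j))" for g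
    using sup_norm_le_nrm[of g j] H_Suc_subset[OF that] by (auto simp: nrm_H_Suc)
  have m1: "bounded_multilinear_between E (H (Suc j)) k (D k u)" if u: "u \<in> U" for k u
    unfolding bounded_multilinear_between_def
  proof (intro conjI allI impI)
    show "D k u vs \<in> carr (H (Suc j))" if "length vs = k \<and> set vs \<subseteq> carr E" for vs
      using commute u that by blast
    show "linear_between E (H (Suc j)) (\<lambda>v. D k u (vs[i := v]))" if vs: "length vs = k \<and> set vs \<subseteq> carr E \<and> i < k" for vs i
    proof -
      have "linear_between E (H j) (\<lambda>v. D k u (vs[i := v]))"
        using Dm[OF u, of k] vs unfolding bounded_multilinear_between_def by blast
      moreover have "D k u (vs[i := v]) \<in> carr (H (Suc j))" if "v \<in> carr E" for v
        using commute[OF u, of "vs[i := v]" k] vs that set_update_subset_insert[of vs i v] by auto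
      ultimately show ?thesis unfolding linear_between_def by blast
    qed
    obtain C where C: "\<And>vs. length vs = k \<and> set vs \<subseteq> carr E \<Longrightarrow> nrm (H j) (D k u vs) \<le> C * prod_list (map (nrm E) vs)"
      using Dm[OF u, of k] unfolding bounded_multilinear_between_def by blast
    obtain C' where C': "\<And>vs. length vs = k \<and> set vs \<subseteq> carr E \<Longrightarrow> nrm (H j) (D' k u vs) \<le> C' * prod_list (map (nrm E) vs)"
      using D'm[OF u, of k] unfolding bounded_multilinear_between_def by blast
    have "nrm (H (Suc j)) (D k u vs) \<le> (C + C') * prod_list (map (nrm E) vs)" if "length vs = k \<and> set vs \<subseteq> carr E" for vs
    proof -
      have "D k u vs \<in> carr (H (Suc j))" "deriv (D k u vs) = D' k u vs" using commute u that by auto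
      then show ?thesis using nSuc[of "D k u vs"] C[OF that] C'[OF that] by (simp add: distrib_right)
    qed
    then show "\<exists>C. \<forall>vs. length vs = k \<and> set vs \<subseteq> carr E \<longrightarrow> nrm (H (Suc j)) (D k u vs) \<le> C * prod_list (map (nrm E) vs)"
      by blast
  qed
  have m2: "\<exists>d>0. \<forall>u'\<in>U. nrm E (u' - u) < d \<longrightarrow> (\<forall>vs. length vs = k \<and> set vs \<subseteq> carr E \<longrightarrow>
      nrm (H (Suc j)) (D k u' vs - D k u vs - D (Suc k) u ((u' - u) # vs)) \<le> e * nrm E (u' - u) * prod_list (map (nrm E) vs))"
    if u: "u \<in> U" and e: "e > 0" for k u e
  proof -
    have e2: "e / 2 > 0" using e by simp
    from Dd[OF u this, of k] obtain d where d: "d > 0" "\<And>u' vs. u' \<in> U \<Longrightarrow> nrm E (u' - u) < d \<Longrightarrow> length vs = k \<Longrightarrow> set vs \<subseteq> carr E \<Longrightarrow>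
        nrm (H j) (D k u' vs - D k u vs - D (Suc k) u ((u' - u) # vs)) \<le> e / 2 * nrm E (u' - u) * prod_list (map (nrm E) vs)" by blast
    from D'd[OF u e2, of k] obtain d' where d': "d' > 0" "\<And>u' vs. u' \<in> U \<Longrightarrow> nrm E (u' - u) < d' \<Longrightarrow> length vs = k \<Longrightarrow> set vs \<subseteq> carr E \<Longrightarrow>
        nrm (H j) (D' k u' vs - D' k u vs - D' (Suc k) u ((u' - u) # vs)) \<le> e / 2 * nrm E (u' - u) * prod_list (map (nrm E) vs)" by blast
    have step: "nrm (H (Suc j)) (D k u' vs - D k u vs - D (Suc k) u ((u' - u) # vs)) \<le> e * nrm E (u' - u) * prod_list (map (nrm E) vs)"
      if *: "u' \<in> U" "nrm E (u' - u) < min d d'" "length vs = k" "set vs \<subseteq> carr E" for u' vs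
    proof -
      have "u' - u \<in> carr E" using * u U by auto
      then have c: "D k u' vs \<in> carr (H (Suc j)) \<and> deriv (D k u' vs) = D' k u' vs" "D k u vs \<in> carr (H (Suc j)) \<and> deriv (D k u vs) = D' k u vs"
        "D (Suc k) u ((u' - u) # vs) \<in> carr (H (Suc j)) \<and> deriv (D (Suc k) u ((u' - u) # vs)) = D' (Suc k) u ((u' - u) # vs)"
        using commute[OF *(1,3,4)] commute[OF u *(3,4)] commute[OF u, of "(u' - u) # vs" "Suc k"] * by auto
      have "deriv (D k u' vs - D k u vs - D (Suc k) u ((u' - u) # vs)) = D' k u' vs - D' k u vs - D' (Suc k) u ((u' - u) # vs)"
        using c by (simp add: deriv_diff_H[of _ j])
      then show ?thesis
        using nSuc[of "D k u' vs - D k u vs - D (Suc k) u ((u' - u) # vs)"] c d(2)[OF *(1) _ *(3,4)] d'(2)[OF *(1) _ *(3,4)] *(2) by simp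
    qed
    have "min d d' > 0" using d(1) d'(1) by simp
    then show ?thesis using step by blast
  qed
  show ?thesis by (rule smooth_betweenI[where D = D, OF U D0 m1 m2])
qed

end

section \<open>Smooth dependence of solutions\<close>

text \<open>What the implicit function theorem delivers: solutions over \<open>U\<close>, a uniform
  bound \<open>b\<close> for the inverse linearizations and a Lipschitz bound \<open>K\<close>.
  Smoothness of the family is derived from these data.\<close>

locale solution_family = periodic_system +
  fixes U :: "rfun set" and sol :: "rfun \<Rightarrow> real \<times> real \<times> rfun" and b K :: real
  assumes U: "U \<subseteq> carr (H r)"
    and sol_carr: "u \<in> U \<Longrightarrow> sol u \<in> carr (YS r)"
    and sol_admissible: "u \<in> U \<Longrightarrow> admissible (bvec u (sol u))"
    and sol_sysmap: "u \<in> U \<Longrightarrow> sysmap u (sol u) = 0"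
    and b: "0 < b" and K: "0 \<le> K"
    and sol_inverse: "u \<in> U \<Longrightarrow> inverse_bounded_by (YS r) (ZS r) (lin (bvec u (sol u)) 0) b"
    and sol_lipschitz: "u \<in> U \<Longrightarrow> u' \<in> U \<Longrightarrow> nrm (YS r) (sol u' - sol u) \<le> K * nrm (H r) (u' - u)"
begin

definition V :: "rfun \<Rightarrow> bvar \<Rightarrow> real \<Rightarrow> real" where "V u = bvec u (sol u)"

text \<open>The inverse of the linearization in the unknowns at the solution over \<open>u\<close>.
  The choice is determined, since the lower bound makes this linearization injective.\<close>

definition Sg :: "rfun \<Rightarrow> rfun \<times> real \<times> real \<Rightarrow> real \<times> real \<times> rfun" where
  "Sg u z = (SOME y. y \<in> carr (YS r) \<and> lin (V u) 0 y = z)"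

text \<open>A component of the inverse linearization. The scalar data enter as integrals of
  functions, so that the arguments and the value all lie in \<open>H r\<close>, as the calculus of
  tame families demands.\<close>

definition op :: "bvar \<Rightarrow> rfun \<Rightarrow> rfun \<Rightarrow> rfun \<Rightarrow> rfun \<Rightarrow> real \<Rightarrow> real" where
  "op i u f g h = bvec 0 (Sg u (f, intP g, intP h)) i"

definition gens :: "(rfun \<Rightarrow> real \<Rightarrow> real) set" where
  "gens = {\<lambda>u. nemytskii e (V u) | e. \<forall>u\<in>U. ok_on e (V u)}"

lemma UD: "u \<in> U \<Longrightarrow> u \<in> carr (H r)" using U by blast

lemma V_carr: "u \<in> U \<Longrightarrow> V u \<in> carr (VS r)"
  unfolding V_def by (rule vec_carr[OF UD sol_carr])

lemma V_admissible: "u \<in> U \<Longrightarrow> admissible (V u)"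
  unfolding V_def by (rule sol_admissible)

lemma bounded_linear_linV: "u \<in> U \<Longrightarrow> bounded_linear_between (YS r) (ZS r) (lin (V u) 0)"
  unfolding V_def by (rule bounded_linear_lin0[OF UD sol_carr sol_admissible])

lemma invV: "u \<in> U \<Longrightarrow> inverse_bounded_by (YS r) (ZS r) (lin (V u) 0) b"
  unfolding V_def by (rule sol_inverse)

lemma nrm_le_lin: "u \<in> U \<Longrightarrow> y \<in> carr (YS r) \<Longrightarrow> nrm (YS r) y \<le> b * nrm (ZS r) (lin (V u) 0 y)"
  using invV unfolding inverse_bounded_by_def by blast

lemma Sg: "u \<in> U \<Longrightarrow> z \<in> carr (ZS r) \<Longrightarrow> Sg u z \<in> carr (YS r) \<and> lin (V u) 0 (Sg u z) = z"
  unfolding Sg_def by (rule someI_ex) (use invV[of u] in \<open>unfold inverse_bounded_by_def, blast\<close>)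

lemmas Sg_carr = Sg[THEN conjunct1] and lin_Sg = Sg[THEN conjunct2]

lemma nrm_Sg: "u \<in> U \<Longrightarrow> z \<in> carr (ZS r) \<Longrightarrow> nrm (YS r) (Sg u z) \<le> b * nrm (ZS r) z"
  using nrm_le_lin[of u "Sg u z"] Sg[of u z] by simp

lemma Sg_unique: "u \<in> U \<Longrightarrow> y \<in> carr (YS r) \<Longrightarrow> Sg u (lin (V u) 0 y) = y"
  using inverse_bounded_by_inj[OF nspace_YS nspace_ZS bounded_linear_linV invV, of u "Sg u (lin (V u) 0 y)" y]
    Sg[of u "lin (V u) 0 y"] bounded_linear_betweenD(1)[OF bounded_linear_linV, of u y] by blast

lemma Sg_add:
  assumes "u \<in> U" "z \<in> carr (ZS r)" "z' \<in> carr (ZS r)"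
  shows "Sg u (z + z') = Sg u z + Sg u z'"
proof -
  have "z + z' = lin (V u) 0 (Sg u z + Sg u z')"
    using bounded_linear_betweenD(2)[OF bounded_linear_linV[OF assms(1)] Sg_carr[OF assms(1,2)] Sg_carr[OF assms(1,3)]]
    by (simp only: lin_Sg assms)
  then show ?thesis using Sg_unique[OF assms(1) YS.add_carr[OF Sg_carr[OF assms(1,2)] Sg_carr[OF assms(1,3)]]] by simp
qed

lemma Sg_scale:
  assumes "u \<in> U" "z \<in> carr (ZS r)"
  shows "Sg u (c *\<^sub>R z) = c *\<^sub>R Sg u z"
proof -
  have "c *\<^sub>R z = lin (V u) 0 (c *\<^sub>R Sg u z)"
    using bounded_linear_betweenD(3)[OF bounded_linear_linV[OF assms(1)] Sg_carr[OF assms], of c]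
    by (simp only: lin_Sg assms)
  then show ?thesis using Sg_unique[OF assms(1) YS.scale_carr[OF Sg_carr[OF assms]]] by simp
qed

lemma Sg_uminus:
  assumes "u \<in> U" "z \<in> carr (ZS r)"
  shows "Sg u (- z) = - Sg u z"
  using Sg_scale[OF assms, of "-1"] by simp

lemma triple_carr: "f \<in> carr (H r) \<Longrightarrow> (f, x, y) \<in> carr (ZS r)"
  by simp

lemma nrm_vec0_le: "y \<in> carr (YS r) \<Longrightarrow> nrm (VS r) (bvec 0 y) \<le> 12 * nrm (YS r) y"
  using nrm_vec_le[OF H.zero_carr, of y r] by simp

lemma vec0_carr: "y \<in> carr (YS r) \<Longrightarrow> bvec 0 y \<in> carr (VS r)"
  by (rule vec_carr[OF H.zero_carr])

lemma vec0_diff: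
  assumes "y \<in> carr (YS r)" "y' \<in> carr (YS r)"
  shows "bvec 0 (y - y') i = bvec 0 y i - bvec 0 y' i"
proof -
  have "bvec (0 + 0) ((y - y') + y') = bvec 0 (y - y') + bvec 0 y'"
    by (rule vec_add[OF YS.diff_carr[OF assms] assms(2)])
  then have "bvec 0 y i = bvec 0 (y - y') i + bvec 0 y' i" by (simp add: plus_fun_apply)
  then show ?thesis by simp
qed

lemma nrm_vec0_component:
  "y \<in> carr (YS r) \<Longrightarrow> nrm (H r) (bvec 0 y i) \<le> 12 * nrm (YS r) y"
  using nrm_vec0_le[of y] H.nrm_component_le[OF vec0_carr, of y i] by linarith

text \<open>A common bound for the weights 1 and \<open>P\<close> with which a function and an
  integral over a period enter the norm of the data.\<close>

definition mass :: real where "mass = 1 + P"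

lemma mass: "1 \<le> mass" "P \<le> mass" using P by (auto simp: mass_def)

lemma nrm_triple_le:
  assumes "f \<in> carr (H r)" "g \<in> carr (H r)" "h \<in> carr (H r)"
  shows "nrm (ZS r) (f, intP g, intP h) \<le> mass * (nrm (H r) f + nrm (H r) g + nrm (H r) h)"
proof -
  have "nrm (H r) f \<le> mass * nrm (H r) f" "P * nrm (H r) g \<le> mass * nrm (H r) g" "P * nrm (H r) h \<le> mass * nrm (H r) h"
    using mass H.nrm_ge_0 assms mult_right_mono[of 1 mass "nrm (H r) f"] by (auto intro!: mult_right_mono)
  then show ?thesis
    using intP_le[OF assms(2) order_refl] intP_le[OF assms(3) order_refl] by (simp add: nrm_ZS distrib_left)
qed

text \<open>
  \<open>V1 u h\<close> is the derivative of \<open>V\<close>: differentiating \<open>sysmap u (sol u) = 0\<close> determines the part that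
  comes from \<open>sol\<close>.
\<close>

definition V1 :: "rfun \<Rightarrow> rfun \<Rightarrow> bvar \<Rightarrow> real \<Rightarrow> real" where
  "V1 u h = bvec h (- Sg u (lin (V u) h 0))"

lemma linV_carr: "u \<in> U \<Longrightarrow> h \<in> carr (H r) \<Longrightarrow> y \<in> carr (YS r) \<Longrightarrow> lin (V u) h y \<in> carr (ZS r)"
  unfolding V_def by (rule lin_carr[OF UD sol_carr sol_admissible])

lemma V1_carr: "u \<in> U \<Longrightarrow> h \<in> carr (H r) \<Longrightarrow> V1 u h \<in> carr (VS r)"
  unfolding V1_def by (rule vec_carr[OF _ YS.uminus_carr[OF Sg_carr[OF _ linV_carr[OF _ _ YS.zero_carr]]]])

lemma nrm_V_diff_le:
  assumes "u \<in> U" "u' \<in> U"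
  shows "nrm (VS r) (V u' - V u) \<le> 12 * (1 + K) * nrm (H r) (u' - u)"
proof -
  have m: "sol u' - sol u \<in> carr (YS r)" by (rule YS.diff_carr[OF sol_carr sol_carr]) (use assms in auto)
  have "bvec ((u' - u) + u) ((sol u' - sol u) + sol u) = bvec (u' - u) (sol u' - sol u) + bvec u (sol u)"
    by (rule vec_add[OF m sol_carr[OF assms(1)]])
  then have "V u' - V u = bvec (u' - u) (sol u' - sol u)" by (simp add: V_def)
  then have "nrm (VS r) (V u' - V u) \<le> 12 * (nrm (H r) (u' - u) + nrm (YS r) (sol u' - sol u))"
    using nrm_vec_le[OF H.diff_carr[OF UD UD] m] assms by simp
  then show ?thesis using sol_lipschitz[OF assms] by (simp add: algebra_simps)
qed

text \<open>Implicit differentiation. Since the system vanishes at both solutions, its strict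
  differentiability makes the linearization small on the true increment; the bounded inverse then
  compares this increment with the candidate that makes the linearization vanish exactly.\<close>

lemma V_derivative:
  assumes u: "u \<in> U" and e: "0 < e"
  shows "\<exists>d>0. \<forall>u'\<in>U. nrm (H r) (u' - u) < d \<longrightarrow> nrm (VS r) (V u' - V u - V1 u (u' - u)) \<le> e * nrm (H r) (u' - u)"
proof -
  \<comment> \<open>Chosen to cancel three losses: 12 for the encoding, \<open>b\<close> for the
    inverse, and \<open>1 + K\<close> for the joint increment of the warp and the solution.\<close>
  define e' where "e' = e / (12 * b * (1 + K))"
  have e': "0 < e'" using e b K by (simp add: e'_def)
  obtain d where d: "d > 0" "\<And>z. z \<in> carr (XS r) \<Longrightarrow> nrm (XS r) (z - (u, sol u)) < d \<Longrightarrow> sysmap (fst z) (snd z) \<in> carr (ZS r)"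
    "\<And>z z'. z \<in> carr (XS r) \<Longrightarrow> z' \<in> carr (XS r) \<Longrightarrow> nrm (XS r) (z - (u, sol u)) < d \<Longrightarrow> nrm (XS r) (z' - (u, sol u)) < d \<Longrightarrow>
      nrm (ZS r) (sysmap (fst z) (snd z) - sysmap (fst z') (snd z') - lin (bvec u (sol u)) (fst (z - z')) (snd (z - z'))) \<le> e' * nrm (XS r) (z - z')"
    by (rule strict_derivative_atE[OF strict_derivative_sysmap[OF UD[OF u] sol_carr[OF u] sol_admissible[OF u]] e']) (rule that)
  define d' where "d' = d / (1 + K)"
  have d': "0 < d'" using d(1) K by (simp add: d'_def)
  have step: "nrm (VS r) (V u' - V u - V1 u (u' - u)) \<le> e * nrm (H r) (u' - u)" if u': "u' \<in> U" "nrm (H r) (u' - u) < d'" for u'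
  proof -
    define k where "k = nrm (H r) (u' - u)"
    define h y where "h = u' - u" and "y = sol u' - sol u"
    have h: "h \<in> carr (H r)" unfolding h_def by (rule H.diff_carr[OF UD UD]) (use u u' in auto)
    have y: "y \<in> carr (YS r)" unfolding y_def by (rule YS.diff_carr[OF sol_carr sol_carr]) (use u u' in auto)
    have X: "(u, sol u) \<in> carr (XS r)" "(u', sol u') \<in> carr (XS r)" using UD sol_carr u u' by auto
    have diff: "(u', sol u') - (u, sol u) = (h, y)" by (simp add: h_def y_def)
    have nX: "nrm (XS r) ((u', sol u') - (u, sol u)) \<le> (1 + K) * k"
      unfolding diff nrm_prod_nspace[of "H r"] using sol_lipschitz[OF u u'(1)] by (simp add: k_def h_def y_def algebra_simps)
    also have "(1 + K) * k < d" using u'(2) K by (simp add: k_def d'_def field_simps)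
    finally have near: "nrm (XS r) ((u', sol u') - (u, sol u)) < d" .
    have near0: "nrm (XS r) ((u, sol u) - (u, sol u)) < d" using d(1) by simp
    have "nrm (ZS r) (sysmap u' (sol u') - sysmap u (sol u) - lin (bvec u (sol u)) h y) \<le> e' * nrm (XS r) ((u', sol u') - (u, sol u))"
      using d(3)[OF X(2) X(1) near near0] unfolding diff by simp
    also have "\<dots> \<le> e' * ((1 + K) * k)" using nX e' by (intro mult_left_mono) auto
    finally have 1: "nrm (ZS r) (lin (V u) h y) \<le> e' * ((1 + K) * k)"
      using sol_sysmap[OF u] sol_sysmap[OF u'(1)] ZS.nrm_uminus[OF linV_carr[OF u h y]] by (simp add: V_def)
    \<comment> \<open>The predicted increment of the solution is \<open>- s\<close>, so
      \<open>y + s\<close> is the error, and the linearization sends it to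
      \<open>lin (V u) h y\<close>.\<close>
    define s where "s = Sg u (lin (V u) h 0)"
    have s: "s \<in> carr (YS r)" "lin (V u) 0 s = lin (V u) h 0"
      unfolding s_def by (rule Sg_carr[OF u linV_carr[OF u h YS.zero_carr]] lin_Sg[OF u linV_carr[OF u h YS.zero_carr]])+
    have "lin (V u) 0 (y + s) = lin (V u) h y"
      using bounded_linear_betweenD(2)[OF bounded_linear_linV[OF u] y s(1)] s(2)
        lin_split[OF UD[OF u] sol_carr[OF u] sol_admissible[OF u] h y] by (simp add: V_def)
    then have 2: "nrm (YS r) (y + s) \<le> b * (e' * ((1 + K) * k))"
      using nrm_le_lin[OF u YS.add_carr[OF y s(1)]] 1 b by (smt (verit) mult_left_mono)
    have "bvec (h + u) (y + sol u) = bvec h y + bvec u (sol u)" by (rule vec_add[OF y sol_carr[OF u]])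
    then have "V u' - V u = bvec h y" by (simp add: V_def h_def y_def)
    moreover have "bvec (0 + h) ((y + s) + - s) = bvec 0 (y + s) + bvec h (- s)"
      by (rule vec_add[OF YS.add_carr[OF y s(1)] YS.uminus_carr[OF s(1)]])
    ultimately have "V u' - V u - V1 u h = bvec 0 (y + s)" by (simp add: V1_def s_def)
    then have "nrm (VS r) (V u' - V u - V1 u h) \<le> 12 * nrm (YS r) (y + s)"
      using nrm_vec0_le[OF YS.add_carr[OF y s(1)]] by simp
    also have "\<dots> \<le> 12 * (b * (e' * ((1 + K) * k)))" using 2 by simp
    also have "\<dots> = e * k" using b K by (simp add: e'_def)
    finally show ?thesis by (simp add: k_def h_def)
  qed
  then show ?thesis using d' by blast
qed

text \<open>The chain rule, with \<open>eps\<close> shared equally between the remainder of the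
  superposition operator, divided by the Lipschitz constant \<open>A\<close> of \<open>V\<close>,
  and the remainder of \<open>V\<close>, divided by the bound \<open>C\<close> of the
  differential.\<close>

lemma nemytskii_V_derivative:
  assumes u: "u \<in> U" and ok: "ok_on e (V u)" and eps: "0 < eps"
  shows "\<exists>d>0. \<forall>u'\<in>U. nrm (H r) (u' - u) < d \<longrightarrow> nemytskii e (V u') \<in> carr (H r) \<and>
     nrm (H r) (nemytskii e (V u') - nemytskii e (V u) - nemytskii_deriv e (V u) (V1 u (u' - u))) \<le> eps * nrm (H r) (u' - u)"
proof -
  define A where "A = 12 * (1 + K)"
  have A: "0 < A" using K by (simp add: A_def)
  note sd = strict_derivative_nemytskii[OF V_carr[OF u] ok]
  note bl = strict_derivative_atD(2)[OF sd]
  obtain C where C: "0 < C" "\<And>W. W \<in> carr (VS r) \<Longrightarrow> nrm (H r) (nemytskii_deriv e (V u) W) \<le> C * nrm (VS r) W"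
    by (rule bounded_linear_between_bound[OF bl nspace_VS]) (rule that)
  have "0 < eps / (2 * A)" using eps A by simp
  then obtain d1 where d1: "d1 > 0" "\<And>W. W \<in> carr (VS r) \<Longrightarrow> nrm (VS r) (W - V u) < d1 \<Longrightarrow> nemytskii e W \<in> carr (H r)"
    "\<And>W W'. W \<in> carr (VS r) \<Longrightarrow> W' \<in> carr (VS r) \<Longrightarrow> nrm (VS r) (W - V u) < d1 \<Longrightarrow> nrm (VS r) (W' - V u) < d1 \<Longrightarrow>
      nrm (H r) (nemytskii e W - nemytskii e W' - nemytskii_deriv e (V u) (W - W')) \<le> eps / (2 * A) * nrm (VS r) (W - W')"
    by (rule strict_derivative_atE[OF sd]) (rule that)
  have "0 < eps / (2 * C)" using eps C by simp
  from V_derivative[OF u this] obtain d2 where d2: "d2 > 0" "\<And>u'. u' \<in> U \<Longrightarrow> nrm (H r) (u' - u) < d2 \<Longrightarrow>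
    nrm (VS r) (V u' - V u - V1 u (u' - u)) \<le> eps / (2 * C) * nrm (H r) (u' - u)" by blast
  define d where "d = min (d1 / A) d2"
  have d: "0 < d" using d1(1) d2(1) A by (simp add: d_def)
  have "nemytskii e (V u') \<in> carr (H r) \<and>
     nrm (H r) (nemytskii e (V u') - nemytskii e (V u) - nemytskii_deriv e (V u) (V1 u (u' - u))) \<le> eps * nrm (H r) (u' - u)"
    if u': "u' \<in> U" "nrm (H r) (u' - u) < d" for u'
  proof -
    define k where "k = nrm (H r) (u' - u)"
    define W where "W = V u' - V u"
    define W1 where "W1 = V1 u (u' - u)"
    have W: "W \<in> carr (VS r)" unfolding W_def by (rule VS.diff_carr[OF V_carr V_carr]) (use u u' in auto)
    have W1: "W1 \<in> carr (VS r)" unfolding W1_def by (rule V1_carr[OF u H.diff_carr[OF UD UD]]) (use u u' in auto)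
    have nW: "nrm (VS r) W \<le> A * k" unfolding W_def k_def A_def by (rule nrm_V_diff_le[OF u u'(1)])
    have near: "nrm (VS r) (V u' - V u) < d1"
    proof -
      have "k < d1 / A" using u'(2) by (simp add: k_def d_def)
      then have "A * k < d1" using A by (simp add: field_simps)
      then show ?thesis using nW by (simp add: W_def)
    qed
    have near0: "nrm (VS r) (V u - V u) < d1" using d1(1) by simp
    have m0: "nemytskii e (V u') \<in> carr (H r)" by (rule d1(2)[OF V_carr[OF u'(1)] near])
    have m1: "nemytskii e (V u) \<in> carr (H r)" by (rule nemytskii_carr[OF V_carr[OF u] ok])
    have m2: "nemytskii_deriv e (V u) W \<in> carr (H r)" "nemytskii_deriv e (V u) (W - W1) \<in> carr (H r)"
      using bounded_linear_betweenD(1)[OF bl] W VS.diff_carr[OF W W1] by blast+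
    have eq: "nemytskii e (V u') - nemytskii e (V u) - nemytskii_deriv e (V u) W1 =
      (nemytskii e (V u') - nemytskii e (V u) - nemytskii_deriv e (V u) W) + nemytskii_deriv e (V u) (W - W1)"
      using bounded_linear_between_diff[OF bl nspace_VS W W1] by simp
    have "nrm (H r) (nemytskii e (V u') - nemytskii e (V u) - nemytskii_deriv e (V u) W1) \<le>
      nrm (H r) (nemytskii e (V u') - nemytskii e (V u) - nemytskii_deriv e (V u) W) + nrm (H r) (nemytskii_deriv e (V u) (W - W1))"
      unfolding eq by (rule H.nrm_triangle) (use m0 m1 m2 in auto)
    also have "\<dots> \<le> eps / (2 * A) * nrm (VS r) W + C * nrm (VS r) (W - W1)"
      using d1(3)[OF V_carr[OF u'(1)] V_carr[OF u] near near0] C(2)[OF VS.diff_carr[OF W W1]] by (simp add: W_def)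
    also have "\<dots> \<le> eps / (2 * A) * (A * k) + C * (eps / (2 * C) * k)"
      using nW d2(2)[OF u'(1)] u'(2) A C(1) eps by (intro add_mono mult_left_mono) (auto simp: W_def W1_def k_def d_def)
    also have "\<dots> = eps * k" using A C(1) by simp
    finally show ?thesis using m0 by (simp add: k_def W1_def)
  qed
  then show ?thesis using d by blast
qed

lemma op_carr: "u \<in> U \<Longrightarrow> f \<in> carr (H r) \<Longrightarrow> op i u f g h \<in> carr (H r)"
  unfolding op_def using vec0_carr[OF Sg_carr[OF _ triple_carr]] by (simp add: carr_fun_nspace)

text \<open>Each coefficient of the differential is a superposition operator and is differentiated
  separately along the solutions. Uniformity in \<open>W\<close> holds because \<open>W\<close>
  enters as a factor only; \<open>HK r\<close> is the constant of the product estimate.\<close>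

lemma nemytskii_deriv_V_derivative:
  assumes u: "u \<in> U" and ok: "ok_on e (V u)" and eps: "0 < eps"
  shows "\<exists>d>0. \<forall>u'\<in>U. nrm (H r) (u' - u) < d \<longrightarrow> (\<forall>W\<in>carr (VS r).
     nrm (H r) (nemytskii_deriv e (V u') W - nemytskii_deriv e (V u) W - nemytskii_deriv2 e (V u) (V1 u (u' - u)) W)
       \<le> eps * nrm (H r) (u' - u) * nrm (VS r) W)"
proof -
  have "0 < eps / HK r" using eps HK_pos by simp
  then have "\<forall>i. \<exists>d>0. \<forall>u'\<in>U. nrm (H r) (u' - u) < d \<longrightarrow> nemytskii (pd i e) (V u') \<in> carr (H r) \<and>
     nrm (H r) (nemytskii (pd i e) (V u') - nemytskii (pd i e) (V u) - nemytskii_deriv (pd i e) (V u) (V1 u (u' - u))) \<le> eps / HK r * nrm (H r) (u' - u)"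
    using nemytskii_V_derivative[OF u ok_on_pd[OF ok]] by blast
  from choice[OF this] obtain d where d: "\<And>i. d i > 0" "\<And>i u'. u' \<in> U \<Longrightarrow> nrm (H r) (u' - u) < d i \<Longrightarrow> nemytskii (pd i e) (V u') \<in> carr (H r) \<and>
     nrm (H r) (nemytskii (pd i e) (V u') - nemytskii (pd i e) (V u) - nemytskii_deriv (pd i e) (V u) (V1 u (u' - u))) \<le> eps / HK r * nrm (H r) (u' - u)"
    by blast
  define d0 where "d0 = Min (range d)"
  have d0: "0 < d0" "\<And>i. d0 \<le> d i" using d(1) by (auto simp: d0_def)
  have "nrm (H r) (nemytskii_deriv e (V u') W - nemytskii_deriv e (V u) W - nemytskii_deriv2 e (V u) (V1 u (u' - u)) W)
       \<le> eps * nrm (H r) (u' - u) * nrm (VS r) W"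
    if u': "u' \<in> U" "nrm (H r) (u' - u) < d0" and W: "W \<in> carr (VS r)" for u' W
  proof -
    define A where "A i = nemytskii (pd i e) (V u') - nemytskii (pd i e) (V u) - nemytskii_deriv (pd i e) (V u) (V1 u (u' - u))" for i
    have near: "nrm (H r) (u' - u) < d i" for i using u'(2) d0(2)[of i] by linarith
    have V1m: "V1 u (u' - u) \<in> carr (VS r)" by (rule V1_carr[OF u H.diff_carr[OF UD UD]]) (use u u' in auto)
    have Ac: "A i \<in> carr (H r)" for i
      unfolding A_def using d(2)[OF u'(1) near[of i]] nemytskii_carr[OF V_carr[OF u] ok_on_pd[OF ok]]
        nemytskii_deriv_carr[OF V_carr[OF u] V1m ok_on_pd[OF ok]] by (intro H.diff_carr) auto
    have "nemytskii_deriv e (V u') W - nemytskii_deriv e (V u) W - nemytskii_deriv2 e (V u) (V1 u (u' - u)) W = (\<Sum>i\<in>UNIV. A i * W i)"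
      by (simp add: nemytskii_deriv_def[of e] nemytskii_deriv2_def A_def sum_subtractf left_diff_distrib)
    moreover have "nrm (H r) (\<Sum>i\<in>UNIV. A i * W i) \<le> HK r * (eps / HK r * nrm (H r) (u' - u)) * nrm (VS r) W"
      by (rule nrm_sum_mult_le[OF Ac W]) (use d(2)[OF u'(1) near] in \<open>simp add: A_def\<close>)
    ultimately show ?thesis using HK_pos[of r] by simp
  qed
  then show ?thesis using d0(1) by blast
qed

section \<open>Dependence of the inverse linearization on the warp\<close>

definition W0 :: "rfun \<Rightarrow> rfun \<Rightarrow> rfun \<Rightarrow> rfun \<Rightarrow> bvar \<Rightarrow> real \<Rightarrow> real" where
  "W0 u f g h = (\<lambda>i. op i u f g h)"

lemma W0_eq: "W0 u f g h = bvec 0 (Sg u (f, intP g, intP h))"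
  by (simp add: W0_def op_def)

text \<open>The formula for the derivative of an inverse, the inverse times the derivative of the
  operator times the inverse, with a minus sign. The linearization contains \<open>e0\<close> with a
  minus sign and the integrands with a plus sign; hence the opposite signs of the three
  arguments.\<close>

definition op1 :: "bvar \<Rightarrow> rfun \<Rightarrow> rfun \<Rightarrow> rfun \<Rightarrow> rfun \<Rightarrow> rfun \<Rightarrow> real \<Rightarrow> real" where
  "op1 i u k f g h = op i u (nemytskii_deriv2 e0 (V u) (V1 u k) (W0 u f g h))
     (- nemytskii_deriv2 e1 (V u) (V1 u k) (W0 u f g h)) (- nemytskii_deriv2 e2 (V u) (V1 u k) (W0 u f g h))"

lemma nemytskii_deriv2_carr:
  assumes "u \<in> U" "k \<in> carr (H r)" "W \<in> carr (VS r)" "ok_on e (V u)"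
  shows "nemytskii_deriv2 e (V u) (V1 u k) W \<in> carr (H r)"
  unfolding nemytskii_deriv2_def
  by (intro H.sum_carr mult_carr nemytskii_deriv_carr V_carr V1_carr ok_on_pd) (use assms in auto)

text \<open>The resolvent identity: the difference of two inverses is minus the inverse at
  \<open>u\<close>, applied to the difference of the operators, applied to the inverse at
  \<open>u'\<close>.\<close>

lemma Sg_lipschitz:
  assumes u: "u \<in> U"
  obtains d C where "0 < d" "0 < C"
    "\<And>u' z. u' \<in> U \<Longrightarrow> nrm (H r) (u' - u) < d \<Longrightarrow> z \<in> carr (ZS r) \<Longrightarrow>
       nrm (YS r) (Sg u' z - Sg u z) \<le> C * nrm (H r) (u' - u) * nrm (ZS r) z"
    "\<And>u' y. u' \<in> U \<Longrightarrow> nrm (H r) (u' - u) < d \<Longrightarrow> y \<in> carr (YS r) \<Longrightarrow>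
       nrm (ZS r) (lin (V u') 0 y - lin (V u) 0 y) \<le> C * nrm (H r) (u' - u) * nrm (YS r) y"
proof -
  define A where "A = 12 * (1 + K)"
  have A: "0 < A" using K by (simp add: A_def)
  obtain d C where dC: "0 < d" "0 < C"
    "\<And>V' k. V' \<in> carr (VS r) \<Longrightarrow> nrm (VS r) (V' - V u) < d \<Longrightarrow> k \<in> carr (YS r) \<Longrightarrow>
       nrm (ZS r) (lin V' 0 k - lin (V u) 0 k) \<le> C * nrm (VS r) (V' - V u) * nrm (YS r) k"
    by (rule lin_lipschitz[OF V_carr[OF u] V_admissible[OF u]]) (rule that)
  have l: "nrm (ZS r) (lin (V u') 0 y - lin (V u) 0 y) \<le> (C * A) * nrm (H r) (u' - u) * nrm (YS r) y"
    if u': "u' \<in> U" "nrm (H r) (u' - u) < d / A" "y \<in> carr (YS r)" for u' y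
  proof -
    have nV: "nrm (VS r) (V u' - V u) \<le> A * nrm (H r) (u' - u)" unfolding A_def by (rule nrm_V_diff_le[OF u u'(1)])
    also have "\<dots> < d" using u'(2) A by (simp add: field_simps)
    finally have "nrm (ZS r) (lin (V u') 0 y - lin (V u) 0 y) \<le> C * nrm (VS r) (V u' - V u) * nrm (YS r) y"
      by (rule dC(3)[OF V_carr[OF u'(1)] _ u'(3)])
    also have "\<dots> \<le> C * (A * nrm (H r) (u' - u)) * nrm (YS r) y"
      using nV dC(2) YS.nrm_ge_0[OF u'(3)] by (intro mult_right_mono mult_left_mono) auto
    finally show ?thesis by (simp add: mult.assoc)
  qed
  \<comment> \<open>A single constant for both conclusions, the second argument being the one for
    the inverse, with a factor \<open>b\<close> for each of the two inverses.\<close>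
  define C1 where "C1 = max (C * A) (b * (C * A) * b)"
  have C1: "0 < C1" "C * A \<le> C1" "b * (C * A) * b \<le> C1" using dC(2) A b by (auto simp: C1_def less_max_iff_disj)
  show ?thesis
  proof (rule that[of "d / A" C1])
    show "0 < d / A" using dC(1) A by simp
    show "0 < C1" by fact
    fix u' assume u': "u' \<in> U" "nrm (H r) (u' - u) < d / A"
    have k: "0 \<le> nrm (H r) (u' - u)" by (rule H.nrm_ge_0[OF H.diff_carr[OF UD UD]]) (use u u' in auto)
    show "nrm (ZS r) (lin (V u') 0 y - lin (V u) 0 y) \<le> C1 * nrm (H r) (u' - u) * nrm (YS r) y" if y: "y \<in> carr (YS r)" for y
    proof -
      have "(C * A) * (nrm (H r) (u' - u) * nrm (YS r) y) \<le> C1 * (nrm (H r) (u' - u) * nrm (YS r) y)"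
        using C1 k YS.nrm_ge_0[OF y] by (intro mult_right_mono) auto
      then show ?thesis using l[OF u' y] by (simp add: mult.assoc)
    qed
    fix z assume z: "z \<in> carr (ZS r)"
    have s: "Sg u z \<in> carr (YS r)" "Sg u' z \<in> carr (YS r)" "lin (V u) 0 (Sg u z) = z" "lin (V u') 0 (Sg u' z) = z"
      using Sg[OF u z] Sg[OF u'(1) z] by auto
    have lm: "lin (V u) 0 (Sg u' z) \<in> carr (ZS r)" by (rule linV_carr[OF u H.zero_carr s(2)])
    have "lin (V u) 0 (Sg u' z - Sg u z) = - (lin (V u') 0 (Sg u' z) - lin (V u) 0 (Sg u' z))"
      using bounded_linear_between_diff[OF bounded_linear_linV[OF u] nspace_YS s(2,1)] s by simp
    then have "nrm (YS r) (Sg u' z - Sg u z) \<le> b * nrm (ZS r) (- (lin (V u') 0 (Sg u' z) - lin (V u) 0 (Sg u' z)))"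
      using nrm_le_lin[OF u YS.diff_carr[OF s(2,1)]] by simp
    also have "\<dots> = b * nrm (ZS r) (lin (V u') 0 (Sg u' z) - lin (V u) 0 (Sg u' z))"
      using ZS.nrm_uminus[OF ZS.diff_carr[OF z lm]] s(4) by simp
    also have "\<dots> \<le> b * ((C * A) * nrm (H r) (u' - u) * nrm (YS r) (Sg u' z))"
      using l[OF u' s(2)] b by (intro mult_left_mono) auto
    also have "\<dots> \<le> b * ((C * A) * nrm (H r) (u' - u) * (b * nrm (ZS r) z))"
      using nrm_Sg[OF u'(1) z] b dC(2) A k by (intro mult_left_mono mult_nonneg_nonneg) auto
    also have "\<dots> = b * (C * A) * b * (nrm (H r) (u' - u) * nrm (ZS r) z)" by simp
    also have "\<dots> \<le> C1 * (nrm (H r) (u' - u) * nrm (ZS r) z)"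
      using C1 k ZS.nrm_ge_0[OF z] by (intro mult_right_mono) auto
    finally show "nrm (YS r) (Sg u' z - Sg u z) \<le> C1 * nrm (H r) (u' - u) * nrm (ZS r) z" by (simp add: mult.assoc)
  qed
qed

end

context solution_family
begin

text \<open>Expands the equation for the solution at \<open>u'\<close> to first order around that at
  \<open>u\<close>: the change of the operator on the old solution contributes the derivative, while
  its action on the change of the solution is of second order by the Lipschitz bounds.\<close>

lemma op_derivative:
  assumes u: "u \<in> U" and eps: "0 < eps"
  shows "\<exists>d>0. \<forall>u'\<in>U. nrm (H r) (u' - u) < d \<longrightarrow> (\<forall>f\<in>carr (H r). \<forall>g\<in>carr (H r). \<forall>h\<in>carr (H r).
     nrm (H r) (op i u' f g h - op i u f g h - op1 i u (u' - u) f g h) \<le>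
       eps * nrm (H r) (u' - u) * (nrm (H r) f + nrm (H r) g + nrm (H r) h))"
proof -
  have ok: "ok_on e0 (V u)" "ok_on e1 (V u)" "ok_on e2 (V u)" using V_admissible[OF u] by (auto simp: admissible_def)
  obtain dS C where C: "0 < dS" "0 < C"
    "\<And>u' z. u' \<in> U \<Longrightarrow> nrm (H r) (u' - u) < dS \<Longrightarrow> z \<in> carr (ZS r) \<Longrightarrow>
       nrm (YS r) (Sg u' z - Sg u z) \<le> C * nrm (H r) (u' - u) * nrm (ZS r) z"
    "\<And>u' y. u' \<in> U \<Longrightarrow> nrm (H r) (u' - u) < dS \<Longrightarrow> y \<in> carr (YS r) \<Longrightarrow>
       nrm (ZS r) (lin (V u') 0 y - lin (V u) 0 y) \<le> C * nrm (H r) (u' - u) * nrm (YS r) y"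
    by (rule Sg_lipschitz[OF u]) (rule that)
  \<comment> \<open>Half of \<open>eps\<close>, divided by the losses met on the way: 12 and
    \<open>b\<close> for the final inverse, \<open>36 * mass * b\<close> for the three components of
    the data evaluated on an inverse, and \<open>mass\<close> for the norm of the data.
    \<open>d3\<close> plays the same part for the second order term.\<close>
  define ep where "ep = eps / (2 * (12 * b * (36 * mass * b) * mass))"
  have ep: "0 < ep" using eps b mass by (simp add: ep_def)
  obtain d0 where d0: "d0 > 0" "\<And>u' W. u' \<in> U \<Longrightarrow> nrm (H r) (u' - u) < d0 \<Longrightarrow> W \<in> carr (VS r) \<Longrightarrow>
     nrm (H r) (nemytskii_deriv e0 (V u') W - nemytskii_deriv e0 (V u) W - nemytskii_deriv2 e0 (V u) (V1 u (u' - u)) W)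
       \<le> ep * nrm (H r) (u' - u) * nrm (VS r) W" using nemytskii_deriv_V_derivative[OF u ok(1) ep] by blast
  obtain d1 where d1: "d1 > 0" "\<And>u' W. u' \<in> U \<Longrightarrow> nrm (H r) (u' - u) < d1 \<Longrightarrow> W \<in> carr (VS r) \<Longrightarrow>
     nrm (H r) (nemytskii_deriv e1 (V u') W - nemytskii_deriv e1 (V u) W - nemytskii_deriv2 e1 (V u) (V1 u (u' - u)) W)
       \<le> ep * nrm (H r) (u' - u) * nrm (VS r) W" using nemytskii_deriv_V_derivative[OF u ok(2) ep] by blast
  obtain d2 where d2: "d2 > 0" "\<And>u' W. u' \<in> U \<Longrightarrow> nrm (H r) (u' - u) < d2 \<Longrightarrow> W \<in> carr (VS r) \<Longrightarrow>
     nrm (H r) (nemytskii_deriv e2 (V u') W - nemytskii_deriv e2 (V u) W - nemytskii_deriv2 e2 (V u) (V1 u (u' - u)) W)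
       \<le> ep * nrm (H r) (u' - u) * nrm (VS r) W" using nemytskii_deriv_V_derivative[OF u ok(3) ep] by blast
  define d3 where "d3 = eps / (2 * (12 * b * (C * C) * mass))"
  have d3: "0 < d3" using eps b mass C(2) by (simp add: d3_def)
  define d where "d = Min {dS, d0, d1, d2, d3}"
  have d: "0 < d" "d \<le> dS" "d \<le> d0" "d \<le> d1" "d \<le> d2" "d \<le> d3"
    using C(1) d0(1) d1(1) d2(1) d3 unfolding d_def by auto
  have step: "nrm (H r) (op i u' f g h - op i u f g h - op1 i u (u' - u) f g h) \<le>
       eps * nrm (H r) (u' - u) * (nrm (H r) f + nrm (H r) g + nrm (H r) h)"
    if u': "u' \<in> U" "nrm (H r) (u' - u) < d" and fgh: "f \<in> carr (H r)" "g \<in> carr (H r)" "h \<in> carr (H r)" for u' f g h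
  proof -
    define k where "k = nrm (H r) (u' - u)"
    have kc: "u' - u \<in> carr (H r)" by (rule H.diff_carr[OF UD UD]) (use u u' in auto)
    have k: "0 \<le> k" unfolding k_def by (rule H.nrm_ge_0[OF kc])
    have near: "nrm (H r) (u' - u) < dS" "nrm (H r) (u' - u) < d0" "nrm (H r) (u' - u) < d1" "nrm (H r) (u' - u) < d2" "k \<le> d3"
      using u'(2) d unfolding k_def by linarith+
    define z y y' where "z = (f, intP g, intP h)" and "y = Sg u z" and "y' = Sg u' z"
    have z: "z \<in> carr (ZS r)" unfolding z_def by (rule triple_carr[OF fgh(1)])
    have zge: "0 \<le> nrm (ZS r) z" by (rule ZS.nrm_ge_0[OF z])
    have y: "y \<in> carr (YS r)" "lin (V u) 0 y = z" "y' \<in> carr (YS r)" "lin (V u') 0 y' = z"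
      unfolding y_def y'_def using Sg[OF u z] Sg[OF u'(1) z] by auto
    define W where "W = bvec 0 y"
    have W: "W \<in> carr (VS r)" unfolding W_def by (rule vec0_carr[OF y(1)])
    have W0: "W0 u f g h = W" by (simp add: W0_eq W_def y_def z_def)
    have nW: "nrm (VS r) W \<le> 12 * (b * nrm (ZS r) z)"
      using nrm_vec0_le[OF y(1)] nrm_Sg[OF u z] by (simp add: W_def y_def)
    define q0 q1 q2 where "q0 = nemytskii_deriv2 e0 (V u) (V1 u (u' - u)) W"
      and "q1 = nemytskii_deriv2 e1 (V u) (V1 u (u' - u)) W" and "q2 = nemytskii_deriv2 e2 (V u) (V1 u (u' - u)) W"
    have qc: "q0 \<in> carr (H r)" "q1 \<in> carr (H r)" "q2 \<in> carr (H r)"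
      unfolding q0_def q1_def q2_def
      by (rule nemytskii_deriv2_carr[OF u kc W ok(1)] nemytskii_deriv2_carr[OF u kc W ok(2)] nemytskii_deriv2_carr[OF u kc W ok(3)])+
    define q where "q = (q0, intP (- q1), intP (- q2))"
    have q: "q \<in> carr (ZS r)" unfolding q_def by (rule triple_carr[OF qc(1)])
    define n where "n e w = nemytskii_deriv e (V w) W" for e w
    have ok': "ok_on e0 (V u')" "ok_on e1 (V u')" "ok_on e2 (V u')" using V_admissible[OF u'(1)] by (auto simp: admissible_def)
    have nc: "n e0 u \<in> carr (H r)" "n e1 u \<in> carr (H r)" "n e2 u \<in> carr (H r)"
      "n e0 u' \<in> carr (H r)" "n e1 u' \<in> carr (H r)" "n e2 u' \<in> carr (H r)"
      unfolding n_def using nemytskii_deriv_carr[OF V_carr[OF u] W] nemytskii_deriv_carr[OF V_carr[OF u'(1)] W] ok ok' by auto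
    have iu: "intP (- q1) = - intP q1" "intP (- q2) = - intP q2"
      using bounded_linear_betweenD(3)[OF bounded_linear_intP qc(2), of "-1"] bounded_linear_betweenD(3)[OF bounded_linear_intP qc(3), of "-1"] by auto
    define D where "D = lin (V u') 0 y - lin (V u) 0 y"
    have D: "D \<in> carr (ZS r)" unfolding D_def
      by (rule ZS.diff_carr[OF linV_carr[OF u'(1) H.zero_carr y(1)] linV_carr[OF u H.zero_carr y(1)]])
    \<comment> \<open>\<open>q\<close> is minus the first order part of \<open>D\<close>, so only
      the remainders of the three coefficient operators are left.\<close>
    have "D + q = (- (n e0 u' - n e0 u - q0), intP (n e1 u' - n e1 u - q1), intP (n e2 u' - n e2 u - q2))"
      using nc qc by (simp add: D_def q_def lin_def n_def W_def intP_diff[of _ r] iu)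
    then have "nrm (ZS r) (D + q) = nrm (H r) (n e0 u' - n e0 u - q0) + \<bar>intP (n e1 u' - n e1 u - q1)\<bar> + \<bar>intP (n e2 u' - n e2 u - q2)\<bar>"
      using H.nrm_uminus[of "n e0 u' - n e0 u - q0" r] nc qc by (simp add: nrm_ZS)
    also have "\<dots> \<le> ep * k * nrm (VS r) W + P * (ep * k * nrm (VS r) W) + P * (ep * k * nrm (VS r) W)"
      using d0(2)[OF u'(1) near(2) W] d1(2)[OF u'(1) near(3) W] d2(2)[OF u'(1) near(4) W] nc qc
      unfolding n_def q0_def q1_def q2_def k_def by (intro add_mono intP_le[of _ r]) auto
    also have "\<dots> = (1 + 2 * P) * (ep * k * nrm (VS r) W)" by (simp add: algebra_simps)
    also have "\<dots> \<le> (3 * mass) * (ep * k * (12 * (b * nrm (ZS r) z)))"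
      using nW ep k VS.nrm_ge_0[OF W] P mass by (intro mult_mono mult_left_mono mult_nonneg_nonneg) (auto simp: mass_def)
    finally have 1: "nrm (ZS r) (D + q) \<le> (36 * mass * b) * ep * k * nrm (ZS r) z" by (simp add: algebra_simps)
    define D' where "D' = lin (V u') 0 (y' - y) - lin (V u) 0 (y' - y)"
    have yy: "y' - y \<in> carr (YS r)" by (rule YS.diff_carr[OF y(3,1)])
    have D': "D' \<in> carr (ZS r)" unfolding D'_def
      by (rule ZS.diff_carr[OF linV_carr[OF u'(1) H.zero_carr yy] linV_carr[OF u H.zero_carr yy]])
    have "nrm (ZS r) D' \<le> C * k * nrm (YS r) (y' - y)" unfolding D'_def k_def by (rule C(4)[OF u'(1) near(1) yy])
    also have "\<dots> \<le> C * k * (C * k * nrm (ZS r) z)"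
      using C(3)[OF u'(1) near(1) z] C(2) k by (intro mult_left_mono) (auto simp: y_def y'_def k_def)
    also have "\<dots> = (C * C * k) * (k * nrm (ZS r) z)" by simp
    also have "\<dots> \<le> (C * C * d3) * (k * nrm (ZS r) z)"
      using near(5) C(2) k zge by (intro mult_right_mono mult_left_mono) auto
    finally have 2: "nrm (ZS r) D' \<le> (C * C) * d3 * k * nrm (ZS r) z" by simp
    \<comment> \<open>The total error of the expansion: the linearization at \<open>u\<close> maps
      it to minus the sum of the first order remainder \<open>D + q\<close> and the second order
      term \<open>D'\<close>.\<close>
    define s where "s = y' - y - Sg u q"
    have s: "s \<in> carr (YS r)" unfolding s_def by (rule YS.diff_carr[OF yy Sg_carr[OF u q]])
    have "lin (V u) 0 s = lin (V u) 0 y' - lin (V u) 0 y - q"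
      unfolding s_def using bounded_linear_between_diff[OF bounded_linear_linV[OF u] nspace_YS] yy y Sg_carr[OF u q] lin_Sg[OF u q] by simp
    also have "\<dots> = - ((D + q) + D')"
      unfolding D_def D'_def using bounded_linear_between_diff[OF bounded_linear_linV[OF u] nspace_YS y(3,1)]
        bounded_linear_between_diff[OF bounded_linear_linV[OF u'(1)] nspace_YS y(3,1)] y by simp
    finally have "nrm (ZS r) (lin (V u) 0 s) = nrm (ZS r) ((D + q) + D')"
      using ZS.nrm_uminus[OF ZS.add_carr[OF ZS.add_carr[OF D q] D']] by simp
    also have "\<dots> \<le> (36 * mass * b) * ep * k * nrm (ZS r) z + (C * C) * d3 * k * nrm (ZS r) z"
      using ZS.nrm_triangle[OF ZS.add_carr[OF D q] D'] 1 2 by linarith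
    finally have ls: "nrm (ZS r) (lin (V u) 0 s) \<le> ((36 * mass * b) * ep + (C * C) * d3) * k * nrm (ZS r) z"
      by (simp add: algebra_simps)
    have "nrm (YS r) s \<le> b * nrm (ZS r) (lin (V u) 0 s)" by (rule nrm_le_lin[OF u s])
    also have "\<dots> \<le> b * (((36 * mass * b) * ep + (C * C) * d3) * k * nrm (ZS r) z)" using ls b by (intro mult_left_mono) auto
    finally have ns: "12 * nrm (YS r) s \<le> 12 * b * ((36 * mass * b) * ep + (C * C) * d3) * k * nrm (ZS r) z" by simp
    have "op i u' f g h - op i u f g h - op1 i u (u' - u) f g h = bvec 0 y' i - bvec 0 y i - bvec 0 (Sg u q) i"
      by (simp add: op_def[of i u'] op_def[of i u f g h] op1_def op_def[of i u _ "- _"] W0 y_def y'_def z_def q_def q0_def q1_def q2_def)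
    also have "\<dots> = bvec 0 s i" unfolding s_def using vec0_diff yy y Sg_carr[OF u q] by simp
    finally have "nrm (H r) (op i u' f g h - op i u f g h - op1 i u (u' - u) f g h) \<le> 12 * nrm (YS r) s"
      using nrm_vec0_component[OF s, of i] by simp
    also have "\<dots> \<le> 12 * b * ((36 * mass * b) * ep + (C * C) * d3) * k * nrm (ZS r) z" by (rule ns)
    also have "\<dots> \<le> 12 * b * ((36 * mass * b) * ep + (C * C) * d3) * k * (mass * (nrm (H r) f + nrm (H r) g + nrm (H r) h))"
      using nrm_triple_le[OF fgh] b mass ep d3 C(2) k unfolding z_def by (intro mult_left_mono mult_nonneg_nonneg add_nonneg_nonneg) auto
    also have "\<dots> = (12 * b * (36 * mass * b) * mass * ep + 12 * b * (C * C) * mass * d3) * k * (nrm (H r) f + nrm (H r) g + nrm (H r) h)"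
      by (simp add: algebra_simps)
    also have "12 * b * (36 * mass * b) * mass * ep = eps / 2" using b mass by (simp add: ep_def)
    also have "12 * b * (C * C) * mass * d3 = eps / 2" using b mass C(2) by (simp add: d3_def)
    finally show ?thesis by (simp add: k_def)
  qed
  then show ?thesis using d(1) by blast
qed

section \<open>Tame form of the solution family and of its derivatives\<close>

sublocale T: tame_base P \<alpha> r U gens op
  by unfold_locales

text \<open>The components of \<open>V1\<close> as a tame expression. The first summand is the
  direct dependence on the warp, written \<open>0 * k\<close> in the other components so that the
  slot is retained; the second is the response of the solution. Signs are products with the constant
  function -1, which is a generator.\<close>

definition W1 :: "bvar \<Rightarrow> rfun \<Rightarrow> rfun \<Rightarrow> real \<Rightarrow> real" where
  "W1 i u k = (if i = VL then k else 0 * k) + op i u (nemytskii (pd VL e0) (V u) * k)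
     ((\<lambda>t. -1) * (nemytskii (pd VL e1) (V u) * k)) ((\<lambda>t. -1) * (nemytskii (pd VL e2) (V u) * k))"

lemma nemytskii_gens: "(\<And>u. u \<in> U \<Longrightarrow> ok_on e (V u)) \<Longrightarrow> (\<lambda>u. nemytskii e (V u)) \<in> gens"
  by (auto simp: gens_def)

lemma gensE:
  assumes "g \<in> gens"
  obtains e where "g = (\<lambda>u. nemytskii e (V u))" "\<forall>u\<in>U. ok_on e (V u)"
proof -
  have "\<exists>e. g = (\<lambda>u. nemytskii e (V u)) \<and> (\<forall>u\<in>U. ok_on e (V u))"
    using assms by (simp only: gens_def mem_Collect_eq)
  then show ?thesis by (elim exE conjE) (rule that)
qed

lemma ok_V: "u \<in> U \<Longrightarrow> ok_on e0 (V u)" "u \<in> U \<Longrightarrow> ok_on e1 (V u)" "u \<in> U \<Longrightarrow> ok_on e2 (V u)"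
  using V_admissible by (auto simp: admissible_def)

lemma const_gens: "(\<lambda>u t. c) \<in> gens"
  using nemytskii_gens[of "Cst c"] by (simp add: nemytskii_simps ok_on_def)

lemma zero_gens: "(\<lambda>u. 0) \<in> gens"
  using const_gens[of 0] by (simp add: zero_fun_def)

lemma tame_W1: "T.tame {n} (\<lambda>u vs. W1 i u (vs n))"
proof -
  have m: "T.tame {n} (\<lambda>u vs. nemytskii (pd VL e) (V u) * vs n)" if "\<And>u. u \<in> U \<Longrightarrow> ok_on e (V u)" for e
  proof -
    have "(\<lambda>u. nemytskii (pd VL e) (V u)) \<in> gens" by (intro nemytskii_gens ok_on_pd that)
    from T.tame_mult[OF T.tame_gen[OF this] T.tame_dir[of n]] show ?thesis by simp
  qed
  have neg: "T.tame {n} (\<lambda>u vs. (\<lambda>t. -1) * f u vs)" if "T.tame {n} f" for f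
    using T.tame_mult[OF T.tame_gen[OF const_gens] that] by simp
  have z: "T.tame {n} (\<lambda>u vs. if i = VL then vs n else 0 * vs n)"
    using T.tame_mult[OF T.tame_gen[OF zero_gens] T.tame_dir[of n]] T.tame_dir[of n] by (cases "i = VL") simp_all
  show ?thesis
    unfolding W1_def by (intro T.tame_add[OF z] T.tame_op neg m ok_V)
qed

lemma V1_component:
  assumes u: "u \<in> U" and k: "k \<in> carr (H r)"
  shows "V1 u k i = W1 i u k"
proof -
  have nd: "nemytskii_deriv e (V u) (bvec k 0) = nemytskii (pd VL e) (V u) * k" for e
  proof -
    have "bvec k 0 i = (if i = VL then k else 0)" for i by (cases i) (auto simp: zero_fun_def)
    then have "nemytskii_deriv e (V u) (bvec k 0) = (\<Sum>i\<in>UNIV. if i = VL then nemytskii (pd i e) (V u) * k else 0)"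
      unfolding nemytskii_deriv_def by (intro sum.cong) auto
    then show ?thesis by simp
  qed
  define n where "n e = nemytskii (pd VL e) (V u) * k" for e
  have nc: "n e0 \<in> carr (H r)" "n e1 \<in> carr (H r)" "n e2 \<in> carr (H r)"
    unfolding n_def by (intro mult_carr k nemytskii_carr[OF V_carr[OF u]] ok_on_pd ok_V[OF u])+
  have neg: "(\<lambda>t. -1) * f = - f" for f :: "real \<Rightarrow> real" by (simp add: fun_eq_iff times_fun_apply uminus_apply)
  have iu: "intP (- n e1) = - intP (n e1)" "intP (- n e2) = - intP (n e2)"
    using bounded_linear_betweenD(3)[OF bounded_linear_intP nc(2), of "-1"] bounded_linear_betweenD(3)[OF bounded_linear_intP nc(3), of "-1"] by auto
  have d0: "deriv (0 :: real \<Rightarrow> real) = 0" by (simp add: zero_fun_def)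
  have "lin (V u) k 0 = - (n e0, intP (- n e1), intP (- n e2))"
    by (simp add: lin_def nd n_def[symmetric] iu d0)
  then have "- Sg u (lin (V u) k 0) = Sg u (n e0, intP (- n e1), intP (- n e2))"
    using Sg_uminus[OF u triple_carr[OF nc(1)]] by simp
  then have "V1 u k i = bvec k (Sg u (n e0, intP (- n e1), intP (- n e2))) i" by (simp add: V1_def)
  also have "\<dots> = (if i = VL then k else 0 * k) + bvec 0 (Sg u (n e0, intP (- n e1), intP (- n e2))) i"
    by (cases i) auto
  finally show ?thesis by (simp add: W1_def op_def neg n_def)
qed

text \<open>The derivative \<open>op1\<close> of the operator with both directions expanded into
  components: \<open>v\<close> for the solution of the linear equation and \<open>w\<close> for the
  derivative of the pointwise data. In this form it is built from generators, \<open>W1\<close> and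
  \<open>op\<close> alone.\<close>

definition op2 :: "bvar \<Rightarrow> rfun \<Rightarrow> rfun \<Rightarrow> rfun \<Rightarrow> rfun \<Rightarrow> rfun \<Rightarrow> real \<Rightarrow> real" where
  "op2 i u k f g h = op i u
     (\<Sum>v\<in>UNIV. (\<Sum>w\<in>UNIV. nemytskii (pd w (pd v e0)) (V u) * W1 w u k) * op v u f g h)
     ((\<lambda>t. -1) * (\<Sum>v\<in>UNIV. (\<Sum>w\<in>UNIV. nemytskii (pd w (pd v e1)) (V u) * W1 w u k) * op v u f g h))
     ((\<lambda>t. -1) * (\<Sum>v\<in>UNIV. (\<Sum>w\<in>UNIV. nemytskii (pd w (pd v e2)) (V u) * W1 w u k) * op v u f g h))"

lemma tame_op2:
  assumes n: "n \<notin> S" and fgh: "T.tame S f" "T.tame S g" "T.tame S h"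
  shows "T.tame (insert n S) (\<lambda>u vs. op2 i u (vs n) (f u vs) (g u vs) (h u vs))"
proof -
  have 1: "T.tame (insert n S) (\<lambda>u vs. \<Sum>v\<in>UNIV. (\<Sum>w\<in>UNIV. nemytskii (pd w (pd v e)) (V u) * W1 w u (vs n)) * op v u (f u vs) (g u vs) (h u vs))"
    if ok: "\<And>u. u \<in> U \<Longrightarrow> ok_on e (V u)" for e
  proof (intro T.tame_sum)
    fix v
    have "T.tame {n} (\<lambda>u vs. \<Sum>w\<in>UNIV. nemytskii (pd w (pd v e)) (V u) * W1 w u (vs n))"
    proof (intro T.tame_sum)
      fix w
      have "(\<lambda>u. nemytskii (pd w (pd v e)) (V u)) \<in> gens" by (intro nemytskii_gens ok_on_pd ok)
      then show "T.tame {n} (\<lambda>u vs. nemytskii (pd w (pd v e)) (V u) * W1 w u (vs n))"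
        using T.tame_mult[OF T.tame_gen tame_W1[of n w]] by simp
    qed auto
    from T.tame_mult[OF this T.tame_op[OF fgh, of v]] n
    show "T.tame (insert n S) (\<lambda>u vs. (\<Sum>w\<in>UNIV. nemytskii (pd w (pd v e)) (V u) * W1 w u (vs n)) * op v u (f u vs) (g u vs) (h u vs))"
      by simp
  qed auto
  have neg: "T.tame (insert n S) (\<lambda>u vs. (\<lambda>t. -1) * f u vs)" if "T.tame (insert n S) f" for f
    using T.tame_mult[OF T.tame_gen[OF const_gens] that] by simp
  show ?thesis unfolding op2_def by (intro T.tame_op neg 1 ok_V)
qed

lemma op2_eq_op1:
  assumes u: "u \<in> U" and k: "k \<in> carr (H r)"
  shows "op2 i u k f g h = op1 i u k f g h"
proof -
  have neg: "(\<lambda>t. -1) * f = - f" for f :: "real \<Rightarrow> real" by (simp add: fun_eq_iff times_fun_apply uminus_apply)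
  show ?thesis
    by (simp add: op2_def op1_def nemytskii_deriv2_def nemytskii_deriv_def neg W0_def V1_component[OF u k])
qed

text \<open>The substantial axioms are the last two. Generators are differentiated by the chain rule
  with the direction \<open>W1\<close>, and operators by \<open>op2\<close>, which agrees with the
  analytic derivative \<open>op1\<close> on actual directions.\<close>

sublocale T: tame_calculus P \<alpha> r U gens op
proof (unfold_locales, goal_cases)
  case 1
  show ?case by (rule U)
next
  case 2
  show ?case by (rule zero_gens)
next
  case (3 g u)
  obtain e where g: "g = (\<lambda>u. nemytskii e (V u))" and ok: "\<forall>u\<in>U. ok_on e (V u)" by (rule gensE[OF 3(1)])
  have "ok_on e (V u)" using ok 3(2) by (rule bspec)
  with V_carr[OF 3(2)] have mem: "nemytskii e (V u) \<in> carr (H r)" by (rule nemytskii_carr)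
  have gu: "g u = nemytskii e (V u)" by (rule fun_cong[OF g])
  show ?case by (subst gu) (rule mem)
next
  case (4 u a b c i)
  then show ?case by (intro op_carr)
next
  case (5 u a b c a' b' c' i)
  have z: "(a + a', intP (b + b'), intP (c + c')) = (a, intP b, intP c) + (a', intP b', intP c')"
    using 5 bounded_linear_betweenD(2)[OF bounded_linear_intP] by simp
  have y: "Sg u (a, intP b, intP c) \<in> carr (YS r)" "Sg u (a', intP b', intP c') \<in> carr (YS r)"
    by (rule Sg_carr[OF 5(1) triple_carr], fact)+
  have "bvec (0 + 0) (Sg u (a, intP b, intP c) + Sg u (a', intP b', intP c')) = bvec 0 (Sg u (a, intP b, intP c)) + bvec 0 (Sg u (a', intP b', intP c'))"
    by (rule vec_add[OF y])
  then show ?case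
    unfolding op_def z Sg_add[OF 5(1) triple_carr[OF 5(2)] triple_carr[OF 5(5)]] by (simp add: plus_fun_apply)
next
  case (6 u a b c i k)
  have z: "(k *\<^sub>R a, intP (k *\<^sub>R b), intP (k *\<^sub>R c)) = k *\<^sub>R (a, intP b, intP c)"
    using 6 bounded_linear_betweenD(3)[OF bounded_linear_intP] by simp
  have y: "Sg u (a, intP b, intP c) \<in> carr (YS r)" by (rule Sg_carr[OF 6(1) triple_carr[OF 6(2)]])
  have "bvec (k *\<^sub>R 0) (k *\<^sub>R Sg u (a, intP b, intP c)) = k *\<^sub>R bvec 0 (Sg u (a, intP b, intP c))"
    by (rule vec_scale[OF y])
  then show ?case
    unfolding op_def z Sg_scale[OF 6(1) triple_carr[OF 6(2)]] by (simp add: scaleR_fun_def[of k "bvec _ _"])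
next
  case (7 i)
  have "nrm (H r) (op i u f g h) \<le> (12 * b * mass) * (nrm (H r) f + nrm (H r) g + nrm (H r) h)"
    if "u \<in> U" "f \<in> carr (H r)" "g \<in> carr (H r)" "h \<in> carr (H r)" for u f g h
  proof -
    have z: "(f, intP g, intP h) \<in> carr (ZS r)" by (rule triple_carr[OF that(2)])
    have "nrm (H r) (op i u f g h) \<le> 12 * nrm (YS r) (Sg u (f, intP g, intP h))"
      unfolding op_def by (rule nrm_vec0_component[OF Sg_carr[OF that(1) z]])
    also have "\<dots> \<le> 12 * (b * nrm (ZS r) (f, intP g, intP h))" using nrm_Sg[OF that(1) z] by simp
    also have "\<dots> \<le> 12 * (b * (mass * (nrm (H r) f + nrm (H r) g + nrm (H r) h)))"
      using nrm_triple_le[OF that(2-4)] b by (intro mult_left_mono) auto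
    finally show ?thesis by simp
  qed
  then show ?case by blast
next
  case (8 u i)
  obtain d C where C: "0 < d" "0 < C"
    "\<And>u' z. u' \<in> U \<Longrightarrow> nrm (H r) (u' - u) < d \<Longrightarrow> z \<in> carr (ZS r) \<Longrightarrow>
       nrm (YS r) (Sg u' z - Sg u z) \<le> C * nrm (H r) (u' - u) * nrm (ZS r) z"
    by (rule Sg_lipschitz[OF 8]) (rule that)
  have "nrm (H r) (op i u' f g h - op i u f g h) \<le> (12 * C * mass) * nrm (H r) (u' - u) * (nrm (H r) f + nrm (H r) g + nrm (H r) h)"
    if u': "u' \<in> U" "nrm (H r) (u' - u) < d" and fgh: "f \<in> carr (H r)" "g \<in> carr (H r)" "h \<in> carr (H r)" for u' f g h
  proof -
    have z: "(f, intP g, intP h) \<in> carr (ZS r)" by (rule triple_carr[OF fgh(1)])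
    have k: "0 \<le> nrm (H r) (u' - u)" by (rule H.nrm_ge_0[OF H.diff_carr[OF UD UD]]) (use 8 u' in auto)
    note s = Sg_carr[OF u'(1) z] Sg_carr[OF 8 z]
    have "nrm (H r) (op i u' f g h - op i u f g h) \<le> 12 * nrm (YS r) (Sg u' (f, intP g, intP h) - Sg u (f, intP g, intP h))"
      unfolding op_def vec0_diff[OF s, symmetric] by (rule nrm_vec0_component[OF YS.diff_carr[OF s]])
    also have "\<dots> \<le> 12 * (C * nrm (H r) (u' - u) * nrm (ZS r) (f, intP g, intP h))" using C(3)[OF u' z] by simp
    also have "\<dots> \<le> 12 * (C * nrm (H r) (u' - u) * (mass * (nrm (H r) f + nrm (H r) g + nrm (H r) h)))"
      using nrm_triple_le[OF fgh] C(2) k by (intro mult_left_mono mult_nonneg_nonneg) auto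
    finally show ?thesis by (simp add: mult_ac)
  qed
  then show ?case using C(1) by blast
next
  case (9 g n)
  obtain e where g: "g = (\<lambda>u. nemytskii e (V u))" and ok': "\<forall>u\<in>U. ok_on e (V u)" by (rule gensE[OF 9])
  note ok = ok'[rule_format]
  define g' where "g' u vs = (\<Sum>i\<in>UNIV. nemytskii (pd i e) (V u) * W1 i u (vs n))" for u and vs :: "nat \<Rightarrow> real \<Rightarrow> real"
  have "T.tame {n} g'"
    unfolding g'_def
  proof (intro T.tame_sum)
    fix i
    have "(\<lambda>u. nemytskii (pd i e) (V u)) \<in> gens" by (intro nemytskii_gens ok_on_pd ok)
    then show "T.tame {n} (\<lambda>u vs. nemytskii (pd i e) (V u) * W1 i u (vs n))"
      using T.tame_mult[OF T.tame_gen tame_W1[of n i]] by simp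
  qed auto
  moreover have "T.tame_derivative {} n (\<lambda>u vs. g u) g'"
    unfolding T.tame_derivative_def
  proof (intro ballI allI impI)
    fix u and eps :: real assume u: "u \<in> U" and eps: "0 < eps"
    obtain d where d: "d > 0" "\<And>u'. u' \<in> U \<Longrightarrow> nrm (H r) (u' - u) < d \<Longrightarrow>
      nrm (H r) (nemytskii e (V u') - nemytskii e (V u) - nemytskii_deriv e (V u) (V1 u (u' - u))) \<le> eps * nrm (H r) (u' - u)"
      using nemytskii_V_derivative[OF u ok[OF u] eps] by blast
    have "g' u (vs(n := u' - u)) = nemytskii_deriv e (V u) (V1 u (u' - u))" if "u' \<in> U" for u' vs
      using V1_component[OF u H.diff_carr[OF UD[OF that] UD[OF u]]] by (simp add: g'_def nemytskii_deriv_def)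
    then show "\<exists>d>0. \<forall>u'\<in>U. nrm (H r) (u' - u) < d \<longrightarrow> (\<forall>vs. (\<forall>i\<in>{}. vs i \<in> carr (H r)) \<longrightarrow>
        nrm (H r) (g u' - g u - g' u (vs(n := u' - u))) \<le> eps * nrm (H r) (u' - u) * (\<Prod>i\<in>{}. nrm (H r) (vs i)))"
      using d by (intro exI[of _ d]) (simp add: g)
  qed
  ultimately show ?case by blast
next
  case (10 i)
  show ?case
  proof (intro exI[of _ "op2 i"] conjI allI impI ballI)
    show "T.tame (insert n S) (\<lambda>u vs. op2 i u (vs n) (f u vs) (g u vs) (h u vs))"
      if "n \<notin> S" "T.tame S f" "T.tame S g" "T.tame S h" for S n f g h
      using that by (rule tame_op2)
    fix u and eps :: real assume u: "u \<in> U" and eps: "0 < eps"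
    show "\<exists>d>0. \<forall>u'\<in>U. nrm (H r) (u' - u) < d \<longrightarrow> (\<forall>f\<in>carr (H r). \<forall>g\<in>carr (H r). \<forall>h\<in>carr (H r).
     nrm (H r) (op i u' f g h - op i u f g h - op2 i u (u' - u) f g h) \<le>
       eps * nrm (H r) (u' - u) * (nrm (H r) f + nrm (H r) g + nrm (H r) h))"
      using op_derivative[OF u eps, of i] op2_eq_op1[OF u H.diff_carr[OF UD UD[OF u]], of _ i] by simp
  qed
qed

lemma smooth_nemytskii_V:
  assumes "\<And>u. u \<in> U \<Longrightarrow> ok_on e (V u)"
  shows "smooth_between (H r) (H r) U (\<lambda>u. nemytskii e (V u))"
  by (rule T.tame_smooth[OF T.tame_gen[OF nemytskii_gens[OF assms]]])

lemma smooth_V: "smooth_between (H r) (H r) U (\<lambda>u. V u i)"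
  using smooth_nemytskii_V[of "Var i"] by (simp add: nemytskii_simps ok_on_def)

lemma bounded_linear_eval: "bounded_linear_between (H r) std (\<lambda>f. f 0)"
  by (rule bounded_linear_betweenI[where C = 1]) (auto simp: plus_fun_apply scaleR_fun_def H_le_nrm)

text \<open>The parameters are constant components of the pointwise data and are recovered by
  evaluation at 0. For x, the functions x, x' and x'' all depend smoothly on the warp at order
  \<open>r\<close>, the last one through the equation; two applications of the lifting lemma raise
  the order by 2.\<close>

lemma smooth_sol:
  assumes open_U: "\<And>u. u \<in> U \<Longrightarrow> \<exists>d>0. \<forall>u'\<in>carr (H r). nrm (H r) (u' - u) < d \<longrightarrow> u' \<in> U"
  shows "smooth_between (H r) std U (\<lambda>u. fst (sol u))"
    and "smooth_between (H r) std U (\<lambda>u. fst (snd (sol u)))"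
    and "smooth_between (H r) (H (r + 2)) U (\<lambda>u. snd (snd (sol u)))"
proof -
  show "smooth_between (H r) std U (\<lambda>u. fst (sol u))"
    using smooth_between_linear[OF nspace_H nspace_H smooth_V[of VM] bounded_linear_eval] by (simp add: V_def)
  show "smooth_between (H r) std U (\<lambda>u. fst (snd (sol u)))"
    using smooth_between_linear[OF nspace_H nspace_H smooth_V[of VD] bounded_linear_eval] by (simp add: V_def)
  define x where "x u = snd (snd (sol u))" for u
  have xc: "x u \<in> carr (H (Suc (Suc r)))" if "u \<in> U" for u using sol_carr[OF that] by (simp add: x_def)
  have x2: "deriv (deriv (x u)) = nemytskii e0 (V u)" if "u \<in> U" for u
    using sol_sysmap[OF that] by (simp add: sysmap_def x_def V_def zero_prod_def)
  have s0: "smooth_between (H r) (H r) U x" using smooth_V[of VX] by (simp add: V_def x_def[abs_def])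
  have s1: "smooth_between (H r) (H r) U (\<lambda>u. deriv (x u))" using smooth_V[of VY] by (simp add: V_def x_def[abs_def])
  have s2: "smooth_between (H r) (H r) U (\<lambda>u. deriv (deriv (x u)))"
    by (rule smooth_between_cong[OF smooth_nemytskii_V[OF ok_V(1)]]) (simp_all add: x2)
  have t1: "smooth_between (H r) (H (Suc r)) U (\<lambda>u. deriv (x u))"
    by (rule smooth_between_H_Suc[OF nspace_H s1 s2]) (use xc H_deriv open_U in auto)
  have t0: "smooth_between (H r) (H (Suc r)) U x"
    by (rule smooth_between_H_Suc[OF nspace_H s0 s1]) (use xc H_Suc_subset open_U in auto)
  have "smooth_between (H r) (H (Suc (Suc r))) U x"
    by (rule smooth_between_H_Suc[OF nspace_H t0 t1]) (use xc open_U in auto)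
  then show "smooth_between (H r) (H (r + 2)) U (\<lambda>u. snd (snd (sol u)))" by (simp add: x_def[abs_def])
qed

end

context periodic_system
begin

text \<open>Existence holds at radius \<open>\<nu>\<close> and uniqueness at radius
  \<open>3 * \<nu>\<close>, because a datum whose parameters and function are each within
  \<open>\<nu>\<close> lies within \<open>3 * \<nu>\<close> in the sum norm. The auxiliary
  \<open>d1\<close> lets the caller shrink both neighbourhoods.\<close>

lemma solution_family_exists:
  assumes L0: "L0 \<in> carr (H r)" and y0: "y0 \<in> carr (YS r)" and adm: "admissible (bvec L0 y0)"
    and sys0: "sysmap L0 y0 = 0" and b: "0 < b"
    and inv: "inverse_bounded_by (YS r) (ZS r) (lin (bvec L0 y0) 0) b" and d1: "0 < d1"
  obtains \<nu> \<eta> sol K where "0 < \<nu>" "3 * \<nu> \<le> d1" "0 < \<eta>" "\<eta> \<le> d1"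
    "solution_family P \<alpha> r e0 e1 e2 c1 c2 {L \<in> carr (H r). nrm (H r) (L - L0) < \<eta>} sol (2 * b) K"
    "\<And>L. L \<in> carr (H r) \<Longrightarrow> nrm (H r) (L - L0) < \<eta> \<Longrightarrow> nrm (YS r) (sol L - y0) < \<nu>"
    "\<And>L y. L \<in> carr (H r) \<Longrightarrow> nrm (H r) (L - L0) < \<eta> \<Longrightarrow> y \<in> carr (YS r) \<Longrightarrow> nrm (YS r) (y - y0) < 3 * \<nu> \<Longrightarrow>
       sysmap L y = 0 \<Longrightarrow> y = sol L"
proof -
  define V0 where "V0 = bvec L0 y0"
  have V0: "V0 \<in> carr (VS r)" unfolding V0_def by (rule vec_carr[OF L0 y0])
  have V0adm: "admissible V0" unfolding V0_def by (rule adm)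
  obtain da where da: "0 < da" "\<And>V'. V' \<in> carr (VS r) \<Longrightarrow> nrm (VS r) (V' - V0) < da \<Longrightarrow> admissible V'"
    by (rule admissible_open[OF V0 V0adm]) (rule that)
  obtain dl C where dl: "0 < dl" "0 < C"
    "\<And>V' k. V' \<in> carr (VS r) \<Longrightarrow> nrm (VS r) (V' - V0) < dl \<Longrightarrow> k \<in> carr (YS r) \<Longrightarrow>
       nrm (ZS r) (lin V' 0 k - lin V0 0 k) \<le> C * nrm (VS r) (V' - V0) * nrm (YS r) k"
    by (rule lin_lipschitz[OF V0 V0adm]) (rule that)
  note sd = strict_derivative_sysmap[OF L0 y0 adm]
  have eb: "0 < 1 / (2 * b)" using b by simp
  obtain ds where ds: "ds > 0" "\<And>z. z \<in> carr (XS r) \<Longrightarrow> nrm (XS r) (z - (L0, y0)) < ds \<Longrightarrow> sysmap (fst z) (snd z) \<in> carr (ZS r)"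
    "\<And>z z'. z \<in> carr (XS r) \<Longrightarrow> z' \<in> carr (XS r) \<Longrightarrow> nrm (XS r) (z - (L0, y0)) < ds \<Longrightarrow> nrm (XS r) (z' - (L0, y0)) < ds \<Longrightarrow>
      nrm (ZS r) (sysmap (fst z) (snd z) - sysmap (fst z') (snd z') - lin (bvec L0 y0) (fst (z - z')) (snd (z - z'))) \<le> 1 / (2 * b) * nrm (XS r) (z - z')"
    by (rule strict_derivative_atE[OF sd eb]) (rule that)
  obtain CL where CL: "0 < CL" "\<And>z. z \<in> carr (XS r) \<Longrightarrow> nrm (ZS r) (lin (bvec L0 y0) (fst z) (snd z)) \<le> CL * nrm (XS r) z"
    by (rule bounded_linear_between_bound[OF strict_derivative_atD(2)[OF sd] nspace_XS]) (rule that)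
  \<comment> \<open>The pointwise data move by less than \<open>24 * d\<close>, which 48
    accommodates with room to spare; the fourth entry gives
    \<open>C * (24 * d) \<le> 1 / (2 * b)\<close>, the perturbation that keeps the linearization
    invertible. \<open>ds / 2\<close> accounts for the sum norm on pairs.\<close>
  define d where "d = Min {da / 48, dl / 48, ds / 2, 1 / (48 * b * C), d1}"
  have d: "0 < d" "48 * d \<le> da" "48 * d \<le> dl" "2 * d \<le> ds" "d * (48 * b * C) \<le> 1" "d \<le> d1"
  proof -
    show "0 < d" using da(1) dl(1,2) ds(1) d1 b by (auto simp: d_def)
    have "d \<le> da / 48" "d \<le> dl / 48" "d \<le> ds / 2" "d \<le> 1 / (48 * b * C)" "d \<le> d1" unfolding d_def by auto
    moreover have "0 < 48 * b * C" using b dl(2) by simp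
    ultimately show "48 * d \<le> da" "48 * d \<le> dl" "2 * d \<le> ds" "d * (48 * b * C) \<le> 1" "d \<le> d1"
      by (auto simp: pos_le_divide_eq)
  qed
  have nbhd: "admissible (bvec L y) \<and> inverse_bounded_by (YS r) (ZS r) (lin (bvec L y) 0) (2 * b)"
    if *: "L \<in> carr (H r)" "y \<in> carr (YS r)" "nrm (H r) (L - L0) < d" "nrm (YS r) (y - y0) < d" for L y
  proof -
    have "bvec ((L - L0) + L0) ((y - y0) + y0) = bvec (L - L0) (y - y0) + bvec L0 y0"
      by (rule vec_add[OF YS.diff_carr[OF *(2) y0] y0])
    then have "bvec L y - V0 = bvec (L - L0) (y - y0)" by (simp add: V0_def)
    then have n: "nrm (VS r) (bvec L y - V0) < 24 * d"
      using nrm_vec_le[OF H.diff_carr[OF *(1) L0] YS.diff_carr[OF *(2) y0]] *(3,4) by simp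
    have m: "bvec L y \<in> carr (VS r)" by (rule vec_carr[OF *(1,2)])
    have a: "admissible (bvec L y)" by (rule da(2)[OF m]) (use n d in linarith)
    have "inverse_bounded_by (YS r) (ZS r) (lin (bvec L y) 0) (2 * b)"
    proof (rule inverse_bounded_by_perturbation[OF nspace_YS nspace_ZS complete_YS bounded_linear_lin0[OF L0 y0 adm] b inv bounded_linear_lin0[OF *(1,2) a]])
      fix k assume k: "k \<in> carr (YS r)"
      have "nrm (ZS r) (lin (bvec L y) 0 k - lin V0 0 k) \<le> C * nrm (VS r) (bvec L y - V0) * nrm (YS r) k"
        by (rule dl(3)[OF m _ k]) (use n d in linarith)
      also have "\<dots> \<le> C * (24 * d) * nrm (YS r) k"
        using n dl(2) YS.nrm_ge_0[OF k] by (intro mult_right_mono mult_left_mono) auto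
      also have "\<dots> \<le> 1 / (2 * b) * nrm (YS r) k"
        using d(5) b YS.nrm_ge_0[OF k] by (intro mult_right_mono) (auto simp: field_simps)
      finally show "nrm (ZS r) (lin (bvec L y) 0 k - lin (bvec L0 y0) 0 k) \<le> 1 / (2 * b) * nrm (YS r) k" by (simp add: V0_def)
    qed
    then show ?thesis using a by simp
  qed
  define CC where "CC = 1 / (2 * b) + CL"
  have CC: "0 \<le> CC" using eb CL(1) by (simp add: CC_def)
  have near: "nrm (XS r) ((L, y) - (L0, y0)) < ds" if "nrm (H r) (L - L0) < d" "nrm (YS r) (y - y0) < d" for L y
    using that d(4) by (simp add: nrm_prod_nspace[of "H r"])
  have Ncarr: "sysmap L y \<in> carr (ZS r)" if "L \<in> carr (H r)" "y \<in> carr (YS r)" "nrm (H r) (L - L0) < d" "nrm (YS r) (y - y0) < d" for L y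
    using ds(2)[of "(L, y)"] near[OF that(3,4)] that(1,2) by simp
  \<comment> \<open>The action of the linearization on the change of the warp is moved to the error
    term, where it only enlarges the Lipschitz constant \<open>CC\<close>; the unknown keeps the
    factor \<open>1 / (2 * b)\<close> required for the contraction.\<close>
  have Nstrict: "nrm (ZS r) (sysmap u1 y1 - sysmap u2 y2 - lin (bvec L0 y0) 0 (y1 - y2)) \<le> 1 / (2 * b) * nrm (YS r) (y1 - y2) + CC * nrm (H r) (u1 - u2)"
    if *: "u1 \<in> carr (H r)" "u2 \<in> carr (H r)" "y1 \<in> carr (YS r)" "y2 \<in> carr (YS r)"
      "nrm (H r) (u1 - L0) < d" "nrm (H r) (u2 - L0) < d" "nrm (YS r) (y1 - y0) < d" "nrm (YS r) (y2 - y0) < d" for u1 u2 y1 y2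
  proof -
    have m: "sysmap u1 y1 \<in> carr (ZS r)" "sysmap u2 y2 \<in> carr (ZS r)" using Ncarr * by auto
    have h: "u1 - u2 \<in> carr (H r)" "y1 - y2 \<in> carr (YS r)" using H.diff_carr[OF *(1,2)] YS.diff_carr[OF *(3,4)] by auto
    have l: "lin (bvec L0 y0) (u1 - u2) (y1 - y2) \<in> carr (ZS r)" "lin (bvec L0 y0) (u1 - u2) 0 \<in> carr (ZS r)"
      by (rule lin_carr[OF L0 y0 adm h] lin_carr[OF L0 y0 adm h(1) YS.zero_carr])+
    have eq: "sysmap u1 y1 - sysmap u2 y2 - lin (bvec L0 y0) 0 (y1 - y2) =
      (sysmap u1 y1 - sysmap u2 y2 - lin (bvec L0 y0) (u1 - u2) (y1 - y2)) + lin (bvec L0 y0) (u1 - u2) 0"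
      using lin_split[OF L0 y0 adm h] by simp
    have "nrm (ZS r) (sysmap u1 y1 - sysmap u2 y2 - lin (bvec L0 y0) 0 (y1 - y2)) \<le>
      nrm (ZS r) (sysmap u1 y1 - sysmap u2 y2 - lin (bvec L0 y0) (u1 - u2) (y1 - y2)) + nrm (ZS r) (lin (bvec L0 y0) (u1 - u2) 0)"
      unfolding eq by (rule ZS.nrm_triangle[OF ZS.diff_carr[OF ZS.diff_carr[OF m] l(1)] l(2)])
    moreover have "nrm (ZS r) (sysmap u1 y1 - sysmap u2 y2 - lin (bvec L0 y0) (u1 - u2) (y1 - y2)) \<le> 1 / (2 * b) * (nrm (H r) (u1 - u2) + nrm (YS r) (y1 - y2))"
      using ds(3)[of "(u1, y1)" "(u2, y2)"] near[OF *(5,7)] near[OF *(6,8)] *(1-4) by (simp add: nrm_prod_nspace[of "H r"])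
    moreover have "nrm (ZS r) (lin (bvec L0 y0) (u1 - u2) 0) \<le> CL * nrm (H r) (u1 - u2)"
      using CL(2)[of "(u1 - u2, 0)"] h(1) YS.zero_carr[of r] by (simp add: nrm_prod_nspace[of "H r"])
    ultimately show ?thesis by (simp add: CC_def algebra_simps)
  qed
  note ift = strict_implicit_function[where N = sysmap, OF nspace_H nspace_YS nspace_ZS complete_YS bounded_linear_lin0[OF L0 y0 adm] b inv L0 y0 sys0 CC d(1)]
  have ift2: "nrm (YS r) (y1 - y2) \<le> 2 * b * CC * nrm (H r) (u1 - u2)"
    if "u1 \<in> carr (H r)" "u2 \<in> carr (H r)" "y1 \<in> carr (YS r)" "y2 \<in> carr (YS r)"
      "nrm (H r) (u1 - L0) < d" "nrm (H r) (u2 - L0) < d" "nrm (YS r) (y1 - y0) < d" "nrm (YS r) (y2 - y0) < d"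
      "sysmap u1 y1 = 0" "sysmap u2 y2 = 0" for u1 u2 y1 y2
    by (rule ift(2), fact Ncarr, fact Nstrict, fact+)
  define \<nu> where "\<nu> = d / 3"
  have \<nu>: "0 < \<nu>" "3 * \<nu> = d" "\<nu> \<le> d" using d(1) by (auto simp: \<nu>_def)
  have "\<exists>\<eta>>0. \<forall>u\<in>carr (H r). nrm (H r) (u - L0) < \<eta> \<longrightarrow> (\<exists>y\<in>carr (YS r). nrm (YS r) (y - y0) < \<nu> \<and> sysmap u y = 0)"
    by (rule ift(1), fact Ncarr, fact Nstrict, fact \<nu>, fact \<nu>)
  then obtain \<eta>0 where \<eta>0: "\<eta>0 > 0" "\<And>u. u \<in> carr (H r) \<Longrightarrow> nrm (H r) (u - L0) < \<eta>0 \<Longrightarrow>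
      \<exists>y\<in>carr (YS r). nrm (YS r) (y - y0) < \<nu> \<and> sysmap u y = 0"
    by blast
  define \<eta> where "\<eta> = min \<eta>0 d"
  have \<eta>: "0 < \<eta>" "\<eta> \<le> \<eta>0" "\<eta> \<le> d" using \<eta>0(1) d(1) by (auto simp: \<eta>_def)
  define sol where "sol u = (SOME y. y \<in> carr (YS r) \<and> nrm (YS r) (y - y0) < \<nu> \<and> sysmap u y = 0)" for u
  have sol: "sol u \<in> carr (YS r) \<and> nrm (YS r) (sol u - y0) < \<nu> \<and> sysmap u (sol u) = 0"
    if "u \<in> carr (H r)" "nrm (H r) (u - L0) < \<eta>" for u
    unfolding sol_def by (rule someI_ex) (use \<eta>0(2)[OF that(1)] that(2) \<eta> in auto)
  have sol_near: "nrm (YS r) (sol u - y0) < d" if "u \<in> carr (H r)" "nrm (H r) (u - L0) < \<eta>" for u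
    using sol[OF that] \<nu> by linarith
  show ?thesis
  proof (rule that[of \<nu> \<eta> sol "2 * b * CC"])
    show "0 < \<nu>" "3 * \<nu> \<le> d1" "0 < \<eta>" "\<eta> \<le> d1" using \<nu> \<eta> d by auto
    show "solution_family P \<alpha> r e0 e1 e2 c1 c2 {L \<in> carr (H r). nrm (H r) (L - L0) < \<eta>} sol (2 * b) (2 * b * CC)"
    proof (unfold_locales, goal_cases)
      case (2 u)
      then show ?case using sol by blast
    next
      case (3 u)
      then have u: "u \<in> carr (H r)" "nrm (H r) (u - L0) < \<eta>" by auto
      show ?case using nbhd[OF u(1) _ _ sol_near[OF u]] sol[OF u] u(2) \<eta> by simp
    next
      case (4 u)
      then show ?case using sol by blast
    next
      case 5
      then show ?case using b by simp
    next
      case 6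
      then show ?case using b CC by simp
    next
      case (7 u)
      then have u: "u \<in> carr (H r)" "nrm (H r) (u - L0) < \<eta>" by auto
      show ?case using nbhd[OF u(1) _ _ sol_near[OF u]] sol[OF u] u(2) \<eta> by simp
    next
      case (8 u u')
      then have u: "u \<in> carr (H r)" "nrm (H r) (u - L0) < \<eta>" "u' \<in> carr (H r)" "nrm (H r) (u' - L0) < \<eta>" by auto
      show ?case
        by (rule ift2) (use u sol[OF u(1,2)] sol[OF u(3,4)] sol_near[OF u(1,2)] sol_near[OF u(3,4)] \<eta> in simp_all)
    qed auto
    show "nrm (YS r) (sol L - y0) < \<nu>" if "L \<in> carr (H r)" "nrm (H r) (L - L0) < \<eta>" for L
      using sol[OF that] by blast
    show "y = sol L" if *: "L \<in> carr (H r)" "nrm (H r) (L - L0) < \<eta>" "y \<in> carr (YS r)" "nrm (YS r) (y - y0) < 3 * \<nu>" "sysmap L y = 0" for L y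
    proof -
      have s: "sol L \<in> carr (YS r)" "sysmap L (sol L) = 0" using sol[OF *(1,2)] by auto
      have "nrm (YS r) (y - sol L) \<le> 2 * b * CC * nrm (H r) (L - L)"
        by (rule ift2[OF *(1,1,3) s(1)]) (use * s sol_near[OF *(1,2)] \<nu> \<eta> in simp_all)
      then have "nrm (YS r) (y - sol L) \<le> 0" by simp
      then show ?thesis by (rule YS.nrm_diff_eq_0[OF *(3) s(1)])
    qed
  qed
qed

end

section \<open>The bordered linearization\<close>

context holder
begin

text \<open>If \<phi> has order \<open>j + 2\<close>, the right hand side has order
  \<open>j + 1\<close> as soon as the coefficients and \<open>f\<close> do, and the equation then
  returns \<phi> at order \<open>j + 3\<close>. The low norm of \<phi> on the right starts the
  induction.\<close>

lemma second_order_regularity: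
  "a0 \<in> carr (H j) \<Longrightarrow> a1 \<in> carr (H j) \<Longrightarrow> \<exists>C\<ge>0. \<forall>\<phi>\<in>carr (H (Suc (Suc 0))). \<forall>f\<in>carr (H j).
     deriv (deriv \<phi>) = f + (a0 * \<phi> + a1 * deriv \<phi>) \<longrightarrow>
     \<phi> \<in> carr (H (Suc (Suc j))) \<and> nrm (H (Suc (Suc j))) \<phi> \<le> C * (nrm (H j) f + nrm (H (Suc (Suc 0))) \<phi>)"
proof (induction j)
  case 0
  have "nrm (H (Suc (Suc 0))) \<phi> \<le> 1 * (nrm (H 0) f + nrm (H (Suc (Suc 0))) \<phi>)" if "f \<in> carr (H 0)" for f \<phi>
    using H.nrm_ge_0[OF that] by simp
  then show ?case by (intro exI[of _ 1]) auto
next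
  case (Suc j)
  then obtain C where C: "0 \<le> C" "\<And>\<phi> f. \<phi> \<in> carr (H (Suc (Suc 0))) \<Longrightarrow> f \<in> carr (H j) \<Longrightarrow> deriv (deriv \<phi>) = f + (a0 * \<phi> + a1 * deriv \<phi>) \<Longrightarrow>
     \<phi> \<in> carr (H (Suc (Suc j))) \<and> nrm (H (Suc (Suc j))) \<phi> \<le> C * (nrm (H j) f + nrm (H (Suc (Suc 0))) \<phi>)"
    using H_Suc_subset by blast
  define N where "N = nrm (H (Suc j)) a0 + nrm (H (Suc j)) a1"
  have N: "0 \<le> N" "nrm (H (Suc j)) a0 \<le> N" "nrm (H (Suc j)) a1 \<le> N"
    using H.nrm_ge_0[OF Suc.prems(1)] H.nrm_ge_0[OF Suc.prems(2)] by (auto simp: N_def)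
  define D where "D = 1 + 9 * C + 12 * (HK (Suc j) * N * C)"
  have HC: "0 \<le> HK (Suc j) * N * C" using HK_pos[of "Suc j"] N(1) C(1) by (intro mult_nonneg_nonneg) auto
  have D: "0 \<le> D" using HC C(1) by (simp add: D_def)
  have "\<phi> \<in> carr (H (Suc (Suc (Suc j)))) \<and> nrm (H (Suc (Suc (Suc j)))) \<phi> \<le> (D + 9 * (1 + HK (Suc j) * N) * C * 3) * (nrm (H (Suc j)) f + nrm (H (Suc (Suc 0))) \<phi>)"
    if \<phi>: "\<phi> \<in> carr (H (Suc (Suc 0)))" and f: "f \<in> carr (H (Suc j))" and eq: "deriv (deriv \<phi>) = f + (a0 * \<phi> + a1 * deriv \<phi>)" for \<phi> f
  proof -
    have fj: "f \<in> carr (H j)" "nrm (H j) f \<le> 3 * nrm (H (Suc j)) f" using H_Suc_subset[OF f] by auto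
    define X where "X = nrm (H (Suc j)) f + nrm (H (Suc (Suc 0))) \<phi>"
    have X: "0 \<le> X" "nrm (H (Suc j)) f \<le> X" "nrm (H (Suc (Suc 0))) \<phi> \<le> X"
      using H.nrm_ge_0[OF f] H.nrm_ge_0[OF \<phi>] by (auto simp: X_def)
    define n where "n = nrm (H (Suc (Suc j))) \<phi>"
    have p: "\<phi> \<in> carr (H (Suc (Suc j)))" and "n \<le> C * (nrm (H j) f + nrm (H (Suc (Suc 0))) \<phi>)"
      using C(2)[OF \<phi> fj(1) eq] by (auto simp: n_def)
    then have n: "n \<le> C * (3 * X)"
      using fj(2) C(1) H.nrm_ge_0[OF \<phi>] by (smt (verit) mult_left_mono X_def)
    have p1: "\<phi> \<in> carr (H (Suc j))" "nrm (H (Suc j)) \<phi> \<le> 3 * n" using H_Suc_subset[OF p] by (auto simp: n_def)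
    have p2: "deriv \<phi> \<in> carr (H (Suc j))" "nrm (H (Suc j)) (deriv \<phi>) \<le> n" using H_deriv[OF p] nrm_H_deriv[OF p] by (auto simp: n_def)
    have m: "a0 * \<phi> \<in> carr (H (Suc j))" "a1 * deriv \<phi> \<in> carr (H (Suc j))" using Suc.prems p1 p2 by (auto intro: mult_carr)
    have dd: "deriv (deriv \<phi>) \<in> carr (H (Suc j))" unfolding eq using f m by auto
    have "nrm (H (Suc j)) (deriv (deriv \<phi>)) \<le> nrm (H (Suc j)) f + (HK (Suc j) * N * (3 * n) + HK (Suc j) * N * n)"
      unfolding eq
      by (intro order_trans[OF H.nrm_triangle] add_mono order_refl nrm_mult_le Suc.prems N p1 p2 f m H.add_carr)
    also have "\<dots> \<le> X + 4 * (HK (Suc j) * N * (C * (3 * X)))"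
    proof -
      have "0 \<le> HK (Suc j) * N" using HK_pos[of "Suc j"] N(1) by simp
      from mult_left_mono[OF n this] X(2) show ?thesis by linarith
    qed
    finally have 1: "nrm (H (Suc j)) (deriv (deriv \<phi>)) \<le> X + 12 * (HK (Suc j) * N * C) * X" by (simp add: algebra_simps)
    have "deriv \<phi> \<in> carr (H (Suc (Suc j)))" using H_periodic[OF p2(1)] p2(1) dd by (simp add: carr_H_Suc[of "deriv \<phi>"])
    then have mem: "\<phi> \<in> carr (H (Suc (Suc (Suc j))))" using p by (simp add: carr_H_Suc[of \<phi>])
    have "nrm (H (Suc (Suc (Suc j)))) \<phi> = sup_norm \<phi> + (sup_norm (deriv \<phi>) + nrm (H (Suc j)) (deriv (deriv \<phi>)))"
      by (simp only: nrm_H_Suc[of "Suc (Suc j)"] nrm_H_Suc[of "Suc j"])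
    moreover have "sup_norm \<phi> \<le> n" using sup_norm_le_nrm[OF p] by (simp add: n_def)
    moreover have "sup_norm (deriv \<phi>) \<le> n" using sup_norm_le_nrm[OF p2(1)] p2(2) by linarith
    ultimately have "nrm (H (Suc (Suc (Suc j)))) \<phi> \<le> 6 * C * X + (X + 12 * (HK (Suc j) * N * C) * X)" using n 1 by linarith
    also have "\<dots> = (1 + 6 * C + 12 * (HK (Suc j) * N * C)) * X" by (simp add: algebra_simps)
    also have "\<dots> \<le> (D + 9 * (1 + HK (Suc j) * N) * C * 3) * X"
    proof (intro mult_right_mono X(1))
      have "0 \<le> 9 * (1 + HK (Suc j) * N) * C * 3" using HK_pos[of "Suc j"] N(1) C(1) by (intro mult_nonneg_nonneg) auto
      then show "1 + 6 * C + 12 * (HK (Suc j) * N * C) \<le> D + 9 * (1 + HK (Suc j) * N) * C * 3"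
        using C(1) by (simp add: D_def)
    qed
    finally show ?thesis using mem by (simp add: X_def)
  qed
  moreover have "0 \<le> D + 9 * (1 + HK (Suc j) * N) * C * 3"
    using D HK_pos[of "Suc j"] N(1) C(1) by (intro add_nonneg_nonneg mult_nonneg_nonneg) auto
  ultimately show ?case by blast
qed

lemma nemytskii_deriv_add: "nemytskii_deriv e V (W + W') = nemytskii_deriv e V W + nemytskii_deriv e V W'"
  by (simp add: nemytskii_deriv_def plus_fun_apply[of W W'] distrib_left sum.distrib)

lemma nemytskii_deriv_bound:
  assumes "V \<in> carr (VS j)" "ok_on e V"
  obtains C where "0 < C" "\<And>W. W \<in> carr (VS j) \<Longrightarrow> nrm (H j) (nemytskii_deriv e V W) \<le> C * nrm (VS j) W"
  using bounded_linear_between_bound[OF strict_derivative_atD(2)[OF strict_derivative_nemytskii[OF assms]] nspace_VS] by blast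

end

context periodic_system
begin

text \<open>The block of the linearization in x alone, with the warp and both parameters
  frozen.\<close>

definition lin_x :: "(bvar \<Rightarrow> real \<Rightarrow> real) \<Rightarrow> rfun \<Rightarrow> real \<Rightarrow> real" where
  "lin_x V \<phi> = deriv (deriv \<phi>) - nemytskii_deriv e0 V (bvec 0 (0, 0, \<phi>))"

text \<open>
  Block elimination: \<open>\<Phi>\<close> is the response of \<open>x\<close> to the two parameters and \<open>B\<close> is the resulting Schur
  complement of the bordered operator.
\<close>

lemma bordered_inverse:
  assumes V: "\<And>j. V \<in> carr (VS j)" and adm: "admissible V"
    and iso: "isomorphism_between (H 2) (H 0) (lin_x V)"
    and \<Phi>: "\<And>w. \<Phi> w \<in> carr (H 2)" "\<And>w. lin_x V (\<Phi> w) = nemytskii_deriv e0 V (bvec 0 (fst w, snd w, 0))"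
    and B: "linear B" "bij B"
    and B_eq: "\<And>w. B w = (intP (nemytskii_deriv e1 V (bvec 0 (fst w, snd w, \<Phi> w))), intP (nemytskii_deriv e2 V (bvec 0 (fst w, snd w, \<Phi> w))))"
  shows "\<exists>b>0. inverse_bounded_by (YS r) (ZS r) (lin V 0) b"
proof -
  have two: "(2 :: nat) = Suc (Suc 0)" by simp
  have ok: "ok_on e0 V" "ok_on e1 V" "ok_on e2 V" using adm by (auto simp: admissible_def)
  have vec_split: "bvec 0 (a, c, \<phi> + \<psi>) = bvec 0 (0, 0, \<phi>) + bvec 0 (a, c, \<psi>)" if "\<phi> \<in> carr (H 2)" "\<psi> \<in> carr (H 2)" for a c \<phi> \<psi>
    using vec_add[of "(0, 0, \<phi>)" 0 "(a, c, \<psi>)" 0 0] that unfolding two by simp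
  have vc: "bvec 0 (a, c, \<phi>) \<in> carr (VS 0)" if "\<phi> \<in> carr (H 2)" for a c \<phi>
    by (rule vec_carr) (use that in \<open>simp_all add: two\<close>)
  have z0: "(0 :: real \<Rightarrow> real) \<in> carr (H 2)" by simp
  have nv: "nrm (VS 0) (bvec 0 (a, c, \<phi>)) \<le> 12 * (\<bar>a\<bar> + \<bar>c\<bar> + nrm (H 2) \<phi>)" if "\<phi> \<in> carr (H 2)" for a c \<phi>
    using nrm_vec_le[of 0 0 "(a, c, \<phi>)"] that unfolding two by (simp add: nrm_prod_nspace)
  obtain C0 where C0: "0 < C0" "\<And>W. W \<in> carr (VS 0) \<Longrightarrow> nrm (H 0) (nemytskii_deriv e0 V W) \<le> C0 * nrm (VS 0) W"
    by (rule nemytskii_deriv_bound[OF V ok(1)]) (rule that)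
  obtain C1 where C1: "0 < C1" "\<And>W. W \<in> carr (VS 0) \<Longrightarrow> nrm (H 0) (nemytskii_deriv e1 V W) \<le> C1 * nrm (VS 0) W"
    by (rule nemytskii_deriv_bound[OF V ok(2)]) (rule that)
  obtain C2 where C2: "0 < C2" "\<And>W. W \<in> carr (VS 0) \<Longrightarrow> nrm (H 0) (nemytskii_deriv e2 V W) \<le> C2 * nrm (VS 0) W"
    by (rule nemytskii_deriv_bound[OF V ok(3)]) (rule that)
  have bij: "bij_betw (lin_x V) (carr (H 2)) (carr (H 0))"
    and binv: "bounded_linear_between (H 0) (H 2) (inv_into (carr (H 2)) (lin_x V))"
    using iso unfolding isomorphism_between_def by auto
  obtain CA where CA: "0 < CA" "\<And>f. f \<in> carr (H 0) \<Longrightarrow> nrm (H 2) (inv_into (carr (H 2)) (lin_x V) f) \<le> CA * nrm (H 0) f"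
    by (rule bounded_linear_between_bound[OF binv nspace_H]) (rule that)
  have A_bound: "nrm (H 2) \<phi> \<le> CA * nrm (H 0) (lin_x V \<phi>)" if "\<phi> \<in> carr (H 2)" for \<phi>
    using CA(2)[of "lin_x V \<phi>"] bij_betw_inv_into_left[OF bij that] bij_betwE[OF bij] that by auto
  have A_surj: "\<exists>\<phi>\<in>carr (H 2). lin_x V \<phi> = f" if "f \<in> carr (H 0)" for f
  proof -
    have "f \<in> lin_x V ` carr (H 2)" using that bij_betw_imp_surj_on[OF bij] by simp
    then show ?thesis by (elim imageE) (rule bexI, rule sym)
  qed
  have dd_add: "deriv (deriv (\<phi> + \<psi>)) = deriv (deriv \<phi>) + deriv (deriv \<psi>)" if "\<phi> \<in> carr (H 2)" "\<psi> \<in> carr (H 2)" for \<phi> \<psi>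
    using that unfolding two by (simp add: deriv_add_H[of _ "Suc 0"] deriv_add_H[of _ 0] H_deriv)
  \<comment> \<open>In the coordinates \<psi> = \<phi> - \<Phi> w the bordered operator is block
    triangular: the equation involves only \<psi>, and the parameters enter the constraints through
    \<open>B\<close>.\<close>
  have main: "lin V 0 (a, c, \<psi> + \<Phi> (a, c)) =
      (lin_x V \<psi>, intP (nemytskii_deriv e1 V (bvec 0 (0, 0, \<psi>))) + fst (B (a, c)), intP (nemytskii_deriv e2 V (bvec 0 (0, 0, \<psi>))) + snd (B (a, c)))"
    if \<psi>: "\<psi> \<in> carr (H 2)" for a c \<psi>
  proof -
    define w where "w = (a, c)"
    have s: "bvec 0 (a, c, \<psi> + \<Phi> w) = bvec 0 (0, 0, \<psi>) + bvec 0 (a, c, \<Phi> w)" by (rule vec_split[OF \<psi> \<Phi>(1)])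
    have s': "bvec 0 (a, c, \<Phi> w) = bvec 0 (0, 0, \<Phi> w) + bvec 0 (a, c, 0)" using vec_split[OF \<Phi>(1)[of w] z0, of a c] by simp
    have "deriv (deriv (\<Phi> w)) = nemytskii_deriv e0 V (bvec 0 (a, c, \<Phi> w))"
      using \<Phi>(2)[of w] unfolding lin_x_def s' nemytskii_deriv_add by (simp add: w_def algebra_simps)
    moreover have "nemytskii_deriv e V (bvec 0 (0, 0, \<psi>)) \<in> carr (H 0)" "nemytskii_deriv e V (bvec 0 (a, c, \<Phi> w)) \<in> carr (H 0)" if "ok_on e V" for e
      using nemytskii_deriv_carr[OF V vc[OF \<psi>] that] nemytskii_deriv_carr[OF V vc[OF \<Phi>(1)] that] by auto
    ultimately show ?thesis
      unfolding w_def[symmetric]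
      using ok bounded_linear_betweenD(2)[OF bounded_linear_intP[of 0]]
      by (simp add: lin_def s nemytskii_deriv_add dd_add[OF \<psi> \<Phi>(1)] lin_x_def B_eq[of w] w_def[symmetric])
        (simp add: w_def)
  qed
  obtain cB where cB: "0 < cB" "\<And>w. cB * norm w \<le> norm (B w)"
    using linear_inj_bounded_below_pos[OF B(1)] bij_is_inj[OF B(2)] by blast
  define cX cY cM cD where [abs_def]: "cX = nemytskii (pd VX e0) V" "cY = nemytskii (pd VY e0) V" "cM = nemytskii (pd VM e0) V" "cD = nemytskii (pd VD e0) V"
  note c_defs = this
  have c: "cX \<in> carr (H j)" "cY \<in> carr (H j)" "cM \<in> carr (H j)" "cD \<in> carr (H j)" for j
    unfolding c_defs by (rule nemytskii_carr[OF V ok_on_pd[OF ok(1)]])+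
  have nd0: "nemytskii_deriv e0 V (bvec 0 (a, k, \<phi>)) = (a *\<^sub>R cM + k *\<^sub>R cD) + (cX * \<phi> + cY * deriv \<phi>)" for a k \<phi>
    by (auto simp: nemytskii_deriv_def UNIV_bvar c_defs fun_eq_iff plus_fun_apply times_fun_apply scaleR_fun_def)
  \<comment> \<open>This is where the given invertibility between orders 2 and 0 is carried over to
    the orders \<open>r + 2\<close> and \<open>r\<close>.\<close>
  obtain CR where CR: "0 \<le> CR" "\<And>\<phi> f. \<phi> \<in> carr (H 2) \<Longrightarrow> f \<in> carr (H r) \<Longrightarrow> deriv (deriv \<phi>) = f + (cX * \<phi> + cY * deriv \<phi>) \<Longrightarrow>
     \<phi> \<in> carr (H (Suc (Suc r))) \<and> nrm (H (Suc (Suc r))) \<phi> \<le> CR * (nrm (H r) f + nrm (H 2) \<phi>)"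
    using second_order_regularity[OF c(1,2), of r] unfolding two by blast
  have H2: "\<phi> \<in> carr (H 2)" if "\<phi> \<in> carr (H (Suc (Suc r)))" for \<phi> using H_mono[OF _ that, of 2] by simp
  have Hr0: "f \<in> carr (H 0) \<and> nrm (H 0) f \<le> 3 ^ r * nrm (H r) f" if "f \<in> carr (H r)" for f
    using H_mono[OF _ that, of 0] nrm_H_mono[OF _ that, of 0] by simp
  define G where "G = 12 * P * (C1 + C2)"
  have G: "0 \<le> G" using P C1(1) C2(1) by (simp add: G_def)
  have int_le: "\<bar>intP (nemytskii_deriv e1 V (bvec 0 (0, 0, \<psi>)))\<bar> + \<bar>intP (nemytskii_deriv e2 V (bvec 0 (0, 0, \<psi>)))\<bar> \<le> G * nrm (H 2) \<psi>" if \<psi>: "\<psi> \<in> carr (H 2)" for \<psi>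
  proof -
    have "nrm (H 0) (nemytskii_deriv e1 V (bvec 0 (0, 0, \<psi>))) \<le> C1 * (12 * nrm (H 2) \<psi>)"
      by (rule order_trans[OF C1(2)[OF vc[OF \<psi>]] mult_left_mono]) (use nv[OF \<psi>, of 0 0] C1(1) in auto)
    moreover have "nrm (H 0) (nemytskii_deriv e2 V (bvec 0 (0, 0, \<psi>))) \<le> C2 * (12 * nrm (H 2) \<psi>)"
      by (rule order_trans[OF C2(2)[OF vc[OF \<psi>]] mult_left_mono]) (use nv[OF \<psi>, of 0 0] C2(1) in auto)
    ultimately have "\<bar>intP (nemytskii_deriv e1 V (bvec 0 (0, 0, \<psi>)))\<bar> \<le> P * (C1 * (12 * nrm (H 2) \<psi>))"
      "\<bar>intP (nemytskii_deriv e2 V (bvec 0 (0, 0, \<psi>)))\<bar> \<le> P * (C2 * (12 * nrm (H 2) \<psi>))"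
      using nemytskii_deriv_carr[OF V vc[OF \<psi>] ok(2)] nemytskii_deriv_carr[OF V vc[OF \<psi>] ok(3)] by (auto intro!: intP_le[of _ 0])
    then show ?thesis by (simp add: G_def algebra_simps)
  qed
  have "\<exists>b>0. \<forall>y\<in>carr (YS r). nrm (YS r) y \<le> b * nrm (ZS r) (lin V 0 y)"
  proof -
    \<comment> \<open>In terms of the norm of the image, \<open>K1\<close> bounds \<psi> at order 2,
      \<open>K2\<close> the size of the parameter vector, \<open>K3\<close> the function \<phi> at
      order 2, and \<open>K4\<close> the same function at order \<open>r + 2\<close>.\<close>
    define K1 where "K1 = CA * 3 ^ r"
    define K2 where "K2 = (1 + G * K1) / cB"
    define K3 where "K3 = K1 + CA * (C0 * 12) * (2 * K2)"
    define K4 where "K4 = CR * (1 + (nrm (H r) cM + nrm (H r) cD) * (2 * K2) + K3)"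
    have K: "0 < K1" "0 < K2" "0 \<le> K3" using CA(1) cB(1) G C0(1) by (auto simp: K1_def K2_def K3_def add_pos_nonneg)
    have cc: "0 \<le> nrm (H r) cM" "0 \<le> nrm (H r) cD" using H.nrm_ge_0[OF c(3)] H.nrm_ge_0[OF c(4)] by auto
    have K4: "0 \<le> K4" unfolding K4_def using CR(1) K cc by (intro mult_nonneg_nonneg add_nonneg_nonneg) auto
    have "nrm (YS r) y \<le> (2 * K2 + K4) * nrm (ZS r) (lin V 0 y)" if y: "y \<in> carr (YS r)" for y
    proof -
      obtain a k \<phi> where y_eq: "y = (a, k, \<phi>)" by (cases y) auto
      have \<phi>: "\<phi> \<in> carr (H (Suc (Suc r)))" "\<phi> \<in> carr (H 2)" using y H2 by (auto simp: y_eq)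
      define w where "w = (a, k)"
      define \<psi> where "\<psi> = \<phi> - \<Phi> w"
      have \<psi>: "\<psi> \<in> carr (H 2)" unfolding \<psi>_def by (rule H.diff_carr[OF \<phi>(2) \<Phi>(1)])
      define f where "f = lin_x V \<psi>"
      define n where "n = nrm (ZS r) (lin V 0 y)"
      have lin_y: "lin V 0 y = (f, intP (nemytskii_deriv e1 V (bvec 0 (0, 0, \<psi>))) + fst (B w), intP (nemytskii_deriv e2 V (bvec 0 (0, 0, \<psi>))) + snd (B w))"
        using main[OF \<psi>, of a k] by (simp add: y_eq f_def \<psi>_def w_def)
      have f_eq: "f = deriv (deriv \<phi>) - nemytskii_deriv e0 V (bvec 0 (a, k, \<phi>))"
        using arg_cong[OF lin_y, of fst] by (simp add: lin_def y_eq)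
      have bc: "bvec 0 y \<in> carr (VS r)" by (rule vec_carr[OF H.zero_carr y])
      have fr: "f \<in> carr (H r)"
        unfolding f_eq using H_deriv[OF H_deriv[OF \<phi>(1)]] nemytskii_deriv_carr[OF V bc ok(1)] by (simp add: y_eq)
      have parts: "nrm (H r) f \<le> n" "norm (fst (B w)) + norm (snd (B w)) \<le> n + G * nrm (H 2) \<psi>"
        using int_le[OF \<psi>] H.nrm_ge_0[OF fr] by (auto simp: n_def lin_y nrm_prod_nspace)
      have n0: "0 \<le> n" using parts(1) H.nrm_ge_0[OF fr] by linarith
      have "nrm (H 2) \<psi> \<le> CA * nrm (H 0) f" unfolding f_def by (rule A_bound[OF \<psi>])
      also have "\<dots> \<le> CA * (3 ^ r * n)"
      proof (rule mult_left_mono)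
        have "3 ^ r * nrm (H r) f \<le> 3 ^ r * n" using parts(1) by simp
        then show "nrm (H 0) f \<le> 3 ^ r * n" using Hr0[OF fr] by linarith
      qed (use CA in simp)
      finally have p1: "nrm (H 2) \<psi> \<le> K1 * n" by (simp add: K1_def)
      have "cB * norm w \<le> norm (B w)" by (rule cB(2))
      also have "\<dots> \<le> norm (fst (B w)) + norm (snd (B w))" using norm_Pair_le[of "fst (B w)" "snd (B w)"] by simp
      also have "\<dots> \<le> n + G * (K1 * n)" using parts(2) mult_left_mono[OF p1 G] by linarith
      finally have "norm w * cB \<le> (1 + G * K1) * n" by (simp add: algebra_simps)
      then have nw: "norm w \<le> K2 * n" using cB(1) by (simp add: K2_def field_simps)
      have ak: "\<bar>a\<bar> + \<bar>k\<bar> \<le> 2 * K2 * n" using norm_fst_le[of a k] norm_snd_le[of k a] nw by (simp add: w_def)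
      have "nrm (H 2) (\<Phi> w) \<le> CA * nrm (H 0) (lin_x V (\<Phi> w))" by (rule A_bound[OF \<Phi>(1)])
      also have "lin_x V (\<Phi> w) = nemytskii_deriv e0 V (bvec 0 (a, k, 0))" using \<Phi>(2)[of w] by (simp add: w_def)
      also have "CA * nrm (H 0) (nemytskii_deriv e0 V (bvec 0 (a, k, 0))) \<le> CA * (C0 * (12 * (2 * K2 * n)))"
      proof (rule mult_left_mono)
        have "nrm (H 0) (nemytskii_deriv e0 V (bvec 0 (a, k, 0))) \<le> C0 * nrm (VS 0) (bvec 0 (a, k, 0))" by (rule C0(2)[OF vc[OF z0]])
        also have "\<dots> \<le> C0 * (12 * (2 * K2 * n))" using nv[OF z0, of a k] ak C0(1) by (intro mult_left_mono) auto
        finally show "nrm (H 0) (nemytskii_deriv e0 V (bvec 0 (a, k, 0))) \<le> C0 * (12 * (2 * K2 * n))" .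
      qed (use CA in simp)
      finally have pw: "nrm (H 2) (\<Phi> w) \<le> CA * (C0 * 12) * (2 * K2) * n" by simp
      have "\<phi> = \<psi> + \<Phi> w" by (simp add: \<psi>_def)
      then have p2: "nrm (H 2) \<phi> \<le> K3 * n"
        using H.nrm_triangle[OF \<psi> \<Phi>(1)[of w]] p1 pw by (simp add: K3_def algebra_simps)
      define g where "g = f + (a *\<^sub>R cM + k *\<^sub>R cD)"
      have g: "g \<in> carr (H r)" unfolding g_def using fr c by auto
      have "deriv (deriv \<phi>) = g + (cX * \<phi> + cY * deriv \<phi>)" using f_eq unfolding nd0 g_def by (simp add: algebra_simps)
      then have "nrm (H (Suc (Suc r))) \<phi> \<le> CR * (nrm (H r) g + nrm (H 2) \<phi>)" using CR(2)[OF \<phi>(2) g] by blast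
      also have "\<dots> \<le> CR * ((n + (nrm (H r) cM + nrm (H r) cD) * (2 * K2 * n)) + K3 * n)"
      proof (intro mult_left_mono add_mono CR(1) p2)
        have "nrm (H r) g \<le> nrm (H r) f + (\<bar>a\<bar> * nrm (H r) cM + \<bar>k\<bar> * nrm (H r) cD)"
          unfolding g_def using H.nrm_triangle[OF fr, of "a *\<^sub>R cM + k *\<^sub>R cD"] H.nrm_triangle[of "a *\<^sub>R cM" r "k *\<^sub>R cD"] c(3,4)[of r]
          by (simp add: H.nrm_scale)
        moreover have "\<bar>a\<bar> * nrm (H r) cM \<le> (2 * K2 * n) * nrm (H r) cM" "\<bar>k\<bar> * nrm (H r) cD \<le> (2 * K2 * n) * nrm (H r) cD"
          using ak cc by (auto intro!: mult_right_mono)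
        ultimately show "nrm (H r) g \<le> n + (nrm (H r) cM + nrm (H r) cD) * (2 * K2 * n)"
          using parts(1) by (simp add: algebra_simps)
      qed
      also have "\<dots> = K4 * n" by (simp add: K4_def algebra_simps)
      finally have "nrm (YS r) y \<le> 2 * K2 * n + K4 * n" using ak by (simp add: y_eq nrm_prod_nspace)
      then show ?thesis by (simp add: n_def algebra_simps)
    qed
    then show ?thesis using K K4 by (intro exI[of _ "2 * K2 + K4"]) auto
  qed
  moreover have "\<exists>y\<in>carr (YS r). lin V 0 y = z" if z: "z \<in> carr (ZS r)" for z
  proof -
    obtain f g1 g2 where z_eq: "z = (f, g1, g2)" by (cases z) auto
    have f: "f \<in> carr (H r)" "f \<in> carr (H 0)" using z Hr0 by (auto simp: z_eq)
    obtain \<psi> where \<psi>: "\<psi> \<in> carr (H 2)" "lin_x V \<psi> = f" using A_surj[OF f(2)] by blast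
    obtain w where w: "B w = (g1 - intP (nemytskii_deriv e1 V (bvec 0 (0, 0, \<psi>))), g2 - intP (nemytskii_deriv e2 V (bvec 0 (0, 0, \<psi>))))"
      using bij_is_surj[OF B(2)] by (metis surjD)
    define \<phi> where "\<phi> = \<psi> + \<Phi> w"
    have \<phi>: "\<phi> \<in> carr (H 2)" unfolding \<phi>_def by (rule H.add_carr[OF \<psi>(1) \<Phi>(1)])
    have lin_eq: "lin V 0 (fst w, snd w, \<phi>) = z" using main[OF \<psi>(1), of "fst w" "snd w"] w \<psi>(2) by (simp add: \<phi>_def z_eq)
    then have "f = deriv (deriv \<phi>) - nemytskii_deriv e0 V (bvec 0 (fst w, snd w, \<phi>))" by (simp add: lin_def z_eq)
    then have "deriv (deriv \<phi>) = (f + (fst w *\<^sub>R cM + snd w *\<^sub>R cD)) + (cX * \<phi> + cY * deriv \<phi>)"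
      unfolding nd0 by (simp add: algebra_simps)
    then have "\<phi> \<in> carr (H (Suc (Suc r)))" using CR(2)[OF \<phi>, of "f + (fst w *\<^sub>R cM + snd w *\<^sub>R cD)"] f(1) c[of r] by auto
    then show ?thesis using lin_eq by (intro bexI[of _ "(fst w, snd w, \<phi>)"]) auto
  qed
  ultimately show ?thesis unfolding inverse_bounded_by_def by blast
qed

end

section \<open>Comparison of C^{j+1} with C^{j,\<alpha>}, and tangents to curves of unknowns\<close>

context holder
begin

lemma carr_Cper_Suc:
  "f \<in> carr (Cper P (Suc j)) \<longleftrightarrow>
     periodic_fun_simple f P \<and> (\<forall>t. f differentiable (at t)) \<and> deriv f \<in> carr (Cper P j)"
  by (auto simp: Cper_def times_cont_diff_Suc periodic_deriv funpow_swap1)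

lemma nrm_Cper_Suc: "nrm (Cper P (Suc j)) f = sup_norm f + nrm (Cper P j) (deriv f)"
  by (simp add: Cper_def sum.atMost_Suc_shift funpow_swap1 del: sum.atMost_Suc)

text \<open>One continuous derivative controls the Hoelder quotient by interpolation. Branches,
  whose smoothness is measured in the spaces \<open>Cper P j\<close>, thereby become usable in
  Hoelder spaces.\<close>

lemma Cper_Suc_subset:
  "f \<in> carr (Cper P (Suc j)) \<Longrightarrow> f \<in> carr (H j) \<and> nrm (H j) f \<le> 3 * nrm (Cper P (Suc j)) f"
proof (induction j arbitrary: f)
  case 0
  then have f: "periodic_fun_simple f P" "\<And>t. (f has_real_derivative deriv f t) (at t)" "periodic_fun_simple (deriv f) P" "continuous_on UNIV (deriv f)"
    by (auto simp: carr_Cper_Suc Cper_def times_cont_diff_def DERIV_deriv_iff_real_differentiable periodic_deriv)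
  have cont: "continuous_on UNIV f" using f(2) by (auto intro!: continuous_at_imp_continuous_on DERIV_isCont)
  obtain C where "\<And>t. \<bar>f t\<bar> \<le> C" using periodic_bounded[OF f(1) P cont] by blast
  then have A: "\<bar>f t\<bar> \<le> sup_norm f" for t by (rule abs_le_sup_norm)
  obtain C' where "\<And>t. \<bar>deriv f t\<bar> \<le> C'" using periodic_bounded[OF f(3) P f(4)] by blast
  then have B: "\<bar>deriv f t\<bar> \<le> sup_norm (deriv f)" for t by (rule abs_le_sup_norm)
  have *: "\<bar>f s - f t\<bar> \<le> (2 * sup_norm f + sup_norm (deriv f)) * \<bar>s - t\<bar> powr \<alpha>" for s t
    by (rule holder_of_derivative_bound[OF f(2) A B])
  have "f \<in> carr (H 0)" by (rule H0I[OF f(1) cont *])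
  moreover have "0 \<le> sup_norm f" "0 \<le> sup_norm (deriv f)" using A[of 0] B[of 0] by auto
  moreover have "nrm (H 0) f \<le> sup_norm f + (2 * sup_norm f + sup_norm (deriv f))"
    by (rule nrm_H0_le[OF A *]) (use A[of 0] B[of 0] in auto)
  ultimately show ?case by (simp add: nrm_Cper_Suc) (simp add: Cper_def)
next
  case (Suc j)
  then have "deriv f \<in> carr (H j)" "nrm (H j) (deriv f) \<le> 3 * nrm (Cper P (Suc j)) (deriv f)" by (auto simp: carr_Cper_Suc[of f])
  moreover from this(1) Suc.prems have m: "f \<in> carr (H (Suc j))" by (simp add: carr_Cper_Suc[of f] carr_H_Suc[of f])
  moreover have "0 \<le> sup_norm f" by (rule sup_norm_ge_0[OF m])
  ultimately show ?case by (simp add: nrm_Cper_Suc[of "Suc j"] nrm_H_Suc[of j f])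
qed

lemma positive_smooth_periodic_H:
  assumes "positive_smooth_periodic P f"
  shows "f \<in> carr (H j)"
proof -
  have "f \<in> carr (Cper P (Suc j))" using assms by (auto simp: positive_smooth_periodic_def Cper_def)
  then show ?thesis using Cper_Suc_subset by blast
qed

end

context periodic_system
begin

text \<open>Compares the linearization with a difference quotient along a curve through
  \<open>y0\<close>. Arbitrarily small positive parameters suffice, so one-sided tangents at the
  boundary of a parameter domain are covered; linearity then allows division by \<tau>.\<close>

lemma tangent_equation:
  assumes L0: "L0 \<in> carr (H r)" and y0: "y0 \<in> carr (YS r)" and adm: "admissible (bvec L0 y0)"
    and \<Phi>: "k \<in> carr (YS r)" and z: "z \<in> carr (ZS r)"
    and curve: "\<And>e. e > 0 \<Longrightarrow> \<exists>\<tau> y. 0 < \<tau> \<and> \<tau> < e \<and> y \<in> carr (YS r) \<and> nrm (YS r) (y - y0 - \<tau> *\<^sub>R k) \<le> e * \<tau> \<and>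
       nrm (ZS r) (sysmap L0 y - sysmap L0 y0 - \<tau> *\<^sub>R z) \<le> e * \<tau>"
  shows "lin (bvec L0 y0) 0 k = z"
proof -
  note bl = bounded_linear_lin0[OF L0 y0 adm]
  obtain CL where CL: "0 < CL" "\<And>v. v \<in> carr (YS r) \<Longrightarrow> nrm (ZS r) (lin (bvec L0 y0) 0 v) \<le> CL * nrm (YS r) v"
    by (rule bounded_linear_between_bound[OF bl nspace_YS]) (rule that)
  have lk: "lin (bvec L0 y0) 0 k \<in> carr (ZS r)" by (rule lin_carr[OF L0 y0 adm H.zero_carr \<Phi>])
  define M where "M = nrm (YS r) k + 1"
  have M: "1 \<le> M" using YS.nrm_ge_0[OF \<Phi>] by (simp add: M_def)
  have "nrm (ZS r) (lin (bvec L0 y0) 0 k - z) \<le> eps" if eps: "0 < eps" for eps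
  proof -
    \<comment> \<open>The three summands collect the deviation of the image from
      \<open>\<tau> *\<^sub>R z\<close>, the strict remainder on an increment of size at most
      \<open>M * \<tau>\<close>, and the linearization of the deviation of the curve from its
      tangent.\<close>
    define e where "e = min 1 (eps / (M + 1 + CL))"
    have e: "0 < e" "e \<le> 1" "e * (M + 1 + CL) \<le> eps"
    proof -
      have S: "0 < M + 1 + CL" using M CL(1) by simp
      then show "0 < e" "e \<le> 1" using eps by (auto simp: e_def)
      have "e \<le> eps / (M + 1 + CL)" by (simp add: e_def)
      then show "e * (M + 1 + CL) \<le> eps" using S by (simp only: pos_le_divide_eq)
    qed
    obtain d where d: "d > 0"
      "\<And>v. v \<in> carr (XS r) \<Longrightarrow> nrm (XS r) (v - (L0, y0)) < d \<Longrightarrow> sysmap (fst v) (snd v) \<in> carr (ZS r)"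
      "\<And>v v'. v \<in> carr (XS r) \<Longrightarrow> v' \<in> carr (XS r) \<Longrightarrow> nrm (XS r) (v - (L0, y0)) < d \<Longrightarrow> nrm (XS r) (v' - (L0, y0)) < d \<Longrightarrow>
      nrm (ZS r) (sysmap (fst v) (snd v) - sysmap (fst v') (snd v') - lin (bvec L0 y0) (fst (v - v')) (snd (v - v'))) \<le> e * nrm (XS r) (v - v')"
      by (rule strict_derivative_atE[OF strict_derivative_sysmap[OF L0 y0 adm] e(1)]) (rule that)
    have "0 < min e (d / M)" using e d(1) M by simp
    from curve[OF this] obtain \<tau> y where \<tau>: "0 < \<tau>" "\<tau> < min e (d / M)" and y: "y \<in> carr (YS r)"
      and 1: "nrm (YS r) (y - y0 - \<tau> *\<^sub>R k) \<le> min e (d / M) * \<tau>"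
      and 2: "nrm (ZS r) (sysmap L0 y - sysmap L0 y0 - \<tau> *\<^sub>R z) \<le> min e (d / M) * \<tau>" by blast
    have me: "min e (d / M) * \<tau> \<le> e * \<tau>" using \<tau>(1) by (intro mult_right_mono) auto
    define \<rho> where "\<rho> = y - y0 - \<tau> *\<^sub>R k"
    have \<rho>: "\<rho> \<in> carr (YS r)" unfolding \<rho>_def by (rule YS.diff_carr[OF YS.diff_carr[OF y y0] YS.scale_carr[OF \<Phi>]])
    have n\<rho>: "nrm (YS r) \<rho> \<le> e * \<tau>" using 1 me by (simp add: \<rho>_def)
    have dy: "y - y0 = \<tau> *\<^sub>R k + \<rho>" by (simp add: \<rho>_def)
    have "nrm (YS r) (y - y0) \<le> \<tau> * nrm (YS r) k + e * \<tau>"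
      unfolding dy using YS.nrm_triangle[OF YS.scale_carr[OF \<Phi>, of \<tau>] \<rho>] n\<rho> \<tau>(1) YS.nrm_scale[OF \<Phi>, of \<tau>] by simp
    also have "\<dots> \<le> M * \<tau>" using e(2) \<tau>(1) by (simp add: M_def algebra_simps)
    finally have ny: "nrm (YS r) (y - y0) \<le> M * \<tau>" .
    have "M * \<tau> < d" using \<tau>(2) M by (simp add: field_simps)
    then have near: "nrm (XS r) ((L0, y) - (L0, y0)) < d" using ny by (simp add: nrm_prod_nspace[of "H r"])
    have near0: "nrm (XS r) ((L0, y0) - (L0, y0)) < d" using d(1) by simp
    have S: "sysmap L0 y \<in> carr (ZS r)" "sysmap L0 y0 \<in> carr (ZS r)"
      using d(2)[of "(L0, y)"] d(2)[of "(L0, y0)"] near near0 L0 y y0 by auto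
    have "nrm (ZS r) (sysmap L0 y - sysmap L0 y0 - lin (bvec L0 y0) 0 (y - y0)) \<le> e * nrm (YS r) (y - y0)"
      using d(3)[of "(L0, y)" "(L0, y0)"] near near0 L0 y y0 by (simp add: nrm_prod_nspace[of "H r"])
    also have "\<dots> \<le> e * (M * \<tau>)" using ny e by (intro mult_left_mono) auto
    finally have 3: "nrm (ZS r) (sysmap L0 y - sysmap L0 y0 - lin (bvec L0 y0) 0 (y - y0)) \<le> e * M * \<tau>" by simp
    have l\<rho>: "lin (bvec L0 y0) 0 \<rho> \<in> carr (ZS r)" "nrm (ZS r) (lin (bvec L0 y0) 0 \<rho>) \<le> CL * (e * \<tau>)"
    proof -
      show "lin (bvec L0 y0) 0 \<rho> \<in> carr (ZS r)" by (rule bounded_linear_betweenD(1)[OF bl \<rho>])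
      show "nrm (ZS r) (lin (bvec L0 y0) 0 \<rho>) \<le> CL * (e * \<tau>)"
        by (rule order_trans[OF CL(2)[OF \<rho>] mult_left_mono[OF n\<rho>]]) (use CL(1) in simp)
    qed
    have ly: "lin (bvec L0 y0) 0 (y - y0) = \<tau> *\<^sub>R lin (bvec L0 y0) 0 k + lin (bvec L0 y0) 0 \<rho>"
      unfolding dy by (simp only: bounded_linear_betweenD(2)[OF bl YS.scale_carr[OF \<Phi>] \<rho>] bounded_linear_betweenD(3)[OF bl \<Phi>])
    define a where "a = sysmap L0 y - sysmap L0 y0 - \<tau> *\<^sub>R z"
    define c where "c = sysmap L0 y - sysmap L0 y0 - lin (bvec L0 y0) 0 (y - y0)"
    have ac: "a \<in> carr (ZS r)" "c \<in> carr (ZS r)"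
      unfolding a_def c_def
      by (rule ZS.diff_carr[OF ZS.diff_carr[OF S] ZS.scale_carr[OF z]]
          ZS.diff_carr[OF ZS.diff_carr[OF S] bounded_linear_betweenD(1)[OF bl YS.diff_carr[OF y y0]]])+
    have "\<tau> *\<^sub>R (lin (bvec L0 y0) 0 k - z) = a - c - lin (bvec L0 y0) 0 \<rho>"
      unfolding a_def c_def ly by (simp add: algebra_simps)
    then have "\<bar>\<tau>\<bar> * nrm (ZS r) (lin (bvec L0 y0) 0 k - z) = nrm (ZS r) (a - c - lin (bvec L0 y0) 0 \<rho>)"
      using ZS.nrm_scale[OF ZS.diff_carr[OF lk z], of \<tau>] by simp
    also have "\<dots> \<le> nrm (ZS r) a + nrm (ZS r) c + nrm (ZS r) (lin (bvec L0 y0) 0 \<rho>)"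
      using ZS.nrm_diff_triangle[OF ZS.diff_carr[OF ac] l\<rho>(1)] ZS.nrm_diff_triangle[OF ac] by linarith
    also have "\<dots> \<le> e * \<tau> + e * M * \<tau> + CL * (e * \<tau>)" using 2 me 3 l\<rho>(2) by (simp add: a_def c_def)
    also have "\<dots> = \<tau> * (e * (M + 1 + CL))" by (simp add: algebra_simps)
    also have "\<dots> \<le> \<tau> * eps" using e(3) \<tau>(1) by (intro mult_left_mono) auto
    finally show ?thesis using \<tau>(1) by simp
  qed
  then have "nrm (ZS r) (lin (bvec L0 y0) 0 k - z) \<le> 0" by (rule field_le_epsilon[of _ 0, simplified])
  then show ?thesis by (rule ZS.nrm_diff_eq_0[OF lk z])
qed

end

section \<open>The magnitude equation\<close>

definition q_ex :: "bvar ex" where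
  "q_ex = Add (Mul (Var VX) (Var VX)) (Add (Var VD)
     (Mul (Cst (-1)) (Mul (Mul (Var VD) (Var VD)) (Mul (Var VX) (Var VX)))))"

definition r_ex :: "bvar ex" where
  "r_ex = Add (Cst 1) (Mul (Cst (-1)) (Mul (Var VD) (Add (Mul (Var VX) (Var VX)) (Mul (Var VY) (Var VY)))))"

definition b_ex :: "bvar ex" where
  "b_ex = Add (Cst 1) (Mul (Cst (-1)) (Mul (Var VD) (Mul (Var VX) (Var VX))))"

text \<open>Divisions are written as powers with exponent -1 or -2, so that the side conditions of
  the syntax record the positivity of L, of x and of the denominator.\<close>

definition rhs_ex :: "nat \<Rightarrow> nat \<Rightarrow> real \<Rightarrow> bvar ex" where
  "rhs_ex k1 k2 d1 = Add (Mul r_ex (Mul (Pow (Var VX) (-1)) (Pow q_ex (-1)))) (Mul (Cst (-1)) (Add (Var VX)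
     (Mul (Mul r_ex (Var VX)) (Add
       (Mul (Mul (Var VM) (Pow (Var VL) (2 * real k1 / real k2)))
          (Pow (Mul (Mul (Var VX) (Var VX)) (Mul r_ex (Pow q_ex (-1)))) (1 / real k2)))
       (Mul (Cst (- d1)) (Pow (Var VL) (-2)))))))"

definition D1_ex :: "bvar ex" where
  "D1_ex = Mul (Pow r_ex (1/2)) (Mul (Pow (Var VX) (-1)) (Pow q_ex (-1/2)))"

definition D2_ex :: "bvar ex" where
  "D2_ex = Mul (Mul (Var VX) (Pow r_ex (1/2))) (Mul (Pow b_ex (-1)) (Pow q_ex (-1/2)))"

locale magnitude = holder +
  fixes r k1 k2 :: nat and d1 \<sigma> \<rho>1 \<rho>2 :: real
  assumes \<sigma>: "\<sigma> \<in> {-1, 1}"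
begin

sublocale periodic_system P \<alpha> r "rhs_ex k1 k2 d1" D1_ex D2_ex "\<sigma> * (2 * pi * \<rho>1)" "\<sigma> * (2 * pi * \<rho>2)"
  by unfold_locales

lemma ev_q: "ev q_ex (\<lambda>i. bvec L (\<mu>, \<delta>, x) i t) = q_fun \<delta> x t"
  by (simp add: q_ex_def q_fun_def power2_eq_square)

lemma ev_r: "ev r_ex (\<lambda>i. bvec L (\<mu>, \<delta>, x) i t) = r_fun \<delta> x t"
  by (simp add: r_ex_def r_fun_def power2_eq_square)

lemma ev_b: "ev b_ex (\<lambda>i. bvec L (\<mu>, \<delta>, x) i t) = 1 - \<delta> * (x t)\<^sup>2"
  by (simp add: b_ex_def power2_eq_square)

text \<open>Dropping the derivative from \<open>r_fun\<close> only increases it, so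
  \<open>1 - \<delta> * (x t)\<^sup>2\<close> is positive, and the denominator equals
  \<open>(x t)\<^sup>2\<close> plus \<delta> times this quantity.\<close>

lemma q_fun_pos:
  assumes "0 < \<delta>" "0 < x t" "0 < r_fun \<delta> x t"
  shows "0 < q_fun \<delta> x t" "0 < 1 - \<delta> * (x t)\<^sup>2"
proof -
  have "0 \<le> \<delta> * (deriv x t)\<^sup>2" using assms(1) by simp
  then show b: "0 < 1 - \<delta> * (x t)\<^sup>2" using assms(3) by (simp add: r_fun_def algebra_simps)
  have "q_fun \<delta> x t = (x t)\<^sup>2 + \<delta> * (1 - \<delta> * (x t)\<^sup>2)" by (simp add: q_fun_def algebra_simps power2_eq_square)
  then show "0 < q_fun \<delta> x t" using assms b by (simp add: add_pos_pos)
qed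

text \<open>The syntactic side conditions amount to the positivity assumptions on a datum; those on
  the remaining bases follow from them. Consequently the openness of admissibility yields openness
  of these assumptions.\<close>

lemma admissible_iff:
  assumes "0 < \<delta>"
  shows "admissible (bvec L (\<mu>, \<delta>, x)) \<longleftrightarrow> (\<forall>t. 0 < L t) \<and> (\<forall>t. 0 < x t) \<and> (\<forall>t. 0 < r_fun \<delta> x t)"
proof
  assume a: "admissible (bvec L (\<mu>, \<delta>, x))"
  then have "\<forall>t. ok D1_ex (\<lambda>i. bvec L (\<mu>, \<delta>, x) i t)" "\<forall>t. ok (rhs_ex k1 k2 d1) (\<lambda>i. bvec L (\<mu>, \<delta>, x) i t)"
    by (auto simp: admissible_def ok_on_def)
  then show "(\<forall>t. 0 < L t) \<and> (\<forall>t. 0 < x t) \<and> (\<forall>t. 0 < r_fun \<delta> x t)"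
    by (simp add: D1_ex_def rhs_ex_def ev_r)
next
  assume p: "(\<forall>t. 0 < L t) \<and> (\<forall>t. 0 < x t) \<and> (\<forall>t. 0 < r_fun \<delta> x t)"
  have q: "0 < q_fun \<delta> x t" "0 < 1 - \<delta> * (x t)\<^sup>2" for t using q_fun_pos[OF assms] p by auto
  have okq: "ok q_ex v" "ok r_ex v" "ok b_ex v" for v by (simp_all add: q_ex_def r_ex_def b_ex_def)
  show "admissible (bvec L (\<mu>, \<delta>, x))"
    unfolding admissible_def ok_on_def
    using p q q(1)[THEN less_imp_neq, symmetric]
    by (auto simp: D1_ex_def D2_ex_def rhs_ex_def okq ev_q ev_r ev_b intro!: divide_pos_pos mult_pos_pos)
qed

lemma nemytskii_rhs:
  assumes "0 < L t" "0 < x t" "0 < q_fun \<delta> x t"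
  shows "nemytskii (rhs_ex k1 k2 d1) (bvec L (\<mu>, \<delta>, x)) t = magnitude_rhs k1 k2 d1 L \<mu> \<delta> x t"
proof -
  have "L t powr (-2) = 1 / (L t)\<^sup>2" using assms(1) by (simp add: powr_minus powr_numeral divide_simps)
  moreover have "x t powr (-1) = 1 / x t" "q_fun \<delta> x t powr (-1) = 1 / q_fun \<delta> x t"
    using assms by (simp_all add: powr_minus divide_simps)
  ultimately show ?thesis
    by (simp add: nemytskii_def rhs_ex_def ev_q ev_r magnitude_rhs_def w_fun_def power2_eq_square algebra_simps)
qed

lemma nemytskii_D1:
  assumes "0 < x t" "0 < q_fun \<delta> x t" "0 < r_fun \<delta> x t"
  shows "nemytskii D1_ex (bvec L (\<mu>, \<delta>, x)) t = sqrt (r_fun \<delta> x t) / (x t * sqrt (q_fun \<delta> x t))"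
proof -
  have "q_fun \<delta> x t powr (-1/2) = 1 / sqrt (q_fun \<delta> x t)" "r_fun \<delta> x t powr (1/2) = sqrt (r_fun \<delta> x t)" "x t powr (-1) = 1 / x t"
    using assms powr_minus[of "q_fun \<delta> x t" "1/2"] by (simp_all add: powr_half_sqrt powr_minus divide_simps)
  then show ?thesis by (simp add: nemytskii_def D1_ex_def ev_q ev_r)
qed

lemma nemytskii_D2:
  assumes "0 < x t" "0 < q_fun \<delta> x t" "0 < r_fun \<delta> x t" "0 < 1 - \<delta> * (x t)\<^sup>2"
  shows "nemytskii D2_ex (bvec L (\<mu>, \<delta>, x)) t = x t * sqrt (r_fun \<delta> x t) / ((1 - \<delta> * (x t)\<^sup>2) * sqrt (q_fun \<delta> x t))"
proof -
  have "q_fun \<delta> x t powr (-1/2) = 1 / sqrt (q_fun \<delta> x t)" "r_fun \<delta> x t powr (1/2) = sqrt (r_fun \<delta> x t)"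
    "(1 - \<delta> * (x t)\<^sup>2) powr (-1) = 1 / (1 - \<delta> * (x t)\<^sup>2)"
    using assms powr_minus[of "q_fun \<delta> x t" "1/2"] by (simp_all add: powr_half_sqrt powr_minus divide_simps)
  then show ?thesis by (simp add: nemytskii_def D2_ex_def ev_q ev_r ev_b)
qed

text \<open>Since \<open>\<sigma>\<^sup>2 = 1\<close>, the return condition reads \<open>D\<^sub>i = \<sigma> * 2 * pi * \<rho>\<^sub>i\<close>.\<close>

lemma sysmap_eq:
  assumes "0 < \<delta>" "\<And>t. 0 < L t" "\<And>t. 0 < x t" "\<And>t. 0 < r_fun \<delta> x t"
  shows "sysmap L (\<mu>, \<delta>, x) = (magnitude_residual k1 k2 d1 L \<mu> \<delta> x, D1 P \<delta> x + - (\<sigma> * (2 * pi * \<rho>1)), D2 P \<delta> x + - (\<sigma> * (2 * pi * \<rho>2)))"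
proof -
  have q: "0 < q_fun \<delta> x t" "0 < 1 - \<delta> * (x t)\<^sup>2" for t using q_fun_pos[OF assms(1)] assms by auto
  have "nemytskii (rhs_ex k1 k2 d1) (bvec L (\<mu>, \<delta>, x)) = magnitude_rhs k1 k2 d1 L \<mu> \<delta> x"
    by (rule ext, rule nemytskii_rhs) (use assms q in auto)
  moreover have "nemytskii D1_ex (bvec L (\<mu>, \<delta>, x)) = (\<lambda>t. sqrt (r_fun \<delta> x t) / (x t * sqrt (q_fun \<delta> x t)))"
    by (rule ext, rule nemytskii_D1) (use assms q in auto)
  moreover have "nemytskii D2_ex (bvec L (\<mu>, \<delta>, x)) = (\<lambda>t. x t * sqrt (r_fun \<delta> x t) / ((1 - \<delta> * (x t)\<^sup>2) * sqrt (q_fun \<delta> x t)))"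
    by (rule ext, rule nemytskii_D2) (use assms q in auto)
  moreover have "deriv (deriv x) + - magnitude_rhs k1 k2 d1 L \<mu> \<delta> x = magnitude_residual k1 k2 d1 L \<mu> \<delta> x"
    by (simp add: fun_eq_iff magnitude_residual_def minus_apply)
  ultimately show ?thesis unfolding sysmap_def intP_def D1_def D2_def snd_conv by (simp only:)
qed

lemma return_iff: "\<sigma> * D = c \<longleftrightarrow> D + - (\<sigma> * c) = 0" for D c :: real
  using \<sigma> by auto

text \<open>Positivity is kept as a separate condition, because only under it do the expressions
  agree with the functions in the equation. Regularity of order 2 is contained in the membership of
  \<open>x\<close>.\<close>

lemma datum_iff:
  assumes L: "\<And>t. 0 < L t" and x: "x \<in> carr (H 2)" and \<mu>: "0 < \<mu>" "0 < \<delta>"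
  shows "datum_with_return k1 k2 d1 P \<sigma> L \<rho>1 \<rho>2 \<mu> \<delta> x \<longleftrightarrow>
    (\<forall>t. 0 < x t) \<and> (\<forall>t. 0 < r_fun \<delta> x t) \<and> sysmap L (\<mu>, \<delta>, x) = 0"
proof -
  have reg: "periodic_fun_simple x P" "times_cont_diff 2 x" using x by (auto simp: Hper_def)
  have "(\<forall>t. deriv (deriv x) t = magnitude_rhs k1 k2 d1 L \<mu> \<delta> x t) \<longleftrightarrow> magnitude_residual k1 k2 d1 L \<mu> \<delta> x = 0"
    by (simp add: magnitude_residual_def fun_eq_iff)
  moreover have "product_return \<sigma> P \<delta> x = (2 * pi * \<rho>1, 2 * pi * \<rho>2) \<longleftrightarrow>
      D1 P \<delta> x + - (\<sigma> * (2 * pi * \<rho>1)) = 0 \<and> D2 P \<delta> x + - (\<sigma> * (2 * pi * \<rho>2)) = 0"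
    unfolding product_return_def prod.inject return_iff ..
  moreover have "sysmap L (\<mu>, \<delta>, x) = 0 \<longleftrightarrow> magnitude_residual k1 k2 d1 L \<mu> \<delta> x = 0 \<and>
      D1 P \<delta> x + - (\<sigma> * (2 * pi * \<rho>1)) = 0 \<and> D2 P \<delta> x + - (\<sigma> * (2 * pi * \<rho>2)) = 0"
    if "\<forall>t. 0 < x t" "\<forall>t. 0 < r_fun \<delta> x t"
    using sysmap_eq[of \<delta> L x \<mu>] that L \<mu> by (simp add: zero_prod_def)
  ultimately show ?thesis
    unfolding datum_with_return_def magnitude_solution_def using reg \<mu> by blast
qed

end

section \<open>The linearized residual and tangents of the branch\<close>

context magnitude
begin

text \<open>Uniqueness of Frechet derivatives: the given derivative and the formal linearization are
  both compared with the increment of the residual along small multiples of \<phi>.\<close>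

lemma frechet_residual_eq:
  assumes L0: "L0 \<in> carr (H r)" "\<And>t. 0 < L0 t" and xs: "xs \<in> carr (H (Suc (Suc r)))" "\<And>t. 0 < xs t" "\<And>t. 0 < r_fun \<delta> xs t"
    and \<delta>: "0 < \<delta>"
    and A: "has_frechet_derivative_between (H (Suc (Suc r))) (H r) (magnitude_residual k1 k2 d1 L0 \<mu> \<delta>) A xs"
    and \<phi>: "\<phi> \<in> carr (H (Suc (Suc r)))"
  shows "A \<phi> = lin_x (bvec L0 (\<mu>, \<delta>, xs)) \<phi>"
proof -
  define y0 where "y0 = (\<mu>, \<delta>, xs)"
  have y0: "y0 \<in> carr (YS r)" using xs by (simp add: y0_def)
  have adm: "admissible (bvec L0 y0)" unfolding y0_def admissible_iff[OF \<delta>] using L0 xs by simp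
  have V0: "bvec L0 y0 \<in> carr (VS r)" by (rule vec_carr[OF L0(1) y0])
  obtain da where da: "0 < da" "\<And>V'. V' \<in> carr (VS r) \<Longrightarrow> nrm (VS r) (V' - bvec L0 y0) < da \<Longrightarrow> admissible V'"
    by (rule admissible_open[OF V0 adm]) (rule that)
  define res where "res = magnitude_residual k1 k2 d1 L0 \<mu> \<delta>"
  have bA: "bounded_linear_between (H (Suc (Suc r))) (H r) A" using A by (simp add: has_frechet_derivative_between_def)
  have A_est: "\<exists>d>0. \<forall>h\<in>carr (H (Suc (Suc r))). nrm (H (Suc (Suc r))) h < d \<longrightarrow> res (xs + h) - res xs - A h \<in> carr (H r) \<and>
      nrm (H r) (res (xs + h) - res xs - A h) \<le> e * nrm (H (Suc (Suc r))) h" if "e > 0" for e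
    using A that unfolding has_frechet_derivative_between_def res_def by blast
  define k where "k = ((0, 0, \<phi>) :: real \<times> real \<times> rfun)"
  have k: "k \<in> carr (YS r)" using \<phi> by (simp add: k_def)
  have nk: "nrm (YS r) k = nrm (H (Suc (Suc r))) \<phi>" by (simp add: k_def nrm_prod_nspace)
  note bl = bounded_linear_lin0[OF L0(1) y0 adm]
  have lin_fst: "fst (lin (bvec L0 y0) 0 k) = lin_x (bvec L0 y0) \<phi>" by (simp add: lin_def lin_x_def k_def)
  have lxc: "lin_x (bvec L0 y0) \<phi> \<in> carr (H r)" using lin_carr[OF L0(1) y0 adm H.zero_carr k] by (simp add: lin_fst[symmetric])
  have Ac: "A \<phi> \<in> carr (H r)" by (rule bounded_linear_betweenD(1)[OF bA \<phi>])
  define M where "M = nrm (H (Suc (Suc r))) \<phi> + 1"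
  have M: "0 < M" using H.nrm_ge_0[OF \<phi>] by (simp add: M_def)
  have "nrm (H r) (A \<phi> - lin_x (bvec L0 y0) \<phi>) \<le> eps" if eps: "0 < eps" for eps
  proof -
    define e where "e = eps / (2 * M)"
    have e: "0 < e" using eps M by (simp add: e_def)
    obtain dA where dA: "dA > 0" "\<And>h. h \<in> carr (H (Suc (Suc r))) \<Longrightarrow> nrm (H (Suc (Suc r))) h < dA \<Longrightarrow> res (xs + h) - res xs - A h \<in> carr (H r) \<and>
      nrm (H r) (res (xs + h) - res xs - A h) \<le> e * nrm (H (Suc (Suc r))) h" using A_est[OF e] by blast
    obtain d where d: "d > 0"
      "\<And>v. v \<in> carr (XS r) \<Longrightarrow> nrm (XS r) (v - (L0, y0)) < d \<Longrightarrow> sysmap (fst v) (snd v) \<in> carr (ZS r)"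
      "\<And>v v'. v \<in> carr (XS r) \<Longrightarrow> v' \<in> carr (XS r) \<Longrightarrow> nrm (XS r) (v - (L0, y0)) < d \<Longrightarrow> nrm (XS r) (v' - (L0, y0)) < d \<Longrightarrow>
      nrm (ZS r) (sysmap (fst v) (snd v) - sysmap (fst v') (snd v') - lin (bvec L0 y0) (fst (v - v')) (snd (v - v'))) \<le> e * nrm (XS r) (v - v')"
      by (rule strict_derivative_atE[OF strict_derivative_sysmap[OF L0(1) y0 adm] e]) (rule that)
    \<comment> \<open>The step along \<phi> must stay in the range of both derivative estimates and
      in the admissible region, where the system and the residual coincide; the factor 12 is the
      norm of the encoding.\<close>
    define s where "s = Min {dA / M, d / M, da / (12 * M)} / 2"
    have m0: "0 < Min {dA / M, d / M, da / (12 * M)}" using dA(1) d(1) da(1) M by simp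
    have s: "0 < s" "s < dA / M" "s < d / M" "s < da / (12 * M)"
    proof -
      show "0 < s" using m0 by (simp add: s_def)
      have "s < Min {dA / M, d / M, da / (12 * M)}" unfolding s_def using m0 by linarith
      then show "s < dA / M" "s < d / M" "s < da / (12 * M)" by auto
    qed
    then have sM: "s * M < dA" "s * M < d" "12 * (s * M) < da" using M by (auto simp: field_simps)
    define h where "h = s *\<^sub>R \<phi>"
    have h: "h \<in> carr (H (Suc (Suc r)))" unfolding h_def using \<phi> by simp
    have nh: "nrm (H (Suc (Suc r))) h = s * nrm (H (Suc (Suc r))) \<phi>" unfolding h_def using \<phi> s(1) by (simp add: H.nrm_scale)
    have nhM: "nrm (H (Suc (Suc r))) h \<le> s * M" unfolding nh using s(1) by (simp add: M_def)
    define y where "y = (\<mu>, \<delta>, xs + h)"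
    have y: "y \<in> carr (YS r)" using xs h by (simp add: y_def)
    have dy: "y - y0 = s *\<^sub>R k" by (simp add: y_def y0_def k_def h_def)
    have ndy: "nrm (YS r) (y - y0) = nrm (H (Suc (Suc r))) h" unfolding dy YS.nrm_scale[OF k] nk nh using s(1) by simp
    have "bvec (0 + L0) ((y - y0) + y0) = bvec 0 (y - y0) + bvec L0 y0" by (rule vec_add[OF YS.diff_carr[OF y y0] y0])
    then have "bvec L0 y - bvec L0 y0 = bvec 0 (y - y0)" by simp
    then have "nrm (VS r) (bvec L0 y - bvec L0 y0) \<le> 12 * nrm (YS r) (y - y0)"
      using nrm_vec_le[OF H.zero_carr YS.diff_carr[OF y y0]] by simp
    then have "admissible (bvec L0 y)" using sM(3) ndy nhM by (intro da(2) vec_carr L0(1) y) linarith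
    then have pos: "0 < (xs + h) t" "0 < r_fun \<delta> (xs + h) t" for t unfolding y_def admissible_iff[OF \<delta>] by auto
    have near: "nrm (XS r) ((L0, y) - (L0, y0)) < d" "nrm (XS r) ((L0, y0) - (L0, y0)) < d"
      using sM(2) nhM d(1) by (simp_all add: nrm_prod_nspace[of "H r"] ndy)
    have S: "sysmap L0 y \<in> carr (ZS r)" "sysmap L0 y0 \<in> carr (ZS r)"
      using d(2)[of "(L0, y)"] d(2)[of "(L0, y0)"] near L0(1) y y0 by auto
    have fs: "fst (sysmap L0 y) = res (xs + h)" "fst (sysmap L0 y0) = res xs"
      unfolding y_def y0_def using sysmap_eq[OF \<delta> L0(2) pos, where \<mu> = \<mu>] sysmap_eq[OF \<delta> L0(2) xs(2,3), where \<mu> = \<mu>] by (simp_all add: res_def)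
    have "nrm (ZS r) (sysmap L0 y - sysmap L0 y0 - lin (bvec L0 y0) 0 (y - y0)) \<le> e * nrm (H (Suc (Suc r))) h"
      using d(3)[of "(L0, y)" "(L0, y0)"] near L0(1) y y0 by (simp add: nrm_prod_nspace[of "H r"] ndy)
    moreover have "lin (bvec L0 y0) 0 (y - y0) = s *\<^sub>R lin (bvec L0 y0) 0 k" unfolding dy by (rule bounded_linear_betweenD(3)[OF bl k])
    ultimately have 1: "nrm (H r) (res (xs + h) - res xs - s *\<^sub>R lin_x (bvec L0 y0) \<phi>) \<le> e * nrm (H (Suc (Suc r))) h"
      by (simp add: nrm_ZS fs lin_fst)
    have As: "A h = s *\<^sub>R A \<phi>" unfolding h_def by (rule bounded_linear_betweenD(3)[OF bA \<phi>])
    have hd: "nrm (H (Suc (Suc r))) h < dA" using sM(1) nhM by linarith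
    have 2: "nrm (H r) (res (xs + h) - res xs - s *\<^sub>R A \<phi>) \<le> e * nrm (H (Suc (Suc r))) h"
      using dA(2)[OF h hd] unfolding As by blast
    have rc: "res (xs + h) - res xs \<in> carr (H r)"
    proof -
      have "res (xs + h) \<in> carr (H r)" "res xs \<in> carr (H r)" using S by (auto simp: fs)
      then show ?thesis by (rule H.diff_carr)
    qed
    have "s *\<^sub>R (A \<phi> - lin_x (bvec L0 y0) \<phi>) =
        (res (xs + h) - res xs - s *\<^sub>R lin_x (bvec L0 y0) \<phi>) - (res (xs + h) - res xs - s *\<^sub>R A \<phi>)"
      by (simp add: scaleR_diff_right)
    then have "s * nrm (H r) (A \<phi> - lin_x (bvec L0 y0) \<phi>) =
        nrm (H r) ((res (xs + h) - res xs - s *\<^sub>R lin_x (bvec L0 y0) \<phi>) - (res (xs + h) - res xs - s *\<^sub>R A \<phi>))"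
      using H.nrm_scale[OF H.diff_carr[OF Ac lxc], of s] s(1) by simp
    also have "\<dots> \<le> nrm (H r) (res (xs + h) - res xs - s *\<^sub>R lin_x (bvec L0 y0) \<phi>) + nrm (H r) (res (xs + h) - res xs - s *\<^sub>R A \<phi>)"
      by (rule H.nrm_diff_triangle[OF H.diff_carr[OF rc H.scale_carr[OF lxc]] H.diff_carr[OF rc H.scale_carr[OF Ac]]])
    also have "\<dots> \<le> 2 * e * (s * M)" using 1 2 mult_left_mono[OF nhM, of e] e by linarith
    also have "\<dots> = s * eps" using M by (simp add: e_def)
    finally show ?thesis using s(1) by simp
  qed
  then have "nrm (H r) (A \<phi> - lin_x (bvec L0 y0) \<phi>) \<le> 0" by (rule field_le_epsilon[of _ 0, simplified])
  then show ?thesis using H.nrm_diff_eq_0[OF Ac lxc] by (simp add: y0_def)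
qed

text \<open>Both maps are compared on the carrier only, and \<open>inv_into\<close> depends on
  nothing else.\<close>

lemma isomorphism_between_cong:
  assumes "isomorphism_between E F A" "\<And>v. v \<in> carr E \<Longrightarrow> A v = B v" "nspace E"
  shows "isomorphism_between E F B"
proof -
  interpret E: nspace E by fact
  have inv: "inv_into (carr E) A = inv_into (carr E) B"
  proof
    fix z
    have "(\<lambda>v. v \<in> carr E \<and> A v = z) = (\<lambda>v. v \<in> carr E \<and> B v = z)" using assms(2) by auto
    then show "inv_into (carr E) A z = inv_into (carr E) B z" by (simp add: inv_into_def)
  qed
  have "bounded_linear_between E F B"
    using assms(1) unfolding isomorphism_between_def bounded_linear_between_def linear_between_def
    by (simp add: assms(2) E.add_carr E.scale_carr)
  then show ?thesis
    using assms(1) bij_betw_cong[of "carr E" A B "carr F"] assms(2) unfolding isomorphism_between_def inv by simp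
qed

text \<open>Along the branch the first component of the system vanishes and the others are the phase increments.\<close>

lemma branch_tangent:
  fixes S :: "(real \<times> real) set" and X :: "real \<Rightarrow> real \<Rightarrow> real \<Rightarrow> real" and T :: "real \<times> real \<Rightarrow> real \<Rightarrow> real"
  assumes r0: "r = 0"
    and L0: "L0 \<in> carr (H r)" "\<And>t. 0 < L0 t" and \<delta>s: "0 < \<delta>s"
    and X: "\<And>\<mu> \<delta>. (\<mu>, \<delta>) \<in> S \<Longrightarrow> X \<mu> \<delta> \<in> carr (H 2)"
    and sol: "\<And>\<mu> \<delta>. (\<mu>, \<delta>) \<in> S \<Longrightarrow> magnitude_solution k1 k2 d1 P L0 \<mu> \<delta> (X \<mu> \<delta>)"
    and uS: "(\<mu>s, \<delta>s) \<in> S"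
    and T: "T a \<in> carr (H 2)" "\<And>\<tau>. T (\<tau> *\<^sub>R a) = \<tau> *\<^sub>R T a"
    and TD: "\<And>e. e > 0 \<Longrightarrow> \<exists>d>0. \<forall>\<mu> \<delta>. (\<mu>, \<delta>) \<in> S \<longrightarrow> norm ((\<mu>, \<delta>) - (\<mu>s, \<delta>s)) < d \<longrightarrow>
        nrm (H 2) (X \<mu> \<delta> - X \<mu>s \<delta>s - T ((\<mu>, \<delta>) - (\<mu>s, \<delta>s))) \<le> e * norm ((\<mu>, \<delta>) - (\<mu>s, \<delta>s))"
    and B: "(branch_increments P X has_derivative B) (at (\<mu>s, \<delta>s) within S)"
    and inward: "0 < \<tau>0" "\<And>\<tau>. 0 < \<tau> \<Longrightarrow> \<tau> < \<tau>0 \<Longrightarrow> (\<mu>s, \<delta>s) + \<tau> *\<^sub>R a \<in> S"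
  shows "lin (bvec L0 (\<mu>s, \<delta>s, X \<mu>s \<delta>s)) 0 (fst a, snd a, T a) = (0, fst (B a), snd (B a))"
proof -
  define u where "u = (\<mu>s, \<delta>s)"
  define xs where "xs = X \<mu>s \<delta>s"
  define y0 where "y0 = (\<mu>s, \<delta>s, xs)"
  have two: "2 = Suc (Suc r)" by (simp add: r0)
  have xs: "xs \<in> carr (H (Suc (Suc r)))" using X[OF uS] by (simp only: xs_def two)
  have y0: "y0 \<in> carr (YS r)" using xs by (simp add: y0_def)
  have pos: "0 < X \<mu> \<delta> t" "0 < r_fun \<delta> (X \<mu> \<delta>) t" "magnitude_residual k1 k2 d1 L0 \<mu> \<delta> (X \<mu> \<delta>) = 0" if "(\<mu>, \<delta>) \<in> S" for \<mu> \<delta> t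
    using sol[OF that] by (auto simp: magnitude_solution_def magnitude_residual_def fun_eq_iff)
  have adm: "admissible (bvec L0 y0)" unfolding y0_def admissible_iff[OF \<delta>s] using L0 pos[OF uS] by (simp add: xs_def)
  have sys: "sysmap L0 (\<mu>, \<delta>, X \<mu> \<delta>) = (0, fst (branch_increments P X (\<mu>, \<delta>)) + - (\<sigma> * (2 * pi * \<rho>1)), snd (branch_increments P X (\<mu>, \<delta>)) + - (\<sigma> * (2 * pi * \<rho>2)))"
    if "(\<mu>, \<delta>) \<in> S" "0 < \<delta>" for \<mu> \<delta>
    using sysmap_eq[OF that(2) L0(2) pos(1,2)[OF that(1)], where \<mu> = \<mu>] pos(3)[OF that(1)] by (simp add: branch_increments_def)
  show ?thesis
    unfolding xs_def[symmetric] y0_def[symmetric]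
  proof (rule tangent_equation[OF L0(1) y0 adm])
    show "(fst a, snd a, T a) \<in> carr (YS r)" using T(1) by (simp add: r0 numeral_2_eq_2)
    show "(0, fst (B a), snd (B a)) \<in> carr (ZS r)" by simp
    fix e :: real assume e: "0 < e"
    define n where "n = norm a + 1"
    have n: "0 < n" "norm a \<le> n" by (auto simp: n_def add_nonneg_pos)
    have e1: "0 < e / n" "0 < e / (2 * n)" using e n by auto
    obtain dT where dT: "dT > 0" "\<And>\<mu> \<delta>. (\<mu>, \<delta>) \<in> S \<Longrightarrow> norm ((\<mu>, \<delta>) - u) < dT \<Longrightarrow>
        nrm (H 2) (X \<mu> \<delta> - xs - T ((\<mu>, \<delta>) - u)) \<le> e / n * norm ((\<mu>, \<delta>) - u)"
      using TD[OF e1(1)] unfolding u_def xs_def by blast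
    have linB: "linear B" using B by (intro bounded_linear.linear has_derivative_bounded_linear)
    obtain dB where dB: "dB > 0" "\<And>v. v \<in> S \<Longrightarrow> norm (v - u) < dB \<Longrightarrow>
        norm (branch_increments P X v - branch_increments P X u - B (v - u)) \<le> e / (2 * n) * norm (v - u)"
      using B e1(2) unfolding has_derivative_within_alt u_def by blast
    \<comment> \<open>The entry \<open>\<delta>s / n\<close> keeps \<delta> positive along the step,
      so that the components of the system are the residual and the phase increments there;
      \<open>\<tau>0\<close> keeps the step inside \<open>S\<close>.\<close>
    define m where "m = Min {e, \<tau>0, dT / n, dB / n, \<delta>s / n}"
    have m: "0 < m" using e inward(1) dT(1) dB(1) \<delta>s n by (simp add: m_def)
    define \<tau> where "\<tau> = m / 2"
    have "\<tau> < m" "0 < \<tau>" using m by (auto simp: \<tau>_def)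
    then have \<tau>: "0 < \<tau>" "\<tau> < e" "\<tau> < \<tau>0" "\<tau> < dT / n" "\<tau> < dB / n" "\<tau> < \<delta>s / n" unfolding m_def by auto
    then have \<tau>n: "\<tau> * n < dT" "\<tau> * n < dB" "\<tau> * n < \<delta>s" using n by (auto simp: field_simps)
    define v where "v = u + \<tau> *\<^sub>R a"
    have v: "v \<in> S" unfolding v_def u_def by (rule inward(2)[OF \<tau>(1,3)])
    obtain \<mu> \<delta> where v_eq: "v = (\<mu>, \<delta>)" by (cases v) auto
    have vS: "(\<mu>, \<delta>) \<in> S" using v by (simp add: v_eq)
    have vu: "v - u = \<tau> *\<^sub>R a" by (simp add: v_def)
    have nvu: "norm (v - u) \<le> \<tau> * n" unfolding vu using n \<tau>(1) by simp
    have "\<delta> - \<delta>s = \<tau> * snd a" "\<mu> - \<mu>s = \<tau> * fst a" using vu by (auto simp: v_eq u_def prod_eq_iff)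
    moreover have "\<bar>\<tau> * snd a\<bar> \<le> \<tau> * n"
      using norm_snd_le[of "snd a" "fst a"] n \<tau>(1) by (simp add: abs_mult)
    ultimately have \<delta>: "0 < \<delta>" using \<tau>n(3) by linarith
    define y where "y = (\<mu>, \<delta>, X \<mu> \<delta>)"
    have Xc: "X \<mu> \<delta> \<in> carr (H (Suc (Suc r)))" using X[OF vS] by (simp only: two)
    have y: "y \<in> carr (YS r)" using Xc by (simp add: y_def)
    have yk: "y - y0 - \<tau> *\<^sub>R (fst a, snd a, T a) = (0, 0, X \<mu> \<delta> - xs - T (v - u))"
      unfolding vu T(2) using \<open>\<delta> - \<delta>s = _\<close> \<open>\<mu> - \<mu>s = _\<close> by (simp add: y_def y0_def)
    have "nrm (H 2) (X \<mu> \<delta> - xs - T (v - u)) \<le> e / n * norm (v - u)"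
      using dT(2)[OF vS] nvu \<tau>n(1) by (simp add: v_eq)
    also have "\<dots> \<le> e / n * (\<tau> * n)" using nvu e1 by (intro mult_left_mono) auto
    finally have 1: "nrm (YS r) (y - y0 - \<tau> *\<^sub>R (fst a, snd a, T a)) \<le> e * \<tau>"
      unfolding yk using n by (simp add: nrm_prod_nspace two[symmetric])
    have "norm (branch_increments P X v - branch_increments P X u - B (v - u)) \<le> e / (2 * n) * norm (v - u)"
      by (rule dB(2)[OF v]) (use nvu \<tau>n(2) in linarith)
    also have "\<dots> \<le> e / (2 * n) * (\<tau> * n)" using nvu e1 by (intro mult_left_mono) auto
    finally have nb: "norm (branch_increments P X v - branch_increments P X u - \<tau> *\<^sub>R B a) \<le> e * \<tau> / 2"
      using n by (simp add: vu linear_cmul[OF linB])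
    define w where "w = branch_increments P X v - branch_increments P X u - \<tau> *\<^sub>R B a"
    have "\<bar>fst w\<bar> \<le> e * \<tau> / 2" "\<bar>snd w\<bar> \<le> e * \<tau> / 2"
      using norm_fst_le[of "fst w" "snd w"] norm_snd_le[of "snd w" "fst w"] nb[folded w_def]
      by (simp_all only: prod.collapse real_norm_def)
    moreover have "sysmap L0 y - sysmap L0 y0 - \<tau> *\<^sub>R (0, fst (B a), snd (B a)) = (0, fst w, snd w)"
      using sys[OF vS \<delta>] sys[OF uS \<delta>s] by (simp add: y_def y0_def w_def v_eq u_def xs_def prod_eq_iff)
    ultimately have 2: "nrm (ZS r) (sysmap L0 y - sysmap L0 y0 - \<tau> *\<^sub>R (0, fst (B a), snd (B a))) \<le> e * \<tau>"
      by (simp add: nrm_ZS)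
    show "\<exists>\<tau> y. 0 < \<tau> \<and> \<tau> < e \<and> y \<in> carr (YS r) \<and> nrm (YS r) (y - y0 - \<tau> *\<^sub>R (fst a, snd a, T a)) \<le> e * \<tau> \<and>
       nrm (ZS r) (sysmap L0 y - sysmap L0 y0 - \<tau> *\<^sub>R (0, fst (B a), snd (B a))) \<le> e * \<tau>"
      using \<tau>(1,2) y 1 2 by blast
  qed
qed

end

section \<open>Products\<close>

lemma continuous_antiderivative:
  fixes f :: "real \<Rightarrow> real"
  assumes "continuous_on UNIV f"
  obtains F where "\<And>t. (F has_real_derivative f t) (at t)"
proof -
  have "\<exists>F. \<forall>x::real. -\<infinity> < ereal x \<longrightarrow> ereal x < \<infinity> \<longrightarrow> (F has_vector_derivative f x) (at x)"
    by (rule einterval_antiderivative) (use assms in \<open>auto simp: continuous_on_eq_continuous_at\<close>)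
  then show ?thesis using that by (auto simp: has_real_derivative_iff_has_vector_derivative)
qed

text \<open>The function \<open>s (t + P) - s t\<close> has derivative zero by periodicity of
  \<open>f\<close>; its constant value is the integral over one period.\<close>

lemma periodic_derivative_shift:
  fixes s f :: "real \<Rightarrow> real"
  assumes s: "\<And>t. (s has_real_derivative f t) (at t)" and f: "\<And>t. f (t + P) = f t" and P: "0 < P"
  shows "s (t + real m * P) = s t + real m * integral {0..P} f"
proof -
  have "((\<lambda>t. s (t + P) - s t) has_real_derivative 0) (at t)" for t
    using DERIV_diff[OF iffD1[OF DERIV_shift[of s "f t" t P]] s[of t]] s[of "t + P"] by (simp add: f)
  then have shift: "s (t + P) - s t = s (0 + P) - s 0" for t by (rule DERIV_isconst_all[rule_format])
  have "(f has_integral (s P - s 0)) {0..P}"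
    using P s by (intro fundamental_theorem_of_calculus)
      (auto simp: has_real_derivative_iff_has_vector_derivative[symmetric] intro: has_field_derivative_at_within)
  then have "integral {0..P} f = s P - s 0" by (rule integral_unique)
  then have step: "s (t + P) = s t + integral {0..P} f" for t
    using shift[of t] by simp
  show ?thesis
  proof (induction m)
    case (Suc m)
    have "s (t + real (Suc m) * P) = s ((t + real m * P) + P)" by (simp add: algebra_simps)
    then show ?case using step[of "t + real m * P"] Suc by (simp add: algebra_simps)
  qed simp
qed

lemma exp_phase_shift:
  assumes "real m * \<rho> \<in> \<int>" "y = x + real m * (2 * pi * \<rho>)"
  shows "exp (\<i> * of_real y) = exp (\<i> * of_real x)"
proof -
  obtain n where n: "real m * \<rho> = of_int n" using assms(1) by (auto elim: Ints_cases)
  have "y = x + 2 * pi * (real m * \<rho>)" using assms(2) by simp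
  then have "\<i> * of_real y = \<i> * of_real x + \<i> * (of_int n * (of_real pi * 2))"
    unfolding n by (simp add: algebra_simps)
  then show ?thesis by simp
qed

section \<open>Phases, magnitudes and warps of the product\<close>

context magnitude
begin

context
  fixes k2' :: nat and d2 \<mu> \<delta> :: real and x :: "real \<Rightarrow> real"
  assumes d2: "0 < d2" and \<mu>: "0 < \<mu>" and \<delta>: "0 < \<delta>" and x: "x \<in> carr (H 2)"
    and x_pos: "\<And>t. 0 < x t" and r_pos: "\<And>t. 0 < r_fun \<delta> x t"
begin

text \<open>With c = 1/\<delta> and a^2 = \<delta> x^2 one has Q = 1 + x^2/\<delta> - \<delta> x^2,
  which is the denominator of the magnitude equation divided by \<delta>; likewise R is the function
  r of that equation.\<close>

lemma prod_simps:
  "(mag_a \<delta> x t)\<^sup>2 = \<delta> * (x t)\<^sup>2" "prod_R \<delta> x t = r_fun \<delta> x t" "prod_Q \<delta> x t = q_fun \<delta> x t / \<delta>"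
  "(mag_b \<delta> x t)\<^sup>2 = 1 - \<delta> * (x t)\<^sup>2"
proof -
  show a: "(mag_a \<delta> x t)\<^sup>2 = \<delta> * (x t)\<^sup>2" for t using \<delta> by (simp add: mag_a_def power_mult_distrib)
  have "(x has_real_derivative deriv x t) (at t)"
    using x H_has_derivative[of x "Suc 0" t] by (simp add: numeral_2_eq_2)
  then have "(mag_a \<delta> x has_real_derivative sqrt \<delta> * deriv x t) (at t)"
    unfolding mag_a_def by (rule DERIV_cmult)
  then have "deriv (mag_a \<delta> x) t = sqrt \<delta> * deriv x t" by (rule DERIV_imp_deriv)
  then show "prod_R \<delta> x t = r_fun \<delta> x t"
    using \<delta> by (simp add: prod_R_def r_fun_def a power_mult_distrib algebra_simps)
  show "prod_Q \<delta> x t = q_fun \<delta> x t / \<delta>"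
    unfolding prod_Q_def prod_c_def q_fun_def a using \<delta> by (simp add: field_simps power2_eq_square)
  show "(mag_b \<delta> x t)\<^sup>2 = 1 - \<delta> * (x t)\<^sup>2"
    using q_fun_pos(2)[of \<delta> x t] \<delta> x_pos r_pos by (simp add: mag_b_def a)
qed

lemma prod_eps_pos: "0 < prod_eps k2' d2 \<mu> \<delta>"
  using d2 \<mu> \<delta> by (simp add: prod_eps_def)

lemma prod_F_eq: "prod_F k2' d2 \<mu> \<delta> x t = sqrt (prod_eps k2' d2 \<mu> \<delta>) * (sqrt (q_fun \<delta> x t) / (\<delta> * x t * sqrt (r_fun \<delta> x t)))"
proof -
  have "prod_F k2' d2 \<mu> \<delta> x t = sqrt (prod_eps k2' d2 \<mu> \<delta> * (q_fun \<delta> x t / ((\<delta> * x t)\<^sup>2 * r_fun \<delta> x t)))"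
    unfolding prod_F_def prod_simps by (simp add: power_mult_distrib power2_eq_square)
  also have "\<dots> = sqrt (prod_eps k2' d2 \<mu> \<delta>) * (sqrt (q_fun \<delta> x t) / (\<delta> * x t * sqrt (r_fun \<delta> x t)))"
    using \<delta> x_pos[of t] by (simp add: real_sqrt_mult real_sqrt_divide)
  finally show ?thesis .
qed

text \<open>The factor \<open>sqrt (prod_eps k2' d2 \<mu> \<delta>)\<close> of F cancels, so \<mu>
  and \<open>d2\<close> disappear and the speeds become \<sigma> times the integrands of the phase
  increments.\<close>

lemma phase_speeds:
  "\<sigma> * sqrt (prod_eps k2' d2 \<mu> \<delta>) / (prod_F k2' d2 \<mu> \<delta> x t * (mag_a \<delta> x t)\<^sup>2) = \<sigma> * (sqrt (r_fun \<delta> x t) / (x t * sqrt (q_fun \<delta> x t)))"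
  "\<sigma> * prod_c \<delta> * sqrt (prod_eps k2' d2 \<mu> \<delta>) / (prod_F k2' d2 \<mu> \<delta> x t * (mag_b \<delta> x t)\<^sup>2) =
     \<sigma> * (x t * sqrt (r_fun \<delta> x t) / ((1 - \<delta> * (x t)\<^sup>2) * sqrt (q_fun \<delta> x t)))"
proof -
  have q: "0 < q_fun \<delta> x t" "0 < 1 - \<delta> * (x t)\<^sup>2" using q_fun_pos[of \<delta> x t] \<delta> x_pos r_pos by auto
  have nz: "sqrt (prod_eps k2' d2 \<mu> \<delta>) \<noteq> 0" "sqrt (q_fun \<delta> x t) \<noteq> 0" "sqrt (r_fun \<delta> x t) \<noteq> 0" "x t \<noteq> 0" "\<delta> \<noteq> 0" "1 - \<delta> * (x t)\<^sup>2 \<noteq> 0"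
    using prod_eps_pos q r_pos[of t] x_pos[of t] \<delta> by auto
  show "\<sigma> * sqrt (prod_eps k2' d2 \<mu> \<delta>) / (prod_F k2' d2 \<mu> \<delta> x t * (mag_a \<delta> x t)\<^sup>2) = \<sigma> * (sqrt (r_fun \<delta> x t) / (x t * sqrt (q_fun \<delta> x t)))"
    unfolding prod_F_eq prod_simps using nz by (simp add: field_simps power2_eq_square)
  show "\<sigma> * prod_c \<delta> * sqrt (prod_eps k2' d2 \<mu> \<delta>) / (prod_F k2' d2 \<mu> \<delta> x t * (mag_b \<delta> x t)\<^sup>2) =
     \<sigma> * (x t * sqrt (r_fun \<delta> x t) / ((1 - \<delta> * (x t)\<^sup>2) * sqrt (q_fun \<delta> x t)))"
    unfolding prod_F_eq prod_simps prod_c_def using nz by simp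
qed

text \<open>The magnitudes are periodic with \<open>x\<close>. Each phase gains a fixed amount per
  period, and after \<open>m\<close> periods the gain is an integral multiple of 2\<pi>, which the
  exponential does not see.\<close>

lemma closes:
  assumes ret: "product_return \<sigma> P \<delta> x = (2 * pi * \<rho>1, 2 * pi * \<rho>2)" and m: "real m * \<rho>1 \<in> \<int>" "real m * \<rho>2 \<in> \<int>"
  shows "closes_with_period k2' d2 \<sigma> (real m * P) \<mu> \<delta> x"
proof -
  define f1 where "f1 t = sqrt (r_fun \<delta> x t) / (x t * sqrt (q_fun \<delta> x t))" for t
  define f2 where "f2 t = x t * sqrt (r_fun \<delta> x t) / ((1 - \<delta> * (x t)\<^sup>2) * sqrt (q_fun \<delta> x t))" for t
  have q: "0 < q_fun \<delta> x t" "0 < 1 - \<delta> * (x t)\<^sup>2" for t using q_fun_pos[of \<delta> x t] \<delta> x_pos r_pos by auto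
  have xc: "continuous_on UNIV x" "continuous_on UNIV (deriv x)"
    using H_continuous[OF x] H_continuous[OF H_deriv[of x "Suc 0"]] x by (auto simp: numeral_2_eq_2)
  have xp: "x (t + P) = x t" "deriv x (t + P) = deriv x t" for t
    using H_periodic[OF x] periodic_deriv[OF H_periodic[OF x]] by (auto simp: periodic_fun_simple_iff)
  have nz: "x t \<noteq> 0" "sqrt (q_fun \<delta> x t) \<noteq> 0" "1 - \<delta> * (x t)\<^sup>2 \<noteq> 0" for t
    using x_pos[of t] q[of t] by auto
  have qc: "continuous_on UNIV (\<lambda>t. sqrt (q_fun \<delta> x t))" "continuous_on UNIV (\<lambda>t. sqrt (r_fun \<delta> x t))"
    unfolding q_fun_def r_fun_def by (intro continuous_intros xc)+
  have c1: "continuous_on UNIV (\<lambda>t. \<sigma> * f1 t)"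
    unfolding f1_def by (intro continuous_intros xc qc) (use nz in auto)
  have c2: "continuous_on UNIV (\<lambda>t. \<sigma> * f2 t)"
    unfolding f2_def by (intro continuous_intros xc qc) (use nz in auto)
  have per: "\<sigma> * f1 (t + P) = \<sigma> * f1 t" "\<sigma> * f2 (t + P) = \<sigma> * f2 t" for t
    by (simp_all add: f1_def f2_def q_fun_def r_fun_def xp)
  have phases: "product_phases k2' d2 \<sigma> \<mu> \<delta> x s1 s2 \<longleftrightarrow>
      (\<forall>t. (s1 has_real_derivative \<sigma> * f1 t) (at t)) \<and> (\<forall>t. (s2 has_real_derivative \<sigma> * f2 t) (at t))" for s1 s2
    unfolding product_phases_def phase_speeds f1_def f2_def ..
  have I: "integral {0..P} (\<lambda>t. \<sigma> * f1 t) = 2 * pi * \<rho>1" "integral {0..P} (\<lambda>t. \<sigma> * f2 t) = 2 * pi * \<rho>2"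
    using ret unfolding product_return_def D1_def D2_def f1_def[symmetric] f2_def[symmetric]
    by (simp_all only: integral_mult_right prod.inject)
  have a: "mag_a \<delta> x (t + real m * P) = mag_a \<delta> x t" "mag_b \<delta> x (t + real m * P) = mag_b \<delta> x t" for t
  proof -
    have "x (t + real m * P) = x t"
    proof (induction m)
      case (Suc n)
      have "x (t + real (Suc n) * P) = x ((t + real n * P) + P)" by (simp add: algebra_simps)
      then show ?case using xp(1) Suc by simp
    qed simp
    then show "mag_a \<delta> x (t + real m * P) = mag_a \<delta> x t" "mag_b \<delta> x (t + real m * P) = mag_b \<delta> x t"
      by (simp_all add: mag_b_def mag_a_def)
  qed
  \<comment> \<open>The antiderivatives provide the existence part of the closing condition; the
    periodicity part is shown for arbitrary phases.\<close>
  obtain S1 where S1: "\<And>t. (S1 has_real_derivative \<sigma> * f1 t) (at t)" using continuous_antiderivative[OF c1] by blast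
  obtain S2 where S2: "\<And>t. (S2 has_real_derivative \<sigma> * f2 t) (at t)" using continuous_antiderivative[OF c2] by blast
  have "profile \<delta> x s1 s2 (t + real m * P) = profile \<delta> x s1 s2 t" if ph: "product_phases k2' d2 \<sigma> \<mu> \<delta> x s1 s2" for s1 s2 t
  proof -
    have s: "\<And>t. (s1 has_real_derivative \<sigma> * f1 t) (at t)" "\<And>t. (s2 has_real_derivative \<sigma> * f2 t) (at t)"
      using ph unfolding phases by auto
    have "s1 (t + real m * P) = s1 t + real m * (2 * pi * \<rho>1)" "s2 (t + real m * P) = s2 t + real m * (2 * pi * \<rho>2)"
      using periodic_derivative_shift[where f = "\<lambda>t. \<sigma> * f1 t", OF s(1) per(1) P, of t m]
        periodic_derivative_shift[where f = "\<lambda>t. \<sigma> * f2 t", OF s(2) per(2) P, of t m] unfolding I by auto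
    then show ?thesis unfolding profile_def a using exp_phase_shift[OF m(1)] exp_phase_shift[OF m(2)] by simp
  qed
  then show ?thesis
    unfolding closes_with_period_def periodic_fun_simple_def using phases S1 S2 by blast
qed

text \<open>
  The lower bounds for \<open>b\<close> and the second warp only use \<open>b\<^sup>2 \<ge> R\<close>, \<open>Q \<ge> x\<^sup>2 / \<delta>\<close> and \<open>a\<^sup>2, R \<le> 1\<close>.
\<close>

lemma lower_bounds:
  assumes c: "0 < c" "\<And>t. c \<le> x t" "\<And>t. c \<le> r_fun \<delta> x t" "c \<le> \<delta>" "\<delta> \<le> C" "\<mu> \<le> C"
    and L: "\<And>t. c \<le> L t" "\<And>t. L t \<le> C" and k2': "0 < k2'"
  shows "sqrt c * c \<le> mag_a \<delta> x t" "sqrt c \<le> mag_b \<delta> x t" "c \<le> warp1 L t"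
    "(sqrt (c\<^sup>2 * (d2 / C) ^ k2' * (c\<^sup>2 / C)) / C ^ k1') powr (1 / real k2') \<le> warp2 k1' k2' d2 L \<mu> \<delta> x t"
proof -
  have q: "0 < q_fun \<delta> x t" "0 < 1 - \<delta> * (x t)\<^sup>2" using q_fun_pos[of \<delta> x t] \<delta> x_pos r_pos by auto
  have C: "0 < C" using c(1,4,5) by linarith
  show "sqrt c * c \<le> mag_a \<delta> x t" unfolding mag_a_def using c by (intro mult_mono) auto
  have r1: "r_fun \<delta> x t \<le> 1 - \<delta> * (x t)\<^sup>2" using \<delta> by (simp add: r_fun_def algebra_simps)
  have "c \<le> 1 - \<delta> * (x t)\<^sup>2" using c(3)[of t] r1 by linarith
  then show "sqrt c \<le> mag_b \<delta> x t" unfolding mag_b_def prod_simps by simp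
  show "c \<le> warp1 L t" using L by (simp add: warp1_def)
  have Lt: "0 < L t" using L(1)[of t] c(1) by linarith
  have e: "c\<^sup>2 * (d2 / C) ^ k2' \<le> prod_eps k2' d2 \<mu> \<delta>"
    unfolding prod_eps_def using c d2 \<mu> C by (intro mult_mono power_mono divide_left_mono) auto
  have "(x t)\<^sup>2 \<le> q_fun \<delta> x t"
  proof -
    have "q_fun \<delta> x t = (x t)\<^sup>2 + \<delta> * (1 - \<delta> * (x t)\<^sup>2)" by (simp add: q_fun_def algebra_simps power2_eq_square)
    then show ?thesis using q \<delta> by simp
  qed
  moreover have "c\<^sup>2 \<le> (x t)\<^sup>2" using c(1,2) by (intro power_mono) auto
  ultimately have Q: "c\<^sup>2 / C \<le> q_fun \<delta> x t / \<delta>" using c \<delta> q(1) by (intro frac_le) auto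
  have ar: "0 < (\<delta> * (x t)\<^sup>2) * r_fun \<delta> x t" "(\<delta> * (x t)\<^sup>2) * r_fun \<delta> x t \<le> 1"
  proof -
    show "0 < (\<delta> * (x t)\<^sup>2) * r_fun \<delta> x t" using \<delta> x_pos[of t] r_pos[of t] by simp
    have "0 \<le> \<delta> * (x t)\<^sup>2" using \<delta> by simp
    then have "\<delta> * (x t)\<^sup>2 \<le> 1" "r_fun \<delta> x t \<le> 1" "0 \<le> \<delta> * (x t)\<^sup>2" using q r1 by linarith+
    then show "(\<delta> * (x t)\<^sup>2) * r_fun \<delta> x t \<le> 1" using r_pos[of t] mult_le_one[of "\<delta> * (x t)\<^sup>2"] by simp
  qed
  have "c\<^sup>2 * (d2 / C) ^ k2' * (c\<^sup>2 / C) \<le> prod_eps k2' d2 \<mu> \<delta> * (q_fun \<delta> x t / \<delta>)"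
    using e Q prod_eps_pos C by (intro mult_mono) auto
  \<comment> \<open>Dividing by a^2 R, which is at most 1, can only increase the value.\<close>
  also have "\<dots> \<le> prod_eps k2' d2 \<mu> \<delta> * (q_fun \<delta> x t / \<delta>) / ((\<delta> * (x t)\<^sup>2) * r_fun \<delta> x t)"
  proof -
    have nn: "0 \<le> prod_eps k2' d2 \<mu> \<delta> * (q_fun \<delta> x t / \<delta>)" using prod_eps_pos q(1) \<delta> by simp
    show ?thesis using divide_left_mono[OF ar(2) nn] ar(1) by simp
  qed
  finally have F: "sqrt (c\<^sup>2 * (d2 / C) ^ k2' * (c\<^sup>2 / C)) \<le> prod_F k2' d2 \<mu> \<delta> x t"
    unfolding prod_F_def prod_simps by simp
  have s0: "0 \<le> sqrt (c\<^sup>2 * (d2 / C) ^ k2' * (c\<^sup>2 / C))" using d2 C by simp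
  have "sqrt (c\<^sup>2 * (d2 / C) ^ k2' * (c\<^sup>2 / C)) / C ^ k1' \<le> prod_F k2' d2 \<mu> \<delta> x t / L t ^ k1'"
    using F order_trans[OF s0 F] Lt L(2) by (intro frac_le power_mono) auto
  then show "(sqrt (c\<^sup>2 * (d2 / C) ^ k2' * (c\<^sup>2 / C)) / C ^ k1') powr (1 / real k2') \<le> warp2 k1' k2' d2 L \<mu> \<delta> x t"
    unfolding warp2_def using s0 C by (intro powr_mono2) auto
qed

end

end

section \<open>Nondegenerate closed data\<close>

context holder
begin

lemma Cper_diff: "f \<in> carr (Cper P j) \<Longrightarrow> g \<in> carr (Cper P j) \<Longrightarrow> f - g \<in> carr (Cper P j)"
proof (induction j arbitrary: f g)
  case 0
  then show ?case by (auto simp: Cper_def times_cont_diff_def periodic_fun_simple_iff fun_diff_def intro: continuous_on_diff)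
next
  case (Suc j)
  have d: "(f has_real_derivative deriv f t) (at t)" "(g has_real_derivative deriv g t) (at t)" for t
    using Suc.prems by (auto simp: carr_Cper_Suc DERIV_deriv_iff_real_differentiable)
  have D: "((f - g) has_real_derivative deriv f t - deriv g t) (at t)" for t
    unfolding fun_diff_def by (rule DERIV_diff[OF d])
  then have eq: "deriv (f - g) = deriv f - deriv g"
    by (auto simp: fun_diff_def intro!: ext DERIV_imp_deriv)
  have "deriv f - deriv g \<in> carr (Cper P j)"
    by (rule Suc.IH) (use Suc.prems in \<open>simp_all add: carr_Cper_Suc\<close>)
  moreover have "(f - g) differentiable (at t)" for t using D real_differentiable_def by blast
  moreover have "periodic_fun_simple (f - g) P"
    using Suc.prems by (simp add: carr_Cper_Suc periodic_fun_simple_iff minus_apply)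
  ultimately show ?case unfolding carr_Cper_Suc eq by blast
qed

text \<open>The first step of the derivative tower at order 0, evaluated on one direction. Three
  continuous derivatives are used because C^3 embeds into C^{2,\<alpha>} with constant 3, which is
  why the estimate starts from \<open>e / 3\<close>.\<close>

lemma smooth_branch_derivative:
  fixes F :: "'a::real_normed_vector \<Rightarrow> real \<Rightarrow> real"
  assumes F: "smooth_between std (Cper P 3) S F" and u: "u \<in> S"
  obtains T where "\<And>w. T w \<in> carr (H 2)" "\<And>v w. T (v + w) = T v + T w" "\<And>c v. T (c *\<^sub>R v) = c *\<^sub>R T v"
    "\<And>e. e > 0 \<Longrightarrow> \<exists>d>0. \<forall>v\<in>S. norm (v - u) < d \<longrightarrow> nrm (H 2) (F v - F u - T (v - u)) \<le> e * norm (v - u)"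
proof -
  have three: "3 = Suc 2" by simp
  obtain D where D0: "\<And>v. v \<in> S \<Longrightarrow> D 0 v [] = F v"
    and Dm: "\<And>j v. v \<in> S \<Longrightarrow> bounded_multilinear_between std (Cper P 3) j (D j v)"
    and Dd: "\<And>j v e. v \<in> S \<Longrightarrow> e > 0 \<Longrightarrow> \<exists>d>0. \<forall>v'\<in>S. nrm std (v' - v) < d \<longrightarrow>
           (\<forall>vs. length vs = j \<and> set vs \<subseteq> carr std \<longrightarrow>
              nrm (Cper P 3) (D j v' vs - D j v vs - D (Suc j) v ((v' - v) # vs)) \<le> e * nrm std (v' - v) * prod_list (map (nrm std) vs))"
    by (rule smooth_betweenE[OF F]) (rule that)
  define T where "T w = D (Suc 0) u [w]" for w
  have Fc: "F v \<in> carr (Cper P 3)" if "v \<in> S" for v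
    using bounded_multilinear_betweenD(1)[OF Dm[OF that, of 0], of "[]"] D0[OF that] by simp
  have Tc: "T w \<in> carr (Cper P 3)" for w
    using bounded_multilinear_betweenD(1)[OF Dm[OF u, of "Suc 0"], of "[w]"] by (simp add: T_def)
  have lin: "linear_between std (Cper P 3) T"
    using bounded_multilinear_betweenD(2)[OF Dm[OF u, of "Suc 0"], of "[0]" 0] by (simp add: T_def[abs_def])
  show ?thesis
  proof (rule that)
    show "T w \<in> carr (H 2)" for w using Cper_Suc_subset[of "T w" 2] Tc[of w] unfolding three by blast
    show "T (v + w) = T v + T w" for v w using lin by (simp add: linear_between_def)
    show "T (c *\<^sub>R v) = c *\<^sub>R T v" for c v using lin by (simp add: linear_between_def)
    fix e :: real assume "e > 0"
    then have e: "e / 3 > 0" by simp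
    obtain d where d: "d > 0" "\<And>v. v \<in> S \<Longrightarrow> norm (v - u) < d \<Longrightarrow>
        nrm (Cper P 3) (D 0 v [] - D 0 u [] - D (Suc 0) u [v - u]) \<le> e / 3 * norm (v - u)"
      using Dd[OF u e, of 0] by auto
    have "nrm (H 2) (F v - F u - T (v - u)) \<le> e * norm (v - u)" if v: "v \<in> S" "norm (v - u) < d" for v
    proof -
      have "F v - F u - T (v - u) \<in> carr (Cper P (Suc 2))" using Fc[OF v(1)] Fc[OF u] Tc unfolding three by (intro Cper_diff)
      then have "nrm (H 2) (F v - F u - T (v - u)) \<le> 3 * nrm (Cper P 3) (F v - F u - T (v - u))"
        using Cper_Suc_subset unfolding three by blast
      then show ?thesis using d(2)[OF v] D0[OF v(1)] D0[OF u] by (simp add: T_def)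
    qed
    then show "\<exists>d>0. \<forall>v\<in>S. norm (v - u) < d \<longrightarrow> nrm (H 2) (F v - F u - T (v - u)) \<le> e * norm (v - u)"
      using d(1) by blast
  qed
qed

end

context magnitude
begin

text \<open>The two nondegeneracy conditions supply the two pivots of the block elimination: the
  residual gives the block in x, and the derivative of the phase increments gives the Schur
  complement. The derivative of the branch itself is the response of x to the parameters.\<close>

lemma closed_data_inverse:
  assumes L0: "positive_smooth_periodic P L0"
    and branch: "positive_warp_branch k1 k2 d1 P \<alpha> L0 \<mu>0 x0 jl jr \<delta>0 X"
    and data: "nondegenerate_closed_data k1 k2 d1 P \<alpha> \<sigma> L0 jl jr \<delta>0 X \<mu>s \<delta>s xs \<rho>1 \<rho>2"
  shows "\<exists>b>0. inverse_bounded_by (YS r) (ZS r) (lin (bvec L0 (\<mu>s, \<delta>s, xs)) 0) b"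
proof -
  \<comment> \<open>The nondegeneracy condition (i) lives at order 0, so the linearized residual and
    the tangents of the branch are identified there; order \<open>r\<close> returns only with the
    bordered inverse.\<close>
  interpret Z: magnitude P \<alpha> 0 k1 k2 d1 \<sigma> \<rho>1 \<rho>2 by unfold_locales (rule \<sigma>)
  define S where "S = {jl..jr} \<times> {0..\<delta>0}"
  define V where "V = bvec L0 (\<mu>s, \<delta>s, xs)"
  have two: "2 = Suc (Suc 0)" by simp
  have u: "\<mu>s \<in> {jl..jr}" "0 < \<delta>s" "\<delta>s \<le> \<delta>0" "(\<mu>s, \<delta>s) \<in> S" and xs: "xs = X \<mu>s \<delta>s"
    using data by (auto simp: nondegenerate_closed_data_def S_def)
  have br: "jl < jr" "\<And>\<mu> \<delta>. (\<mu>, \<delta>) \<in> S \<Longrightarrow> positive_smooth_periodic P (X \<mu> \<delta>)"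
    "\<And>\<mu> \<delta>. (\<mu>, \<delta>) \<in> S \<Longrightarrow> magnitude_solution k1 k2 d1 P L0 \<mu> \<delta> (X \<mu> \<delta>)"
    "smooth_between std (Cper P 3) S (\<lambda>(\<mu>, \<delta>). X \<mu> \<delta>)"
    using branch by (auto simp: positive_warp_branch_def S_def)
  have L0c: "L0 \<in> carr (H j)" "0 < L0 t" for j t
    using positive_smooth_periodic_H[OF L0] L0 by (auto simp: positive_smooth_periodic_def)
  have Xc: "X \<mu> \<delta> \<in> carr (H j)" if "(\<mu>, \<delta>) \<in> S" for \<mu> \<delta> j by (rule positive_smooth_periodic_H[OF br(2)[OF that]])
  have xsc: "xs \<in> carr (H j)" for j unfolding xs by (rule Xc[OF u(4)])
  have xsp: "0 < xs t" "0 < r_fun \<delta>s xs t" for t using br(3)[OF u(4)] by (auto simp: magnitude_solution_def xs)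
  have VV: "V \<in> carr (VS j)" for j unfolding V_def by (rule vec_carr) (use L0c xsc in auto)
  have adm: "admissible V" unfolding V_def admissible_iff[OF u(2)] using L0c xsp by simp
  obtain A where A: "has_frechet_derivative_between (H 2) (H 0) (magnitude_residual k1 k2 d1 L0 \<mu>s \<delta>s) A xs"
    "isomorphism_between (H 2) (H 0) A"
    using data by (auto simp: nondegenerate_closed_data_def)
  have iso: "isomorphism_between (H 2) (H 0) (lin_x V)"
  proof (rule isomorphism_between_cong[OF A(2) _ nspace_H])
    fix \<phi> assume "\<phi> \<in> carr (H 2)"
    then show "A \<phi> = lin_x V \<phi>"
      unfolding V_def by (intro Z.frechet_residual_eq[OF L0c xsc xsp u(2)]) (use A(1) in \<open>simp_all add: two\<close>)
  qed
  obtain B where B: "(branch_increments P X has_derivative B) (at (\<mu>s, \<delta>s) within S)" "bij B"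
    using data by (auto simp: nondegenerate_closed_data_def S_def)
  have linB: "linear B" using B(1) by (intro bounded_linear.linear has_derivative_bounded_linear)
  obtain T where T: "\<And>w. T w \<in> carr (H 2)" "\<And>v w. T (v + w) = T v + T w" "\<And>c v. T (c *\<^sub>R v) = c *\<^sub>R T v"
    and TD: "\<And>e. e > 0 \<Longrightarrow> \<exists>d>0. \<forall>v\<in>S. norm (v - (\<mu>s, \<delta>s)) < d \<longrightarrow>
      nrm (H 2) ((\<lambda>(\<mu>, \<delta>). X \<mu> \<delta>) v - (\<lambda>(\<mu>, \<delta>). X \<mu> \<delta>) (\<mu>s, \<delta>s) - T (v - (\<mu>s, \<delta>s))) \<le> e * norm (v - (\<mu>s, \<delta>s))"
    by (rule smooth_branch_derivative[OF br(4) u(4)]) (rule that)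
  have TD': "\<exists>d>0. \<forall>\<mu> \<delta>. (\<mu>, \<delta>) \<in> S \<longrightarrow> norm ((\<mu>, \<delta>) - (\<mu>s, \<delta>s)) < d \<longrightarrow>
        nrm (H 2) (X \<mu> \<delta> - X \<mu>s \<delta>s - T ((\<mu>, \<delta>) - (\<mu>s, \<delta>s))) \<le> e * norm ((\<mu>, \<delta>) - (\<mu>s, \<delta>s))" if "e > 0" for e
    using TD[OF that] by fastforce
  have tan: "lin V 0 (fst a, snd a, T a) = (0, fst (B a), snd (B a))"
    if "0 < \<tau>0" "\<And>\<tau>. 0 < \<tau> \<Longrightarrow> \<tau> < \<tau>0 \<Longrightarrow> (\<mu>s, \<delta>s) + \<tau> *\<^sub>R a \<in> S" for a \<tau>0
    unfolding V_def xs
    by (rule Z.branch_tangent[OF refl L0c u(2) Xc br(3) u(4) T(1,3) TD' B(1) that])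
  \<comment> \<open>At the right end of the interval the direction of increasing \<mu> leaves the
    rectangle, so the opposite one is used.\<close>
  define s :: real where "s = (if \<mu>s < jr then 1 else - 1)"
  have s: "s \<noteq> 0" by (simp add: s_def)
  have tan1: "lin V 0 (s, 0, T (s, 0)) = (0, fst (B (s, 0)), snd (B (s, 0)))"
  proof (rule tan[of "if \<mu>s < jr then jr - \<mu>s else jr - jl" "(s, 0)", unfolded fst_conv snd_conv])
    show "0 < (if \<mu>s < jr then jr - \<mu>s else jr - jl)" using br(1) by simp
    show "(\<mu>s, \<delta>s) + \<tau> *\<^sub>R (s, 0) \<in> S" if "0 < \<tau>" "\<tau> < (if \<mu>s < jr then jr - \<mu>s else jr - jl)" for \<tau>
      using that u by (auto simp: S_def s_def split: if_splits)
  qed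
  \<comment> \<open>Decreasing \<delta> is always possible, since \<open>\<delta>s\<close> is
    positive, whereas it may equal \<open>\<delta>0\<close>.\<close>
  have tan2: "lin V 0 (0, - 1, T (0, - 1)) = (0, fst (B (0, - 1)), snd (B (0, - 1)))"
    by (rule tan[of \<delta>s "(0, - 1)", unfolded fst_conv snd_conv]) (use u in \<open>auto simp: S_def\<close>)
  have blin: "bounded_linear_between (YS 0) (ZS 0) (lin V 0)"
    unfolding V_def by (rule Z.bounded_linear_lin0) (use L0c xsc adm in \<open>auto simp: V_def\<close>)
  have full: "lin V 0 (fst w, snd w, T w) = (0, fst (B w), snd (B w))" for w
  proof -
    \<comment> \<open>The two inward directions form a basis of the parameter plane, and both sides
      of the tangent identity are linear in the direction.\<close>
    define a b where "a = fst w / s" and "b = - snd w"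
    have w: "w = a *\<^sub>R (s, 0) + b *\<^sub>R (0, - 1)" using s by (simp add: a_def b_def prod_eq_iff)
    have c: "(s, 0, T (s, 0)) \<in> carr (YS 0)" "(0, - 1, T (0, - 1)) \<in> carr (YS 0)" using T(1) by (simp_all add: two)
    have "(fst w, snd w, T w) = a *\<^sub>R (s, 0, T (s, 0)) + b *\<^sub>R (0, - 1, T (0, - 1))"
      using s unfolding w T(2) T(3) by simp
    then have "lin V 0 (fst w, snd w, T w) = a *\<^sub>R lin V 0 (s, 0, T (s, 0)) + b *\<^sub>R lin V 0 (0, - 1, T (0, - 1))"
      using bounded_linear_betweenD(2)[OF blin YS.scale_carr[OF c(1)] YS.scale_carr[OF c(2)]]
        bounded_linear_betweenD(3)[OF blin c(1)] bounded_linear_betweenD(3)[OF blin c(2)] by simp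
    also have "\<dots> = (0, fst (B w), snd (B w))"
      unfolding tan1 tan2 w linear_add[OF linB] linear_cmul[OF linB] by (simp add: prod_eq_iff)
    finally show ?thesis .
  qed
  have split: "nemytskii_deriv e V (bvec 0 (fst w, snd w, T w)) =
      nemytskii_deriv e V (bvec 0 (0, 0, T w)) + nemytskii_deriv e V (bvec 0 (fst w, snd w, 0))" for e w
    using vec_add[of "(0, 0, T w)" 0 "(fst w, snd w, 0)" 0 0] T(1)[of w] by (simp add: two nemytskii_deriv_add[symmetric])
  have T_x: "lin_x V (T w) = nemytskii_deriv (rhs_ex k1 k2 d1) V (bvec 0 (fst w, snd w, 0))" for w
    using full[of w] unfolding lin_def lin_x_def split by (simp add: algebra_simps)
  have B_eq: "B w = (intP (nemytskii_deriv D1_ex V (bvec 0 (fst w, snd w, T w))), intP (nemytskii_deriv D2_ex V (bvec 0 (fst w, snd w, T w))))" for w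
    using full[of w] by (simp add: lin_def prod_eq_iff)
  show ?thesis
    unfolding V_def[symmetric] by (rule bordered_inverse[OF VV adm iso T(1) T_x linB B(2) B_eq])
qed

text \<open>One lower bound for the warp, the solution and \<open>r_fun\<close> on a whole
  neighbourhood. For \<open>r_fun\<close> it comes from the local Lipschitz dependence of the
  associated superposition operator; for the other two it is immediate from the norm.\<close>

lemma positivity_bounds:
  assumes L0: "L0 \<in> carr (H r)" "\<And>t. 0 < L0 t" and x0: "x0 \<in> carr (H (Suc (Suc r)))" "\<And>t. 0 < x0 t" "\<And>t. 0 < r_fun \<delta>0 x0 t"
  obtains m d where "0 < m" "0 < d"
    "\<And>L \<mu> \<delta> x t. L \<in> carr (H r) \<Longrightarrow> x \<in> carr (H (Suc (Suc r))) \<Longrightarrow>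
       nrm (H r) (L - L0) + (\<bar>\<mu> - \<mu>0\<bar> + (\<bar>\<delta> - \<delta>0\<bar> + nrm (H (Suc (Suc r))) (x - x0))) < d \<Longrightarrow>
       m < L t \<and> m < x t \<and> m < r_fun \<delta> x t"
proof -
  define z0 where "z0 = (L0, \<mu>0, \<delta>0, x0)"
  have z0: "(L0, \<mu>0, \<delta>0, x0) \<in> carr (XS r)" using L0 x0 by simp
  have "ok_on r_ex (bvec L0 (\<mu>0, \<delta>0, x0))" by (simp add: ok_on_def r_ex_def)
  note sd = strict_derivative_nemytskii_vec[OF z0 this]
  obtain dr C where dr: "0 < dr" "0 < C"
    "\<And>z. z \<in> carr (XS r) \<Longrightarrow> nrm (XS r) (z - z0) < dr \<Longrightarrow> nemytskii r_ex (bvec (fst z) (snd z)) \<in> carr (H r)"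
    "\<And>z z'. z \<in> carr (XS r) \<Longrightarrow> z' \<in> carr (XS r) \<Longrightarrow> nrm (XS r) (z - z0) < dr \<Longrightarrow> nrm (XS r) (z' - z0) < dr \<Longrightarrow>
      nrm (H r) (nemytskii r_ex (bvec (fst z) (snd z)) - nemytskii r_ex (bvec (fst z') (snd z'))) \<le> C * nrm (XS r) (z - z')"
    by (rule strict_derivative_lipschitz[OF sd nspace_XS nspace_H]) (rule that[unfolded z0_def, rotated 3])
  have nr: "nemytskii r_ex (bvec L (\<mu>, \<delta>, x)) = r_fun \<delta> x" for L \<mu> \<delta> x by (rule ext) (simp only: nemytskii_def ev_r)
  have "r_fun \<delta>0 x0 \<in> carr (H r)" using dr(3)[of z0] z0 dr(1) by (simp add: z0_def nr)
  then obtain mr where mr: "0 < mr" "\<And>f t. f \<in> carr (H r) \<Longrightarrow> nrm (H r) (f - r_fun \<delta>0 x0) < mr \<Longrightarrow> mr < f t"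
    using positive_neighbourhood x0(3) by blast
  obtain mL where mL: "0 < mL" "\<And>f t. f \<in> carr (H r) \<Longrightarrow> nrm (H r) (f - L0) < mL \<Longrightarrow> mL < f t"
    using positive_neighbourhood[OF L0] by blast
  obtain mx where mx: "0 < mx" "\<And>f t. f \<in> carr (H (Suc (Suc r))) \<Longrightarrow> nrm (H (Suc (Suc r))) (f - x0) < mx \<Longrightarrow> mx < f t"
    using positive_neighbourhood[OF x0(1,2)] by blast
  show ?thesis
  proof (rule that[of "Min {mr, mL, mx}" "Min {dr, mr / C, mL, mx}"])
    show "0 < Min {mr, mL, mx}" "0 < Min {dr, mr / C, mL, mx}" using mr(1) mL(1) mx(1) dr by auto
    fix L x :: "real \<Rightarrow> real" and \<mu> \<delta> t :: real
    assume a: "L \<in> carr (H r)" "x \<in> carr (H (Suc (Suc r)))"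
      and n: "nrm (H r) (L - L0) + (\<bar>\<mu> - \<mu>0\<bar> + (\<bar>\<delta> - \<delta>0\<bar> + nrm (H (Suc (Suc r))) (x - x0))) < Min {dr, mr / C, mL, mx}"
    define z where "z = (L, \<mu>, \<delta>, x)"
    have z: "z \<in> carr (XS r)" using a by (simp add: z_def)
    have nz: "nrm (XS r) (z - z0) = nrm (H r) (L - L0) + (\<bar>\<mu> - \<mu>0\<bar> + (\<bar>\<delta> - \<delta>0\<bar> + nrm (H (Suc (Suc r))) (x - x0)))"
      by (simp add: z_def z0_def nrm_prod_nspace)
    have nn: "nrm (XS r) (z - z0) < dr" "nrm (XS r) (z - z0) < mr / C" "nrm (XS r) (z - z0) < mL" "nrm (XS r) (z - z0) < mx"
      using n unfolding nz[symmetric] by auto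
    have "nrm (H r) (r_fun \<delta> x - r_fun \<delta>0 x0) \<le> C * nrm (XS r) (z - z0)"
      using dr(4)[of z z0] z z0 nn(1) dr(1) by (simp add: z_def z0_def nr)
    also have "\<dots> < mr" using nn(2) dr(2) by (simp add: field_simps)
    finally have "mr < r_fun \<delta> x t" using dr(3)[OF z nn(1)] by (intro mr(2)) (simp_all add: z_def nr)
    moreover have "0 \<le> nrm (H r) (L - L0)" "0 \<le> nrm (H (Suc (Suc r))) (x - x0)"
      using H.nrm_ge_0 a L0(1) x0(1) by auto
    then have "mL < L t" "mx < x t" using nn(3,4) nz by (auto intro!: mL(2)[OF a(1)] mx(2)[OF a(2)])
    ultimately show "Min {mr, mL, mx} < L t \<and> Min {mr, mL, mx} < x t \<and> Min {mr, mL, mx} < r_fun \<delta> x t"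
      by (auto simp: min_less_iff_disj)
  qed
qed

end

theorem theorem5p5:
  fixes \<A>1 :: "('m1::{t2_space, second_countable_topology}, 'k1::finite) chart set"
    and g1 :: "('m1, 'k1) chart \<Rightarrow> 'm1 \<Rightarrow> real ^ 'k1 ^ 'k1"
    and f1 :: "'m1 \<Rightarrow> complex ^ ('n1::finite)"
    and \<A>2 :: "('m2::{t2_space, second_countable_topology}, 'k2::finite) chart set"
    and g2 :: "('m2, 'k2) chart \<Rightarrow> 'm2 \<Rightarrow> real ^ 'k2 ^ 'k2"
    and f2 :: "'m2 \<Rightarrow> complex ^ ('n2::finite)"
    and k1 k2 r :: nat
    and d1 d2 P \<sigma> \<alpha> \<mu>0 jl jr \<delta>0 \<mu>s \<delta>s \<rho>1 \<rho>2 :: real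
    and L0 x0 xs :: "real \<Rightarrow> real"
    and X :: "real \<Rightarrow> real \<Rightarrow> real \<Rightarrow> real"
  assumes "eigenmap \<A>1 g1 f1 d1" and "k1 = CARD('k1)"
    and "eigenmap \<A>2 g2 f2 d2" and "k2 = CARD('k2)"
    and "0 < P" and "\<sigma> \<in> {-1, 1}"
    and "2 \<le> r" and "0 < \<alpha>" and "\<alpha> < 1"
    and "positive_smooth_periodic P L0"
    and "positive_warp_branch k1 k2 d1 P \<alpha> L0 \<mu>0 x0 jl jr \<delta>0 X"
    and "nondegenerate_closed_data k1 k2 d1 P \<alpha> \<sigma> L0 jl jr \<delta>0 X \<mu>s \<delta>s xs \<rho>1 \<rho>2"
  shows "\<exists>\<nu>>0. \<exists>\<eta>>0. \<exists>(mu :: (real \<Rightarrow> real) \<Rightarrow> real) (del :: (real \<Rightarrow> real) \<Rightarrow> real)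
            (xi :: (real \<Rightarrow> real) \<Rightarrow> real \<Rightarrow> real).
     (\<forall>L \<in> nearby_positive (Hper P r \<alpha>) \<eta> L0.
        (mu L, del L, xi L) \<in> nearby_data (Hper P (r + 2) \<alpha>) \<nu> \<mu>s \<delta>s xs \<and>
        datum_with_return k1 k2 d1 P \<sigma> L \<rho>1 \<rho>2 (mu L) (del L) (xi L) \<and>
        (\<forall>(\<mu>, \<delta>, x) \<in> nearby_data (Hper P (r + 2) \<alpha>) \<nu> \<mu>s \<delta>s xs.
           datum_with_return k1 k2 d1 P \<sigma> L \<rho>1 \<rho>2 \<mu> \<delta> x \<longrightarrow> (\<mu>, \<delta>, x) = (mu L, del L, xi L))) \<and>
     smooth_between (Hper P r \<alpha>) std (nearby_positive (Hper P r \<alpha>) \<eta> L0) mu \<and>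
     smooth_between (Hper P r \<alpha>) std (nearby_positive (Hper P r \<alpha>) \<eta> L0) del \<and>
     smooth_between (Hper P r \<alpha>) (Hper P (r + 2) \<alpha>) (nearby_positive (Hper P r \<alpha>) \<eta> L0) xi \<and>
     (\<forall>m\<ge>1. real m * \<rho>1 \<in> \<int> \<and> real m * \<rho>2 \<in> \<int> \<longrightarrow>
        (\<forall>L \<in> nearby_positive (Hper P r \<alpha>) \<eta> L0.
           closes_with_period k2 d2 \<sigma> (real m * P) (mu L) (del L) (xi L))) \<and>
     (\<exists>\<kappa>>0. \<forall>L \<in> nearby_positive (Hper P r \<alpha>) \<eta> L0. \<forall>t.
        \<kappa> \<le> mag_a (del L) (xi L) t \<and> \<kappa> \<le> mag_b (del L) (xi L) t \<and>
        \<kappa> \<le> warp1 L t \<and> \<kappa> \<le> warp2 k1 k2 d2 L (mu L) (del L) (xi L) t)"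
proof -
  interpret magnitude P \<alpha> r k1 k2 d1 \<sigma> \<rho>1 \<rho>2
    by unfold_locales (use assms(5,6,8,9) in auto)
  have d2: "0 < d2" and k2: "0 < k2" using assms(3,4) by (auto simp: eigenmap_def)
  define y0 where "y0 = (\<mu>s, \<delta>s, xs)"
  have r2: "r + 2 = Suc (Suc r)" by simp
  have u: "\<mu>s \<in> {jl..jr}" "\<delta>s \<in> {0..\<delta>0}" "0 < \<delta>s" and xs: "xs = X \<mu>s \<delta>s"
    and ret: "product_return \<sigma> P \<delta>s xs = (2 * pi * \<rho>1, 2 * pi * \<rho>2)"
    using assms(12) by (auto simp: nondegenerate_closed_data_def)
  have \<mu>s: "0 < \<mu>s" using u(1) assms(11) by (auto simp: positive_warp_branch_def)
  have X: "positive_smooth_periodic P xs" "magnitude_solution k1 k2 d1 P L0 \<mu>s \<delta>s xs"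
    using assms(11) u unfolding xs positive_warp_branch_def by blast+
  have L0: "L0 \<in> carr (H r)" "\<And>t. 0 < L0 t"
    using positive_smooth_periodic_H[OF assms(10)] assms(10) by (auto simp: positive_smooth_periodic_def)
  have xsc: "xs \<in> carr (H j)" for j by (rule positive_smooth_periodic_H[OF X(1)])
  have xsp: "0 < xs t" "0 < r_fun \<delta>s xs t" for t using X(2) by (auto simp: magnitude_solution_def)
  have y0: "y0 \<in> carr (YS r)" using xsc by (simp add: y0_def)
  have adm: "admissible (bvec L0 y0)" unfolding y0_def admissible_iff[OF u(3)] using L0 xsp by simp
  have sys0: "sysmap L0 y0 = 0"
    using datum_iff[OF L0(2) xsc \<mu>s u(3)] X(2) ret \<mu>s u(3) by (simp add: y0_def datum_with_return_def)
  obtain b where b: "0 < b" "inverse_bounded_by (YS r) (ZS r) (lin (bvec L0 y0) 0) b"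
    using closed_data_inverse[OF assms(10-12)] unfolding y0_def by blast
  obtain m d where md: "0 < m" "0 < d"
    "\<And>L \<mu> \<delta> x t. L \<in> carr (H r) \<Longrightarrow> x \<in> carr (H (Suc (Suc r))) \<Longrightarrow>
       nrm (H r) (L - L0) + (\<bar>\<mu> - \<mu>s\<bar> + (\<bar>\<delta> - \<delta>s\<bar> + nrm (H (Suc (Suc r))) (x - xs))) < d \<Longrightarrow>
       m < L t \<and> m < x t \<and> m < r_fun \<delta> x t"
    by (rule positivity_bounds[OF L0 xsc xsp]) (rule that[rotated 2])
  \<comment> \<open>\<open>d / 2\<close> is shared between the distance of the warp and that of the
    unknowns; the other entries keep both parameters above half of their values at the given
    datum.\<close>
  define e where "e = Min {d / 2, \<mu>s / 2, \<delta>s / 2}"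
  have e: "0 < e" "e \<le> d / 2" "e \<le> \<mu>s / 2" "e \<le> \<delta>s / 2" using md(2) \<mu>s u(3) by (auto simp: e_def)
  obtain \<nu> \<eta> sol K where \<nu>: "0 < \<nu>" "3 * \<nu> \<le> e" "0 < \<eta>" "\<eta> \<le> e"
    and fam: "solution_family P \<alpha> r (rhs_ex k1 k2 d1) D1_ex D2_ex (\<sigma> * (2 * pi * \<rho>1)) (\<sigma> * (2 * pi * \<rho>2))
      {L \<in> carr (H r). nrm (H r) (L - L0) < \<eta>} sol (2 * b) K"
    and near: "\<And>L. L \<in> carr (H r) \<Longrightarrow> nrm (H r) (L - L0) < \<eta> \<Longrightarrow> nrm (YS r) (sol L - y0) < \<nu>"
    and uniq: "\<And>L y. L \<in> carr (H r) \<Longrightarrow> nrm (H r) (L - L0) < \<eta> \<Longrightarrow> y \<in> carr (YS r) \<Longrightarrow> nrm (YS r) (y - y0) < 3 * \<nu> \<Longrightarrow>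
       sysmap L y = 0 \<Longrightarrow> y = sol L"
    by (rule solution_family_exists[OF L0(1) y0 adm sys0 b e(1)]) (rule that)
  define U where "U = {L \<in> carr (H r). nrm (H r) (L - L0) < \<eta>}"
  define mu where "mu L = fst (sol L)" for L
  define del where "del L = fst (snd (sol L))" for L
  define xi where "xi L = snd (snd (sol L))" for L
  have sol: "sol L = (mu L, del L, xi L)" for L by (simp add: mu_def del_def xi_def)
  have close: "xi L \<in> carr (H (Suc (Suc r)))" "xi L \<in> carr (H 2)"
      "\<bar>mu L - \<mu>s\<bar> < \<nu>" "\<bar>del L - \<delta>s\<bar> < \<nu>" "nrm (H (Suc (Suc r))) (xi L - xs) < \<nu>"
      "m < L t" "m < xi L t" "m < r_fun (del L) (xi L) t" if L: "L \<in> U" for L t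
  proof -
    show x: "xi L \<in> carr (H (Suc (Suc r)))"
      using solution_family.sol_carr[OF fam, folded U_def, OF L] by (simp add: sol)
    then show "xi L \<in> carr (H 2)" by (rule H_mono[rotated]) simp
    have n: "\<bar>mu L - \<mu>s\<bar> + (\<bar>del L - \<delta>s\<bar> + nrm (H (Suc (Suc r))) (xi L - xs)) < \<nu>"
      using near[of L] L by (simp add: U_def sol y0_def nrm_prod_nspace)
    moreover have "0 \<le> nrm (H (Suc (Suc r))) (xi L - xs)" using x xsc by (intro H.nrm_ge_0) auto
    ultimately show "\<bar>mu L - \<mu>s\<bar> < \<nu>" "\<bar>del L - \<delta>s\<bar> < \<nu>" "nrm (H (Suc (Suc r))) (xi L - xs) < \<nu>" by linarith+
    have "nrm (H r) (L - L0) < \<eta>" using L by (simp add: U_def)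
    then have "m < L t \<and> m < xi L t \<and> m < r_fun (del L) (xi L) t"
      using n \<nu> e L by (intro md(3)[OF _ x, where \<mu> = "mu L"]) (auto simp: U_def)
    then show "m < L t" "m < xi L t" "m < r_fun (del L) (xi L) t" by auto
  qed
  have par: "0 < mu L" "0 < del L" "\<delta>s / 2 \<le> del L" "mu L \<le> 2 * \<mu>s" "del L \<le> 2 * \<delta>s" if "L \<in> U" for L
    using close(3,4)[OF that] \<nu> e \<mu>s u(3) by linarith+
  have pos: "0 < L t" "0 < xi L t" "0 < r_fun (del L) (xi L) t" if "L \<in> U" for L t
    using close(6-8)[OF that, of t] md(1) by linarith+
  \<comment> \<open>On this ball positivity of the warp is automatic, so the neighbourhood of the
    statement is an open ball, on which the smoothness of the solution map applies.\<close>
  have U_eq: "nearby_positive (H r) \<eta> L0 = U"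
    using pos(1) by (auto simp: nearby_positive_def U_def)
  have datum: "datum_with_return k1 k2 d1 P \<sigma> L \<rho>1 \<rho>2 (mu L) (del L) (xi L)" if L: "L \<in> U" for L
    unfolding datum_iff[OF pos(1)[OF L] close(2)[OF L] par(1,2)[OF L]]
    using pos[OF L] solution_family.sol_sysmap[OF fam, folded U_def, OF L] by (simp add: sol)
  have unique: "(\<mu>, \<delta>, x) = (mu L, del L, xi L)"
    if L: "L \<in> U" and n: "(\<mu>, \<delta>, x) \<in> nearby_data (H (r + 2)) \<nu> \<mu>s \<delta>s xs"
      and dt: "datum_with_return k1 k2 d1 P \<sigma> L \<rho>1 \<rho>2 \<mu> \<delta> x" for L \<mu> \<delta> x
  proof -
    have n': "\<bar>\<mu> - \<mu>s\<bar> < \<nu>" "\<bar>\<delta> - \<delta>s\<bar> < \<nu>" "x \<in> carr (H (Suc (Suc r)))" "nrm (H (Suc (Suc r))) (x - xs) < \<nu>"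
      using n by (auto simp: nearby_data_def)
    have x: "x \<in> carr (H 2)" using n'(3) by (rule H_mono[rotated]) simp
    have p: "0 < \<mu>" "0 < \<delta>" using dt by (auto simp: datum_with_return_def)
    have "sysmap L (\<mu>, \<delta>, x) = 0" using dt datum_iff[where L = L, OF pos(1)[OF L] x p] by blast
    \<comment> \<open>Three separate bounds by \<open>\<nu>\<close> give distance below
      \<open>3 * \<nu>\<close> in the sum norm, exactly the radius of uniqueness.\<close>
    then have "(\<mu>, \<delta>, x) = sol L"
      using L n' by (intro uniq) (auto simp: U_def y0_def nrm_prod_nspace)
    then show ?thesis by (simp add: sol)
  qed
  have data: "\<forall>L\<in>U. (mu L, del L, xi L) \<in> nearby_data (H (r + 2)) \<nu> \<mu>s \<delta>s xs \<and>
      datum_with_return k1 k2 d1 P \<sigma> L \<rho>1 \<rho>2 (mu L) (del L) (xi L) \<and>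
      (\<forall>(\<mu>, \<delta>, x) \<in> nearby_data (H (r + 2)) \<nu> \<mu>s \<delta>s xs.
         datum_with_return k1 k2 d1 P \<sigma> L \<rho>1 \<rho>2 \<mu> \<delta> x \<longrightarrow> (\<mu>, \<delta>, x) = (mu L, del L, xi L))"
  proof
    fix L assume L: "L \<in> U"
    have "(mu L, del L, xi L) \<in> nearby_data (H (r + 2)) \<nu> \<mu>s \<delta>s xs"
      unfolding nearby_data_def r2 using close(1,3-5)[OF L] by simp
    then show "(mu L, del L, xi L) \<in> nearby_data (H (r + 2)) \<nu> \<mu>s \<delta>s xs \<and>
      datum_with_return k1 k2 d1 P \<sigma> L \<rho>1 \<rho>2 (mu L) (del L) (xi L) \<and>
      (\<forall>(\<mu>, \<delta>, x) \<in> nearby_data (H (r + 2)) \<nu> \<mu>s \<delta>s xs.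
         datum_with_return k1 k2 d1 P \<sigma> L \<rho>1 \<rho>2 \<mu> \<delta> x \<longrightarrow> (\<mu>, \<delta>, x) = (mu L, del L, xi L))"
      using datum[OF L] unique[OF L] by blast
  qed
  have open_U: "\<exists>d>0. \<forall>u'\<in>carr (H r). nrm (H r) (u' - u) < d \<longrightarrow> u' \<in> U" if u: "u \<in> U" for u
  proof (intro exI[of _ "\<eta> - nrm (H r) (u - L0)"] conjI ballI impI)
    show "0 < \<eta> - nrm (H r) (u - L0)" using u by (simp add: U_def)
    fix u' assume u': "u' \<in> carr (H r)" "nrm (H r) (u' - u) < \<eta> - nrm (H r) (u - L0)"
    have "nrm (H r) ((u' - u) + (u - L0)) \<le> nrm (H r) (u' - u) + nrm (H r) (u - L0)"
      by (rule H.nrm_triangle) (use u u' L0(1) in \<open>auto simp: U_def\<close>)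
    then show "u' \<in> U" using u' by (simp add: U_def)
  qed
  note smooth = solution_family.smooth_sol[OF fam, folded U_def, OF open_U, folded mu_def del_def xi_def]
  have close_period: "\<forall>m\<ge>1. real m * \<rho>1 \<in> \<int> \<and> real m * \<rho>2 \<in> \<int> \<longrightarrow>
      (\<forall>L\<in>U. closes_with_period k2 d2 \<sigma> (real m * P) (mu L) (del L) (xi L))"
  proof (intro allI impI ballI)
    fix m :: nat and L assume m: "real m * \<rho>1 \<in> \<int> \<and> real m * \<rho>2 \<in> \<int>" and L: "L \<in> U"
    show "closes_with_period k2 d2 \<sigma> (real m * P) (mu L) (del L) (xi L)"
      by (rule closes[OF d2 par(1,2)[OF L] close(2)[OF L] pos(2,3)[OF L]])
        (use m datum[OF L] in \<open>auto simp: datum_with_return_def\<close>)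
  qed
  \<comment> \<open>\<open>c\<close> is a common lower bound for L, x, \<open>r_fun\<close> and
    \<delta> over all warps in the ball, and \<open>C\<close> a common upper bound for \<mu>,
    \<delta> and L; the last entry of \<open>C\<close> bounds L through its distance from
    \<open>L0\<close>.\<close>
  define c where "c = min m (\<delta>s / 2)"
  define C where "C = Max {2 * \<mu>s, 2 * \<delta>s, nrm (H r) L0 + \<eta>}"
  have c: "0 < c" "c \<le> m" "c \<le> \<delta>s / 2" using md(1) u(3) by (auto simp: c_def)
  have C: "2 * \<mu>s \<le> C" "2 * \<delta>s \<le> C" "nrm (H r) L0 + \<eta> \<le> C" by (auto simp: C_def)
  \<comment> \<open>The smallest of the four lower bounds for the two magnitudes and the two warps;
    it depends only on the ball.\<close>
  define \<kappa> where "\<kappa> = Min {sqrt c * c, sqrt c, c, (sqrt (c\<^sup>2 * (d2 / C) ^ k2 * (c\<^sup>2 / C)) / C ^ k1) powr (1 / real k2)}"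
  have C_pos: "0 < C" using C(1) \<mu>s by linarith
  have \<kappa>: "0 < \<kappa>" using c(1) C_pos d2 by (simp add: \<kappa>_def)
  have \<kappa>_le: "\<kappa> \<le> sqrt c * c" "\<kappa> \<le> sqrt c" "\<kappa> \<le> c"
    "\<kappa> \<le> (sqrt (c\<^sup>2 * (d2 / C) ^ k2 * (c\<^sup>2 / C)) / C ^ k1) powr (1 / real k2)"
    unfolding \<kappa>_def by (rule Min_le; simp)+
  have bounds: "\<forall>L\<in>U. \<forall>t. \<kappa> \<le> mag_a (del L) (xi L) t \<and> \<kappa> \<le> mag_b (del L) (xi L) t \<and>
      \<kappa> \<le> warp1 L t \<and> \<kappa> \<le> warp2 k1 k2 d2 L (mu L) (del L) (xi L) t"
  proof (intro ballI allI)
    fix L t assume L: "L \<in> U"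
    have Lc: "L \<in> carr (H r)" "nrm (H r) (L - L0) < \<eta>" using L by (auto simp: U_def)
    have "nrm (H r) ((L - L0) + L0) \<le> nrm (H r) (L - L0) + nrm (H r) L0"
      by (rule H.nrm_triangle) (use Lc L0(1) in auto)
    then have "L s \<le> C" for s using H_le_nrm[OF Lc(1), of s] Lc(2) C(3) by simp
    moreover have "c \<le> xi L s" "c \<le> r_fun (del L) (xi L) s" "c \<le> L s" for s
      using close(6-8)[OF L, of s] c(2) by linarith+
    moreover have "c \<le> del L" "del L \<le> C" "mu L \<le> C" using par(3-5)[OF L] c(3) C by linarith+
    ultimately have "sqrt c * c \<le> mag_a (del L) (xi L) t" "sqrt c \<le> mag_b (del L) (xi L) t" "c \<le> warp1 L t"
        "(sqrt (c\<^sup>2 * (d2 / C) ^ k2 * (c\<^sup>2 / C)) / C ^ k1) powr (1 / real k2) \<le> warp2 k1 k2 d2 L (mu L) (del L) (xi L) t"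
      using lower_bounds[where C = C and L = L, OF d2 par(1,2)[OF L] close(2)[OF L] pos(2,3)[OF L] c(1) _ _ _ _ _ _ _ k2] by auto
    then show "\<kappa> \<le> mag_a (del L) (xi L) t \<and> \<kappa> \<le> mag_b (del L) (xi L) t \<and>
        \<kappa> \<le> warp1 L t \<and> \<kappa> \<le> warp2 k1 k2 d2 L (mu L) (del L) (xi L) t"
      using \<kappa>_le by (auto intro: order_trans)
  qed
  show ?thesis
  proof (rule exI[of _ \<nu>], rule conjI[OF \<nu>(1)], rule exI[of _ \<eta>], rule conjI[OF \<nu>(3)],
      rule exI[of _ mu], rule exI[of _ del], rule exI[of _ xi], unfold U_eq, intro conjI)
    show "\<exists>\<kappa>>0. \<forall>L\<in>U. \<forall>t. \<kappa> \<le> mag_a (del L) (xi L) t \<and> \<kappa> \<le> mag_b (del L) (xi L) t \<and>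
        \<kappa> \<le> warp1 L t \<and> \<kappa> \<le> warp2 k1 k2 d2 L (mu L) (del L) (xi L) t"
      using \<kappa> bounds by blast
  qed (rule data smooth close_period; assumption?)+
qed

end
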